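(* Let $k\ge1$ and let $p_1p_2\cdots p_k$ be a string in $\{1,2\}$. In the chart $\mathcal{C}(p_1p_2\cdots p_k)$, the node binomial $B(p_1p_2\cdots p_k)=\alpha\,\mathbf{n}\mathbf{r}+\beta\,\mathbf{d}$ determines the multiplicities, in the fundamental cycle of the $k$th prolongation $X(k)_0$ of the nodal curve, of the two twigs meeting at $N(p_1p_2\cdots p_k)$: the multiplicity of the retained twig is $\alpha$, and the multiplicity of the emergent twig is $\alpha+\beta$.
   Context: Work over an algebraically closed field $\mathbf{k}$ of characteristic $0$. **Monster tower.** Let $S$ be a nonsingular surface, $S(0)=S$, $\mathcal{B}(0)=TS$. Recursively, $S(k)=\mathbb{P}(\mathcal{B}(k-1))$ is the total space of the bundle of lines in the rank 2 bundle $\mathcal{B}(k-1)\subset TS(k-1)$, with projection $\pi_k:S(k)\to S(k-1)$ (a $\mathbb{P}^1$-bundle). The rank 2 subbundle $\mathcal{B}(k)\subset TS(k)$ consists, at a point $\tilde p$, of the tangent vectors that $d\pi_k$ maps into the line in $T_{\pi_k(\tilde p)}S(k-1)$ represented by $\tilde p$ (vectors mapped to $0$ included). **Charts.** $U\subset S$ is an open set with local coordinates $x_1,x_2$ (so $dx_1,dx_2$ trivialize the cotangent bundle), on which the curves $x_1=0$ and $x_2=0$ are irreducible and meet in exactly one point, the origin. Everything takes place over $U$ (i.e. $S(k)$ is replaced by its part over $U$). For $p\in\{1,2\}$ let $\overline{p}=3-p$. For each string $p_1\cdots p_k$ in $\{1,2\}$ there is a chart $\mathcal{C}(p_1\cdots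 p_k)\cong U\times\mathbb{A}^k$ of $S(k)$ with two active coordinates $x_1(p_1\cdots p_k),x_2(p_1\cdots p_k)$, defined recursively: $\mathcal{C}(\varnothing)=U$ with active coordinates $x_i(\varnothing)=x_i$; $\mathcal{C}(p_1\cdots p_k)$ is the set of points of $\pi_k^{-1}(\mathcal{C}(p_1\cdots p_{k-1}))$ representing directions on which $dx_{p_k}(p_1\cdots p_{k-1})\ne0$, and on it $$x_{p_k}(p_1\cdots p_k):=x_{p_k}(p_1\cdots p_{k-1}),\qquad x_{\overline{p_k}}(p_1\cdots p_k):=\frac{dx_{\overline{p_k}}(p_1\cdots p_{k-1})}{dx_{p_k}(p_1\cdots p_{k-1})}.$$ These $2^k$ charts cover $S(k)$. The $k+2$ coordinates on $\mathcal{C}(p_1\cdots p_k)$ are $x_1,x_2$ and $x_{\overline{p_j}}(p_1\cdots p_j)$ for $1\le j\le k$ (coordinates from lower levels are pulled back). For $k\ge1$ put $\mathbf{n}=x_{\overline{p_k}}(p_1\cdots p_k)$ (new coordinate), $\mathbf{r}=x_{p_k}(p_1\cdots p_k)=x_{p_k}(p_1\cdots p_{k-1})$ (retained coordinate), $\mathbf{d}=x_{\overline{p_k}}(p_1\cdots p_{k-1})$ (deactivated coordinate). $N(p_1\cdots p_k)$ denotes the origin of $\mathcal{C}(p_1\cdots p_k)$, the point where all $k+2$ coordinates vanish. **Node binomials.** Define integers $\alpha,\beta$ for each string: for $\varnothing$, $(\alpha,\beta)=(1,0)$; if $(\alpha,\beta)$ belongs to $p_1\cdots p_{k-1}$, then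 the pair for $p_1\cdots p_k$ is $(\alpha,\alpha+\beta)$ if $k=1$ or $p_k=p_{k-1}$, and $(\alpha+\beta,\alpha)$ if $k\ge2$ and $p_k\neq p_{k-1}$. Set $B(\varnothing)=x_1x_2$, and for $k\ge1$, $B(p_1\cdots p_k)=\alpha\,\mathbf{n}\mathbf{r}+\beta\,\mathbf{d}$ with the $(\alpha,\beta)$ and $\mathbf{n},\mathbf{r},\mathbf{d}$ belonging to $p_1\cdots p_k$. **Prolongation.** If $C$ is a curve in $S(j)$ that is tangent to $\mathcal{B}(j)$ at its nonsingular points (automatic for $j=0$), its prolongation is the closure in $S(j+1)=\mathbb{P}(\mathcal{B}(j))$ of the set of tangent directions to $C$ at nonsingular points; this is again tangent to $\mathcal{B}(j+1)$, so it can be iterated; the $k$th prolongation is the $k$-fold iterate. **The family.** $T$ is a neighborhood of $0$ in the line with coordinate $t$; $X_t\subset U$ is the curve $x_1x_2=t$. For $t\ne0$ it is nonsingular; let $X(k)_t\subset S(k)$ be its $k$th prolongation. $\mathcal{X}(k)\subset S(k)\times T$ is the unique family, flat over $T$, extending the family $\{X(k)_t\}_{t\neq0}$ (the scheme-theoretic closure of that family). $X(k)_0$ is its scheme-theoretic fiber over $t=0$, called the $k$th prolongation of the nodal curve. **Twigs.** A twig is an irreducible component of $X(k)_0$. The twigs form a chain with nodes the $2^k$ points $N(p_1\cdots p_k)$; exactly two twigs pass through each $N(p_1\cdots p_k)$, and these are the only twigs meeting the chart $\mathcal{C}(p_1\cdots p_k)$. Of these two, one is collapsed by $\pi_k$ to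 the point $N(p_1\cdots p_{k-1})$; it is called the emergent twig (in the chart it is the axis with affine coordinate $\mathbf{n}$, all other coordinates vanishing). The other is mapped by $\pi_k$ isomorphically (with reduced structures) to a twig of $X(k-1)_0$; it is called the retained twig (in the chart it is the axis with affine coordinate $\mathbf{r}$, all other coordinates vanishing). The multiplicity of a twig is its coefficient in the fundamental cycle of the scheme $X(k)_0$, i.e. the length of the local ring of $X(k)_0$ at the generic point of the twig. *)

theory Defs
  imports
    "HOL-Analysis.Function_Topology"
    "HOL-Algebra.QuotRing"
    "HOL-Computational_Algebra.Polynomial"
    "HOL-Library.Extended_Nat"
begin

section \<open>Classical varieties as spaces with functions\<close>

text \<open>
  A variety is given by its Zariski topology and, for every point, the set of functions that are
  regular in some neighbourhood of that point.  Functions are total; a germ is represented by all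
  the functions that have this germ, so values far away from the point are irrelevant.
\<close>

record ('p, 'k) space =
  zar :: "'p topology"
  reg :: "'p \<Rightarrow> ('p \<Rightarrow> 'k) set"

abbreviation points :: "('p, 'k) space \<Rightarrow> 'p set" where
  "points X \<equiv> topspace (zar X)"

definition regular_on :: "('p, 'k) space \<Rightarrow> 'p set \<Rightarrow> ('p \<Rightarrow> 'k) \<Rightarrow> bool" where
  "regular_on X V f \<longleftrightarrow> (\<forall>p\<in>V. f \<in> reg X p)"

text \<open>For \<open>Z\<close> closed this is the reduced structure on \<open>Z\<close>; for \<open>Z\<close> open it is the open subvariety.\<close>

definition restr_space :: "('p, 'k) space \<Rightarrow> 'p set \<Rightarrow> ('p, 'k) space" where
  "restr_space X Z =
     \<lparr> zar = subtopology (zar X) Z,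
       reg = (\<lambda>p. {f. \<exists>g\<in>reg X p. \<exists>W. openin (zar X) W \<and> p \<in> W \<and> (\<forall>q\<in>W \<inter> Z. f q = g q)}) \<rparr>"

definition space_iso :: "('p, 'k) space \<Rightarrow> ('q, 'k) space \<Rightarrow> ('p \<Rightarrow> 'q) \<Rightarrow> bool" where
  "space_iso X Y \<phi> \<longleftrightarrow>
     homeomorphic_map (zar X) (zar Y) \<phi> \<and>
     (\<forall>p\<in>points X. \<forall>f. f \<in> reg Y (\<phi> p) \<longleftrightarrow> f \<circ> \<phi> \<in> reg X p)"

inductive_set gen_alg :: "('p \<Rightarrow> 'k::comm_ring_1) set \<Rightarrow> ('p \<Rightarrow> 'k) set"
  for G :: "('p \<Rightarrow> 'k) set"
where
  gen_alg_const: "(\<lambda>_. c) \<in> gen_alg G"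
| gen_alg_gen: "g \<in> G \<Longrightarrow> g \<in> gen_alg G"
| gen_alg_add: "f \<in> gen_alg G \<Longrightarrow> g \<in> gen_alg G \<Longrightarrow> (\<lambda>p. f p + g p) \<in> gen_alg G"
| gen_alg_mult: "f \<in> gen_alg G \<Longrightarrow> g \<in> gen_alg G \<Longrightarrow> (\<lambda>p. f p * g p) \<in> gen_alg G"

text \<open>The point set \<open>P\<close> with coordinate ring \<open>A\<close>.\<close>

definition alg_space :: "'p set \<Rightarrow> ('p \<Rightarrow> 'k::field) set \<Rightarrow> ('p, 'k) space" where
  "alg_space P A =
     \<lparr> zar = topology_generated_by {{p \<in> P. f p \<noteq> 0} | f. f \<in> A},
       reg = (\<lambda>p. {f. \<exists>g\<in>A. \<exists>h\<in>A. h p \<noteq> 0 \<and> (\<forall>q\<in>P. h q \<noteq> 0 \<longrightarrow> f q = g q / h q)}) \<rparr>"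

definition affine_space :: "nat \<Rightarrow> ('k::field list, 'k) space" where
  "affine_space n = alg_space {ys. length ys = n} (gen_alg {(\<lambda>ys. ys ! i) | i. i < n})"

definition affine_line :: "('k::field, 'k) space" where
  "affine_line = alg_space UNIV (gen_alg {\<lambda>t. t})"

definition tensor_on ::
  "('p, 'k::field) space \<Rightarrow> ('q, 'k) space \<Rightarrow> 'p set \<Rightarrow> 'q set \<Rightarrow> ('p \<times> 'q \<Rightarrow> 'k) \<Rightarrow> bool" where
  "tensor_on X Y V W F \<longleftrightarrow>
     openin (zar X) V \<and> openin (zar Y) W \<and>
     (\<exists>(n::nat) a b. (\<forall>i<n. regular_on X V (a i) \<and> regular_on Y W (b i)) \<and>
        (\<forall>p\<in>V. \<forall>q\<in>W. F (p, q) = (\<Sum>i<n. a i p * b i q)))"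

text \<open>The product variety; its topology is finer than the product topology.\<close>

definition prod_space :: "('p, 'k::field) space \<Rightarrow> ('q, 'k) space \<Rightarrow> ('p \<times> 'q, 'k) space" where
  "prod_space X Y =
     \<lparr> zar = topology_generated_by {{z \<in> V \<times> W. F z \<noteq> 0} | V W F. tensor_on X Y V W F},
       reg = (\<lambda>z. {f. \<exists>V W F G. tensor_on X Y V W F \<and> tensor_on X Y V W G \<and>
                        z \<in> V \<times> W \<and> G z \<noteq> 0 \<and>
                        (\<forall>z'\<in>V \<times> W. G z' \<noteq> 0 \<longrightarrow> f z' = F z' / G z')}) \<rparr>"

definition irreducible_set :: "'p topology \<Rightarrow> 'p set \<Rightarrow> bool" where
  "irreducible_set \<tau> Z \<longleftrightarrow>
     Z \<noteq> {} \<and> Z \<subseteq> topspace \<tau> \<and>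
     (\<forall>A B. closedin \<tau> A \<longrightarrow> closedin \<tau> B \<longrightarrow> Z \<subseteq> A \<union> B \<longrightarrow> Z \<subseteq> A \<or> Z \<subseteq> B)"

definition irreducible_components :: "'p topology \<Rightarrow> 'p set \<Rightarrow> 'p set set" where
  "irreducible_components \<tau> E =
     {Z. irreducible_set \<tau> Z \<and> closedin \<tau> Z \<and> Z \<subseteq> E \<and>
         (\<forall>Z'. irreducible_set \<tau> Z' \<longrightarrow> closedin \<tau> Z' \<longrightarrow> Z' \<subseteq> E \<longrightarrow> Z \<subseteq> Z' \<longrightarrow> Z' = Z)}"

text \<open>Supremum of the numbers \<open>n\<close> for which there is a chain \<open>c 0 \<subset> c 1 \<subset> \<dots> \<subset> c n\<close> in \<open>\<F>\<close>.\<close>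

definition chain_length :: "'s set set \<Rightarrow> enat" where
  "chain_length \<F> =
     Sup {enat n | n. \<exists>c. (\<forall>i\<le>n. c i \<in> \<F>) \<and> (\<forall>i<n. c i \<subset> c (Suc i))}"

definition top_dimension :: "'p topology \<Rightarrow> enat" where
  "top_dimension \<tau> = chain_length {Z. irreducible_set \<tau> Z \<and> closedin \<tau> Z}"

definition affine_open :: "('p, 'k::field) space \<Rightarrow> 'p set \<Rightarrow> bool" where
  "affine_open X V \<longleftrightarrow>
     openin (zar X) V \<and>
     (\<exists>n Z \<phi>. closedin (zar (affine_space n :: ('k list, 'k) space)) Z \<and>
        space_iso (restr_space X V) (restr_space (affine_space n) Z) \<phi>)"

definition variety :: "('p, 'k::field) space \<Rightarrow> bool" where
  "variety X \<longleftrightarrow>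
     (\<forall>p\<in>points X. \<forall>f\<in>reg X p. \<forall>g W.
        openin (zar X) W \<longrightarrow> p \<in> W \<longrightarrow> (\<forall>q\<in>W. f q = g q) \<longrightarrow> g \<in> reg X p) \<and>
     (\<exists>\<V>. finite \<V> \<and> \<Union>\<V> = points X \<and> (\<forall>V\<in>\<V>. affine_open X V)) \<and>
     closedin (zar (prod_space X X)) {(p, p) | p. p \<in> points X} \<and>
     irreducible_set (zar X) (points X)"

text \<open>
  Tangent vectors at \<open>p\<close> are the \<open>k\<close>-linear derivations of the local ring at \<open>p\<close>, extended by \<open>0\<close>
  to the functions that are not regular at \<open>p\<close>.  The differential of a function \<open>f\<close> sends the
  tangent vector \<open>v\<close> to \<open>v f\<close>.
\<close>

definition tangent :: "('p, 'k::field) space \<Rightarrow> 'p \<Rightarrow> (('p \<Rightarrow> 'k) \<Rightarrow> 'k) set" where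
  "tangent X p = {v.
     (\<forall>f\<in>reg X p. \<forall>g\<in>reg X p. v (\<lambda>q. f q + g q) = v f + v g) \<and>
     (\<forall>f\<in>reg X p. \<forall>c. v (\<lambda>q. c * f q) = c * v f) \<and>
     (\<forall>f\<in>reg X p. \<forall>g\<in>reg X p. v (\<lambda>q. f q * g q) = f p * v g + g p * v f) \<and>
     (\<forall>f\<in>reg X p. \<forall>g\<in>reg X p. \<forall>W.
        openin (zar X) W \<longrightarrow> p \<in> W \<longrightarrow> (\<forall>q\<in>W. f q = g q) \<longrightarrow> v f = v g) \<and>
     (\<forall>f. f \<notin> reg X p \<longrightarrow> v f = 0)}"

definition pushforward ::
  "('q, 'k::field) space \<Rightarrow> ('p \<Rightarrow> 'q) \<Rightarrow> 'p \<Rightarrow> (('p \<Rightarrow> 'k) \<Rightarrow> 'k) \<Rightarrow> (('q \<Rightarrow> 'k) \<Rightarrow> 'k)" where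
  "pushforward Y \<phi> p v = (\<lambda>f. if f \<in> reg Y (\<phi> p) then v (f \<circ> \<phi>) else 0)"

definition tangent_sub :: "('p, 'k::field) space \<Rightarrow> 'p set \<Rightarrow> 'p \<Rightarrow> (('p \<Rightarrow> 'k) \<Rightarrow> 'k) set" where
  "tangent_sub X C p = {v \<in> tangent X p.
     \<forall>f\<in>reg X p. (\<exists>W. openin (zar X) W \<and> p \<in> W \<and> (\<forall>q\<in>W \<inter> C. f q = 0)) \<longrightarrow> v f = 0}"

definition linear_dim :: "('f \<Rightarrow> 'k::field) set \<Rightarrow> nat \<Rightarrow> bool" where
  "linear_dim E n \<longleftrightarrow>
     (\<exists>vs. length vs = n \<and>
        (\<forall>cs. length cs = n \<longrightarrow> (\<lambda>f. \<Sum>i<n. cs ! i * (vs ! i) f) \<in> E) \<and>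
        (\<forall>v\<in>E. \<exists>!cs. length cs = n \<and> v = (\<lambda>f. \<Sum>i<n. cs ! i * (vs ! i) f)))"

definition nonsingular_surface :: "('p, 'k::field) space \<Rightarrow> bool" where
  "nonsingular_surface X \<longleftrightarrow>
     variety X \<and> top_dimension (zar X) = 2 \<and> (\<forall>p\<in>points X. linear_dim (tangent X p) 2)"


section \<open>The Monster tower over a coordinate patch\<close>

datatype idx = I1 | I2

fun other :: "idx \<Rightarrow> idx" where
  "other I1 = I2"
| "other I2 = I1"

text \<open>
  The third condition says that at every point of \<open>U\<close> the differentials of the two coordinates form
  a basis of the cotangent space.
\<close>

definition coordinate_patch ::
  "('u, 'k::field) space \<Rightarrow> 'u set \<Rightarrow> (idx \<Rightarrow> 'u \<Rightarrow> 'k) \<Rightarrow> 'u \<Rightarrow> bool" where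
  "coordinate_patch S U x org \<longleftrightarrow>
     openin (zar S) U \<and>
     (\<forall>i. regular_on S U (x i)) \<and>
     (\<forall>u\<in>U. \<forall>a b. \<exists>!v. v \<in> tangent S u \<and> v (x I1) = a \<and> v (x I2) = b) \<and>
     (\<forall>i. irreducible_set (zar S) {u \<in> U. x i u = 0}) \<and>
     {u \<in> U. x I1 u = 0 \<and> x I2 u = 0} = {org}"

text \<open>
  Strings are written with the most recent letter first: the string \<open>p\<^sub>1 \<dots> p\<^sub>k\<close> is the list
  \<open>[p\<^sub>k, \<dots>, p\<^sub>1]\<close>.  A point of the chart of a string of length \<open>k\<close> is a pair \<open>(u, ys)\<close>, where \<open>ys\<close>
  lists the values of the \<open>k\<close> new coordinates, again the most recent one first.
\<close>

type_synonym word = "idx list"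

definition chart :: "('u, 'k::field) space \<Rightarrow> 'u set \<Rightarrow> word \<Rightarrow> ('u \<times> 'k list, 'k) space" where
  "chart S U w = prod_space (restr_space S U) (affine_space (length w))"

definition proj :: "'u \<times> 'k list \<Rightarrow> 'u \<times> 'k list" where
  "proj q = (fst q, tl (snd q))"

fun active :: "(idx \<Rightarrow> 'u \<Rightarrow> 'k) \<Rightarrow> word \<Rightarrow> idx \<Rightarrow> 'u \<times> 'k list \<Rightarrow> 'k" where
  "active x [] i q = x i (fst q)"
| "active x (p # w) i q = (if i = p then active x w p (proj q) else hd (snd q))"

text \<open>
  Given the rank two space \<open>E\<close> of focal vectors at \<open>proj q\<close> in the chart of \<open>w\<close>, this is the line
  in \<open>E\<close> which the point \<open>q\<close> of the chart of \<open>p # w\<close> represents.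
\<close>

definition line_in ::
  "(idx \<Rightarrow> 'u \<Rightarrow> 'k::field) \<Rightarrow> idx \<Rightarrow> word \<Rightarrow> (('u \<times> 'k list \<Rightarrow> 'k) \<Rightarrow> 'k) set \<Rightarrow> 'u \<times> 'k list
    \<Rightarrow> (('u \<times> 'k list \<Rightarrow> 'k) \<Rightarrow> 'k) set" where
  "line_in x p w E q = {v \<in> E. v (active x w (other p)) = hd (snd q) * v (active x w p)}"

text \<open>The fibre at \<open>q\<close> of the bundle \<open>\<B>(k)\<close>, in the chart of a string of length \<open>k\<close>.\<close>

fun focal ::
  "('u, 'k::field) space \<Rightarrow> 'u set \<Rightarrow> (idx \<Rightarrow> 'u \<Rightarrow> 'k) \<Rightarrow> word \<Rightarrow> 'u \<times> 'k list
    \<Rightarrow> (('u \<times> 'k list \<Rightarrow> 'k) \<Rightarrow> 'k) set" where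
  "focal S U x [] q = tangent (chart S U []) q"
| "focal S U x (p # w) q =
     {v \<in> tangent (chart S U (p # w)) q.
        pushforward (chart S U w) proj q v \<in> line_in x p w (focal S U x w (proj q)) q}"


section \<open>Prolongation and the node\<close>

text \<open>
  \<open>C\<close> is a curve in the chart of \<open>w\<close>; the result is the part of its prolongation in the chart of
  \<open>p # w\<close>.  Taking closures commutes with restriction to the open subset of the tower covered by
  this chart, and so does taking nonsingular points.  A point of a curve is nonsingular when the
  Zariski tangent space of the curve there is one-dimensional.
\<close>

definition prolong ::
  "('u, 'k::field) space \<Rightarrow> 'u set \<Rightarrow> (idx \<Rightarrow> 'u \<Rightarrow> 'k) \<Rightarrow> idx \<Rightarrow> word
    \<Rightarrow> ('u \<times> 'k list) set \<Rightarrow> ('u \<times> 'k list) set" where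
  "prolong S U x p w C =
     Abstract_Topology.closure_of (zar (chart S U (p # w)))
       {q \<in> points (chart S U (p # w)).
          proj q \<in> C \<and>
          linear_dim (tangent_sub (chart S U w) C (proj q)) 1 \<and>
          tangent_sub (chart S U w) C (proj q) = line_in x p w (focal S U x w (proj q)) q}"

text \<open>The part of \<open>X(k)\<^sub>t\<close> in the chart of \<open>w\<close>, where \<open>k\<close> is the length of \<open>w\<close>.\<close>

fun prolonged_fibre ::
  "('u, 'k::field) space \<Rightarrow> 'u set \<Rightarrow> (idx \<Rightarrow> 'u \<Rightarrow> 'k) \<Rightarrow> 'k \<Rightarrow> word \<Rightarrow> ('u \<times> 'k list) set" where
  "prolonged_fibre S U x t [] = {q \<in> points (chart S U []). x I1 (fst q) * x I2 (fst q) = t}"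
| "prolonged_fibre S U x t (p # w) = prolong S U x p w (prolonged_fibre S U x t w)"

text \<open>
  The ideal of \<open>X(k)\<^sub>0\<close> in the local ring of the chart at \<open>q\<close>.  The scheme-theoretic closure of the
  family over \<open>T - {0}\<close> is defined by the functions \<open>F\<close> on the product with \<open>T\<close> that vanish on the
  family; the ideal of its fibre over \<open>0\<close> consists of the restrictions of these \<open>F\<close> to \<open>t = 0\<close>.
\<close>

definition special_ideal ::
  "('u, 'k::field) space \<Rightarrow> 'u set \<Rightarrow> (idx \<Rightarrow> 'u \<Rightarrow> 'k) \<Rightarrow> 'k set \<Rightarrow> word \<Rightarrow> 'u \<times> 'k list
    \<Rightarrow> ('u \<times> 'k list \<Rightarrow> 'k) set" where
  "special_ideal S U x T w q =
     (let Y = prod_space (chart S U w) (restr_space affine_line T) in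
      {f. \<exists>F\<in>reg Y (q, 0).
        (\<exists>\<Omega>. openin (zar Y) \<Omega> \<and> (q, 0) \<in> \<Omega> \<and>
           (\<forall>q' t. (q', t) \<in> \<Omega> \<longrightarrow> t \<noteq> 0 \<longrightarrow> q' \<in> prolonged_fibre S U x t w \<longrightarrow> F (q', t) = 0)) \<and>
        (\<exists>W. openin (zar (chart S U w)) W \<and> q \<in> W \<and> (\<forall>q'\<in>W. f q' = F (q', 0)))})"

definition special_support ::
  "('u, 'k::field) space \<Rightarrow> 'u set \<Rightarrow> (idx \<Rightarrow> 'u \<Rightarrow> 'k) \<Rightarrow> 'k set \<Rightarrow> word \<Rightarrow> ('u \<times> 'k list) set" where
  "special_support S U x T w =
     {q \<in> points (chart S U w). \<forall>f\<in>special_ideal S U x T w q. f q = 0}"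

text \<open>
  The twigs that meet the chart of \<open>w\<close>, each represented by its intersection with this chart.
\<close>

definition twigs ::
  "('u, 'k::field) space \<Rightarrow> 'u set \<Rightarrow> (idx \<Rightarrow> 'u \<Rightarrow> 'k) \<Rightarrow> 'k set \<Rightarrow> word \<Rightarrow> ('u \<times> 'k list) set set" where
  "twigs S U x T w = irreducible_components (zar (chart S U w)) (special_support S U x T w)"

definition node :: "'u \<Rightarrow> word \<Rightarrow> 'u \<times> 'k::field list" where
  "node org w = (org, replicate (length w) 0)"

definition emergent_twig ::
  "('u, 'k::field) space \<Rightarrow> 'u set \<Rightarrow> (idx \<Rightarrow> 'u \<Rightarrow> 'k) \<Rightarrow> 'u \<Rightarrow> 'k set \<Rightarrow> word
    \<Rightarrow> ('u \<times> 'k list) set \<Rightarrow> bool" where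
  "emergent_twig S U x org T w Z \<longleftrightarrow>
     Z \<in> twigs S U x T w \<and> node org w \<in> Z \<and> proj ` Z = {node org (tl w)}"

definition retained_twig ::
  "('u, 'k::field) space \<Rightarrow> 'u set \<Rightarrow> (idx \<Rightarrow> 'u \<Rightarrow> 'k) \<Rightarrow> 'u \<Rightarrow> 'k set \<Rightarrow> word
    \<Rightarrow> ('u \<times> 'k list) set \<Rightarrow> bool" where
  "retained_twig S U x org T w Z \<longleftrightarrow>
     Z \<in> twigs S U x T w \<and> node org w \<in> Z \<and>
     (\<exists>Z'\<in>twigs S U x T (tl w).
        space_iso (restr_space (chart S U w) Z) (restr_space (chart S U (tl w)) Z') proj)"

text \<open>
  The local ring at the generic point of the twig \<open>Z\<close>.  Rational functions that are regular on some
  open set meeting \<open>Z\<close> are taken as total functions with pointwise operations; the ideal divided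
  out contains all functions vanishing on such an open set, so that the quotient depends on germs
  at the generic point only.
\<close>

definition function_ring :: "('p \<Rightarrow> 'k::field) set \<Rightarrow> ('p \<Rightarrow> 'k) ring" where
  "function_ring A =
     \<lparr> carrier = A, monoid.mult = (\<lambda>f g p. f p * g p), one = (\<lambda>_. 1),
       zero = (\<lambda>_. 0), add = (\<lambda>f g p. f p + g p) \<rparr>"

definition generic_functions :: "('p, 'k::field) space \<Rightarrow> 'p set \<Rightarrow> ('p \<Rightarrow> 'k) set" where
  "generic_functions X Z =
     {f. \<exists>W. openin (zar X) W \<and> W \<inter> Z \<noteq> {} \<and> regular_on X W f}"

definition generic_local_ring ::
  "('u, 'k::field) space \<Rightarrow> 'u set \<Rightarrow> (idx \<Rightarrow> 'u \<Rightarrow> 'k) \<Rightarrow> 'k set \<Rightarrow> word \<Rightarrow> ('u \<times> 'k list) set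
    \<Rightarrow> ('u \<times> 'k list \<Rightarrow> 'k) set ring" where
  "generic_local_ring S U x T w Z =
     function_ring (generic_functions (chart S U w) Z) Quot
       {f \<in> generic_functions (chart S U w) Z.
          \<exists>W. openin (zar (chart S U w)) W \<and> W \<inter> Z \<noteq> {} \<and> (\<forall>q\<in>W. f \<in> special_ideal S U x T w q)}"

definition ring_length :: "('a, 'b) ring_scheme \<Rightarrow> enat" where
  "ring_length R = chain_length {I. ideal I R}"

definition twig_multiplicity ::
  "('u, 'k::field) space \<Rightarrow> 'u set \<Rightarrow> (idx \<Rightarrow> 'u \<Rightarrow> 'k) \<Rightarrow> 'k set \<Rightarrow> word \<Rightarrow> ('u \<times> 'k list) set \<Rightarrow> enat" where
  "twig_multiplicity S U x T w Z = ring_length (generic_local_ring S U x T w Z)"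


section \<open>Node binomials\<close>

fun node_coeffs :: "word \<Rightarrow> nat \<times> nat" where
  "node_coeffs [] = (1, 0)"
| "node_coeffs (p # w) =
     (let (\<alpha>, \<beta>) = node_coeffs w
      in if w = [] \<or> p = hd w then (\<alpha>, \<alpha> + \<beta>) else (\<alpha> + \<beta>, \<alpha>))"

definition new_coord :: "(idx \<Rightarrow> 'u \<Rightarrow> 'k) \<Rightarrow> word \<Rightarrow> 'u \<times> 'k list \<Rightarrow> 'k" where
  "new_coord x w q = active x w (other (hd w)) q"

definition retained_coord :: "(idx \<Rightarrow> 'u \<Rightarrow> 'k) \<Rightarrow> word \<Rightarrow> 'u \<times> 'k list \<Rightarrow> 'k" where
  "retained_coord x w q = active x w (hd w) q"

definition deactivated_coord :: "(idx \<Rightarrow> 'u \<Rightarrow> 'k) \<Rightarrow> word \<Rightarrow> 'u \<times> 'k list \<Rightarrow> 'k" where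
  "deactivated_coord x w q = active x (tl w) (other (hd w)) (proj q)"

definition node_binomial ::
  "(idx \<Rightarrow> 'u \<Rightarrow> 'k::field) \<Rightarrow> word \<Rightarrow> 'u \<times> 'k list \<Rightarrow> 'k" where
  "node_binomial x w q =
     (if w = [] then x I1 (fst q) * x I2 (fst q)
      else of_nat (fst (node_coeffs w)) * (new_coord x w q * retained_coord x w q)
         + of_nat (snd (node_coeffs w)) * deactivated_coord x w q)"

end

theory Submission
  imports Defs "HOL-Computational_Algebra.Formal_Power_Series" "HOL-Library.Function_Algebras"
    "HOL-Analysis.Abstract_Limits"
begin

text \<open>
  For \<open>t \<noteq> 0\<close> the curve \<open>x\<^sub>1 x\<^sub>2 = t\<close> has the tangent derivation \<open>\<nu>\<close> with \<open>\<nu> x\<^sub>1 = x\<^sub>1\<close> and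
  \<open>\<nu> x\<^sub>2 = - x\<^sub>2\<close>, so in every chart its prolongation is the graph of a section over it. Let
  \<open>m\<^sub>1, m\<^sub>2\<close> be the integers \<open>twig_mult w I1\<close>, \<open>twig_mult w I2\<close>, and \<open>a\<^sub>1, a\<^sub>2\<close> the active
  coordinates. If \<open>x\<^sub>1 x\<^sub>2 = C a\<^sub>1\<^sup>m\<^sup>1 a\<^sub>2\<^sup>m\<^sup>2\<close> with a constant \<open>C \<noteq> 0\<close>, logarithmic
  differentiation along the curve gives the slope \<open>n = d a\<^sub>2 / d a\<^sub>1 = - m\<^sub>1 a\<^sub>2 / (m\<^sub>2 a\<^sub>1)\<close>.
  This is the equation \<open>m\<^sub>2 n a\<^sub>1 + m\<^sub>1 a\<^sub>2 = 0\<close>, and eliminating \<open>a\<^sub>2\<close> with it one obtains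
  \<open>x\<^sub>1 x\<^sub>2 = C' a\<^sub>1\<^sup>m\<^sup>1\<^sup>+\<^sup>m\<^sup>2 n\<^sup>m\<^sup>2\<close> in the next chart, where \<open>a\<^sub>1\<close> is retained and \<open>n\<close> is new. The
  equation is the node binomial of that chart, \<open>\<alpha> = m\<^sub>2\<close> and \<open>\<beta> = m\<^sub>1\<close> (\<open>node_coeffs_mult\<close>),
  and the new exponents are \<open>\<alpha> + \<beta>\<close> and \<open>\<alpha>\<close>. So all fibres over \<open>t \<noteq> 0\<close> are the curves
  \<open>x\<^sub>1 x\<^sub>2 = t\<close> in the model surface, the common zero set of the node binomials of all
  levels (\<open>prolonged_fibre_graph\<close>). On the model surface the active coordinates determine
  all other coordinates, and \<open>t\<close> is the monomial \<open>C a\<^sub>1\<^sup>m\<^sup>1 a\<^sub>2\<^sup>m\<^sup>2\<close> (\<open>tfun_monomial\<close>). The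
  fibre over \<open>0\<close> is therefore supported on the two axes \<open>a\<^sub>i = 0\<close>, with multiplicities \<open>m\<^sub>i\<close>.

  The support requires that each point of the model surface with \<open>x\<^sub>1 x\<^sub>2 = 0\<close> is a limit of points of
  the family (\<open>family_dense\<close>).  Such a point lies on a formal arc that leaves the fibre over \<open>0\<close>, and
  the arc is turned into actual points by specializing finitely generated subalgebras of \<open>k[[s]]\<close> to
  \<open>k\<close>, which is a form of the Nullstellensatz (\<open>specialization\<close>, \<open>arc_points\<close>).  Formal arcs exist
  because the coordinate vector fields preserve the local rings of the surface (\<open>partial_reg\<close>), which
  rests on \<open>max_ideal_coords\<close>: the two coordinates generate the maximal ideals.  This follows from the
  description of the tangent spaces with Nakayama's lemma.

  For the multiplicity, a function that vanishes on the axis \<open>a\<^sub>i = 0\<close> is a multiple of \<open>a\<^sub>i\<close> modulo the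
  node binomials (\<open>vanishing_on_axis\<close>), so every element of the local ring at the generic point is a
  unit or a multiple of \<open>a\<^sub>i\<close>.  The power \<open>a\<^sub>i\<^sup>m\<^sup>i\<close> is zero there (\<open>active_power_special\<close>) and no smaller
  power is (\<open>active_power_not_special\<close>).  The ideals of such a ring are the powers of one element, and
  its length is \<open>m\<^sub>i\<close> (\<open>uniserial_length\<close>).
\<close>

section \<open>Specialization of finitely generated algebras\<close>

text \<open>A subring, given by its carrier in a commutative ring.\<close>

definition subring_set :: "'a::comm_ring_1 set \<Rightarrow> bool" where
  "subring_set B \<longleftrightarrow> 0 \<in> B \<and> 1 \<in> B \<and> (\<forall>a\<in>B. - a \<in> B) \<and> (\<forall>a\<in>B. \<forall>b\<in>B. a + b \<in> B \<and> a * b \<in> B)"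

definition coeffs_in :: "'a::comm_ring_1 set \<Rightarrow> 'a poly \<Rightarrow> bool" where
  "coeffs_in B p \<longleftrightarrow> (\<forall>i. coeff p i \<in> B)"

text \<open>
  The ring \<open>B[a]\<close>, generated by \<open>a\<close> over the subring \<open>B\<close>.
\<close>

definition adjoin :: "'a::comm_ring_1 set \<Rightarrow> 'a \<Rightarrow> 'a set" where
  "adjoin B a = {poly p a | p. coeffs_in B p}"

lemma subring_sum: "subring_set B \<Longrightarrow> (\<And>i. i \<in> I \<Longrightarrow> f i \<in> B) \<Longrightarrow> sum f I \<in> B"
  by (induction I rule: infinite_finite_induct) (auto simp: subring_set_def)

lemma subring_power: "subring_set B \<Longrightarrow> a \<in> B \<Longrightarrow> a ^ n \<in> B"
  by (induction n) (auto simp: subring_set_def)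

lemma subring_diff: "subring_set B \<Longrightarrow> a \<in> B \<Longrightarrow> b \<in> B \<Longrightarrow> a - b \<in> B"
  unfolding subring_set_def by (metis diff_conv_add_uminus)

lemma coeffs_in_mult: "subring_set B \<Longrightarrow> coeffs_in B p \<Longrightarrow> coeffs_in B q \<Longrightarrow> coeffs_in B (p * q)"
  unfolding coeffs_in_def coeff_mult by (auto intro!: subring_sum simp: subring_set_def)

lemma coeffs_in_add: "subring_set B \<Longrightarrow> coeffs_in B p \<Longrightarrow> coeffs_in B q \<Longrightarrow> coeffs_in B (p + q)"
  unfolding coeffs_in_def by (auto simp: subring_set_def)

lemma coeffs_in_diff: "subring_set B \<Longrightarrow> coeffs_in B p \<Longrightarrow> coeffs_in B q \<Longrightarrow> coeffs_in B (p - q)"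
  unfolding coeffs_in_def by (auto simp: subring_diff)

lemma coeffs_in_uminus: "subring_set B \<Longrightarrow> coeffs_in B p \<Longrightarrow> coeffs_in B (- p)"
  unfolding coeffs_in_def by (auto simp: subring_set_def)

lemma coeffs_in_smult: "subring_set B \<Longrightarrow> c \<in> B \<Longrightarrow> coeffs_in B p \<Longrightarrow> coeffs_in B (smult c p)"
  unfolding coeffs_in_def by (auto simp: subring_set_def)

lemma coeffs_in_monom: "subring_set B \<Longrightarrow> c \<in> B \<Longrightarrow> coeffs_in B (monom c n)"
  unfolding coeffs_in_def by (auto simp: subring_set_def)

lemma coeffs_in_0: "subring_set B \<Longrightarrow> coeffs_in B 0"
  unfolding coeffs_in_def by (auto simp: subring_set_def)

lemma coeffs_in_1: "subring_set B \<Longrightarrow> coeffs_in B 1"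
  using coeffs_in_monom[of B 1 0] by (simp add: subring_set_def)

lemma subring_coeffs_in: "subring_set B \<Longrightarrow> subring_set {p. coeffs_in B p}"
  by (simp add: subring_set_def[of "{p. coeffs_in B p}"] coeffs_in_0 coeffs_in_1 coeffs_in_uminus
      coeffs_in_add coeffs_in_mult)

lemma subring_adjoin:
  assumes B: "subring_set B" shows "subring_set (adjoin B a)"
proof -
  have I: "poly p a \<in> adjoin B a" if "coeffs_in B p" for p
    using that by (auto simp: adjoin_def)
  show ?thesis
    unfolding subring_set_def
  proof (intro conjI ballI)
    show "0 \<in> adjoin B a" "1 \<in> adjoin B a"
      using I[OF coeffs_in_0[OF B]] I[OF coeffs_in_1[OF B]] by auto
  next
    fix b assume "b \<in> adjoin B a"
    then obtain p where p: "coeffs_in B p" "b = poly p a" by (auto simp: adjoin_def)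
    show "- b \<in> adjoin B a" using I[OF coeffs_in_uminus[OF B p(1)]] p(2) by simp
    fix c assume "c \<in> adjoin B a"
    then obtain q where q: "coeffs_in B q" "c = poly q a" by (auto simp: adjoin_def)
    show "b + c \<in> adjoin B a" using I[OF coeffs_in_add[OF B p(1) q(1)]] p(2) q(2) by simp
    show "b * c \<in> adjoin B a" using I[OF coeffs_in_mult[OF B p(1) q(1)]] p(2) q(2) by simp
  qed
qed

lemma adjoin_base: "subring_set B \<Longrightarrow> b \<in> B \<Longrightarrow> b \<in> adjoin B a"
  unfolding adjoin_def
  by (rule CollectI, rule exI[of _ "monom b 0"]) (simp add: coeffs_in_monom poly_monom)

lemma adjoin_gen: "subring_set B \<Longrightarrow> a \<in> adjoin B a"
  unfolding adjoin_def
  by (rule CollectI, rule exI[of _ "monom 1 1"]) (simp add: coeffs_in_monom poly_monom subring_set_def)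

lemma pseudo_division_in:
  fixes p q :: "'a::idom poly"
  assumes B: "subring_set B" and p: "coeffs_in B p" "p \<noteq> 0" and q: "coeffs_in B q"
  shows "\<exists>e s r. coeffs_in B s \<and> coeffs_in B r \<and> smult (lead_coeff p ^ e) q = p * s + r \<and>
           (r = 0 \<or> degree r < degree p)"
  using q
proof (induction "degree q" arbitrary: q rule: less_induct)
  case less
  let ?l = "lead_coeff p"
  have l: "?l \<in> B" using p by (auto simp: coeffs_in_def)
  show ?case
  proof (cases "q = 0 \<or> degree q < degree p")
    case True
    then show ?thesis
      using less.prems coeffs_in_0[OF B]
      by (intro exI[of _ "0::nat"] exI[of _ "0::'a poly"] exI[of _ q]) auto
  next
    case False
    let ?m = "monom (lead_coeff q) (degree q - degree p)"
    let ?q = "smult ?l q - ?m * p"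
    have m: "coeffs_in B ?m" using less.prems by (intro coeffs_in_monom[OF B]) (auto simp: coeffs_in_def)
    have q': "coeffs_in B ?q"
      by (intro coeffs_in_diff[OF B] coeffs_in_smult[OF B] coeffs_in_mult[OF B] l m p less.prems)
    have "degree (?m * p) \<le> degree q"
      using False degree_mult_le[of ?m p] degree_monom_le[of "lead_coeff q" "degree q - degree p"]
      by linarith
    then have d: "degree ?q \<le> degree q"
      by (intro degree_diff_le) (auto intro: order.trans[OF degree_smult_le])
    have "coeff ?q (degree q) = 0"
      using False by (simp add: coeff_monom_mult)
    then consider "?q = 0" | "degree ?q < degree q"
      using eq_zero_or_degree_less[OF d] by blast
    then show ?thesis
    proof cases
      case 1
      then have "smult (?l ^ 1) q = p * ?m + 0" by (simp add: mult.commute)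
      then show ?thesis using m coeffs_in_0[OF B] by blast
    next
      case 2
      from less.hyps[OF 2 q'] obtain e s r where
        s: "coeffs_in B s" "coeffs_in B r" "smult (?l ^ e) ?q = p * s + r"
          "r = 0 \<or> degree r < degree p" by blast
      have "smult (?l ^ Suc e) q = smult (?l ^ e) ?q + p * smult (?l ^ e) ?m"
        by (simp add: smult_diff_right mult.commute)
      then have "smult (?l ^ Suc e) q = p * (s + smult (?l ^ e) ?m) + r"
        unfolding s(3) by (simp add: algebra_simps)
      moreover have "coeffs_in B (s + smult (?l ^ e) ?m)"
        by (intro coeffs_in_add[OF B] coeffs_in_smult[OF B] s m subring_power[OF B l])
      ultimately show ?thesis using s by blast
    qed
  qed
qed

text \<open>
  A homomorphism of algebras from \<open>B\<close> to \<open>k\<close>; \<open>h\<close> is the structure map of the \<open>k\<close>-algebra \<open>B\<close>.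
\<close>

definition alg_hom_on :: "('k::field \<Rightarrow> 'a::comm_ring_1) \<Rightarrow> 'a set \<Rightarrow> ('a \<Rightarrow> 'k) \<Rightarrow> bool" where
  "alg_hom_on h B \<phi> \<longleftrightarrow> (\<forall>c. \<phi> (h c) = c) \<and>
     (\<forall>a\<in>B. \<forall>b\<in>B. \<phi> (a + b) = \<phi> a + \<phi> b \<and> \<phi> (a * b) = \<phi> a * \<phi> b)"

text \<open>
  Each nonzero element of \<open>B\<close> is nonzero under some homomorphism of algebras to \<open>k\<close>.
\<close>

definition specializable :: "('k::field \<Rightarrow> 'a::comm_ring_1) \<Rightarrow> 'a set \<Rightarrow> bool" where
  "specializable h B \<longleftrightarrow> (\<forall>g\<in>B. g \<noteq> 0 \<longrightarrow> (\<exists>\<phi>. alg_hom_on h B \<phi> \<and> \<phi> g \<noteq> 0))"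

text \<open>A homomorphism from the field \<open>k\<close> to an integral domain.\<close>

locale scalar_embedding =
  fixes h :: "'k::field \<Rightarrow> 'a::idom"
  assumes h_add: "h (a + b) = h a + h b" and h_mult: "h (a * b) = h a * h b" and h_1: "h 1 = 1"
begin

lemma h_0: "h 0 = 0"
  using h_add[of 0 0] by (metis add_cancel_right_right add_0)

context
  fixes B \<phi>
  assumes B: "subring_set B" "range h \<subseteq> B" and \<phi>: "alg_hom_on h B \<phi>"
begin

lemma hom_0: "\<phi> 0 = 0"
  using \<phi> h_0 unfolding alg_hom_on_def by metis

lemma hom_1: "\<phi> 1 = 1"
  using \<phi> h_1 unfolding alg_hom_on_def by metis

lemma hom_sum: "(\<And>i. i \<in> I \<Longrightarrow> f i \<in> B) \<Longrightarrow> \<phi> (sum f I) = (\<Sum>i\<in>I. \<phi> (f i))"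
proof (induction I rule: infinite_finite_induct)
  case (insert x F)
  then have "sum f F \<in> B" by (intro subring_sum[OF B(1)]) auto
  then show ?case using insert \<phi> by (simp add: alg_hom_on_def)
qed (auto simp: hom_0)

lemma map_poly_add: "coeffs_in B p \<Longrightarrow> coeffs_in B q \<Longrightarrow> map_poly \<phi> (p + q) = map_poly \<phi> p + map_poly \<phi> q"
  using \<phi> by (intro poly_eqI) (simp add: coeff_map_poly hom_0 alg_hom_on_def coeffs_in_def)

lemma map_poly_mult:
  assumes "coeffs_in B p" "coeffs_in B q"
  shows "map_poly \<phi> (p * q) = map_poly \<phi> p * map_poly \<phi> q"
proof (rule poly_eqI)
  fix n
  have "\<phi> (\<Sum>i\<le>n. coeff p i * coeff q (n - i)) = (\<Sum>i\<le>n. \<phi> (coeff p i * coeff q (n - i)))"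
    using assms B by (intro hom_sum) (auto simp: coeffs_in_def subring_set_def)
  also have "\<dots> = (\<Sum>i\<le>n. \<phi> (coeff p i) * \<phi> (coeff q (n - i)))"
    using assms \<phi> by (intro sum.cong) (auto simp: alg_hom_on_def coeffs_in_def)
  finally show "coeff (map_poly \<phi> (p * q)) n = coeff (map_poly \<phi> p * map_poly \<phi> q) n"
    by (simp add: coeff_map_poly hom_0 coeff_mult)
qed

lemma map_poly_smult:
  assumes "coeffs_in B p" "b \<in> B"
  shows "map_poly \<phi> (smult b p) = smult (\<phi> b) (map_poly \<phi> p)"
  using assms \<phi> by (intro poly_eqI) (auto simp: coeff_map_poly hom_0 alg_hom_on_def coeffs_in_def)

lemma map_poly_const: "map_poly \<phi> [:b:] = [:\<phi> b:]"
  by (intro poly_eqI) (auto simp: coeff_map_poly hom_0 coeff_pCons split: nat.splits)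

text \<open>
  The value of the extension at \<open>poly p a\<close> does not depend on \<open>p\<close> by the assumption on \<open>c\<close>.
\<close>

lemma hom_extends:
  assumes c: "\<And>q. coeffs_in B q \<Longrightarrow> poly q a = 0 \<Longrightarrow> poly (map_poly \<phi> q) c = 0"
  shows "\<exists>\<psi>. alg_hom_on h (adjoin B a) \<psi> \<and>
           (\<forall>p. coeffs_in B p \<longrightarrow> \<psi> (poly p a) = poly (map_poly \<phi> p) c)"
proof -
  define \<psi> where "\<psi> y = poly (map_poly \<phi> (SOME p. coeffs_in B p \<and> poly p a = y)) c" for y
  have \<psi>: "\<psi> (poly p a) = poly (map_poly \<phi> p) c" if p: "coeffs_in B p" for p
  proof -
    define q where "q = (SOME q. coeffs_in B q \<and> poly q a = poly p a)"
    have q: "coeffs_in B q" "poly q a = poly p a"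
      using someI[of "\<lambda>q. coeffs_in B q \<and> poly q a = poly p a" p] p by (auto simp: q_def)
    have "poly (map_poly \<phi> (q - p)) c = 0"
      using q p by (intro c coeffs_in_diff[OF B(1)]) auto
    moreover have "map_poly \<phi> q = map_poly \<phi> (q - p) + map_poly \<phi> p"
      using map_poly_add[of "q - p" p] q p coeffs_in_diff[OF B(1)] by simp
    ultimately show ?thesis by (simp add: \<psi>_def q_def[symmetric])
  qed
  have "alg_hom_on h (adjoin B a) \<psi>"
    unfolding alg_hom_on_def
  proof (intro conjI allI ballI)
    fix k
    have "coeffs_in B [:h k:]" using B coeffs_in_monom[of B "h k" 0] by (auto simp: monom_0)
    from \<psi>[OF this] show "\<psi> (h k) = k"
      using \<phi> by (simp add: map_poly_const alg_hom_on_def)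
  next
    fix y z assume "y \<in> adjoin B a" "z \<in> adjoin B a"
    then obtain p q where p: "coeffs_in B p" "y = poly p a" and q: "coeffs_in B q" "z = poly q a"
      by (auto simp: adjoin_def)
    show "\<psi> (y + z) = \<psi> y + \<psi> z"
      using \<psi>[OF coeffs_in_add[OF B(1) p(1) q(1)]] p q by (simp add: \<psi> map_poly_add)
    show "\<psi> (y * z) = \<psi> y * \<psi> z"
      using \<psi>[OF coeffs_in_mult[OF B(1) p(1) q(1)]] p q by (simp add: \<psi> map_poly_mult)
  qed
  then show ?thesis using \<psi> by blast
qed

end

end

text \<open>
  The polynomial \<open>p\<close> is a minimal polynomial of \<open>a\<close>, and \<open>g\<close> is prime to it as \<open>g(a) \<noteq> 0\<close>.
  The proof runs the Euclidean algorithm without denominators: among the combinations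
  of \<open>p\<close> and \<open>g\<close> that do not vanish at \<open>a\<close>, one of least degree is constant.
\<close>

lemma coprime_combination:
  fixes a :: "'a::idom"
  assumes B: "subring_set B"
    and p: "coeffs_in B p" "p \<noteq> 0" "poly p a = 0"
    and pmin: "\<And>q. coeffs_in B q \<Longrightarrow> poly q a = 0 \<Longrightarrow> degree q < degree p \<Longrightarrow> q = 0"
    and g: "coeffs_in B g" "poly g a \<noteq> 0"
  shows "\<exists>s t b. coeffs_in B s \<and> coeffs_in B t \<and> b \<in> B \<and> b \<noteq> 0 \<and> p * s + g * t = [:b:]"
proof -
  define Q where "Q q \<longleftrightarrow> (\<exists>s t. coeffs_in B s \<and> coeffs_in B t \<and> q = p * s + g * t) \<and> poly q a \<noteq> 0" for q
  have Qg: "Q g" using g coeffs_in_0[OF B] coeffs_in_1[OF B] unfolding Q_def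
    by (intro conjI exI[of _ 0] exI[of _ 1]) auto
  define q where "q = (ARG_MIN degree q. Q q)"
  have Qq: "Q q" and qmin: "\<And>r. Q r \<Longrightarrow> degree q \<le> degree r"
    using arg_min_nat_lemma[of Q g degree] Qg by (auto simp: q_def)
  have QB: "coeffs_in B r" if "Q r" for r
    using that p g unfolding Q_def by (auto intro!: coeffs_in_add[OF B] coeffs_in_mult[OF B])
  have Qlin: "Q r" if "smult b q = p * s + r" "poly r a \<noteq> 0" "coeffs_in B s" "b \<in> B" for b r s
  proof -
    from Qq obtain s' t' where st: "coeffs_in B s'" "coeffs_in B t'" "q = p * s' + g * t'"
      by (auto simp: Q_def)
    have "r = p * (smult b s' - s) + g * smult b t'"
      using that(1) st(3) by (simp add: algebra_simps smult_add_right)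
    moreover have "coeffs_in B (smult b s' - s)" "coeffs_in B (smult b t')"
      using st that by (auto intro!: coeffs_in_diff[OF B] coeffs_in_smult[OF B])
    ultimately show ?thesis using that unfolding Q_def by blast
  qed
  have lB: "lead_coeff r ^ e \<in> B" if "coeffs_in B r" for r e
    using that by (intro subring_power[OF B]) (auto simp: coeffs_in_def)
  have q0: "q \<noteq> 0" using Qq by (auto simp: Q_def)
  \<comment> \<open>reduction modulo \<open>p\<close> shows that \<open>q\<close> has smaller degree than \<open>p\<close>\<close>
  from pseudo_division_in[OF B p(1,2) QB[OF Qq]] obtain e s r where
    r: "coeffs_in B s" "coeffs_in B r" "smult (lead_coeff p ^ e) q = p * s + r"
       "r = 0 \<or> degree r < degree p" by blast
  have "poly r a = lead_coeff p ^ e * poly q a"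
    using arg_cong[OF r(3), of "\<lambda>f. poly f a"] p by simp
  then have ra: "poly r a \<noteq> 0" using Qq p by (auto simp: Q_def)
  have "Q r" using Qlin[OF r(3) ra r(1) lB[OF p(1)]] .
  with qmin[OF this] ra r(4) have dq: "degree q < degree p" by auto
  \<comment> \<open>and reduction of \<open>p\<close> modulo \<open>q\<close> that \<open>q\<close> is constant\<close>
  from pseudo_division_in[OF B QB[OF Qq] q0 p(1)] obtain e s r where
    r: "coeffs_in B s" "coeffs_in B r" "smult (lead_coeff q ^ e) p = q * s + r"
       "r = 0 \<or> degree r < degree q" by blast
  have r0: "r = 0"
  proof (cases "poly r a = 0")
    case True
    then show ?thesis using pmin[OF r(2)] r(4) dq by auto
  next
    case False
    from Qq obtain s' t' where st: "coeffs_in B s'" "coeffs_in B t'" "q = p * s' + g * t'"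
      by (auto simp: Q_def)
    let ?b = "lead_coeff q ^ e"
    have "smult ?b p = (p * s' + g * t') * s + r"
      using r(3) st(3) by simp
    then have "r = p * ([:?b:] - s' * s) + g * (- (t' * s))"
      by (simp add: algebra_simps)
    moreover have "coeffs_in B [:?b:]"
      using coeffs_in_monom[OF B lB[OF QB[OF Qq]], of e 0] by (simp add: monom_0)
    ultimately have "Q r" unfolding Q_def using False st r
      by (intro conjI exI[of _ "[:?b:] - s' * s"] exI[of _ "- (t' * s)"])
         (auto intro!: coeffs_in_diff[OF B] coeffs_in_mult[OF B] coeffs_in_uminus[OF B])
    from qmin[OF this] r(4) show ?thesis by auto
  qed
  have eq: "smult (lead_coeff q ^ e) p = q * s" using r(3) r0 by simp
  then have s0: "s \<noteq> 0" using q0 p by auto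
  have "poly q a * poly s a = 0"
    using arg_cong[OF eq, of "\<lambda>f. poly f a"] p by simp
  then have "poly s a = 0" using Qq by (auto simp: Q_def)
  then have "\<not> degree s < degree p" using pmin[OF r(1)] s0 by auto
  moreover have "degree p = degree q + degree s"
    using arg_cong[OF eq, of degree] q0 s0 by (simp add: degree_mult_eq)
  ultimately have "degree q = 0" by simp
  then obtain b where b: "q = [:b:]" by (metis degree_eq_zeroE)
  have "b \<noteq> 0" using q0 b by auto
  moreover have "b \<in> B" using QB[OF Qq] b unfolding coeffs_in_def by (metis coeff_pCons_0)
  ultimately show ?thesis using Qq b unfolding Q_def by metis
qed

text \<open>
  If \<open>a\<close> is transcendental over \<open>B\<close>, its image can be any element outside a finite set.  If \<open>a\<close> is
  algebraic with minimal polynomial \<open>p\<close>, its image is a root of the image of \<open>p\<close>, and \<open>B\<close> is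
  specialized in such a way that the leading coefficient of \<open>p\<close> and the constant \<open>b = p s + g t\<close>
  survive; then \<open>p\<close> keeps its positive degree, and \<open>g(a)\<close> survives as well.
\<close>

lemma (in scalar_embedding) specializable_adjoin:
  fixes a :: 'a
  assumes B: "subring_set B" "range h \<subseteq> B" and sp: "specializable h B"
    and alg: "\<And>p::'k poly. degree p > 0 \<Longrightarrow> \<exists>x. poly p x = 0" and inf: "infinite (UNIV::'k set)"
  shows "specializable h (adjoin B a)"
  unfolding specializable_def
proof (intro ballI impI)
  fix y assume "y \<in> adjoin B a" "y \<noteq> 0"
  then obtain g where g: "coeffs_in B g" "y = poly g a" "poly g a \<noteq> 0" by (auto simp: adjoin_def)
  show "\<exists>\<psi>. alg_hom_on h (adjoin B a) \<psi> \<and> \<psi> y \<noteq> 0"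
  proof (cases "\<exists>p. coeffs_in B p \<and> p \<noteq> 0 \<and> poly p a = 0")
    case False
    have "lead_coeff g \<in> B" "lead_coeff g \<noteq> 0" using g by (auto simp: coeffs_in_def)
    with sp obtain \<phi> where \<phi>: "alg_hom_on h B \<phi>" "\<phi> (lead_coeff g) \<noteq> 0"
      unfolding specializable_def by blast
    have "map_poly \<phi> g \<noteq> 0"
      using \<phi>(2) coeff_map_poly[of \<phi>] hom_0[OF B \<phi>(1)] by (metis coeff_0)
    then have "finite {c. poly (map_poly \<phi> g) c = 0}" by (rule poly_roots_finite)
    then obtain c where c: "poly (map_poly \<phi> g) c \<noteq> 0" using inf ex_new_if_finite by fastforce
    have "poly (map_poly \<phi> q) c = 0" if "coeffs_in B q" "poly q a = 0" for q
      using False that by auto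
    from hom_extends[OF B \<phi>(1) this] obtain \<psi> where
      "alg_hom_on h (adjoin B a) \<psi>" "\<psi> (poly g a) = poly (map_poly \<phi> g) c"
      using g by blast
    then show ?thesis using c g by auto
  next
    case True
    define P where "P p \<longleftrightarrow> coeffs_in B p \<and> p \<noteq> 0 \<and> poly p a = 0" for p
    define p where "p = (ARG_MIN degree p. P p)"
    obtain p0 where "P p0" using True by (auto simp: P_def)
    then have p: "P p" and pm: "\<And>q. P q \<Longrightarrow> degree p \<le> degree q"
      using arg_min_nat_lemma[of P p0 degree] unfolding p_def by blast+
    have pB: "coeffs_in B p" "p \<noteq> 0" "poly p a = 0" using p by (auto simp: P_def)
    have pmin: "q = 0" if "coeffs_in B q" "poly q a = 0" "degree q < degree p" for q
      using pm[of q] that by (auto simp: P_def)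
    obtain s t b where st: "coeffs_in B s" "coeffs_in B t" "b \<in> B" "b \<noteq> 0" "p * s + g * t = [:b:]"
      using coprime_combination[OF B(1) pB pmin g(1,3)] by blast
    have l: "lead_coeff p \<in> B" using pB by (auto simp: coeffs_in_def)
    have "b * lead_coeff p \<in> B" "b * lead_coeff p \<noteq> 0"
      using st pB l B by (auto simp: subring_set_def)
    with sp obtain \<phi> where \<phi>: "alg_hom_on h B \<phi>" "\<phi> (b * lead_coeff p) \<noteq> 0"
      unfolding specializable_def by blast
    then have \<phi>b: "\<phi> b \<noteq> 0" and \<phi>l: "\<phi> (lead_coeff p) \<noteq> 0"
      using st l unfolding alg_hom_on_def by auto
    note h0 = hom_0[OF B \<phi>(1)]
    have dp: "degree p > 0"
    proof (rule ccontr)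
      assume "\<not> degree p > 0"
      then obtain z where "p = [:z:]" by (metis degree_eq_zeroE neq0_conv)
      then show False using pB by auto
    qed
    have "degree (map_poly \<phi> p) \<ge> degree p"
      using \<phi>l by (intro le_degree) (simp add: coeff_map_poly h0)
    then obtain c where c: "poly (map_poly \<phi> p) c = 0" using alg[of "map_poly \<phi> p"] dp by auto
    have "poly (map_poly \<phi> q) c = 0" if q: "coeffs_in B q" "poly q a = 0" for q
    proof -
      from pseudo_division_in[OF B(1) pB(1,2) q(1)] obtain e u r where
        r: "coeffs_in B u" "coeffs_in B r" "smult (lead_coeff p ^ e) q = p * u + r"
           "r = 0 \<or> degree r < degree p" by blast
      have "poly r a = 0" using arg_cong[OF r(3), of "\<lambda>f. poly f a"] pB q by simp
      then have "r = 0" using pmin[OF r(2)] r(4) by auto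
      then have "map_poly \<phi> (smult (lead_coeff p ^ e) q) = map_poly \<phi> (p * u)" using r(3) by simp
      then have "smult (\<phi> (lead_coeff p ^ e)) (map_poly \<phi> q) = map_poly \<phi> p * map_poly \<phi> u"
        using map_poly_smult[OF B \<phi>(1) q(1) subring_power[OF B(1) l, of e]]
          map_poly_mult[OF B \<phi>(1) pB(1) r(1)] by simp
      from arg_cong[OF this, of "\<lambda>f. poly f c"] c
      have "\<phi> (lead_coeff p ^ e) * poly (map_poly \<phi> q) c = 0" by simp
      moreover have "\<phi> (lead_coeff p ^ e) = \<phi> (lead_coeff p) ^ e"
      proof (induction e)
        case 0 then show ?case using hom_1[OF B \<phi>(1)] by simp
      next
        case (Suc e)
        then show ?case using \<phi>(1) l subring_power[OF B(1) l, of e] by (simp add: alg_hom_on_def)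
      qed
      ultimately show ?thesis using \<phi>l by simp
    qed
    from hom_extends[OF B \<phi>(1) this] obtain \<psi> where
      \<psi>: "alg_hom_on h (adjoin B a) \<psi>" "\<psi> (poly g a) = poly (map_poly \<phi> g) c"
      using g by blast
    have "map_poly \<phi> p * map_poly \<phi> s + map_poly \<phi> g * map_poly \<phi> t = [:\<phi> b:]"
      using arg_cong[OF st(5), of "map_poly \<phi>"] map_poly_mult[OF B \<phi>(1) pB(1) st(1)]
        map_poly_mult[OF B \<phi>(1) g(1) st(2)] map_poly_const[OF B \<phi>(1), of b]
        map_poly_add[OF B \<phi>(1) coeffs_in_mult[OF B(1) pB(1) st(1)] coeffs_in_mult[OF B(1) g(1) st(2)]]
      by simp
    from arg_cong[OF this, of "\<lambda>f. poly f c"] c \<phi>b have "poly (map_poly \<phi> g) c \<noteq> 0" by auto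
    then show ?thesis using \<psi> g by auto
  qed
qed

text \<open>
  Polynomial expressions in the variables \<open>0, 1, 2, \<dots>\<close>, as a substitute for multivariate polynomials.
  Two expressions of the same polynomial are not identified; only the values \<open>peval\<close> matter.
\<close>

datatype 'k pexpr = PConst 'k | PVar nat | PAdd "'k pexpr" "'k pexpr" | PMul "'k pexpr" "'k pexpr"

fun peval :: "('k \<Rightarrow> 'a::comm_ring_1) \<Rightarrow> (nat \<Rightarrow> 'a) \<Rightarrow> 'k pexpr \<Rightarrow> 'a" where
  "peval h a (PConst c) = h c"
| "peval h a (PVar i) = a i"
| "peval h a (PAdd e f) = peval h a e + peval h a f"
| "peval h a (PMul e f) = peval h a e * peval h a f"

text \<open>
  A point with coordinates in a domain over \<open>k\<close> can be replaced by a point with coordinates in \<open>k\<close>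
  that satisfies all polynomial equations of the first point and one of its inequations.
\<close>

theorem (in scalar_embedding) specialization:
  fixes a :: "nat \<Rightarrow> 'a"
  assumes alg: "\<And>p::'k poly. degree p > 0 \<Longrightarrow> \<exists>x. poly p x = 0" and inf: "infinite (UNIV::'k set)"
    and a: "\<And>i. i \<ge> N \<Longrightarrow> a i = 0" and e0: "peval h a e0 \<noteq> 0"
  shows "\<exists>c. peval (\<lambda>k. k) c e0 \<noteq> 0 \<and> (\<forall>e. peval h a e = 0 \<longrightarrow> peval (\<lambda>k. k) c e = 0)"
proof -
  define B where "B n = rec_nat (range h) (\<lambda>n B. adjoin B (a n)) n" for n
  have B0: "B 0 = range h" and BS: "\<And>n. B (Suc n) = adjoin (B n) (a n)" by (simp_all add: B_def)
  have hm: "- h x = h (- x)" for x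
    using h_add[of x "- x"] h_0 by (simp add: add_eq_0_iff2 minus_equation_iff)
  have sub: "subring_set (B n) \<and> range h \<subseteq> B n \<and> specializable h (B n) \<and> a ` {..<n} \<subseteq> B n" for n
  proof (induction n)
    case 0
    have "subring_set (range h)"
      unfolding subring_set_def
      by (auto simp: hm h_add[symmetric] h_mult[symmetric]) (metis h_0 rangeI, metis h_1 rangeI)
    moreover have "specializable h (range h)"
    proof -
      have i: "inj h"
      proof (rule injI, rule ccontr)
        fix x y assume "h x = h y" "x \<noteq> y"
        then have "h (x - y) = 0" using h_add[of "x - y" y] by simp
        then have "h ((x - y) * inverse (x - y)) = 0" unfolding h_mult by simp
        then show False using \<open>x \<noteq> y\<close> h_1 by simp
      qed
      then have "alg_hom_on h (range h) (inv_into UNIV h)"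
        unfolding alg_hom_on_def by (auto simp: h_add[symmetric] h_mult[symmetric])
      moreover have "inv_into UNIV h g \<noteq> 0" if "g \<in> range h" "g \<noteq> 0" for g
        using that i h_0 by auto
      ultimately show ?thesis unfolding specializable_def by blast
    qed
    ultimately show ?case by (auto simp: B0)
  next
    case (Suc n)
    then show ?case
      using subring_adjoin[of "B n" "a n"] specializable_adjoin[of "B n" "a n", OF _ _ _ alg inf]
        adjoin_base[of "B n" _ "a n"] adjoin_gen[of "B n" "a n"]
      by (fastforce simp: BS less_Suc_eq)
  qed
  have aB: "a i \<in> B N" for i
    using sub[of N] a[of i] by (cases "i < N") (auto simp: subring_set_def)
  have eB: "peval h a e \<in> B N" for e
    using sub[of N] aB by (induction e) (auto simp: subring_set_def)
  from sub[of N] eB[of e0] e0 obtain \<phi> where \<phi>: "alg_hom_on h (B N) \<phi>" "\<phi> (peval h a e0) \<noteq> 0"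
    unfolding specializable_def by blast
  have ev: "peval (\<lambda>k. k) (\<lambda>i. \<phi> (a i)) e = \<phi> (peval h a e)" for e
    using \<phi>(1) eB by (induction e) (auto simp: alg_hom_on_def)
  have "\<phi> 0 = 0" using \<phi>(1) h_0 unfolding alg_hom_on_def by metis
  then show ?thesis using ev \<phi>(2) by (intro exI[of _ "\<lambda>i. \<phi> (a i)"]) auto
qed


section \<open>The Hilbert basis theorem\<close>

text \<open>
  The linear combinations of elements of \<open>F\<close> with coefficients in \<open>A\<close>.
\<close>

inductive_set ispan :: "'a::comm_ring_1 set \<Rightarrow> 'a set \<Rightarrow> 'a set" for A F where
  ispan_0: "0 \<in> ispan A F"
| ispan_step: "f \<in> ispan A F \<Longrightarrow> a \<in> A \<Longrightarrow> g \<in> F \<Longrightarrow> f + a * g \<in> ispan A F"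

text \<open>\<open>I\<close> is an ideal of the subring \<open>A\<close>.\<close>

definition ideal_in :: "'a::comm_ring_1 set \<Rightarrow> 'a set \<Rightarrow> bool" where
  "ideal_in A I \<longleftrightarrow> I \<subseteq> A \<and> 0 \<in> I \<and> (\<forall>f\<in>I. \<forall>g\<in>I. f + g \<in> I) \<and> (\<forall>a\<in>A. \<forall>f\<in>I. a * f \<in> I)"

text \<open>All ideals of the subring \<open>A\<close> are finitely generated.\<close>

definition noetherian_set :: "'a::comm_ring_1 set \<Rightarrow> bool" where
  "noetherian_set A \<longleftrightarrow> (\<forall>I. ideal_in A I \<longrightarrow> (\<exists>F. finite F \<and> F \<subseteq> I \<and> I \<subseteq> ispan A F))"

lemma ispan_add: "g \<in> ispan A F \<Longrightarrow> f \<in> ispan A F \<Longrightarrow> f + g \<in> ispan A F"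
  by (induction g rule: ispan.induct) (auto simp: add.assoc[symmetric] intro: ispan.intros)

lemma ispan_mono: "f \<in> ispan A F \<Longrightarrow> F \<subseteq> F' \<Longrightarrow> f \<in> ispan A F'"
  by (induction f rule: ispan.induct) (auto intro: ispan.intros)

lemma ispan_subset: "f \<in> ispan A F \<Longrightarrow> ideal_in A I \<Longrightarrow> F \<subseteq> I \<Longrightarrow> f \<in> I"
  by (induction f rule: ispan.induct) (auto simp: ideal_in_def)

lemma ispan_lift_coeff:
  assumes A: "subring_set A" and c: "c \<in> ispan A F" and mn: "m \<le> n"
    and P: "\<And>g. g \<in> F \<Longrightarrow> degree (P g) \<le> m \<and> coeff (P g) m = g"
  shows "\<exists>r\<in>ispan {p. coeffs_in A p} (P ` F). degree r \<le> n \<and> coeff r n = c"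
  using c
proof (induction c rule: ispan.induct)
  case ispan_0
  then show ?case by (intro bexI[of _ 0] ispan.intros) auto
next
  case (ispan_step f a g)
  then obtain r where r: "r \<in> ispan {p. coeffs_in A p} (P ` F)" "degree r \<le> n" "coeff r n = f" by auto
  let ?m = "monom a (n - m) * P g"
  have "r + ?m \<in> ispan {p. coeffs_in A p} (P ` F)"
    using ispan_step r by (intro ispan.intros) (auto intro: coeffs_in_monom[OF A])
  moreover have "degree ?m \<le> n"
    using degree_mult_le[of "monom a (n - m)" "P g"] degree_monom_le[of a "n - m"] P[OF ispan_step(3)] mn
    by linarith
  moreover have "coeff ?m n = a * g"
    using P[OF ispan_step(3)] mn by (simp add: coeff_monom_mult)
  ultimately show ?case using r by (intro bexI[of _ "r + ?m"]) (auto intro: degree_add_le)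
qed

theorem hilbert_basis:
  fixes A :: "'a::comm_ring_1 set"
  assumes A: "subring_set A" and noeth: "noetherian_set A"
  shows "noetherian_set (adjoin A x)"
  unfolding noetherian_set_def
proof (intro allI impI)
  fix I assume I: "ideal_in (adjoin A x) I"
  define AX where "AX = {p. coeffs_in A p}"
  have AX: "subring_set AX" unfolding AX_def by (rule subring_coeffs_in[OF A])
  define J where "J = {p. coeffs_in A p \<and> poly p x \<in> I}"
  have J: "ideal_in AX J"
    using I AX unfolding ideal_in_def J_def AX_def subring_set_def adjoin_def by auto
  \<comment> \<open>the leading coefficients in degree \<open>n\<close> form an increasing sequence of ideals of \<open>A\<close>\<close>
  define L where "L n = {coeff p n | p. p \<in> J \<and> degree p \<le> n}" for n
  have L: "ideal_in A (L n)" for n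
    unfolding ideal_in_def
  proof (intro conjI ballI)
    show "L n \<subseteq> A" by (auto simp: L_def J_def coeffs_in_def)
    show "0 \<in> L n" using J by (auto simp: L_def ideal_in_def intro!: exI[of _ 0])
  next
    fix f assume "f \<in> L n"
    then obtain p where p: "p \<in> J" "degree p \<le> n" "f = coeff p n" by (auto simp: L_def)
    { fix g assume "g \<in> L n"
      then obtain q where q: "q \<in> J" "degree q \<le> n" "g = coeff q n" by (auto simp: L_def)
      then show "f + g \<in> L n" using p J unfolding L_def ideal_in_def
        by (intro CollectI exI[of _ "p + q"]) (auto intro: degree_add_le) }
    { fix a assume "a \<in> A"
      then have "[:a:] \<in> AX" using coeffs_in_monom[OF A, of a 0] by (simp add: AX_def monom_0)
      then have "[:a:] * p \<in> J" using J p unfolding ideal_in_def by blast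
      then show "a * f \<in> L n" using p unfolding L_def
        by (intro CollectI exI[of _ "[:a:] * p"]) (auto intro: order.trans[OF degree_smult_le]) }
  qed
  have LSuc: "L n \<subseteq> L (Suc n)" for n
  proof
    fix f assume "f \<in> L n"
    then obtain p where p: "p \<in> J" "degree p \<le> n" "f = coeff p n" by (auto simp: L_def)
    have "monom 1 1 * p \<in> J"
      using J p coeffs_in_monom[OF A, of 1 1] A unfolding ideal_in_def AX_def subring_set_def by blast
    moreover have "degree (monom 1 1 * p) \<le> Suc n"
      using degree_mult_le[of "monom 1 1" p] degree_monom_le[of "1::'a" 1] p by linarith
    moreover have "coeff (monom 1 1 * p) (Suc n) = f" using p by (simp add: coeff_monom_mult)
    ultimately show "f \<in> L (Suc n)" by (auto simp: L_def intro!: exI[of _ "monom 1 1 * p"])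
  qed
  have Lmono: "m \<le> n \<Longrightarrow> L m \<subseteq> L n" for m n by (rule lift_Suc_mono_le[of L, OF LSuc])
  have LL: "ideal_in A (\<Union>n. L n)"
    unfolding ideal_in_def
  proof (intro conjI ballI)
    show "(\<Union>n. L n) \<subseteq> A" "0 \<in> (\<Union>n. L n)" using L unfolding ideal_in_def by blast+
    fix f g assume "f \<in> (\<Union>n. L n)" "g \<in> (\<Union>n. L n)"
    then obtain m n where "f \<in> L m" "g \<in> L n" by auto
    then have "f \<in> L (max m n)" "g \<in> L (max m n)"
      using Lmono[of m "max m n"] Lmono[of n "max m n"] by auto
    then show "f + g \<in> (\<Union>n. L n)" using L[of "max m n"] by (auto simp: ideal_in_def)
  next
    fix a f assume "a \<in> A" "f \<in> (\<Union>n. L n)"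
    then show "a * f \<in> (\<Union>n. L n)" using L unfolding ideal_in_def by blast
  qed
  with noeth obtain F where F: "finite F" "F \<subseteq> (\<Union>n. L n)" "(\<Union>n. L n) \<subseteq> ispan A F"
    unfolding noetherian_set_def by blast
  have "\<exists>N. F \<subseteq> L N" using F(1,2)
  proof (induction F rule: finite_induct)
    case (insert f F)
    then obtain N n where "F \<subseteq> L N" "f \<in> L n" by auto
    then have "insert f F \<subseteq> L (max N n)"
      using Lmono[of N "max N n"] Lmono[of n "max N n"] by auto
    then show ?case by blast
  qed auto
  then obtain N where N: "F \<subseteq> L N" ..
  have "\<forall>n. \<exists>G. finite G \<and> G \<subseteq> L n \<and> L n \<subseteq> ispan A G"
    using noeth L unfolding noetherian_set_def by blast
  then obtain G where G: "\<And>n. finite (G n) \<and> G n \<subseteq> L n \<and> L n \<subseteq> ispan A (G n)" by metis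
  have "\<forall>n g. \<exists>p. g \<in> L n \<longrightarrow> p \<in> J \<and> degree p \<le> n \<and> coeff p n = g" by (auto simp: L_def)
  then obtain P where P: "\<And>n g. g \<in> L n \<Longrightarrow> P n g \<in> J \<and> degree (P n g) \<le> n \<and> coeff (P n g) n = g" by metis
  \<comment> \<open>for \<open>n \<le> N\<close> the ideal \<open>L n\<close> has its own generators, for \<open>n > N\<close> it lies in \<open>ispan A F\<close>;
    generators of \<open>J\<close> are chosen with these leading coefficients\<close>
  define H where "H = (\<Union>n\<le>N. P n ` G n) \<union> P N ` F"
  have Hfin: "finite H" using G F by (auto simp: H_def)
  have HJ: "H \<subseteq> J" using P G N by (force simp: H_def)
  have gen: "p \<in> J \<Longrightarrow> degree p < n \<or> p = 0 \<Longrightarrow> p \<in> ispan AX H" for n p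
  proof (induction n arbitrary: p)
    case 0
    then show ?case by (auto intro: ispan.intros)
  next
    case (Suc n)
    then have d: "degree p \<le> n" by auto
    have c: "coeff p n \<in> L n" using Suc d by (auto simp: L_def)
    have "\<exists>r\<in>ispan AX H. degree r \<le> n \<and> coeff r n = coeff p n"
    proof (cases "n \<le> N")
      case True
      have "coeff p n \<in> ispan A (G n)" using G[of n] c by auto
      from ispan_lift_coeff[OF A this order.refl, of "P n"] P[of _ n] G[of n]
      obtain r where "r \<in> ispan AX (P n ` G n)" "degree r \<le> n" "coeff r n = coeff p n"
        unfolding AX_def by blast
      moreover have "P n ` G n \<subseteq> H" using True by (auto simp: H_def)
      ultimately show ?thesis using ispan_mono by blast
    next
      case False
      have "coeff p n \<in> ispan A F" using F c by auto
      from ispan_lift_coeff[OF A this, of N n "P N"] P[of _ N] N False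
      obtain r where "r \<in> ispan AX (P N ` F)" "degree r \<le> n" "coeff r n = coeff p n"
        unfolding AX_def by force
      moreover have "P N ` F \<subseteq> H" by (auto simp: H_def)
      ultimately show ?thesis using ispan_mono by blast
    qed
    then obtain r where r: "r \<in> ispan AX H" "degree r \<le> n" "coeff r n = coeff p n" by blast
    have rJ: "r \<in> J" using ispan_subset[OF r(1) J HJ] .
    have "- r = [:-1:] * r" by simp
    moreover have "[:-1:] \<in> AX" using AX unfolding subring_set_def by (metis one_pCons neg_equal_zero minus_pCons minus_zero)
    ultimately have "p - r \<in> J" using J rJ Suc(2) unfolding ideal_in_def by (metis diff_conv_add_uminus)
    moreover have "degree (p - r) < n \<or> p - r = 0"
      using r d eq_zero_or_degree_less[of "p - r" n] by (auto intro: degree_diff_le)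
    ultimately have "p - r \<in> ispan AX H" by (rule Suc.IH)
    from ispan_add[OF this r(1)] show ?case by simp
  qed
  have ev: "p \<in> ispan AX H \<Longrightarrow> poly p x \<in> ispan (adjoin A x) ((\<lambda>p. poly p x) ` H)" for p
  proof (induction p rule: ispan.induct)
    case (ispan_step f a g)
    then show ?case by (auto simp: AX_def adjoin_def intro!: ispan.ispan_step)
  qed (auto intro: ispan.intros)
  have "I \<subseteq> ispan (adjoin A x) ((\<lambda>p. poly p x) ` H)"
  proof
    fix y assume y: "y \<in> I"
    then obtain p where p: "coeffs_in A p" "y = poly p x" using I by (auto simp: ideal_in_def adjoin_def)
    then have "p \<in> J" using y by (auto simp: J_def)
    then have "p \<in> ispan AX H" using gen[of p "Suc (degree p)"] by auto
    then show "y \<in> ispan (adjoin A x) ((\<lambda>p. poly p x) ` H)" using ev p by auto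
  qed
  moreover have "(\<lambda>p. poly p x) ` H \<subseteq> I" using HJ by (auto simp: J_def)
  ultimately show "\<exists>F. finite F \<and> F \<subseteq> I \<and> I \<subseteq> ispan (adjoin A x) F" using Hfin by blast
qed

lemma subring_gen_alg: "subring_set (gen_alg G)"
  unfolding subring_set_def
proof (intro conjI ballI)
  show "0 \<in> gen_alg G" "1 \<in> gen_alg G"
    using gen_alg_const[of 0 G] gen_alg_const[of 1 G] by (simp_all add: zero_fun_def one_fun_def)
  fix f assume f: "f \<in> gen_alg G"
  from gen_alg_mult[OF gen_alg_const[of "-1"] f] show "- f \<in> gen_alg G" by (simp add: fun_Compl_def)
  fix g assume g: "g \<in> gen_alg G"
  show "f + g \<in> gen_alg G" "f * g \<in> gen_alg G"
    using gen_alg_add[OF f g] gen_alg_mult[OF f g] by (simp_all add: plus_fun_def times_fun_def)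
qed

lemma gen_alg_mono: "f \<in> gen_alg G \<Longrightarrow> G \<subseteq> H \<Longrightarrow> f \<in> gen_alg H"
  by (induction f rule: gen_alg.induct) (auto intro: gen_alg.intros)

lemma gen_alg_insert: "gen_alg (insert g G) = adjoin (gen_alg G) g"
proof (intro equalityI subsetI)
  fix f assume "f \<in> gen_alg (insert g G)"
  then show "f \<in> adjoin (gen_alg G) g"
  proof (induction f rule: gen_alg.induct)
    case (gen_alg_const c)
    then show ?case by (intro adjoin_base subring_gen_alg gen_alg.intros)
  next
    case (gen_alg_gen f)
    then show ?case
      using adjoin_gen[OF subring_gen_alg] adjoin_base[OF subring_gen_alg] gen_alg.gen_alg_gen[of f G] by auto
  next
    case (gen_alg_add f h)
    then show ?case using subring_adjoin[OF subring_gen_alg, of G g]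
      unfolding subring_set_def by (auto simp: plus_fun_def)
  next
    case (gen_alg_mult f h)
    then show ?case using subring_adjoin[OF subring_gen_alg, of G g]
      unfolding subring_set_def by (auto simp: times_fun_def)
  qed
next
  fix f assume "f \<in> adjoin (gen_alg G) g"
  then obtain p where p: "coeffs_in (gen_alg G) p" "f = poly p g" by (auto simp: adjoin_def)
  have "coeff p i * g ^ i \<in> gen_alg (insert g G)" for i
    using p gen_alg_mono[of _ G "insert g G"] subring_power[OF subring_gen_alg gen_alg_gen[of g "insert g G"], of i]
      subring_gen_alg[of "insert g G"]
    unfolding coeffs_in_def subring_set_def by blast
  then show "f \<in> gen_alg (insert g G)"
    unfolding p(2) poly_altdef by (intro subring_sum[OF subring_gen_alg])
qed

lemma noetherian_gen_alg:
  fixes G :: "('p \<Rightarrow> 'k::field) set"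
  assumes "finite G" shows "noetherian_set (gen_alg G)"
  using assms
proof (induction G rule: finite_induct)
  case empty
  have g0: "f \<in> gen_alg {} \<Longrightarrow> \<exists>c. f = (\<lambda>_. c)" for f :: "'p \<Rightarrow> 'k"
    by (induction f rule: gen_alg.induct) auto
  show ?case
    unfolding noetherian_set_def
  proof (intro allI impI)
    fix I :: "('p \<Rightarrow> 'k) set" assume I: "ideal_in (gen_alg {}) I"
    show "\<exists>F. finite F \<and> F \<subseteq> I \<and> I \<subseteq> ispan (gen_alg {}) F"
    proof (cases "I \<subseteq> {0}")
      case True
      then show ?thesis by (intro exI[of _ "{}"]) (auto intro: ispan.intros)
    next
      case False
      then obtain f where f: "f \<in> I" "f \<noteq> 0" by auto
      then obtain c where c: "f = (\<lambda>_. c)" using g0 I by (auto simp: ideal_in_def)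
      then have c0: "c \<noteq> 0" using f by (auto simp: zero_fun_def)
      have "I \<subseteq> ispan (gen_alg {}) {f}"
      proof
        fix g assume "g \<in> I"
        then obtain d where d: "g = (\<lambda>_. d)" using g0 I by (auto simp: ideal_in_def)
        have "g = 0 + (\<lambda>_. d / c) * f" using c c0 d by (auto simp: times_fun_def zero_fun_def plus_fun_def)
        then show "g \<in> ispan (gen_alg {}) {f}"
          using ispan_step[OF ispan_0 gen_alg_const[of "d/c"], of f "{f}"] by simp
      qed
      then show ?thesis using f by (intro exI[of _ "{f}"]) auto
    qed
  qed
next
  case (insert g G)
  then show ?case unfolding gen_alg_insert by (intro hilbert_basis subring_gen_alg)
qed

section \<open>Local algebras of germs\<close>

text \<open>
  A local algebra of germs at \<open>pt\<close>.  Its elements are total functions, and functions that agree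
  eventually with respect to \<open>F\<close>, the filter of neighbourhoods of \<open>pt\<close>, represent the same germ.
\<close>

locale germ_algebra =
  fixes F :: "'p filter" and A :: "('p \<Rightarrow> 'k::field) set" and pt :: 'p
  assumes germ_const: "(\<lambda>_. c) \<in> A"
    and germ_add: "f \<in> A \<Longrightarrow> g \<in> A \<Longrightarrow> (\<lambda>q. f q + g q) \<in> A"
    and germ_mult: "f \<in> A \<Longrightarrow> g \<in> A \<Longrightarrow> (\<lambda>q. f q * g q) \<in> A"
    and germ_cong: "f \<in> A \<Longrightarrow> (\<forall>\<^sub>F q in F. g q = f q) \<Longrightarrow> g \<in> A"
    and germ_inverse: "f \<in> A \<Longrightarrow> f pt \<noteq> 0 \<Longrightarrow> (\<lambda>q. inverse (f q)) \<in> A"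
    and germ_nonzero: "f \<in> A \<Longrightarrow> f pt \<noteq> 0 \<Longrightarrow> \<forall>\<^sub>F q in F. f q \<noteq> 0"
    and at_pt: "eventually P F \<Longrightarrow> P pt"
begin

lemma germ_cmult: "f \<in> A \<Longrightarrow> (\<lambda>q. c * f q) \<in> A"
  by (rule germ_mult[OF germ_const])

lemma germ_uminus: "f \<in> A \<Longrightarrow> (\<lambda>q. - f q) \<in> A"
  using germ_cmult[of f "-1"] by simp

lemma germ_diff: "f \<in> A \<Longrightarrow> g \<in> A \<Longrightarrow> (\<lambda>q. f q - g q) \<in> A"
  using germ_add[OF _ germ_uminus] by simp

lemma germ_divide: "f \<in> A \<Longrightarrow> g \<in> A \<Longrightarrow> g pt \<noteq> 0 \<Longrightarrow> (\<lambda>q. f q / g q) \<in> A"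
  using germ_mult[OF _ germ_inverse] by (simp add: divide_inverse)

lemma germ_sum: "(\<And>i. i \<in> I \<Longrightarrow> f i \<in> A) \<Longrightarrow> (\<lambda>q. \<Sum>i\<in>I. f i q) \<in> A"
proof (induction I rule: infinite_finite_induct)
  case (insert x J)
  then show ?case using germ_add[of "f x" "\<lambda>q. \<Sum>i\<in>J. f i q"] by simp
qed (auto intro: germ_const)

lemma germ_power: "f \<in> A \<Longrightarrow> (\<lambda>q. f q ^ n) \<in> A"
  by (induction n) (auto intro: germ_const germ_mult)

text \<open>
  The ideal generated by \<open>G\<close>, as a set of representatives closed under equality of germs.
\<close>

inductive_set germ_ideal :: "('p \<Rightarrow> 'k) set \<Rightarrow> ('p \<Rightarrow> 'k) set" for G where
  germ_ideal_0: "\<forall>\<^sub>F q in F. f q = 0 \<Longrightarrow> f \<in> germ_ideal G"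
| germ_ideal_step: "f \<in> germ_ideal G \<Longrightarrow> a \<in> A \<Longrightarrow> g \<in> G \<Longrightarrow>
     \<forall>\<^sub>F q in F. f' q = f q + a q * g q \<Longrightarrow> f' \<in> germ_ideal G"

lemma germ_ideal_cong:
  assumes "f \<in> germ_ideal G" "\<forall>\<^sub>F q in F. g q = f q" shows "g \<in> germ_ideal G"
  using assms
proof cases
  case germ_ideal_0
  show ?thesis by (rule germ_ideal.germ_ideal_0) (use assms(2) germ_ideal_0 in eventually_elim, simp)
next
  case (germ_ideal_step h a b)
  show ?thesis
    by (rule germ_ideal.germ_ideal_step[OF germ_ideal_step(1-3)])
      (use assms(2) germ_ideal_step(4) in eventually_elim, simp)
qed

lemma germ_ideal_gen: "a \<in> A \<Longrightarrow> g \<in> G \<Longrightarrow> (\<lambda>q. a q * g q) \<in> germ_ideal G"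
  by (rule germ_ideal_step[OF germ_ideal_0[of "\<lambda>_. 0"]]) auto

lemma germ_ideal_base: "g \<in> G \<Longrightarrow> g \<in> germ_ideal G"
  using germ_ideal_gen[OF germ_const[of 1]] by simp

lemma germ_ideal_add:
  assumes "g \<in> germ_ideal G" "f \<in> germ_ideal G"
  shows "(\<lambda>q. f q + g q) \<in> germ_ideal G"
  using assms(1)
proof (induction g rule: germ_ideal.induct)
  case (germ_ideal_0 g)
  show ?case by (rule germ_ideal_cong[OF assms(2)]) (use germ_ideal_0 in eventually_elim, simp)
next
  case (germ_ideal_step g a b g')
  show ?case
    by (rule germ_ideal.germ_ideal_step[OF germ_ideal_step(5,2,3)])
      (use germ_ideal_step(4) in eventually_elim, simp)
qed

lemma germ_ideal_mult:
  assumes "g \<in> germ_ideal G" "b \<in> A"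
  shows "(\<lambda>q. b q * g q) \<in> germ_ideal G"
  using assms(1)
proof (induction g rule: germ_ideal.induct)
  case (germ_ideal_0 g)
  show ?case by (rule germ_ideal.germ_ideal_0) (use germ_ideal_0 in eventually_elim, simp)
next
  case (germ_ideal_step g a c g')
  show ?case
    by (rule germ_ideal.germ_ideal_step[OF germ_ideal_step(5) germ_mult[OF assms(2) germ_ideal_step(2)] germ_ideal_step(3)])
      (use germ_ideal_step(4) in eventually_elim, simp add: algebra_simps)
qed

lemma germ_ideal_cmult: "g \<in> germ_ideal G \<Longrightarrow> (\<lambda>q. c * g q) \<in> germ_ideal G"
  by (rule germ_ideal_mult[OF _ germ_const])

lemma germ_ideal_diff: "f \<in> germ_ideal G \<Longrightarrow> g \<in> germ_ideal G \<Longrightarrow> (\<lambda>q. f q - g q) \<in> germ_ideal G"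
  using germ_ideal_add[OF germ_ideal_cmult[of g G "-1"]] by simp

lemma germ_ideal_trans:
  assumes "f \<in> germ_ideal G" "G \<subseteq> germ_ideal H" shows "f \<in> germ_ideal H"
  using assms(1)
proof (induction f rule: germ_ideal.induct)
  case (germ_ideal_step g a b g')
  have "(\<lambda>q. g q + a q * b q) \<in> germ_ideal H"
    using germ_ideal_step assms(2) by (intro germ_ideal_add germ_ideal_mult) auto
  then show ?case by (rule germ_ideal_cong) (rule germ_ideal_step(4))
qed (rule germ_ideal.germ_ideal_0)

lemma germ_ideal_mono: "f \<in> germ_ideal G \<Longrightarrow> G \<subseteq> H \<Longrightarrow> f \<in> germ_ideal H"
  using germ_ideal_trans germ_ideal_base by blast

lemma germ_ideal_subset: "f \<in> germ_ideal G \<Longrightarrow> G \<subseteq> A \<Longrightarrow> f \<in> A"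
proof (induction f rule: germ_ideal.induct)
  case (germ_ideal_0 f)
  then show ?case using germ_cong[OF germ_const[of 0]] by simp
next
  case (germ_ideal_step f a g f')
  have "(\<lambda>q. f q + a q * g q) \<in> A" using germ_ideal_step by (intro germ_add germ_mult) auto
  then show ?case by (rule germ_cong) (rule germ_ideal_step(4))
qed

lemma germ_ideal_finite:
  assumes "f \<in> germ_ideal (w ` {..<N::nat})"
  shows "\<exists>a. (\<forall>l. a l \<in> A) \<and> (\<forall>\<^sub>F q in F. f q = (\<Sum>l<N. a l q * w l q))"
  using assms
proof (induction f rule: germ_ideal.induct)
  case (germ_ideal_0 f)
  then show ?case by (intro exI[of _ "\<lambda>_ _. 0"]) (auto intro: germ_const)
next
  case (germ_ideal_step f a g f')
  then obtain b m where b: "\<forall>l. b l \<in> A" "\<forall>\<^sub>F q in F. f q = (\<Sum>l<N. b l q * w l q)"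
    and m: "m < N" "g = w m" by auto
  let ?c = "\<lambda>l. if l = m then (\<lambda>q. b l q + a q) else b l"
  have "\<forall>\<^sub>F q in F. f' q = (\<Sum>l<N. ?c l q * w l q)"
    using germ_ideal_step(4) b(2)
  proof eventually_elim
    case (elim q)
    have "(\<Sum>l<N. ?c l q * w l q) = (\<Sum>l<N. b l q * w l q + (if l = m then a q * w m q else 0))"
      by (intro sum.cong) (auto simp: algebra_simps)
    also have "\<dots> = f q + a q * g q" using elim(2) m by (simp add: sum.distrib)
    finally show ?case using elim(1) by simp
  qed
  moreover have "\<forall>l. ?c l \<in> A" using b(1) germ_ideal_step(2) germ_add by auto
  ultimately show ?case by (intro exI[of _ ?c] conjI)
qed

lemma germ_ideal_split:
  "f \<in> germ_ideal (insert b G) \<Longrightarrow> \<exists>g\<in>A. (\<lambda>z. f z - b z * g z) \<in> germ_ideal G"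
proof (induction f rule: germ_ideal.induct)
  case (germ_ideal_0 f)
  then show ?case by (intro bexI[of _ "\<lambda>_. 0"] germ_const) (simp add: germ_ideal.germ_ideal_0)
next
  case (germ_ideal_step f a c f')
  then obtain g where g: "g \<in> A" "(\<lambda>z. f z - b z * g z) \<in> germ_ideal G" by blast
  show ?case
  proof (cases "c = b")
    case True
    show ?thesis
    proof (rule bexI[of _ "\<lambda>z. g z + a z"])
      show "(\<lambda>z. f' z - b z * (g z + a z)) \<in> germ_ideal G"
        by (rule germ_ideal_cong[OF g(2)]) (use germ_ideal_step(4) in eventually_elim, simp add: True algebra_simps)
    qed (rule germ_add[OF g(1) germ_ideal_step(2)])
  next
    case False
    then have c: "c \<in> G" using germ_ideal_step(3) by simp
    show ?thesis
    proof (rule bexI[OF _ g(1)])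
      show "(\<lambda>z. f' z - b z * g z) \<in> germ_ideal G"
        by (rule germ_ideal.germ_ideal_step[OF g(2) germ_ideal_step(2) c])
          (use germ_ideal_step(4) in eventually_elim, simp)
    qed
  qed
qed

text \<open>
  The set \<open>L\<close> is a submodule of the germs of all functions, regular or not.  If a tuple \<open>w\<close> of
  germs satisfies \<open>w \<equiv> M w\<close> modulo \<open>L\<close> with a matrix \<open>M\<close> over the maximal ideal, then \<open>w\<close> lies in \<open>L\<close>.
  The regularity of functions is proved by taking \<open>L\<close> to be the regular germs.
\<close>

lemma nakayama:
  fixes w :: "nat \<Rightarrow> 'p \<Rightarrow> 'k"
  assumes L_add: "\<And>f g. f \<in> L \<Longrightarrow> g \<in> L \<Longrightarrow> (\<lambda>q. f q + g q) \<in> L"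
    and L_mult: "\<And>a f. a \<in> A \<Longrightarrow> f \<in> L \<Longrightarrow> (\<lambda>q. a q * f q) \<in> L"
    and L_cong: "\<And>f g. f \<in> L \<Longrightarrow> (\<forall>\<^sub>F q in F. g q = f q) \<Longrightarrow> g \<in> L"
    and rel: "\<And>l. l < N \<Longrightarrow> \<exists>c\<in>L. \<exists>M. (\<forall>m<N. M m \<in> A \<and> M m pt = 0) \<and>
                (\<forall>\<^sub>F q in F. w l q = c q + (\<Sum>m<N. M m q * w m q))"
  shows "\<forall>l<N. w l \<in> L"
  using rel
proof (induction N)
  case (Suc N)
  obtain c M where c: "c \<in> L" and M: "\<forall>m<Suc N. M m \<in> A \<and> M m pt = 0"
    and e: "\<forall>\<^sub>F q in F. w N q = c q + (\<Sum>m<Suc N. M m q * w m q)"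
    using Suc.prems[OF lessI] by blast
  define i where "i q = inverse (1 - M N q)" for q
  have MN: "(\<lambda>q. 1 - M N q) \<in> A" "1 - M N pt \<noteq> 0"
    using M by (auto intro!: germ_diff germ_const)
  have i: "i \<in> A" unfolding i_def by (rule germ_inverse[OF MN])
  have wN: "\<forall>\<^sub>F q in F. w N q = i q * c q + (\<Sum>m<N. i q * M m q * w m q)"
    using e germ_nonzero[OF MN]
  proof eventually_elim
    case (elim q)
    have "w N q * (1 - M N q) = c q + (\<Sum>m<N. M m q * w m q)"
      using elim(1) by (simp add: algebra_simps)
    then have "w N q = i q * (c q + (\<Sum>m<N. M m q * w m q))"
      using elim(2) by (simp add: i_def divide_simps)
    then show ?case by (simp add: algebra_simps sum_distrib_left)
  qed
  have IH: "\<forall>l<N. w l \<in> L"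
  proof (rule Suc.IH)
    fix l assume "l < N"
    then obtain c' M' where c': "c' \<in> L" and M': "\<forall>m<Suc N. M' m \<in> A \<and> M' m pt = 0"
      and e': "\<forall>\<^sub>F q in F. w l q = c' q + (\<Sum>m<Suc N. M' m q * w m q)"
      using Suc.prems[OF less_SucI] by blast
    have "\<forall>\<^sub>F q in F. w l q = (c' q + (M' N q * i q) * c q) +
            (\<Sum>m<N. (M' m q + (M' N q * i q) * M m q) * w m q)"
      using e' wN
    proof eventually_elim
      case (elim q)
      have "w l q = c' q + (\<Sum>m<N. M' m q * w m q) + M' N q * w N q" using elim(1) by simp
      also have "\<dots> = c' q + (\<Sum>m<N. M' m q * w m q) + M' N q * (i q * c q + (\<Sum>m<N. i q * M m q * w m q))"
        using elim(2) by simp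
      finally show ?case by (simp add: algebra_simps sum.distrib sum_distrib_left)
    qed
    moreover have "(\<lambda>q. c' q + (M' N q * i q) * c q) \<in> L"
      using c c' M' i by (intro L_add L_mult germ_mult) auto
    moreover have "\<forall>m<N. (\<lambda>q. M' m q + (M' N q * i q) * M m q) \<in> A \<and>
        M' m pt + (M' N pt * i pt) * M m pt = 0"
      using M M' i by (auto intro!: germ_add germ_mult)
    ultimately show "\<exists>c\<in>L. \<exists>M. (\<forall>m<N. M m \<in> A \<and> M m pt = 0) \<and>
                (\<forall>\<^sub>F q in F. w l q = c q + (\<Sum>m<N. M m q * w m q))"
      by (intro bexI[of _ "\<lambda>q. c' q + (M' N q * i q) * c q"]
            exI[of _ "\<lambda>m q. M' m q + (M' N q * i q) * M m q"]) auto
  qed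
  have Lc: "(\<lambda>q. i q * c q) \<in> L" by (rule L_mult[OF i c])
  have "(\<lambda>q. i q * c q + (\<Sum>m\<in>J. i q * M m q * w m q)) \<in> L" if "finite J" "J \<subseteq> {..<N}" for J
    using that
  proof (induction J rule: finite_induct)
    case (insert m J)
    have "(\<lambda>q. (i q * M m q) * w m q) \<in> L"
      using insert IH M i by (intro L_mult germ_mult) auto
    moreover have "(\<lambda>q. i q * c q + (\<Sum>m\<in>J. i q * M m q * w m q)) \<in> L" using insert by auto
    ultimately have "(\<lambda>q. (i q * M m q) * w m q + (i q * c q + (\<Sum>m\<in>J. i q * M m q * w m q))) \<in> L"
      by (rule L_add)
    then show ?case using insert by (simp add: add.left_commute)
  qed (simp add: Lc)
  from L_cong[OF this[of "{..<N}"] wN] IH show ?case by (auto simp: less_Suc_eq)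
qed simp

end


section \<open>Affine charts of spaces with functions\<close>

text \<open>The filter of Zariski neighbourhoods of a point.\<close>

abbreviation near :: "('p, 'k) space \<Rightarrow> 'p \<Rightarrow> 'p filter" where
  "near X \<equiv> nhdsin (zar X)"

text \<open>
  The open set \<open>V\<close> is an affine chart with coordinate ring \<open>gen_alg G\<close>: principal open sets are a
  base of the topology of \<open>V\<close>, and regular functions are locally fractions.  It is not required that
  \<open>V\<close> contains all points which the coordinate ring allows.
\<close>

definition presents :: "('p, 'k::field) space \<Rightarrow> 'p set \<Rightarrow> ('p \<Rightarrow> 'k) set \<Rightarrow> bool" where
  "presents X V G \<longleftrightarrow>
     (\<forall>Q\<in>gen_alg G. openin (zar X) {q \<in> V. Q q \<noteq> 0}) \<and>
     (\<forall>p\<in>V. \<forall>\<Omega>. openin (zar X) \<Omega> \<longrightarrow> p \<in> \<Omega> \<longrightarrow> (\<exists>Q\<in>gen_alg G. Q p \<noteq> 0 \<and> {q \<in> V. Q q \<noteq> 0} \<subseteq> \<Omega>)) \<and>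
     (\<forall>p\<in>V. \<forall>f. f \<in> reg X p \<longleftrightarrow>
        (\<exists>P\<in>gen_alg G. \<exists>Q\<in>gen_alg G. Q p \<noteq> 0 \<and> (\<forall>q\<in>V. Q q \<noteq> 0 \<longrightarrow> f q = P q / Q q)))"

lemma gen_alg_1: "(\<lambda>_. 1) \<in> gen_alg G"
  by (rule gen_alg_const)

lemma presents_basic: "presents X V G \<Longrightarrow> Q \<in> gen_alg G \<Longrightarrow> openin (zar X) {q \<in> V. Q q \<noteq> 0}"
  unfolding presents_def by (elim conjE) (drule bspec, assumption, assumption)

lemma presents_nbhd:
  assumes "presents X V G" "p \<in> V" "openin (zar X) \<Omega>" "p \<in> \<Omega>"
  obtains Q where "Q \<in> gen_alg G" "Q p \<noteq> 0" "{q \<in> V. Q q \<noteq> 0} \<subseteq> \<Omega>"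
proof -
  have "\<forall>p\<in>V. \<forall>\<Omega>. openin (zar X) \<Omega> \<longrightarrow> p \<in> \<Omega> \<longrightarrow> (\<exists>Q\<in>gen_alg G. Q p \<noteq> 0 \<and> {q \<in> V. Q q \<noteq> 0} \<subseteq> \<Omega>)"
    using assms(1) unfolding presents_def by (elim conjE)
  then show ?thesis using that assms(2-4) by meson
qed

lemma presents_open: "presents X V G \<Longrightarrow> openin (zar X) V"
  using presents_basic[OF _ gen_alg_1, of X V G] by simp

lemma presents_points: "presents X V G \<Longrightarrow> p \<in> V \<Longrightarrow> p \<in> points X"
  using presents_open openin_subset by blast

lemma presents_near:
  assumes X: "presents X V G" and p: "p \<in> V"
  shows "eventually P (near X p) \<longleftrightarrow> (\<exists>Q\<in>gen_alg G. Q p \<noteq> 0 \<and> (\<forall>q\<in>V. Q q \<noteq> 0 \<longrightarrow> P q))"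
proof -
  have "eventually P (near X p) \<longleftrightarrow> (\<exists>S. openin (zar X) S \<and> p \<in> S \<and> (\<forall>x\<in>S. P x))"
    using presents_points[OF X p] by (simp add: eventually_nhdsin)
  also have "\<dots> \<longleftrightarrow> (\<exists>Q\<in>gen_alg G. Q p \<noteq> 0 \<and> (\<forall>q\<in>V. Q q \<noteq> 0 \<longrightarrow> P q))"
  proof
    assume "\<exists>S. openin (zar X) S \<and> p \<in> S \<and> (\<forall>x\<in>S. P x)"
    then obtain S where S: "openin (zar X) S" "p \<in> S" "\<forall>x\<in>S. P x" by blast
    then obtain Q where "Q \<in> gen_alg G" "Q p \<noteq> 0" "{q \<in> V. Q q \<noteq> 0} \<subseteq> S"
      using presents_nbhd[OF X p] by metis
    then show "\<exists>Q\<in>gen_alg G. Q p \<noteq> 0 \<and> (\<forall>q\<in>V. Q q \<noteq> 0 \<longrightarrow> P q)" using S by blast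
  next
    assume "\<exists>Q\<in>gen_alg G. Q p \<noteq> 0 \<and> (\<forall>q\<in>V. Q q \<noteq> 0 \<longrightarrow> P q)"
    then obtain Q where Q: "Q \<in> gen_alg G" "Q p \<noteq> 0" "\<forall>q\<in>V. Q q \<noteq> 0 \<longrightarrow> P q" by blast
    then show "\<exists>S. openin (zar X) S \<and> p \<in> S \<and> (\<forall>x\<in>S. P x)"
      using presents_basic[OF X] p by (intro exI[of _ "{q \<in> V. Q q \<noteq> 0}"]) auto
  qed
  finally show ?thesis .
qed

lemma presents_reg:
  assumes X: "presents X V G" and p: "p \<in> V"
  shows "f \<in> reg X p \<longleftrightarrow> (\<exists>P\<in>gen_alg G. \<exists>Q\<in>gen_alg G. Q p \<noteq> 0 \<and> (\<forall>q\<in>V. Q q \<noteq> 0 \<longrightarrow> f q = P q / Q q))"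
proof -
  have "\<forall>p\<in>V. \<forall>f. f \<in> reg X p \<longleftrightarrow>
        (\<exists>P\<in>gen_alg G. \<exists>Q\<in>gen_alg G. Q p \<noteq> 0 \<and> (\<forall>q\<in>V. Q q \<noteq> 0 \<longrightarrow> f q = P q / Q q))"
    using X unfolding presents_def by (elim conjE)
  from bspec[OF this p] show ?thesis by (rule spec)
qed

lemma presents_gen_alg: "presents X V G \<Longrightarrow> p \<in> V \<Longrightarrow> f \<in> gen_alg G \<Longrightarrow> f \<in> reg X p"
  by (subst presents_reg, assumption, assumption)
    (intro bexI[of _ f] bexI[of _ "\<lambda>_. 1"] gen_alg_1 conjI; simp)

lemma presents_regI:
  assumes "presents X V G" "p \<in> V" "P \<in> gen_alg G" "Q \<in> gen_alg G" "Q p \<noteq> 0"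
    "\<And>q. q \<in> V \<Longrightarrow> Q q \<noteq> 0 \<Longrightarrow> f q = P q / Q q"
  shows "f \<in> reg X p"
  unfolding presents_reg[OF assms(1,2)] using assms(3-6) by blast

lemma presents_regE:
  assumes "presents X V G" "p \<in> V" "f \<in> reg X p"
  obtains P Q where "P \<in> gen_alg G" "Q \<in> gen_alg G" "Q p \<noteq> 0"
    "\<And>q. q \<in> V \<Longrightarrow> Q q \<noteq> 0 \<Longrightarrow> f q = P q / Q q"
  using assms(3) unfolding presents_reg[OF assms(1,2)] by blast

lemma presents_nearI:
  assumes "presents X V G" "p \<in> V" "Q \<in> gen_alg G" "Q p \<noteq> 0" "\<And>q. q \<in> V \<Longrightarrow> Q q \<noteq> 0 \<Longrightarrow> P q"
  shows "eventually P (near X p)"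
  unfolding presents_near[OF assms(1,2)] using assms(3-5) by blast

lemma presents_nearE:
  assumes "presents X V G" "p \<in> V" "eventually P (near X p)"
  obtains Q where "Q \<in> gen_alg G" "Q p \<noteq> 0" "\<And>q. q \<in> V \<Longrightarrow> Q q \<noteq> 0 \<Longrightarrow> P q"
  using assms(3) unfolding presents_near[OF assms(1,2)] by blast

lemma presents_germ_algebra:
  assumes X: "presents X V G" and p: "p \<in> V"
  shows "germ_algebra (near X p) (reg X p) p"
proof
  note RI = presents_regI[OF X p]
  show "(\<lambda>_. c) \<in> reg X p" for c using presents_gen_alg[OF X p gen_alg_const] .
  fix f assume "f \<in> reg X p"
  then obtain P Q where PQ: "P \<in> gen_alg G" "Q \<in> gen_alg G" "Q p \<noteq> 0" "\<And>q. q \<in> V \<Longrightarrow> Q q \<noteq> 0 \<Longrightarrow> f q = P q / Q q"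
    by (rule presents_regE[OF X p]) blast
  { fix g assume "g \<in> reg X p"
    then obtain P' Q' where PQ': "P' \<in> gen_alg G" "Q' \<in> gen_alg G" "Q' p \<noteq> 0" "\<And>q. q \<in> V \<Longrightarrow> Q' q \<noteq> 0 \<Longrightarrow> g q = P' q / Q' q"
      by (rule presents_regE[OF X p]) blast
    have QQ: "(\<lambda>q. Q q * Q' q) \<in> gen_alg G" "Q p * Q' p \<noteq> 0" using PQ PQ' gen_alg_mult by auto
    show "(\<lambda>q. f q + g q) \<in> reg X p"
    proof (rule RI[OF _ QQ(1)])
      show "(\<lambda>q. P q * Q' q + P' q * Q q) \<in> gen_alg G" by (intro gen_alg_add gen_alg_mult PQ PQ')
      show "q \<in> V \<Longrightarrow> Q q * Q' q \<noteq> 0 \<Longrightarrow> f q + g q = (P q * Q' q + P' q * Q q) / (Q q * Q' q)" for q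
        by (simp add: PQ(4) PQ'(4) divide_simps)
    qed (rule QQ)
    show "(\<lambda>q. f q * g q) \<in> reg X p"
    proof (rule RI[OF _ QQ(1)])
      show "(\<lambda>q. P q * P' q) \<in> gen_alg G" by (intro gen_alg_add gen_alg_mult PQ PQ')
      show "q \<in> V \<Longrightarrow> Q q * Q' q \<noteq> 0 \<Longrightarrow> f q * g q = (P q * P' q) / (Q q * Q' q)" for q
        by (simp add: PQ(4) PQ'(4))
    qed (rule QQ) }
  { fix g assume "\<forall>\<^sub>F q in near X p. g q = f q"
    then obtain Q' where Q': "Q' \<in> gen_alg G" "Q' p \<noteq> 0" "\<And>q. q \<in> V \<Longrightarrow> Q' q \<noteq> 0 \<Longrightarrow> g q = f q"
      by (rule presents_nearE[OF X p]) blast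
    show "g \<in> reg X p"
    proof (rule RI[of "\<lambda>q. P q * Q' q" "\<lambda>q. Q q * Q' q"])
      show "q \<in> V \<Longrightarrow> Q q * Q' q \<noteq> 0 \<Longrightarrow> g q = (P q * Q' q) / (Q q * Q' q)" for q
        by (simp add: PQ(4) Q'(3))
    qed (use PQ Q' gen_alg_mult in auto) }
  assume fp: "f p \<noteq> 0"
  then have P: "P p \<noteq> 0" using PQ p by auto
  have PQm: "(\<lambda>q. P q * Q q) \<in> gen_alg G" "P p * Q p \<noteq> 0" using PQ P gen_alg_mult by auto
  show "(\<lambda>q. inverse (f q)) \<in> reg X p"
  proof (rule RI[OF _ PQm(1)])
    show "(\<lambda>q. Q q * Q q) \<in> gen_alg G" by (intro gen_alg_mult PQ)
    show "q \<in> V \<Longrightarrow> P q * Q q \<noteq> 0 \<Longrightarrow> inverse (f q) = (Q q * Q q) / (P q * Q q)" for q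
      by (simp add: PQ(4))
  qed (rule PQm)
  show "\<forall>\<^sub>F q in near X p. f q \<noteq> 0"
    by (rule presents_nearI[OF X p PQm]) (simp add: PQ(4))
next
  fix P assume "eventually P (near X p)"
  then show "P p" using p unfolding presents_near[OF X p] by blast
qed

lemma presents_reg_near:
  assumes X: "presents X V G" and p: "p \<in> V" and f: "f \<in> reg X p"
  shows "\<forall>\<^sub>F q in near X p. q \<in> V \<and> f \<in> reg X q"
proof -
  obtain P Q where PQ: "P \<in> gen_alg G" "Q \<in> gen_alg G" "Q p \<noteq> 0" "\<And>q. q \<in> V \<Longrightarrow> Q q \<noteq> 0 \<Longrightarrow> f q = P q / Q q"
    using f unfolding presents_reg[OF X p] by blast
  have "q \<in> V \<Longrightarrow> Q q \<noteq> 0 \<Longrightarrow> f \<in> reg X q" for q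
    unfolding presents_reg[OF X] using PQ by blast
  then show ?thesis unfolding presents_near[OF X p] using PQ by blast
qed

lemma eventually_near_open: "openin (zar X) \<Omega> \<Longrightarrow> p \<in> \<Omega> \<Longrightarrow> \<forall>\<^sub>F q in near X p. q \<in> \<Omega>"
  using openin_subset[of "zar X" \<Omega>] unfolding eventually_nhdsin by blast

lemma eventually_near_iff: "p \<in> points X \<Longrightarrow> eventually P (near X p) \<longleftrightarrow> (\<exists>\<Omega>. openin (zar X) \<Omega> \<and> p \<in> \<Omega> \<and> (\<forall>q\<in>\<Omega>. P q))"
  unfolding eventually_nhdsin by blast

lemma zero_set_closed:
  assumes X: "\<And>p. p \<in> points X \<Longrightarrow> \<exists>V G. presents X V G \<and> p \<in> V" and f: "\<And>p. p \<in> points X \<Longrightarrow> f \<in> reg X p"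
  shows "closedin (zar X) {p \<in> points X. f p = 0}"
proof -
  have "openin (zar X) {p \<in> points X. f p \<noteq> 0}"
    unfolding openin_subopen[of _ "{p \<in> points X. f p \<noteq> 0}"]
  proof
    fix p assume p: "p \<in> {p \<in> points X. f p \<noteq> 0}"
    then obtain V G where VG: "presents X V G" "p \<in> V" using X[of p] by blast
    have "\<forall>\<^sub>F q in near X p. f q \<noteq> 0"
      using germ_algebra.germ_nonzero[OF presents_germ_algebra[OF VG] f] p by auto
    then show "\<exists>T. openin (zar X) T \<and> p \<in> T \<and> T \<subseteq> {p \<in> points X. f p \<noteq> 0}"
      using p openin_subset by (fastforce simp: eventually_near_iff)
  qed
  then have "closedin (zar X) (points X - {p \<in> points X. f p \<noteq> 0})" by (rule closedin_diff[OF closedin_topspace])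
  moreover have "points X - {p \<in> points X. f p \<noteq> 0} = {p \<in> points X. f p = 0}" by auto
  ultimately show ?thesis by simp
qed

text \<open>
  No condition on \<open>Z\<close> is needed, because a regular function of \<open>restr_space X Z\<close> is by definition
  the restriction of a regular function of \<open>X\<close>.
\<close>

lemma presents_restr:
  assumes X: "presents X V G" shows "presents (restr_space X Z) (V \<inter> Z) G"
  unfolding presents_def
proof (intro conjI ballI allI impI)
  fix Q assume Q: "Q \<in> gen_alg G"
  have "openin (zar X) {q \<in> V. Q q \<noteq> 0}" using presents_basic[OF X Q] .
  moreover have "{q \<in> V \<inter> Z. Q q \<noteq> 0} = {q \<in> V. Q q \<noteq> 0} \<inter> Z" by auto
  ultimately show "openin (zar (restr_space X Z)) {q \<in> V \<inter> Z. Q q \<noteq> 0}"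
    by (auto simp: restr_space_def openin_subtopology)
next
  fix p \<Omega> assume p: "p \<in> V \<inter> Z" and "openin (zar (restr_space X Z)) \<Omega>" "p \<in> \<Omega>"
  then obtain W where W: "openin (zar X) W" "\<Omega> = W \<inter> Z" by (auto simp: restr_space_def openin_subtopology)
  then obtain Q where "Q \<in> gen_alg G" "Q p \<noteq> 0" "{q \<in> V. Q q \<noteq> 0} \<subseteq> W"
    using presents_nbhd[OF X, of p W] p \<open>p \<in> \<Omega>\<close> by blast
  then show "\<exists>Q\<in>gen_alg G. Q p \<noteq> 0 \<and> {q \<in> V \<inter> Z. Q q \<noteq> 0} \<subseteq> \<Omega>" using W by blast
next
  fix p f assume p: "p \<in> V \<inter> Z"
  then have pV: "p \<in> V" by auto
  have restr: "f \<in> reg (restr_space X Z) p \<longleftrightarrow> (\<exists>g\<in>reg X p. \<forall>\<^sub>F q in near X p. q \<in> Z \<longrightarrow> f q = g q)"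
    unfolding eventually_near_iff[OF presents_points[OF X pV]] by (auto simp: restr_space_def)
  show "f \<in> reg (restr_space X Z) p \<longleftrightarrow>
          (\<exists>P\<in>gen_alg G. \<exists>Q\<in>gen_alg G. Q p \<noteq> 0 \<and> (\<forall>q\<in>V \<inter> Z. Q q \<noteq> 0 \<longrightarrow> f q = P q / Q q))"
  proof
    assume "f \<in> reg (restr_space X Z) p"
    then obtain g where g: "g \<in> reg X p" "\<forall>\<^sub>F q in near X p. q \<in> Z \<longrightarrow> f q = g q" unfolding restr by blast
    obtain P Q where PQ: "P \<in> gen_alg G" "Q \<in> gen_alg G" "Q p \<noteq> 0" "\<And>q. q \<in> V \<Longrightarrow> Q q \<noteq> 0 \<Longrightarrow> g q = P q / Q q"
      using presents_regE[OF X pV g(1)] by blast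
    obtain Q' where Q': "Q' \<in> gen_alg G" "Q' p \<noteq> 0" "\<And>q. q \<in> V \<Longrightarrow> Q' q \<noteq> 0 \<Longrightarrow> q \<in> Z \<longrightarrow> f q = g q"
      using presents_nearE[OF X pV g(2)] by blast
    show "\<exists>P\<in>gen_alg G. \<exists>Q\<in>gen_alg G. Q p \<noteq> 0 \<and> (\<forall>q\<in>V \<inter> Z. Q q \<noteq> 0 \<longrightarrow> f q = P q / Q q)"
    proof (intro bexI conjI ballI impI)
      show "q \<in> V \<inter> Z \<Longrightarrow> Q q * Q' q \<noteq> 0 \<Longrightarrow> f q = (P q * Q' q) / (Q q * Q' q)" for q
        by (simp add: PQ(4) Q'(3))
    qed (use PQ Q' gen_alg_mult in auto)
  next
    assume "\<exists>P\<in>gen_alg G. \<exists>Q\<in>gen_alg G. Q p \<noteq> 0 \<and> (\<forall>q\<in>V \<inter> Z. Q q \<noteq> 0 \<longrightarrow> f q = P q / Q q)"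
    then obtain P Q where PQ: "P \<in> gen_alg G" "Q \<in> gen_alg G" "Q p \<noteq> 0" "\<forall>q\<in>V \<inter> Z. Q q \<noteq> 0 \<longrightarrow> f q = P q / Q q" by blast
    have "(\<lambda>q. P q / Q q) \<in> reg X p" unfolding presents_reg[OF X pV] using PQ by blast
    moreover have "\<forall>\<^sub>F q in near X p. q \<in> Z \<longrightarrow> f q = P q / Q q"
      unfolding presents_near[OF X pV] using PQ by blast
    ultimately show "f \<in> reg (restr_space X Z) p" unfolding restr by (intro bexI[of _ "\<lambda>q. P q / Q q"])
  qed
qed

lemma generated_topology_base:
  assumes int: "\<And>A B. A \<in> \<C> \<Longrightarrow> B \<in> \<C> \<Longrightarrow> A \<inter> B \<in> \<C>"
    and sub: "\<And>B. B \<in> \<B> \<Longrightarrow> p \<in> B \<Longrightarrow> \<exists>C\<in>\<C>. p \<in> C \<and> C \<subseteq> B"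
    and \<Omega>: "openin (topology_generated_by \<B>) \<Omega>" "p \<in> \<Omega>"
  shows "\<exists>C\<in>\<C>. p \<in> C \<and> C \<subseteq> \<Omega>"
proof -
  have "generate_topology_on \<B> \<Omega>" using \<Omega>(1) by (simp add: openin_topology_generated_by_iff)
  then show ?thesis using \<Omega>(2)
  proof (induction \<Omega> rule: generate_topology_on.induct)
    case (Int a b)
    then obtain A where A: "A \<in> \<C>" "p \<in> A" "A \<subseteq> a" by blast
    from Int obtain B where B: "B \<in> \<C>" "p \<in> B" "B \<subseteq> b" by blast
    show ?case using A B int[OF A(1) B(1)] by (intro bexI[of _ "A \<inter> B"]) auto
  next
    case (UN K)
    then obtain k where k: "k \<in> K" "p \<in> k" by blast
    from UN.IH[OF this] obtain B where "B \<in> \<C>" "p \<in> B" "B \<subseteq> k" by blast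
    then show ?case using k by blast
  next
    case (Basis B)
    then show ?case by (rule sub)
  qed simp
qed

lemma presents_alg_space: "presents (alg_space P (gen_alg G)) P G"
proof -
  let ?B = "{{p \<in> P. f p \<noteq> 0} | f. f \<in> gen_alg G}"
  have int: "A \<inter> B \<in> ?B" if "A \<in> ?B" "B \<in> ?B" for A B
  proof -
    from that(1) obtain f where "f \<in> gen_alg G" "A = {p \<in> P. f p \<noteq> 0}" by auto
    moreover from that(2) obtain g where "g \<in> gen_alg G" "B = {p \<in> P. g p \<noteq> 0}" by auto
    ultimately
    show ?thesis by (intro CollectI exI[of _ "\<lambda>p. f p * g p"]) (auto intro: gen_alg_mult)
  qed
  show ?thesis
    unfolding presents_def
  proof (intro conjI ballI allI impI)
    fix Q assume "Q \<in> gen_alg G"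
    then show "openin (zar (alg_space P (gen_alg G))) {q \<in> P. Q q \<noteq> 0}"
      by (auto simp: alg_space_def intro!: topology_generated_by_Basis)
  next
    fix p \<Omega> assume "openin (zar (alg_space P (gen_alg G))) \<Omega>" "p \<in> \<Omega>"
    then obtain B where "B \<in> ?B" "p \<in> B" "B \<subseteq> \<Omega>"
      using generated_topology_base[OF int, of ?B p \<Omega>] by (auto simp: alg_space_def)
    then show "\<exists>Q\<in>gen_alg G. Q p \<noteq> 0 \<and> {q \<in> P. Q q \<noteq> 0} \<subseteq> \<Omega>" by blast
  next
    fix p f assume "p \<in> P"
    then show "f \<in> reg (alg_space P (gen_alg G)) p \<longleftrightarrow>
       (\<exists>Pa\<in>gen_alg G. \<exists>Q\<in>gen_alg G. Q p \<noteq> 0 \<and> (\<forall>q\<in>P. Q q \<noteq> 0 \<longrightarrow> f q = Pa q / Q q))"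
      by (auto simp: alg_space_def)
  qed
qed

section \<open>Affine space and products\<close>

lemma presents_affine_space:
  "presents (affine_space n :: ('k::field list, 'k) space) {ys. length ys = n} {(\<lambda>ys. ys ! i) | i. i < n}"
  unfolding affine_space_def by (rule presents_alg_space)

lemma points_affine_space: "points (affine_space n :: ('k::field list, 'k) space) = {ys. length ys = n}"
proof
  show "{ys. length ys = n} \<subseteq> points (affine_space n :: ('k list, 'k) space)"
    using presents_points[OF presents_affine_space] by blast
  have "points (affine_space n :: ('k list, 'k) space) \<subseteq>
      \<Union>{{p \<in> {ys. length ys = n}. f p \<noteq> 0} | f. f \<in> gen_alg {(\<lambda>ys. ys ! i) | i. i < n}}"
    by (simp add: affine_space_def alg_space_def)
  then show "points (affine_space n :: ('k list, 'k) space) \<subseteq> {ys. length ys = n}" by blast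
qed

lemma presents_affine_line: "presents (affine_line :: ('k::field, 'k) space) UNIV {\<lambda>t. t}"
  unfolding affine_line_def by (rule presents_alg_space)

lemma points_affine_line: "points (affine_line :: ('k::field, 'k) space) = UNIV"
  using presents_points[OF presents_affine_line] by blast

lemma gen_alg_comp:
  "f \<in> gen_alg G \<Longrightarrow> (\<And>g. g \<in> G \<Longrightarrow> (\<lambda>z. g (\<phi> z)) \<in> gen_alg K) \<Longrightarrow> (\<lambda>z. f (\<phi> z)) \<in> gen_alg K"
  by (induction f rule: gen_alg.induct) (auto intro: gen_alg.intros)

context
  fixes X :: "('p, 'k::field) space" and Y :: "('q, 'k) space" and V W G H
  assumes X: "presents X V G" and Y: "presents Y W H"
begin

text \<open>The generators of the coordinate ring of a product of affine charts.\<close>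

definition prod_gens :: "('p \<times> 'q \<Rightarrow> 'k) set" where
  "prod_gens = (\<lambda>g z. g (fst z)) ` G \<union> (\<lambda>h z. h (snd z)) ` H"

lemma prod_gens_fst: "P \<in> gen_alg G \<Longrightarrow> (\<lambda>z. P (fst z)) \<in> gen_alg prod_gens"
  by (erule gen_alg_comp) (auto simp: prod_gens_def intro: gen_alg_gen)

lemma prod_gens_snd: "P \<in> gen_alg H \<Longrightarrow> (\<lambda>z. P (snd z)) \<in> gen_alg prod_gens"
  by (erule gen_alg_comp) (auto simp: prod_gens_def intro: gen_alg_gen)

lemma tensor_add:
  assumes "tensor_on X Y V0 W0 F" "tensor_on X Y V0 W0 F'"
  shows "tensor_on X Y V0 W0 (\<lambda>z. F z + F' z)"
proof -
  from assms(1) obtain n a b where 1: "openin (zar X) V0" "openin (zar Y) W0"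
    "\<forall>i<n. regular_on X V0 (a i) \<and> regular_on Y W0 (b i)" "\<forall>p\<in>V0. \<forall>q\<in>W0. F (p, q) = (\<Sum>i<n::nat. a i p * b i q)"
    unfolding tensor_on_def by blast
  from assms(2) obtain m a' b' where 2:
    "\<forall>i<m. regular_on X V0 (a' i) \<and> regular_on Y W0 (b' i)" "\<forall>p\<in>V0. \<forall>q\<in>W0. F' (p, q) = (\<Sum>i<m::nat. a' i p * b' i q)"
    unfolding tensor_on_def by blast
  let ?a = "\<lambda>i. if i < n then a i else a' (i - n)" and ?b = "\<lambda>i. if i < n then b i else b' (i - n)"
  have "(\<Sum>i<n + m. ?a i p * ?b i q) = (\<Sum>i<n. a i p * b i q) + (\<Sum>i<m. a' i p * b' i q)" for p q
  proof -
    have "(\<Sum>i<n + m. ?a i p * ?b i q) = (\<Sum>i<n. ?a i p * ?b i q) + (\<Sum>i<m. ?a (n + i) p * ?b (n + i) q)"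
      by (induction m) (simp_all add: add.assoc)
    then show ?thesis by simp
  qed
  then have "\<forall>p\<in>V0. \<forall>q\<in>W0. F (p, q) + F' (p, q) = (\<Sum>i<n + m. ?a i p * ?b i q)"
    using 1(4) 2(2) by simp
  moreover have "\<forall>i<n + m. regular_on X V0 (?a i) \<and> regular_on Y W0 (?b i)"
    using 1(3) 2(1) by auto
  ultimately show ?thesis
    unfolding tensor_on_def using 1(1,2) by (intro conjI exI[of _ "n + m"] exI[of _ ?a] exI[of _ ?b])
qed

lemma regular_on_gen_alg: "f \<in> gen_alg G \<Longrightarrow> regular_on X V f" "g \<in> gen_alg H \<Longrightarrow> regular_on Y W g"
  unfolding regular_on_def using presents_gen_alg[OF X] presents_gen_alg[OF Y] by auto

lemma regular_on_mult:
  "regular_on X V f \<Longrightarrow> regular_on X V f' \<Longrightarrow> regular_on X V (\<lambda>p. f p * f' p)"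
  "regular_on Y W g \<Longrightarrow> regular_on Y W g' \<Longrightarrow> regular_on Y W (\<lambda>p. g p * g' p)"
  unfolding regular_on_def
  using germ_algebra.germ_mult[OF presents_germ_algebra[OF X]] germ_algebra.germ_mult[OF presents_germ_algebra[OF Y]]
  by auto

lemma tensor_simple: "regular_on X V f \<Longrightarrow> regular_on Y W g \<Longrightarrow> tensor_on X Y V W (\<lambda>z. f (fst z) * g (snd z))"
  unfolding tensor_on_def using presents_open[OF X] presents_open[OF Y]
  by (intro conjI exI[of _ "1::nat"] exI[of _ "\<lambda>_. f"] exI[of _ "\<lambda>_. g"]) auto

lemma tensor_mult:
  assumes "tensor_on X Y V W F" "tensor_on X Y V W F'"
  shows "tensor_on X Y V W (\<lambda>z. F z * F' z)"
proof -
  from assms(1) obtain n a b where 1: 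
    "\<forall>i<n. regular_on X V (a i) \<and> regular_on Y W (b i)" "\<forall>p\<in>V. \<forall>q\<in>W. F (p, q) = (\<Sum>i<n::nat. a i p * b i q)"
    unfolding tensor_on_def by blast
  from assms(2) obtain m a' b' where 2:
    "\<forall>i<m. regular_on X V (a' i) \<and> regular_on Y W (b' i)" "\<forall>p\<in>V. \<forall>q\<in>W. F' (p, q) = (\<Sum>i<m::nat. a' i p * b' i q)"
    unfolding tensor_on_def by blast
  have tc: "tensor_on X Y V W F2" if "tensor_on X Y V W F1" "\<forall>p\<in>V. \<forall>q\<in>W. F2 (p, q) = F1 (p, q)" for F1 F2
    using that unfolding tensor_on_def by auto
  have inner: "tensor_on X Y V W (\<lambda>z. a i (fst z) * b i (snd z) * (\<Sum>j<l. a' j (fst z) * b' j (snd z)))"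
    if "i < n" "l \<le> m" for i l
    using that(2)
  proof (induction l)
    case 0
    show ?case
      by (rule tc[OF tensor_simple[of "\<lambda>_. 0" "\<lambda>_. 0"]])
        (use regular_on_gen_alg gen_alg_const in auto)
  next
    case (Suc l)
    have "tensor_on X Y V W (\<lambda>z. (a i (fst z) * a' l (fst z)) * (b i (snd z) * b' l (snd z)))"
      using 1(1) 2(1) that(1) Suc.prems
      by (intro tensor_simple[of "\<lambda>p. a i p * a' l p" "\<lambda>p. b i p * b' l p"] regular_on_mult) auto
    from tensor_add[OF Suc.IH this] Suc.prems show ?case by (simp add: algebra_simps)
  qed
  have "tensor_on X Y V W (\<lambda>z. (\<Sum>i<l. a i (fst z) * b i (snd z)) * (\<Sum>j<m. a' j (fst z) * b' j (snd z)))"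
    if "l \<le> n" for l
    using that
  proof (induction l)
    case 0
    show ?case
      by (rule tc[OF tensor_simple[of "\<lambda>_. 0" "\<lambda>_. 0"]])
        (use regular_on_gen_alg gen_alg_const in auto)
  next
    case (Suc l)
    from tensor_add[OF Suc.IH inner[of l m]] Suc.prems show ?case by (simp add: distrib_right)
  qed
  from tc[OF this[of n]] 1(2) 2(2) show ?thesis by simp
qed

lemma tensor_gen_alg: "F \<in> gen_alg prod_gens \<Longrightarrow> tensor_on X Y V W F"
proof (induction F rule: gen_alg.induct)
  case (gen_alg_const c)
  from tensor_simple[OF regular_on_gen_alg(1)[OF gen_alg.gen_alg_const[of c]] regular_on_gen_alg(2)[OF gen_alg.gen_alg_const[of 1]]]
  show ?case by simp
next
  case (gen_alg_gen g)
  then consider f where "f \<in> G" "g = (\<lambda>z. f (fst z))" | f where "f \<in> H" "g = (\<lambda>z. f (snd z))"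
    by (auto simp: prod_gens_def)
  then show ?case
  proof cases
    case 1
    with tensor_simple[OF regular_on_gen_alg(1)[OF gen_alg.gen_alg_gen[of f]] regular_on_gen_alg(2)[OF gen_alg.gen_alg_const[of 1]]]
    show ?thesis by simp
  next
    case 2
    with tensor_simple[OF regular_on_gen_alg(1)[OF gen_alg.gen_alg_const[of 1]] regular_on_gen_alg(2)[OF gen_alg.gen_alg_gen[of f]]]
    show ?thesis by simp
  qed
qed (auto intro: tensor_add tensor_mult)

text \<open>
  Any \<open>F\<close> from the definition of the product variety is locally a fraction of elements of the
  tensor product of the coordinate rings.
\<close>

lemma tensor_fraction:
  assumes F: "tensor_on X Y V0 W0 F" and z0: "z0 \<in> V0 \<times> W0" "z0 \<in> V \<times> W"
  obtains P Q where "P \<in> gen_alg prod_gens" "Q \<in> gen_alg prod_gens" "Q z0 \<noteq> 0"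
    "\<And>z. z \<in> V \<times> W \<Longrightarrow> Q z \<noteq> 0 \<Longrightarrow> z \<in> V0 \<times> W0 \<and> F z = P z / Q z"
proof -
  obtain p q where pq: "z0 = (p, q)" by (cases z0)
  note assms = F z0[unfolded pq]
  have "p \<in> V0" "q \<in> W0" "p \<in> V" "q \<in> W" using assms(2,3) by auto
  note assms = F this
  from assms(1) obtain n a b where 1: "openin (zar X) V0" "openin (zar Y) W0"
    "\<forall>i<n. regular_on X V0 (a i) \<and> regular_on Y W0 (b i)" "\<forall>p\<in>V0. \<forall>q\<in>W0. F (p, q) = (\<Sum>i<n::nat. a i p * b i q)"
    unfolding tensor_on_def by blast
  have "\<exists>P\<in>gen_alg prod_gens. \<exists>Q\<in>gen_alg prod_gens. Q (p, q) \<noteq> 0 \<and>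
      (\<forall>z\<in>V \<times> W. Q z \<noteq> 0 \<longrightarrow> (\<Sum>i<l. a i (fst z) * b i (snd z)) = P z / Q z)" if "l \<le> n" for l
    using that
  proof (induction l)
    case 0
    show ?case by (intro bexI[of _ "\<lambda>_. 0"] bexI[of _ "\<lambda>_. 1"] gen_alg_const) auto
  next
    case (Suc l)
    then obtain P Q where PQ: "P \<in> gen_alg prod_gens" "Q \<in> gen_alg prod_gens" "Q (p, q) \<noteq> 0"
      "\<forall>z\<in>V \<times> W. Q z \<noteq> 0 \<longrightarrow> (\<Sum>i<l. a i (fst z) * b i (snd z)) = P z / Q z" by auto
    have "a l \<in> reg X p" "b l \<in> reg Y q" using 1(3) assms Suc.prems unfolding regular_on_def by auto
    then obtain A A' B B' where
      A: "A \<in> gen_alg G" "A' \<in> gen_alg G" "A' p \<noteq> 0" "\<And>p. p \<in> V \<Longrightarrow> A' p \<noteq> 0 \<Longrightarrow> a l p = A p / A' p" and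
      B: "B \<in> gen_alg H" "B' \<in> gen_alg H" "B' q \<noteq> 0" "\<And>q. q \<in> W \<Longrightarrow> B' q \<noteq> 0 \<Longrightarrow> b l q = B q / B' q"
      using presents_regE[OF X assms(4)] presents_regE[OF Y assms(5)] by metis
    let ?D = "\<lambda>z. A' (fst z) * B' (snd z)"
    show ?case
    proof (intro bexI conjI ballI impI)
      fix z assume z: "z \<in> V \<times> W" "Q z * ?D z \<noteq> 0"
      then have "a l (fst z) = A (fst z) / A' (fst z)" "b l (snd z) = B (snd z) / B' (snd z)"
        by (auto intro!: A B)
      moreover have "(\<Sum>i<l. a i (fst z) * b i (snd z)) = P z / Q z" using bspec[OF PQ(4) z(1)] z(2) by simp
      ultimately show "(\<Sum>i<Suc l. a i (fst z) * b i (snd z)) = (P z * ?D z + A (fst z) * B (snd z) * Q z) / (Q z * ?D z)"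
        using z(2) by (simp add: add_divide_distrib)
    next
      show "Q (p, q) * ?D (p, q) \<noteq> 0" using PQ A B by simp
      show "(\<lambda>z. Q z * ?D z) \<in> gen_alg prod_gens"
        by (intro gen_alg_mult PQ prod_gens_fst prod_gens_snd A B)
      show "(\<lambda>z. P z * ?D z + A (fst z) * B (snd z) * Q z) \<in> gen_alg prod_gens"
        by (intro gen_alg_add gen_alg_mult PQ prod_gens_fst prod_gens_snd A B)
    qed
  qed
  from this[of n] obtain P Q where PQ: "P \<in> gen_alg prod_gens" "Q \<in> gen_alg prod_gens" "Q (p, q) \<noteq> 0"
    "\<forall>z\<in>V \<times> W. Q z \<noteq> 0 \<longrightarrow> (\<Sum>i<n. a i (fst z) * b i (snd z)) = P z / Q z" by auto
  obtain A where A: "A \<in> gen_alg G" "A p \<noteq> 0" "{p \<in> V. A p \<noteq> 0} \<subseteq> V0"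
    using presents_nbhd[OF X assms(4) 1(1) assms(2)] by blast
  obtain B where B: "B \<in> gen_alg H" "B q \<noteq> 0" "{q \<in> W. B q \<noteq> 0} \<subseteq> W0"
    using presents_nbhd[OF Y assms(5) 1(2) assms(3)] by blast
  let ?D = "\<lambda>z. A (fst z) * B (snd z)"
  show thesis
  proof (rule that)
    show "(\<lambda>z. P z * ?D z) \<in> gen_alg prod_gens" "(\<lambda>z. Q z * ?D z) \<in> gen_alg prod_gens"
      by (intro gen_alg_mult PQ prod_gens_fst prod_gens_snd A B)+
    show "Q z0 * ?D z0 \<noteq> 0" using PQ A B by (simp add: pq)
    fix z assume z: "z \<in> V \<times> W" "Q z * ?D z \<noteq> 0"
    then have z0: "z \<in> V0 \<times> W0" using A B by (cases z) auto
    then have "F z = (\<Sum>i<n. a i (fst z) * b i (snd z))" using 1(4) by (cases z) auto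
    also have "\<dots> = P z / Q z" using bspec[OF PQ(4) z(1)] z(2) by simp
    finally show "z \<in> V0 \<times> W0 \<and> F z = P z * ?D z / (Q z * ?D z)" using z0 z(2) by simp
  qed
qed

lemma presents_prod_gens: "presents (prod_space X Y) (V \<times> W) prod_gens"
proof -
  let ?B = "{{z \<in> V \<times> W. F z \<noteq> 0} | V W F. tensor_on X Y V W F}"
  let ?C = "{{z \<in> V \<times> W. F z \<noteq> 0} | F. F \<in> gen_alg prod_gens}"
  have int: "A \<inter> B \<in> ?C" if A: "A \<in> ?C" and B: "B \<in> ?C" for A B
  proof -
    from A obtain F1 where 1: "F1 \<in> gen_alg prod_gens" "A = {z \<in> V \<times> W. F1 z \<noteq> 0}" by auto
    from B obtain F2 where 2: "F2 \<in> gen_alg prod_gens" "B = {z \<in> V \<times> W. F2 z \<noteq> 0}" by auto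
    show ?thesis
      using gen_alg_mult[OF 1(1) 2(1)] unfolding 1(2) 2(2) by (intro CollectI exI[of _ "\<lambda>z. F1 z * F2 z"]) auto
  qed
  have sub: "\<exists>C\<in>?C. z \<in> C \<and> C \<subseteq> B" if B: "B \<in> ?B" "z \<in> B" and z: "z \<in> V \<times> W" for B z
  proof -
    from B obtain V0 W0 F where F: "tensor_on X Y V0 W0 F" "B = {z \<in> V0 \<times> W0. F z \<noteq> 0}" by blast
    with B have "z \<in> V0 \<times> W0" by auto
    then obtain P Q where PQ: "P \<in> gen_alg prod_gens" "Q \<in> gen_alg prod_gens" "Q z \<noteq> 0"
      "\<And>z. z \<in> V \<times> W \<Longrightarrow> Q z \<noteq> 0 \<Longrightarrow> z \<in> V0 \<times> W0 \<and> F z = P z / Q z"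
      by (rule tensor_fraction[OF F(1) _ z]) blast
    have "F z \<noteq> 0" using B F by auto
    then have "P z \<noteq> 0" using PQ(3) PQ(4)[OF z PQ(3)] by auto
    then have "z \<in> {z \<in> V \<times> W. P z * Q z \<noteq> 0}" using PQ(3) z by simp
    moreover have "{z \<in> V \<times> W. P z * Q z \<noteq> 0} \<subseteq> B"
    proof
      fix z assume z: "z \<in> {z \<in> V \<times> W. P z * Q z \<noteq> 0}"
      then have "z \<in> V0 \<times> W0 \<and> F z = P z / Q z" by (intro PQ(4)) auto
      then show "z \<in> B" using z F(2) by simp
    qed
    moreover have "{z \<in> V \<times> W. P z * Q z \<noteq> 0} \<in> ?C"
      by (intro CollectI exI[of _ "\<lambda>z. P z * Q z"] conjI refl gen_alg_mult PQ)
    ultimately show ?thesis by blast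
  qed
  show ?thesis
    unfolding presents_def
  proof (intro conjI ballI allI impI)
    fix Q assume "Q \<in> gen_alg prod_gens"
    then have "tensor_on X Y V W Q" by (rule tensor_gen_alg)
    then have "{z \<in> V \<times> W. Q z \<noteq> 0} \<in> ?B"
      by (intro CollectI exI[of _ V] exI[of _ W] exI[of _ Q] conjI refl)
    then show "openin (zar (prod_space X Y)) {z \<in> V \<times> W. Q z \<noteq> 0}"
      unfolding prod_space_def by (simp add: topology_generated_by_Basis)
  next
    fix z \<Omega> assume z: "z \<in> V \<times> W" and \<Omega>: "openin (zar (prod_space X Y)) \<Omega>" "z \<in> \<Omega>"
    from \<Omega>(1) have o: "openin (topology_generated_by ?B) \<Omega>" by (simp add: prod_space_def)
    obtain C where "C \<in> ?C" "z \<in> C" "C \<subseteq> \<Omega>"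
      using generated_topology_base[of ?C ?B z \<Omega>, OF int sub[OF _ _ z] o \<Omega>(2)] by blast
    moreover from \<open>C \<in> ?C\<close> obtain F where "F \<in> gen_alg prod_gens" "C = {z \<in> V \<times> W. F z \<noteq> 0}" by auto
    ultimately show "\<exists>Q\<in>gen_alg prod_gens. Q z \<noteq> 0 \<and> {q \<in> V \<times> W. Q q \<noteq> 0} \<subseteq> \<Omega>"
      by (intro bexI[of _ F]) simp_all
  next
    fix z f assume z: "z \<in> V \<times> W"
    have reg: "f \<in> reg (prod_space X Y) z \<longleftrightarrow>
       (\<exists>V W F G. tensor_on X Y V W F \<and> tensor_on X Y V W G \<and> z \<in> V \<times> W \<and> G z \<noteq> 0 \<and>
          (\<forall>z'\<in>V \<times> W. G z' \<noteq> 0 \<longrightarrow> f z' = F z' / G z'))"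
      by (simp add: prod_space_def)
    show "f \<in> reg (prod_space X Y) z \<longleftrightarrow> (\<exists>P\<in>gen_alg prod_gens. \<exists>Q\<in>gen_alg prod_gens. Q z \<noteq> 0 \<and>
            (\<forall>q\<in>V \<times> W. Q q \<noteq> 0 \<longrightarrow> f q = P q / Q q))"
    proof
      assume "f \<in> reg (prod_space X Y) z"
      then obtain V0 W0 F E where F: "tensor_on X Y V0 W0 F" "tensor_on X Y V0 W0 E" "z \<in> V0 \<times> W0"
        "E z \<noteq> 0" "\<And>z'. z' \<in> V0 \<times> W0 \<Longrightarrow> E z' \<noteq> 0 \<Longrightarrow> f z' = F z' / E z'" unfolding reg by blast
      obtain P Q where PQ: "P \<in> gen_alg prod_gens" "Q \<in> gen_alg prod_gens" "Q z \<noteq> 0"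
        "\<And>z. z \<in> V \<times> W \<Longrightarrow> Q z \<noteq> 0 \<Longrightarrow> z \<in> V0 \<times> W0 \<and> F z = P z / Q z"
        by (rule tensor_fraction[OF F(1,3) z]) blast
      obtain P' Q' where PQ': "P' \<in> gen_alg prod_gens" "Q' \<in> gen_alg prod_gens" "Q' z \<noteq> 0"
        "\<And>z. z \<in> V \<times> W \<Longrightarrow> Q' z \<noteq> 0 \<Longrightarrow> z \<in> V0 \<times> W0 \<and> E z = P' z / Q' z"
        by (rule tensor_fraction[OF F(2,3) z]) blast
      have P': "P' z \<noteq> 0" using PQ'(4)[OF z PQ'(3)] F(4) by auto
      show "\<exists>P\<in>gen_alg prod_gens. \<exists>Q\<in>gen_alg prod_gens. Q z \<noteq> 0 \<and> (\<forall>q\<in>V \<times> W. Q q \<noteq> 0 \<longrightarrow> f q = P q / Q q)"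
      proof (intro bexI conjI ballI impI)
        fix q assume q: "q \<in> V \<times> W" "Q q * (P' q * Q' q) \<noteq> 0"
        then have "q \<in> V0 \<times> W0 \<and> F q = P q / Q q" "q \<in> V0 \<times> W0 \<and> E q = P' q / Q' q"
          using PQ(4)[of q] PQ'(4)[of q] by auto
        then show "f q = (P q * (Q' q * Q' q)) / (Q q * (P' q * Q' q))"
          using F(5)[of q] q by simp
      next
        show "Q z * (P' z * Q' z) \<noteq> 0" using PQ PQ' P' by simp
      qed (intro gen_alg_mult PQ PQ')+
    next
      assume "\<exists>P\<in>gen_alg prod_gens. \<exists>Q\<in>gen_alg prod_gens. Q z \<noteq> 0 \<and> (\<forall>q\<in>V \<times> W. Q q \<noteq> 0 \<longrightarrow> f q = P q / Q q)"
      then show "f \<in> reg (prod_space X Y) z" unfolding reg using tensor_gen_alg z by meson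
    qed
  qed
qed

end



section \<open>Affine charts of a variety\<close>

lemma gen_alg_image: "gen_alg ((\<lambda>h p. h (\<phi> p)) ` H) = (\<lambda>f p. f (\<phi> p)) ` gen_alg H"
proof (intro equalityI subsetI)
  fix f assume "f \<in> gen_alg ((\<lambda>h p. h (\<phi> p)) ` H)"
  then show "f \<in> (\<lambda>f p. f (\<phi> p)) ` gen_alg H"
  proof (induction f rule: gen_alg.induct)
    case (gen_alg_const c)
    show ?case by (rule image_eqI[OF _ gen_alg.gen_alg_const[of c]]) simp
  next
    case (gen_alg_gen g)
    then show ?case using gen_alg.gen_alg_gen by blast
  next
    case (gen_alg_add f g)
    then obtain f' g' where "f' \<in> gen_alg H" "g' \<in> gen_alg H" "f = (\<lambda>p. f' (\<phi> p))" "g = (\<lambda>p. g' (\<phi> p))" by blast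
    then show ?case by (intro image_eqI[OF _ gen_alg.gen_alg_add[of f' H g']]) auto
  next
    case (gen_alg_mult f g)
    then obtain f' g' where "f' \<in> gen_alg H" "g' \<in> gen_alg H" "f = (\<lambda>p. f' (\<phi> p))" "g = (\<lambda>p. g' (\<phi> p))" by blast
    then show ?case by (intro image_eqI[OF _ gen_alg.gen_alg_mult[of f' H g']]) auto
  qed
next
  fix f assume "f \<in> (\<lambda>f p. f (\<phi> p)) ` gen_alg H"
  then obtain f' where f': "f' \<in> gen_alg H" "f = (\<lambda>p. f' (\<phi> p))" by auto
  show "f \<in> gen_alg ((\<lambda>h p. h (\<phi> p)) ` H)"
    unfolding f'(2) by (rule gen_alg_comp[OF f'(1)]) (rule gen_alg_gen, rule image_eqI, rule refl, assumption)
qed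

lemma presents_iso:
  fixes X :: "('p, 'k::field) space" and Y :: "('q, 'k) space"
  assumes iso: "space_iso X Y \<phi>" and Y: "presents Y (points Y) H"
    and local: "\<And>p f g. p \<in> points X \<Longrightarrow> f \<in> reg X p \<Longrightarrow> (\<And>q. q \<in> points X \<Longrightarrow> g q = f q) \<Longrightarrow> g \<in> reg X p"
  shows "presents X (points X) ((\<lambda>h p. h (\<phi> p)) ` H)"
proof -
  from iso have hom: "homeomorphic_map (zar X) (zar Y) \<phi>" and
    reg: "\<And>p f. p \<in> points X \<Longrightarrow> f \<in> reg Y (\<phi> p) \<longleftrightarrow> f \<circ> \<phi> \<in> reg X p"
    by (auto simp: space_iso_def)
  have im: "\<phi> ` points X = points Y" and inj: "inj_on \<phi> (points X)"
    using homeomorphic_imp_surjective_map[OF hom] homeomorphic_imp_injective_map[OF hom] by auto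
  show ?thesis
    unfolding presents_def gen_alg_image
  proof (intro conjI ballI allI impI)
    fix Q assume "Q \<in> (\<lambda>f p. f (\<phi> p)) ` gen_alg H"
    then obtain Q' where Q': "Q' \<in> gen_alg H" "Q = (\<lambda>p. Q' (\<phi> p))" by blast
    have "openin (zar X) {p \<in> points X. \<phi> p \<in> {q \<in> points Y. Q' q \<noteq> 0}}"
      using homeomorphic_imp_continuous_map[OF hom] presents_basic[OF Y Q'(1)] by (rule openin_continuous_map_preimage)
    moreover have "{p \<in> points X. \<phi> p \<in> {q \<in> points Y. Q' q \<noteq> 0}} = {p \<in> points X. Q p \<noteq> 0}" using im Q' by auto
    ultimately show "openin (zar X) {p \<in> points X. Q p \<noteq> 0}" by simp
  next
    fix p \<Omega> assume p: "p \<in> points X" and \<Omega>: "openin (zar X) \<Omega>" "p \<in> \<Omega>"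
    have "openin (zar Y) (\<phi> ` \<Omega>)" using homeomorphic_imp_open_map[OF hom] \<Omega>(1) unfolding open_map_def by blast
    then obtain Q' where Q': "Q' \<in> gen_alg H" "Q' (\<phi> p) \<noteq> 0" "{q \<in> points Y. Q' q \<noteq> 0} \<subseteq> \<phi> ` \<Omega>"
      using presents_nbhd[OF Y, of "\<phi> p" "\<phi> ` \<Omega>"] p im \<Omega>(2) by blast
    have "{q \<in> points X. Q' (\<phi> q) \<noteq> 0} \<subseteq> \<Omega>"
    proof
      fix q assume q: "q \<in> {q \<in> points X. Q' (\<phi> q) \<noteq> 0}"
      then have "\<phi> q \<in> \<phi> ` \<Omega>" using Q'(3) im by auto
      then show "q \<in> \<Omega>" using q inj openin_subset[OF \<Omega>(1)] by (auto dest: inj_onD)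
    qed
    then show "\<exists>Q\<in>(\<lambda>f p. f (\<phi> p)) ` gen_alg H. Q p \<noteq> 0 \<and> {q \<in> points X. Q q \<noteq> 0} \<subseteq> \<Omega>"
      using Q'(1,2) by (intro bexI[of _ "\<lambda>p. Q' (\<phi> p)"]) auto
  next
    fix p and f :: "'p \<Rightarrow> 'k" assume p: "p \<in> points X"
    then have pY: "\<phi> p \<in> points Y" using im by auto
    define g where "g = (\<lambda>y. f (inv_into (points X) \<phi> y))"
    have g: "g (\<phi> q) = f q" if "q \<in> points X" for q using that inj by (simp add: g_def)
    have "f \<in> reg X p \<longleftrightarrow> g \<circ> \<phi> \<in> reg X p"
      using local[OF p, of f "g \<circ> \<phi>"] local[OF p, of "g \<circ> \<phi>" f] g by auto
    also have "\<dots> \<longleftrightarrow> g \<in> reg Y (\<phi> p)" using reg[OF p] by simp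
    also have "\<dots> \<longleftrightarrow> (\<exists>P\<in>gen_alg H. \<exists>Q\<in>gen_alg H. Q (\<phi> p) \<noteq> 0 \<and> (\<forall>q\<in>points Y. Q q \<noteq> 0 \<longrightarrow> g q = P q / Q q))"
      by (rule presents_reg[OF Y pY])
    also have "\<dots> \<longleftrightarrow> (\<exists>P\<in>gen_alg H. \<exists>Q\<in>gen_alg H. Q (\<phi> p) \<noteq> 0 \<and> (\<forall>q\<in>points X. Q (\<phi> q) \<noteq> 0 \<longrightarrow> f q = P (\<phi> q) / Q (\<phi> q)))"
      unfolding im[symmetric] by (simp add: g)
    finally show "f \<in> reg X p \<longleftrightarrow> (\<exists>P\<in>(\<lambda>f p. f (\<phi> p)) ` gen_alg H. \<exists>Q\<in>(\<lambda>f p. f (\<phi> p)) ` gen_alg H.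
           Q p \<noteq> 0 \<and> (\<forall>q\<in>points X. Q q \<noteq> 0 \<longrightarrow> f q = P q / Q q))"
      by simp
  qed
qed

text \<open>The coordinates of the point \<open>q\<close> of a chart, extended by zeros.\<close>

definition gen_vals :: "('p \<Rightarrow> 'k::zero) list \<Rightarrow> 'p \<Rightarrow> nat \<Rightarrow> 'k" where
  "gen_vals zs q i = (if i < length zs then (zs ! i) q else 0)"

text \<open>The value of a polynomial expression at a point with coordinates in \<open>k\<close>.\<close>

abbreviation kev :: "(nat \<Rightarrow> 'k::comm_ring_1) \<Rightarrow> 'k pexpr \<Rightarrow> 'k" where
  "kev \<equiv> peval (\<lambda>k. k)"

lemma gen_alg_peval:
  assumes "f \<in> gen_alg (set zs)"
  obtains e where "f = (\<lambda>q. kev (gen_vals zs q) e)"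
proof -
  have "\<exists>e. f = (\<lambda>q. kev (gen_vals zs q) e)"
    using assms
  proof (induction f rule: gen_alg.induct)
    case (gen_alg_const c)
    then show ?case by (intro exI[of _ "PConst c"]) simp
  next
    case (gen_alg_gen g)
    then obtain i where "i < length zs" "zs ! i = g" by (auto simp: in_set_conv_nth)
    then show ?case by (intro exI[of _ "PVar i"]) (simp add: gen_vals_def)
  next
    case (gen_alg_add f g)
    then obtain e e' where "f = (\<lambda>q. kev (gen_vals zs q) e)" "g = (\<lambda>q. kev (gen_vals zs q) e')" by blast
    then show ?case by (intro exI[of _ "PAdd e e'"]) simp
  next
    case (gen_alg_mult f g)
    then obtain e e' where "f = (\<lambda>q. kev (gen_vals zs q) e)" "g = (\<lambda>q. kev (gen_vals zs q) e')" by blast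
    then show ?case by (intro exI[of _ "PMul e e'"]) simp
  qed
  then show ?thesis using that by blast
qed

lemma peval_gen_alg: "(\<lambda>q. kev (gen_vals zs q) e) \<in> gen_alg (set zs)"
proof (induction e)
  case (PVar i)
  then show ?case using gen_alg_gen[of "zs ! i" "set zs"] gen_alg_const[of 0]
    by (cases "i < length zs") (simp_all add: gen_vals_def)
qed (auto intro: gen_alg.intros)

text \<open>
  The coordinates embed \<open>V\<close> as a closed set: each solution \<open>c\<close> of all the equations satisfied on \<open>V\<close>
  is the coordinate vector of a point of \<open>V\<close>.
\<close>

definition point_complete :: "'p set \<Rightarrow> ('p \<Rightarrow> 'k::comm_ring_1) list \<Rightarrow> bool" where
  "point_complete V zs \<longleftrightarrow>
     (\<forall>c. (\<forall>e. (\<forall>q\<in>V. kev (gen_vals zs q) e = 0) \<longrightarrow> kev c e = 0) \<longrightarrow> (\<exists>q\<in>V. gen_vals zs q = c))"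

theorem variety_chart:
  fixes S :: "('p, 'k::field) space"
  assumes S: "variety S" and u: "u \<in> points S"
  obtains V zs where "u \<in> V" "presents S V (set zs)" "point_complete V zs"
proof -
  have "\<exists>\<V>. finite \<V> \<and> \<Union>\<V> = points S \<and> (\<forall>V\<in>\<V>. affine_open S V)" using S unfolding variety_def by blast
  then obtain V where V: "affine_open S V" "u \<in> V" using u by blast
  then obtain n Z \<phi> where oV: "openin (zar S) V" and
    Z: "closedin (zar (affine_space n :: ('k list, 'k) space)) Z" and
    iso: "space_iso (restr_space S V) (restr_space (affine_space n) Z) \<phi>"
    unfolding affine_open_def by blast
  let ?A = "affine_space n :: ('k list, 'k) space" and ?G = "{(\<lambda>ys::'k list. ys ! i) | i. i < n}"
  note PA = presents_affine_space[of n, where 'k='k]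
  have local: "g \<in> reg S p" if "p \<in> points S" "f \<in> reg S p" "openin (zar S) W" "p \<in> W" "\<And>q. q \<in> W \<Longrightarrow> f q = g q" for p f g W
    using S that unfolding variety_def by blast
  have VS: "V \<subseteq> points S" using oV openin_subset by blast
  note ptsA = points_affine_space[of n, where 'k='k]
  have ZA: "Z \<subseteq> {ys. length ys = n}" using closedin_subset[OF Z] ptsA by simp
  have pV: "points (restr_space S V) = V" using VS by (auto simp: restr_space_def)
  have pZ: "points (restr_space ?A Z) = Z" using ZA ptsA by (auto simp: restr_space_def)
  have PZ: "presents (restr_space ?A Z) (points (restr_space ?A Z)) ?G"
    using presents_restr[OF PA, of Z] ZA pZ by (simp add: Int_absorb1)
  have PV': "presents (restr_space S V) V ((\<lambda>h p. h (\<phi> p)) ` ?G)"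
    using presents_iso[OF iso PZ] unfolding pV
    by (auto simp: restr_space_def)
  have regV: "reg (restr_space S V) p = reg S p" if "p \<in> V" for p
  proof (intro equalityI subsetI)
    fix f assume "f \<in> reg (restr_space S V) p"
    then obtain g W where g: "g \<in> reg S p" "openin (zar S) W" "p \<in> W" "\<forall>q\<in>W \<inter> V. f q = g q"
      unfolding restr_space_def by auto
    show "f \<in> reg S p"
      by (rule local[OF _ g(1), of "W \<inter> V"]) (use g that VS oV in auto)
  next
    fix f assume "f \<in> reg S p"
    then show "f \<in> reg (restr_space S V) p"
      unfolding restr_space_def using that oV by auto
  qed
  define zs where "zs = map (\<lambda>i q. \<phi> q ! i) [0..<n]"
  have G: "?G = (\<lambda>i ys. ys ! i) ` {..<n}" by auto
  have set_zs: "set zs = (\<lambda>h p. h (\<phi> p)) ` ?G"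
    unfolding G image_image by (simp add: zs_def atLeast0LessThan)
  have PS: "presents S V (set zs)"
    unfolding presents_def set_zs
  proof (intro conjI ballI allI impI)
    fix Q assume "Q \<in> gen_alg ((\<lambda>h p. h (\<phi> p)) ` ?G)"
    from presents_basic[OF PV' this] oV show "openin (zar S) {q \<in> V. Q q \<noteq> 0}"
      by (simp add: restr_space_def openin_open_subtopology)
  next
    fix p \<Omega> assume p: "p \<in> V" and \<Omega>: "openin (zar S) \<Omega>" "p \<in> \<Omega>"
    then have "openin (zar (restr_space S V)) (\<Omega> \<inter> V)" by (auto simp: restr_space_def openin_subtopology)
    moreover have "p \<in> \<Omega> \<inter> V" using p \<Omega> by simp
    ultimately obtain Q where Q: "Q \<in> gen_alg ((\<lambda>h p. h (\<phi> p)) ` ?G)" "Q p \<noteq> 0" "{q \<in> V. Q q \<noteq> 0} \<subseteq> \<Omega> \<inter> V"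
      by (rule presents_nbhd[OF PV' p]) blast
    then show "\<exists>Q\<in>gen_alg ((\<lambda>h p. h (\<phi> p)) ` ?G). Q p \<noteq> 0 \<and> {q \<in> V. Q q \<noteq> 0} \<subseteq> \<Omega>"
      by (intro bexI[of _ Q]) auto
  next
    fix p and f :: "'p \<Rightarrow> 'k" assume p: "p \<in> V"
    show "f \<in> reg S p \<longleftrightarrow> (\<exists>P\<in>gen_alg ((\<lambda>h p. h (\<phi> p)) ` ?G). \<exists>Q\<in>gen_alg ((\<lambda>h p. h (\<phi> p)) ` ?G).
        Q p \<noteq> 0 \<and> (\<forall>q\<in>V. Q q \<noteq> 0 \<longrightarrow> f q = P q / Q q))"
      unfolding regV[OF p, symmetric] by (rule presents_reg[OF PV' p])
  qed
  have imV: "\<phi> ` V = Z"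
    using iso homeomorphic_imp_surjective_map[of "zar (restr_space S V)" "zar (restr_space ?A Z)" \<phi>] pV pZ
    by (auto simp: space_iso_def)
  have gv: "gen_vals zs q = (\<lambda>i. if i < n then \<phi> q ! i else 0)" for q
    by (auto simp: gen_vals_def zs_def)
  have "point_complete V zs"
    unfolding point_complete_def
  proof (intro allI impI)
    fix c assume c: "\<forall>e. (\<forall>q\<in>V. kev (gen_vals zs q) e = 0) \<longrightarrow> kev c e = 0"
    define y where "y = map c [0..<n]"
    have c0: "c i = 0" if "i \<ge> n" for i
      using c[rule_format, of "PVar i"] that by (simp add: gv)
    have "y \<in> Z"
    proof (rule ccontr)
      assume "y \<notin> Z"
      have y: "y \<in> {ys. length ys = n}" by (simp add: y_def)
      have "openin (zar ?A) (points ?A - Z)" using Z by (simp add: closedin_def)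
      moreover have "y \<in> points ?A - Z" using y \<open>y \<notin> Z\<close> ptsA by blast
      ultimately obtain Q where Q: "Q \<in> gen_alg ?G" "Q y \<noteq> 0" "{ys \<in> {ys. length ys = n}. Q ys \<noteq> 0} \<subseteq> points ?A - Z"
        by (rule presents_nbhd[OF PA y]) blast
      have "?G = set (map (\<lambda>i ys. ys ! i) [0..<n])" unfolding G by (simp add: atLeast0LessThan)
      with Q(1) have "Q \<in> gen_alg (set (map (\<lambda>i ys. ys ! i) [0..<n]))" by simp
      then obtain e where e: "Q = (\<lambda>q. kev (gen_vals (map (\<lambda>i ys. ys ! i) [0..<n]) q) e)"
        by (rule gen_alg_peval) blast
      have ge: "gen_vals (map (\<lambda>i ys. ys ! i) [0..<n]) (\<phi> q) = gen_vals zs q" for q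
        by (auto simp: gen_vals_def zs_def)
      have "kev (gen_vals zs q) e = 0" if "q \<in> V" for q
      proof -
        have "\<phi> q \<in> Z" using that imV by auto
        then have "Q (\<phi> q) = 0" using Q(3) ZA by auto
        then show ?thesis by (simp add: e ge)
      qed
      then have "kev c e = 0" using c by blast
      moreover have "gen_vals (map (\<lambda>i ys. ys ! i) [0..<n]) y = c"
        using c0 by (auto simp: gen_vals_def y_def fun_eq_iff)
      ultimately show False using Q(2) by (simp add: e)
    qed
    then obtain q where q: "q \<in> V" "\<phi> q = y" using imV by auto
    then have "gen_vals zs q = c" using c0 by (auto simp: gv y_def fun_eq_iff)
    then show "\<exists>q\<in>V. gen_vals zs q = c" using q by blast
  qed
  then show thesis using that V(2) PS by blast
qed

section \<open>Tangent vectors and the cotangent space\<close>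

text \<open>
  The ideal generated by \<open>G\<close> in the local ring of \<open>X\<close> at \<open>p\<close>.
\<close>

abbreviation lideal :: "('p, 'k::field) space \<Rightarrow> 'p \<Rightarrow> ('p \<Rightarrow> 'k) set \<Rightarrow> ('p \<Rightarrow> 'k) set" where
  "lideal X p \<equiv> germ_algebra.germ_ideal (near X p) (reg X p)"

lemma eventually_near_near:
  assumes "p \<in> points X" "eventually P (near X p)"
  shows "\<forall>\<^sub>F q in near X p. eventually P (near X q)"
proof -
  obtain \<Omega> where \<Omega>: "openin (zar X) \<Omega>" "p \<in> \<Omega>" "\<forall>q\<in>\<Omega>. P q"
    using assms eventually_near_iff by metis
  show ?thesis
    using eventually_near_open[OF \<Omega>(1,2)]
  proof eventually_elim
    case (elim q)
    show ?case using eventually_near_open[OF \<Omega>(1) elim] by eventually_elim (use \<Omega>(3) in blast)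
  qed
qed

text \<open>A point of an affine chart.\<close>

locale presented_point =
  fixes X :: "('p, 'k::field) space" and V G and p :: 'p
  assumes presented: "presents X V G" and in_chart: "p \<in> V"
begin

sublocale germ_algebra "near X p" "reg X p" p
  by (rule presents_germ_algebra[OF presented in_chart])

lemma eventually_in_chart: "\<forall>\<^sub>F q in near X p. q \<in> V"
  by (rule eventually_near_open[OF presents_open[OF presented] in_chart])

lemma eventually_reg: "f \<in> reg X p \<Longrightarrow> \<forall>\<^sub>F q in near X p. f \<in> reg X q"
  by (rule eventually_mono[OF presents_reg_near[OF presented in_chart, of f]]) simp_all

lemma in_points: "p \<in> points X"
  by (rule presents_points[OF presented in_chart])

lemma gen_alg_reg: "f \<in> gen_alg G \<Longrightarrow> f \<in> reg X p"
  by (rule presents_gen_alg[OF presented in_chart])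

lemma fraction:
  assumes "f \<in> reg X p"
  obtains P Q where "P \<in> gen_alg G" "Q \<in> gen_alg G" "Q p \<noteq> 0"
    "\<forall>\<^sub>F q in near X p. q \<in> V \<and> Q q \<noteq> 0 \<and> f q = P q / Q q"
proof -
  obtain P Q where PQ: "P \<in> gen_alg G" "Q \<in> gen_alg G" "Q p \<noteq> 0"
    "\<And>q. q \<in> V \<Longrightarrow> Q q \<noteq> 0 \<Longrightarrow> f q = P q / Q q"
    by (rule presents_regE[OF presented in_chart assms]) blast
  have "\<forall>\<^sub>F q in near X p. q \<in> V \<and> Q q \<noteq> 0 \<and> f q = P q / Q q"
    using eventually_in_chart germ_nonzero[OF gen_alg_reg[OF PQ(2)] PQ(3)]
    by eventually_elim (simp add: PQ(4))
  with PQ(1-3) show thesis by (rule that)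
qed

text \<open>
  If \<open>\<phi>\<close> fixes \<open>p\<close>, it suffices to compare \<open>f\<close> with \<open>f \<circ> \<phi>\<close> for generators of the coordinate ring,
  since \<open>f g - f' g' = f (g - g') + g' (f - f')\<close> and similarly for quotients.
\<close>

lemma first_order:
  assumes fixed: "\<phi> p = p" and pull: "\<And>f. f \<in> reg X p \<Longrightarrow> (\<lambda>q. f (\<phi> q)) \<in> reg X p"
    and V: "\<forall>\<^sub>F q in near X p. \<phi> q \<in> V"
    and gens: "\<And>g. g \<in> G \<Longrightarrow> (\<lambda>q. g q - g (\<phi> q)) \<in> germ_ideal H"
    and f: "f \<in> reg X p"
  shows "(\<lambda>q. f q - f (\<phi> q)) \<in> germ_ideal H"
proof -
  have alg: "(\<lambda>q. f q - f (\<phi> q)) \<in> germ_ideal H" if "f \<in> gen_alg G" for f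
    using that
  proof (induction f rule: gen_alg.induct)
    case (gen_alg_const c)
    then show ?case by (intro germ_ideal_0) simp
  next
    case (gen_alg_gen g)
    then show ?case by (rule gens)
  next
    case (gen_alg_add f g)
    from germ_ideal_add[OF gen_alg_add(4,3)] show ?case by (simp add: algebra_simps)
  next
    case (gen_alg_mult f g)
    have "(\<lambda>q. f q * (g q - g (\<phi> q)) + g (\<phi> q) * (f q - f (\<phi> q))) \<in> germ_ideal H"
      using gen_alg_mult by (intro germ_ideal_add germ_ideal_mult gen_alg_reg pull)
    then show ?case by (simp add: algebra_simps)
  qed
  obtain P Q where PQ: "P \<in> gen_alg G" "Q \<in> gen_alg G" "Q p \<noteq> 0"
    "\<And>q. q \<in> V \<Longrightarrow> Q q \<noteq> 0 \<Longrightarrow> f q = P q / Q q"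
    by (rule presents_regE[OF presented in_chart f]) blast
  note r = gen_alg_reg[OF PQ(1)] gen_alg_reg[OF PQ(2)]
  note r' = pull[OF r(1)] pull[OF r(2)]
  have Q': "Q (\<phi> p) \<noteq> 0" using PQ fixed by simp
  have "(\<lambda>q. (1 / (Q q * Q (\<phi> q))) * (Q (\<phi> q) * (P q - P (\<phi> q)) - P (\<phi> q) * (Q q - Q (\<phi> q)))) \<in> germ_ideal H"
    using PQ(1-3) Q' by (intro germ_ideal_mult germ_ideal_diff alg germ_divide germ_const germ_mult r r') auto
  then show ?thesis
  proof (rule germ_ideal_cong)
    show "\<forall>\<^sub>F q in near X p. f q - f (\<phi> q) = (1 / (Q q * Q (\<phi> q))) * (Q (\<phi> q) * (P q - P (\<phi> q)) - P (\<phi> q) * (Q q - Q (\<phi> q)))"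
      using eventually_in_chart V germ_nonzero[OF r(2) PQ(3)] germ_nonzero[OF r'(2) Q']
    proof eventually_elim
      case (elim q)
      then have "f q = P q / Q q" "f (\<phi> q) = P (\<phi> q) / Q (\<phi> q)" using PQ(4) by auto
      then show ?case using elim by (simp add: field_simps)
    qed
  qed
qed

lemma max_ideal_gens: "f \<in> reg X p \<Longrightarrow> (\<lambda>q. f q - f p) \<in> germ_ideal ((\<lambda>g q. g q - g p) ` G)"
proof (rule first_order[of "\<lambda>_. p"])
  show "\<forall>\<^sub>F q in near X p. p \<in> V" using in_chart by simp
  fix g assume "g \<in> G"
  then show "(\<lambda>q. g q - g p) \<in> germ_ideal ((\<lambda>g q. g q - g p) ` G)" by (intro germ_ideal_base imageI)
qed (auto intro: germ_const)

lemma tangent_add: "v \<in> tangent X p \<Longrightarrow> f \<in> reg X p \<Longrightarrow> g \<in> reg X p \<Longrightarrow> v (\<lambda>q. f q + g q) = v f + v g"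
  by (simp add: tangent_def)

lemma tangent_cmult: "v \<in> tangent X p \<Longrightarrow> f \<in> reg X p \<Longrightarrow> v (\<lambda>q. c * f q) = c * v f"
  by (simp add: tangent_def)

lemma tangent_mult: "v \<in> tangent X p \<Longrightarrow> f \<in> reg X p \<Longrightarrow> g \<in> reg X p \<Longrightarrow> v (\<lambda>q. f q * g q) = f p * v g + g p * v f"
  by (simp add: tangent_def)

lemma tangent_off: "v \<in> tangent X p \<Longrightarrow> f \<notin> reg X p \<Longrightarrow> v f = 0"
  by (simp add: tangent_def)

lemma tangent_cong:
  assumes "v \<in> tangent X p" "f \<in> reg X p" "\<forall>\<^sub>F q in near X p. g q = f q"
  shows "v g = v f"
proof -
  have g: "g \<in> reg X p" by (rule germ_cong[OF assms(2,3)])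
  obtain W where W: "openin (zar X) W" "p \<in> W" "\<forall>q\<in>W. g q = f q"
    using assms(3) unfolding eventually_near_iff[OF in_points] by auto
  have "\<forall>f\<in>reg X p. \<forall>g\<in>reg X p. \<forall>W. openin (zar X) W \<longrightarrow> p \<in> W \<longrightarrow> (\<forall>q\<in>W. f q = g q) \<longrightarrow> v f = v g"
    using assms(1) unfolding tangent_def mem_Collect_eq by (elim conjE)
  from this[THEN bspec, OF g, THEN bspec, OF assms(2), THEN spec, THEN mp, OF W(1), THEN mp, OF W(2)]
  show ?thesis using W(3) by (rule mp)
qed

lemma tangent_const: "v \<in> tangent X p \<Longrightarrow> v (\<lambda>_. c) = 0"
proof -
  assume v: "v \<in> tangent X p"
  have "v (\<lambda>q. 1 * 1) = 1 * v (\<lambda>_. 1) + 1 * v (\<lambda>_. 1)"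
    by (rule tangent_mult[OF v germ_const germ_const])
  then have "v (\<lambda>_. 1) + 0 = v (\<lambda>_. 1) + v (\<lambda>_. 1)" by simp
  then have "v (\<lambda>_. 1) = 0" by (simp only: add_left_cancel)
  then show ?thesis using tangent_cmult[OF v germ_const[of 1], of c] by simp
qed

lemma tangent_diff: "v \<in> tangent X p \<Longrightarrow> f \<in> reg X p \<Longrightarrow> g \<in> reg X p \<Longrightarrow> v (\<lambda>q. f q - g q) = v f - v g"
  using tangent_add[of v f "\<lambda>q. -1 * g q"] tangent_cmult[of v g "-1"] germ_cmult[of g "-1"] by simp

lemma tangentI:
  assumes "\<And>f g. f \<in> reg X p \<Longrightarrow> g \<in> reg X p \<Longrightarrow> v (\<lambda>q. f q + g q) = v f + v g"
    "\<And>f c. f \<in> reg X p \<Longrightarrow> v (\<lambda>q. c * f q) = c * v f"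
    "\<And>f g. f \<in> reg X p \<Longrightarrow> g \<in> reg X p \<Longrightarrow> v (\<lambda>q. f q * g q) = f p * v g + g p * v f"
    "\<And>f g. f \<in> reg X p \<Longrightarrow> g \<in> reg X p \<Longrightarrow> \<forall>\<^sub>F q in near X p. f q = g q \<Longrightarrow> v f = v g"
    "\<And>f. f \<notin> reg X p \<Longrightarrow> v f = 0"
  shows "v \<in> tangent X p"
proof -
  have "v f = v g" if "f \<in> reg X p" "g \<in> reg X p" "openin (zar X) W" "p \<in> W" "\<forall>q\<in>W. f q = g q" for f g W
    using that(1,2)
  proof (rule assms(4))
    show "\<forall>\<^sub>F q in near X p. f q = g q"
      using eventually_near_open[OF that(3,4)] by eventually_elim (use that(5) in blast)
  qed
  then show ?thesis unfolding tangent_def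
    by (intro CollectI conjI ballI allI impI assms(1,2,3,5)) (assumption | blast)+
qed

lemma tangent_lincomb:
  assumes "v \<in> tangent X p" "v' \<in> tangent X p"
  shows "(\<lambda>f. a * v f + b * v' f) \<in> tangent X p"
proof (rule tangentI)
  fix f g assume "f \<in> reg X p" "g \<in> reg X p" "\<forall>\<^sub>F q in near X p. f q = g q"
  then show "a * v f + b * v' f = a * v g + b * v' g"
    using tangent_cong[OF assms(1)] tangent_cong[OF assms(2)] by metis
qed (auto simp: tangent_add[OF assms(1)] tangent_add[OF assms(2)] tangent_mult[OF assms(1)] tangent_mult[OF assms(2)]
    tangent_cmult[OF assms(1)] tangent_cmult[OF assms(2)] tangent_off[OF assms(1)] tangent_off[OF assms(2)] algebra_simps)

lemma tangent_fraction:
  assumes v: "v \<in> tangent X p" and f: "f \<in> reg X p" and P: "P \<in> reg X p" and Q: "Q \<in> reg X p" "Q p \<noteq> 0"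
    and e: "\<forall>\<^sub>F q in near X p. f q = P q / Q q"
  shows "v f = (v P - f p * v Q) / Q p"
proof -
  have "\<forall>\<^sub>F q in near X p. P q = f q * Q q"
    using e germ_nonzero[OF Q] by eventually_elim simp
  then have "v P = v (\<lambda>q. f q * Q q)" by (rule tangent_cong[OF v germ_mult[OF f Q(1)]])
  also have "\<dots> = f p * v Q + Q p * v f" by (rule tangent_mult[OF v f Q(1)])
  finally show ?thesis using Q(2) by (simp add: field_simps)
qed

lemma tangent_ext:
  assumes v: "v \<in> tangent X p" and v': "v' \<in> tangent X p" and G: "\<And>g. g \<in> G \<Longrightarrow> v g = v' g"
  shows "v = v'"
proof
  fix f
  have alg: "v f = v' f" if "f \<in> gen_alg G" for f
    using that
  proof (induction f rule: gen_alg.induct)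
    case (gen_alg_gen g)
    then show ?case by (rule G)
  qed (use v v' in \<open>simp_all add: tangent_const tangent_add tangent_mult gen_alg_reg\<close>)
  show "v f = v' f"
  proof (cases "f \<in> reg X p")
    case True
    then obtain P Q where PQ: "P \<in> gen_alg G" "Q \<in> gen_alg G" "Q p \<noteq> 0"
      "\<forall>\<^sub>F q in near X p. q \<in> V \<and> Q q \<noteq> 0 \<and> f q = P q / Q q" by (rule fraction) blast
    from PQ(4) have e: "\<forall>\<^sub>F q in near X p. f q = P q / Q q" by eventually_elim simp
    note r = gen_alg_reg[OF PQ(1)] gen_alg_reg[OF PQ(2)]
    show ?thesis
      unfolding tangent_fraction[OF v True r PQ(3) e] tangent_fraction[OF v' True r PQ(3) e]
      using alg PQ(1,2) by simp
  next
    case False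
    show ?thesis using tangent_off[OF v False] tangent_off[OF v' False] by simp
  qed
qed

end

text \<open>
  The coefficients are regular and do not depend on \<open>v\<close>; they are the partial derivatives of an
  expression of \<open>g\<close> as a fraction of polynomials in the generators \<open>zs\<close>.
\<close>

lemma tangent_chain_rule:
  fixes zs :: "('p \<Rightarrow> 'k::field) list"
  assumes X: "presents X V (set zs)" and p: "p \<in> V" and g: "g \<in> reg X p"
  shows "\<exists>a. (\<forall>m. a m \<in> reg X p) \<and>
    (\<forall>\<^sub>F q in near X p. \<forall>v\<in>tangent X q. v g = (\<Sum>m<length zs. a m q * v (zs ! m)))"
proof -
  interpret presented_point X V "set zs" p by unfold_locales (fact X p)+
  have pq: "presented_point X V (set zs) q" if "q \<in> V" for q
    using X that by unfold_locales
  let ?D = "\<lambda>f a. (\<forall>m. a m \<in> reg X p) \<and> (\<forall>\<^sub>F q in near X p. \<forall>v\<in>tangent X q. v f = (\<Sum>m<length zs. a m q * v (zs ! m)))"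
  have alg: "\<exists>a. ?D f a" if "f \<in> gen_alg (set zs)" for f
    using that
  proof (induction f rule: gen_alg.induct)
    case (gen_alg_const c)
    show ?case
    proof (intro exI[of _ "\<lambda>_ _. 0"] conjI allI germ_const)
      show "\<forall>\<^sub>F q in near X p. \<forall>v\<in>tangent X q. v (\<lambda>_. c) = (\<Sum>m<length zs. 0 * v (zs ! m))"
        using eventually_in_chart by eventually_elim (simp add: presented_point.tangent_const[OF pq])
    qed
  next
    case (gen_alg_gen g)
    then obtain i where i: "i < length zs" "zs ! i = g" by (auto simp: in_set_conv_nth)
    have "(\<Sum>m<length zs. (if m = i then 1 else 0) * v (zs ! m)) = v g" for v :: "('p \<Rightarrow> 'k) \<Rightarrow> 'k"
    proof -
      have "(\<Sum>m<length zs. (if m = i then 1 else 0) * v (zs ! m)) = (\<Sum>m<length zs. if m = i then v (zs ! m) else 0)"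
        by (intro sum.cong) auto
      then show ?thesis using i by simp
    qed
    then show ?case
      by (intro exI[of _ "\<lambda>m _. if m = i then 1 else 0"] conjI allI germ_const) simp
  next
    case (gen_alg_add f g)
    then obtain a b where a: "?D f a" and b: "?D g b" by blast
    have "\<forall>\<^sub>F q in near X p. \<forall>v\<in>tangent X q. v (\<lambda>q. f q + g q) = (\<Sum>m<length zs. (a m q + b m q) * v (zs ! m))"
      using conjunct2[OF a] conjunct2[OF b] eventually_in_chart
    proof eventually_elim
      case (elim q)
      interpret q: presented_point X V "set zs" q by (rule pq[OF elim(3)])
      show ?case using elim gen_alg_add(1,2)
        by (simp add: q.tangent_add q.gen_alg_reg sum.distrib algebra_simps)
    qed
    then show ?case using a b by (intro exI[of _ "\<lambda>m q. a m q + b m q"] conjI allI germ_add) auto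
  next
    case (gen_alg_mult f g)
    then obtain a b where a: "?D f a" and b: "?D g b" by blast
    have "\<forall>\<^sub>F q in near X p. \<forall>v\<in>tangent X q. v (\<lambda>q. f q * g q) = (\<Sum>m<length zs. (g q * a m q + f q * b m q) * v (zs ! m))"
      using conjunct2[OF a] conjunct2[OF b] eventually_in_chart
    proof eventually_elim
      case (elim q)
      interpret q: presented_point X V "set zs" q by (rule pq[OF elim(3)])
      show ?case
      proof
        fix v assume v: "v \<in> tangent X q"
        have "v (\<lambda>q. f q * g q) = f q * (\<Sum>m<length zs. b m q * v (zs ! m)) + g q * (\<Sum>m<length zs. a m q * v (zs ! m))"
          using q.tangent_mult[OF v q.gen_alg_reg[OF gen_alg_mult(1)] q.gen_alg_reg[OF gen_alg_mult(2)]] elim(1,2) v by simp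
        then show "v (\<lambda>q. f q * g q) = (\<Sum>m<length zs. (g q * a m q + f q * b m q) * v (zs ! m))"
          by (simp add: sum.distrib algebra_simps sum_distrib_left)
      qed
    qed
    then show ?case using a b gen_alg_reg[OF gen_alg_mult(1)] gen_alg_reg[OF gen_alg_mult(2)]
      by (intro exI[of _ "\<lambda>m q. g q * a m q + f q * b m q"] conjI allI germ_add germ_mult) auto
  qed
  obtain P Q where PQ: "P \<in> gen_alg (set zs)" "Q \<in> gen_alg (set zs)" "Q p \<noteq> 0"
    "\<forall>\<^sub>F q in near X p. q \<in> V \<and> Q q \<noteq> 0 \<and> g q = P q / Q q" using g by (rule fraction) blast
  obtain a b where a: "?D P a" and b: "?D Q b" using alg[OF PQ(1)] alg[OF PQ(2)] by blast
  have "\<forall>\<^sub>F q in near X p. \<forall>v\<in>tangent X q. v g = (\<Sum>m<length zs. ((a m q - g q * b m q) / Q q) * v (zs ! m))"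
    using eventually_near_near[OF in_points PQ(4)] PQ(4) conjunct2[OF a] conjunct2[OF b] eventually_reg[OF g]
  proof eventually_elim
    case (elim q)
    then interpret q: presented_point X V "set zs" q by (intro pq) simp
    from elim(1) have e: "\<forall>\<^sub>F q in near X q. g q = P q / Q q" by eventually_elim simp
    show ?case
    proof
      fix v assume v: "v \<in> tangent X q"
      have "v g = (v P - g q * v Q) / Q q"
        by (rule q.tangent_fraction[OF v elim(5) q.gen_alg_reg[OF PQ(1)] q.gen_alg_reg[OF PQ(2)] _ e])
          (use elim(2) in simp)
      then show "v g = (\<Sum>m<length zs. ((a m q - g q * b m q) / Q q) * v (zs ! m))"
        unfolding bspec[OF elim(3) v] bspec[OF elim(4) v] by (simp add: sum_subtractf sum_distrib_left sum_divide_distrib left_diff_distrib diff_divide_distrib mult.assoc)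
    qed
  qed
  moreover have "\<forall>m. (\<lambda>q. (a m q - g q * b m q) / Q q) \<in> reg X p"
    using a b g gen_alg_reg[OF PQ(2)] PQ(3) by (intro allI germ_divide germ_diff germ_mult) auto
  ultimately show ?thesis by (intro exI[of _ "\<lambda>m q. (a m q - g q * b m q) / Q q"] conjI)
qed

lemma separating_functional:
  fixes L :: "('p \<Rightarrow> 'k::field) set"
  assumes L: "(\<lambda>_. 0) \<in> L" "\<And>f g. f \<in> L \<Longrightarrow> g \<in> L \<Longrightarrow> (\<lambda>q. f q + g q) \<in> L" "\<And>c f. f \<in> L \<Longrightarrow> (\<lambda>q. c * f q) \<in> L"
    and f0: "f0 \<notin> L"
  shows "\<exists>l. (\<forall>f g. l (\<lambda>q. f q + g q) = l f + l g) \<and> (\<forall>c f. l (\<lambda>q. c * f q) = c * l f) \<and>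
           (\<forall>f\<in>L. l f = 0) \<and> l f0 = (1::'k)"
proof -
  let ?s = "\<lambda>c (f :: 'p \<Rightarrow> 'k) q. c * f q"
  interpret V: vector_space ?s
    by unfold_locales (auto simp: fun_eq_iff algebra_simps)
  interpret K: vector_space "(*) :: 'k \<Rightarrow> 'k \<Rightarrow> 'k"
    by unfold_locales (auto simp: algebra_simps)
  interpret VK: vector_space_pair ?s "(*) :: 'k \<Rightarrow> 'k \<Rightarrow> 'k" ..
  have sub: "V.subspace L"
    unfolding V.subspace_def using L by (auto simp: plus_fun_def zero_fun_def)
  obtain B where B: "B \<subseteq> L" "V.independent B" "L \<subseteq> V.span B"
    using V.maximal_independent_subset[of L] by blast
  have sp: "V.span B \<subseteq> L" using V.span_minimal[OF B(1) sub] .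
  have ind: "V.independent (insert f0 B)" using V.independent_insertI[OF _ B(2), of f0] f0 sp by blast
  obtain l where l: "Vector_Spaces.linear ?s (*) l" "\<forall>x\<in>insert f0 B. l x = (if x = f0 then 1 else 0)"
    using VK.linear_independent_extend[OF ind, of "\<lambda>x. if x = f0 then 1 else 0"] by blast
  have "l x = 0" if "x \<in> B" for x using l(2) that B(1) f0 by auto
  then have "l f = 0" if "f \<in> L" for f
    using VK.linear_eq_0_on_span[OF l(1), of B f] B(3) that by auto
  moreover have "l (\<lambda>q. f q + g q) = l f + l g" for f g
    using VK.linear_add[OF l(1), of f g] by (simp add: plus_fun_def)
  moreover have "l (\<lambda>q. c * f q) = c * l f" for c f
    using VK.linear_scale[OF l(1), of c f] by simp
  ultimately show ?thesis using l(2) by (intro exI[of _ l]) auto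
qed

lemma idx_other: "i \<noteq> j \<longleftrightarrow> i = other j" "other (other i) = i" "other i \<noteq> i" "i \<noteq> other i"
  by (cases i; cases j; simp)+

text \<open>
  A variety with a coordinate patch.  The condition on tangent vectors in the definition of a patch
  provides coordinate vector fields and makes the points of \<open>U\<close> nonsingular.
\<close>

locale patch =
  fixes S :: "('u, 'k::{alg_closed_field, field_char_0}) space"
    and U :: "'u set" and x :: "idx \<Rightarrow> 'u \<Rightarrow> 'k" and org :: 'u
  assumes variety: "variety S" and coords: "coordinate_patch S U x org"
begin

lemma U_open: "openin (zar S) U"
  using coords by (simp add: coordinate_patch_def)

lemma U_points: "u \<in> U \<Longrightarrow> u \<in> points S"
  using openin_subset[OF U_open] by blast

lemma x_reg: "u \<in> U \<Longrightarrow> x i \<in> reg S u"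
  using coords by (simp add: coordinate_patch_def regular_on_def)

lemma org_zero: "x i org = 0"
  using coords by (cases i) (auto simp: coordinate_patch_def)

lemma org_U: "org \<in> U"
  using coords by (auto simp: coordinate_patch_def)

lemma org_unique: "u \<in> U \<Longrightarrow> x i u = 0 \<Longrightarrow> x (other i) u = 0 \<Longrightarrow> u = org"
  using coords by (cases i) (auto simp: coordinate_patch_def)

lemma coord_axis_irreducible: "irreducible_set (zar S) {u \<in> U. x i u = 0}"
  using coords by (simp add: coordinate_patch_def)

lemma tangent_exists:
  assumes "u \<in> U" obtains v where "v \<in> tangent S u" "v (x I1) = a" "v (x I2) = b"
proof -
  have "\<forall>u\<in>U. \<forall>a b. \<exists>!v. v \<in> tangent S u \<and> v (x I1) = a \<and> v (x I2) = b"
    using coords by (simp add: coordinate_patch_def)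
  then show thesis using assms that by metis
qed

lemma tangent_unique:
  assumes u: "u \<in> U" and v: "v \<in> tangent S u" and v': "v' \<in> tangent S u" and e: "\<And>i. v (x i) = v' (x i)"
  shows "v = v'"
proof -
  have "\<exists>!w. w \<in> tangent S u \<and> w (x I1) = v' (x I1) \<and> w (x I2) = v' (x I2)"
    using coords u by (simp add: coordinate_patch_def)
  then show ?thesis using v v' e by blast
qed

lemma chart_at:
  assumes "u \<in> points S" obtains V zs where "presented_point S V (set zs) u" "point_complete V zs"
  by (rule variety_chart[OF variety assms]) (simp add: that presented_point_def)

lemma germ_algebra_S: "u \<in> points S \<Longrightarrow> germ_algebra (near S u) (reg S u) u"
  by (rule chart_at) (auto simp: presented_point_def intro: presents_germ_algebra)

text \<open>The coordinate \<open>x i\<close> centred at \<open>u\<close>.\<close>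

definition dx :: "'u \<Rightarrow> idx \<Rightarrow> 'u \<Rightarrow> 'k" where
  "dx u i q = x i q - x i u"

text \<open>
  The coordinates span \<open>m / m\<^sup>2\<close> for the maximal ideal \<open>m\<close> at \<open>u\<close>.  Otherwise a linear form on the local
  ring that vanishes on the constants, the coordinates and \<open>m\<^sup>2\<close> is a nonzero tangent vector which
  annihilates the coordinates.
\<close>

lemma cotangent_space:
  assumes u: "u \<in> U" and f: "f \<in> reg S u"
  shows "\<exists>a b. (\<lambda>q. f q - f u - a * dx u I1 q - b * dx u I2 q)
    \<in> lideal S u {\<lambda>q. f q * g q | f g. f \<in> reg S u \<and> g \<in> reg S u \<and> f u = 0 \<and> g u = 0}"
proof (rule ccontr)
  obtain V zs where "presented_point S V (set zs) u" by (rule chart_at[OF U_points[OF u]])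
  then interpret presented_point S V "set zs" u .
  define M2 where "M2 = {\<lambda>q. f q * g q | f g. f \<in> reg S u \<and> g \<in> reg S u \<and> f u = 0 \<and> g u = 0}"
  define L where "L = {f \<in> reg S u. \<exists>a b. (\<lambda>q. f q - f u - a * dx u I1 q - b * dx u I2 q) \<in> germ_ideal M2}"
  assume "\<not> (\<exists>a b. (\<lambda>q. f q - f u - a * dx u I1 q - b * dx u I2 q)
    \<in> lideal S u {\<lambda>q. f q * g q | f g. f \<in> reg S u \<and> g \<in> reg S u \<and> f u = 0 \<and> g u = 0})"
  then have fL: "f \<notin> L" by (auto simp: L_def M2_def)
  have LI: "g \<in> L" if "g \<in> reg S u" "(\<lambda>q. g q - g u - a * dx u I1 q - b * dx u I2 q) \<in> germ_ideal M2" for g a b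
    using that by (auto simp: L_def)
  have L_const: "(\<lambda>_. c) \<in> L" for c
    by (rule LI[of _ 0 0]) (auto intro: germ_const germ_ideal_0)
  have L_add: "(\<lambda>q. f q + g q) \<in> L" if "f \<in> L" "g \<in> L" for f g
  proof -
    from that obtain a b a' b' where
      "(\<lambda>q. f q - f u - a * dx u I1 q - b * dx u I2 q) \<in> germ_ideal M2"
      "(\<lambda>q. g q - g u - a' * dx u I1 q - b' * dx u I2 q) \<in> germ_ideal M2" unfolding L_def by blast
    from germ_ideal_add[OF this]
    have "(\<lambda>q. (f q + g q) - (f u + g u) - (a + a') * dx u I1 q - (b + b') * dx u I2 q) \<in> germ_ideal M2"
      by (simp add: algebra_simps)
    then show ?thesis using that by (intro LI[of _ "a + a'" "b + b'"]) (auto simp: L_def intro: germ_add)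
  qed
  have L_cmult: "(\<lambda>q. c * f q) \<in> L" if "f \<in> L" for c f
  proof -
    from that obtain a b where
      "(\<lambda>q. f q - f u - a * dx u I1 q - b * dx u I2 q) \<in> germ_ideal M2" unfolding L_def by blast
    from germ_ideal_cmult[OF this, of c]
    have "(\<lambda>q. c * f q - c * f u - (c * a) * dx u I1 q - (c * b) * dx u I2 q) \<in> germ_ideal M2"
      by (simp add: algebra_simps)
    then show ?thesis using that by (intro LI[of _ "c * a" "c * b"]) (auto simp: L_def intro: germ_cmult)
  qed
  from separating_functional[of L f, OF L_const L_add L_cmult fL] obtain l where
    l: "\<And>f g. l (\<lambda>q. f q + g q) = l f + l g" "\<And>c f. l (\<lambda>q. c * f q) = c * l f"
       "\<And>f. f \<in> L \<Longrightarrow> l f = 0" "l f = 1" by blast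
  define v where "v g = (if g \<in> reg S u then l g else 0)" for g
  have "v \<in> tangent S u"
  proof (rule tangentI)
    fix g h assume g: "g \<in> reg S u" and h: "h \<in> reg S u"
    show "v (\<lambda>q. g q + h q) = v g + v h" using g h by (simp add: v_def germ_add l)
    let ?m = "\<lambda>q. (g q - g u) * (h q - h u)"
    have "?m \<in> M2" unfolding M2_def using g h
      by (intro CollectI exI[of _ "\<lambda>q. g q - g u"] exI[of _ "\<lambda>q. h q - h u"]) (auto intro: germ_diff germ_const)
    then have "?m \<in> L" using g h
      by (intro LI[of _ 0 0]) (auto intro!: germ_mult germ_diff germ_const germ_ideal_base)
    then have "l ?m = 0" by (rule l(3))
    moreover have "(\<lambda>q. g q * h q) = (\<lambda>q. ?m q + (g u * h q + (h u * g q + - (g u * h u))))"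
      by (auto simp: algebra_simps)
    then have "l (\<lambda>q. g q * h q) = l (\<lambda>q. ?m q + (g u * h q + (h u * g q + - (g u * h u))))" by simp
    then have "l (\<lambda>q. g q * h q) = l ?m + (g u * l h + (h u * l g + l (\<lambda>_. - (g u * h u))))"
      by (simp only: l)
    ultimately show "v (\<lambda>q. g q * h q) = g u * v h + h u * v g"
      using g h l(3)[OF L_const] by (simp add: v_def germ_mult)
    assume e: "\<forall>\<^sub>F q in near S u. g q = h q"
    have "(\<lambda>q. g q + -1 * h q) \<in> L"
    proof (rule LI[of _ 0 0])
      show "(\<lambda>q. g q + - 1 * h q) \<in> reg S u" by (intro germ_add germ_mult germ_const g h)
      show "(\<lambda>q. g q + - 1 * h q - (g u + - 1 * h u) - 0 * dx u I1 q - 0 * dx u I2 q) \<in> germ_ideal M2"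
      proof (rule germ_ideal_0)
        have gu: "g u = h u" by (rule at_pt[OF e])
        show "\<forall>\<^sub>F q in near S u. g q + - 1 * h q - (g u + - 1 * h u) - 0 * dx u I1 q - 0 * dx u I2 q = 0"
          using e by eventually_elim (simp add: gu)
      qed
    qed
    from l(3)[OF this] have "l g + -1 * l h = 0" by (simp only: l)
    then show "v g = v h" using g h by (simp add: v_def)
  next
    fix g c assume "g \<in> reg S u"
    then show "v (\<lambda>q. c * g q) = c * v g" by (simp add: v_def germ_cmult l)
  qed (simp add: v_def)
  moreover have "(\<lambda>_. 0) \<in> tangent S u" by (rule tangentI) auto
  moreover have "v (x i) = 0" for i
  proof -
    have "x i \<in> L"
      by (rule LI[where a = "if i = I1 then 1 else 0" and b = "if i = I2 then 1 else 0", OF x_reg[OF u]])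
        (cases i; simp add: dx_def germ_ideal_0)
    then show ?thesis using l(3) by (simp add: v_def)
  qed
  ultimately have "v = (\<lambda>_. 0)" by (intro tangent_unique[OF u]) auto
  then have "v f = 0" by simp
  then show False using l(4) f by (simp add: v_def)
qed

text \<open>
  Nakayama's lemma lifts generators of \<open>m / m\<^sup>2\<close> to generators of the maximal ideal \<open>m\<close>.
\<close>

theorem max_ideal_coords:
  assumes u: "u \<in> U" and f: "f \<in> reg S u"
  shows "(\<lambda>q. f q - f u) \<in> lideal S u {dx u I1, dx u I2}"
proof -
  obtain V zs where "presented_point S V (set zs) u" by (rule chart_at[OF U_points[OF u]])
  then interpret presented_point S V "set zs" u .
  define N where "N = length zs"
  define Z where "Z l q = (zs ! l) q - (zs ! l) u" for l q
  have zs: "zs ! l \<in> reg S u" if "l < N" for l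
    using that by (intro gen_alg_reg gen_alg_gen) (simp add: N_def)
  have "set zs = (\<lambda>l. zs ! l) ` {..<N}" by (auto simp: N_def in_set_conv_nth)
  then have im: "(\<lambda>g q. g q - g u) ` set zs = Z ` {..<N}"
    by (simp add: image_image Z_def[abs_def])
  have gens: "(\<lambda>q. f q - f u) \<in> germ_ideal (Z ` {..<N})" if "f \<in> reg S u" for f
    using max_ideal_gens[OF that] unfolding im .
  let ?M2 = "{\<lambda>q. f q * g q | f g. f \<in> reg S u \<and> g \<in> reg S u \<and> f u = 0 \<and> g u = 0}"
  have M2: "\<exists>M. (\<forall>l<N. M l \<in> reg S u \<and> M l u = 0) \<and> (\<forall>\<^sub>F q in near S u. s q = (\<Sum>l<N. M l q * Z l q))"
    if "s \<in> germ_ideal ?M2" for s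
    using that
  proof (induction s rule: germ_ideal.induct)
    case (germ_ideal_0 f)
    then show ?case by (intro exI[of _ "\<lambda>_ _. 0"]) (auto intro: germ_const)
  next
    case (germ_ideal_step f a m f')
    then obtain M where M: "\<forall>l<N. M l \<in> reg S u \<and> M l u = 0" "\<forall>\<^sub>F q in near S u. f q = (\<Sum>l<N. M l q * Z l q)"
      by blast
    from germ_ideal_step(3) obtain g h where gh: "m = (\<lambda>q. g q * h q)" "g \<in> reg S u" "h \<in> reg S u" "g u = 0" "h u = 0"
      by blast
    have "h \<in> germ_ideal (Z ` {..<N})" using gens[OF gh(3)] gh(5) by simp
    then obtain c where c: "\<forall>l. c l \<in> reg S u" "\<forall>\<^sub>F q in near S u. h q = (\<Sum>l<N. c l q * Z l q)"
      using germ_ideal_finite by blast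
    have "\<forall>\<^sub>F q in near S u. f' q = (\<Sum>l<N. (M l q + a q * g q * c l q) * Z l q)"
      using M(2) c(2) germ_ideal_step(4)
      by eventually_elim (simp add: gh(1) sum.distrib sum_distrib_left algebra_simps)
    moreover have "\<forall>l<N. (\<lambda>q. M l q + a q * g q * c l q) \<in> reg S u \<and> M l u + a u * g u * c l u = 0"
      using M(1) c(1) gh germ_ideal_step(2) by (auto intro!: germ_add germ_mult)
    ultimately show ?case by (intro exI[of _ "\<lambda>l q. M l q + a q * g q * c l q"] conjI) auto
  qed
  have "\<forall>l<N. Z l \<in> germ_ideal {dx u I1, dx u I2}"
  proof (rule nakayama)
    fix l assume l: "l < N"
    from cotangent_space[OF u zs[OF l]] obtain a b where
      ab: "(\<lambda>q. (zs ! l) q - (zs ! l) u - a * dx u I1 q - b * dx u I2 q) \<in> germ_ideal ?M2" by blast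
    from M2[OF ab] obtain M where M: "\<forall>l<N. M l \<in> reg S u \<and> M l u = 0"
      "\<forall>\<^sub>F q in near S u. (zs ! l) q - (zs ! l) u - a * dx u I1 q - b * dx u I2 q = (\<Sum>l<N. M l q * Z l q)" by blast
    have "(\<lambda>q. a * dx u I1 q + b * dx u I2 q) \<in> germ_ideal {dx u I1, dx u I2}"
      by (intro germ_ideal_add germ_ideal_cmult germ_ideal_base) auto
    moreover have "\<forall>\<^sub>F q in near S u. Z l q = (a * dx u I1 q + b * dx u I2 q) + (\<Sum>m<N. M m q * Z m q)"
      using M(2) by eventually_elim (simp add: Z_def algebra_simps)
    ultimately show "\<exists>c\<in>germ_ideal {dx u I1, dx u I2}. \<exists>M. (\<forall>m<N. M m \<in> reg S u \<and> M m u = 0) \<and>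
        (\<forall>\<^sub>F q in near S u. Z l q = c q + (\<Sum>m<N. M m q * Z m q))"
      using M(1) by (intro bexI[of _ "\<lambda>q. a * dx u I1 q + b * dx u I2 q"] exI[of _ M]) auto
  qed (auto intro: germ_ideal_add germ_ideal_mult germ_ideal_cong)
  then have "Z ` {..<N} \<subseteq> germ_ideal {dx u I1, dx u I2}" by auto
  from germ_ideal_trans[OF gens[OF f] this] show ?thesis .
qed

end

section \<open>Coordinate vector fields\<close>

lemma (in germ_algebra) germ_ideal_pair:
  assumes "f \<in> germ_ideal {g, h}"
  obtains a b where "a \<in> A" "b \<in> A" "\<forall>\<^sub>F q in F. f q = a q * g q + b q * h q"
proof -
  have "\<exists>a\<in>A. \<exists>b\<in>A. \<forall>\<^sub>F q in F. f q = a q * g q + b q * h q"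
    using assms
  proof (induction f rule: germ_ideal.induct)
    case (germ_ideal_0 f)
    then show ?case by (intro bexI[of _ "\<lambda>_. 0"] germ_const) simp
  next
    case (germ_ideal_step f c k f')
    then obtain a b where ab: "a \<in> A" "b \<in> A" "\<forall>\<^sub>F q in F. f q = a q * g q + b q * h q" by blast
    show ?case
    proof (cases "k = g")
      case True
      have "\<forall>\<^sub>F q in F. f' q = (a q + c q) * g q + b q * h q"
        using ab(3) germ_ideal_step(4) by eventually_elim (simp add: True algebra_simps)
      then show ?thesis using ab germ_ideal_step(2)
        by (intro bexI[of _ "\<lambda>q. a q + c q"] bexI[of _ b] germ_add)
    next
      case False
      then have "k = h" using germ_ideal_step(3) by blast
      have "\<forall>\<^sub>F q in F. f' q = a q * g q + (b q + c q) * h q"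
        using ab(3) germ_ideal_step(4) by eventually_elim (simp add: \<open>k = h\<close> algebra_simps)
      then show ?thesis using ab germ_ideal_step(2)
        by (intro bexI[of _ "\<lambda>q. b q + c q"] bexI[of _ a] germ_add)
    qed
  qed
  then show thesis using that by blast
qed

lemma (in germ_algebra) germ_ideal_single:
  assumes "f \<in> germ_ideal {g}"
  obtains a where "a \<in> A" "\<forall>\<^sub>F q in F. f q = a q * g q"
proof -
  have "f \<in> germ_ideal {g, g}" using assms by simp
  then obtain a b where ab: "a \<in> A" "b \<in> A" "\<forall>\<^sub>F q in F. f q = a q * g q + b q * g q" by (rule germ_ideal_pair)
  from ab(3) have "\<forall>\<^sub>F q in F. f q = (a q + b q) * g q" by eventually_elim (simp add: algebra_simps)
  with germ_add[OF ab(1,2)] show thesis by (rule that)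
qed

context patch
begin

lemma chart_in_U:
  assumes "u \<in> U" obtains V zs where "presented_point S V (set zs) u" "point_complete V zs"
  by (rule chart_at[OF U_points[OF assms]]) (rule that)

lemma germ_algebra_U: "u \<in> U \<Longrightarrow> germ_algebra (near S u) (reg S u) u"
  by (rule germ_algebra_S[OF U_points])

lemma eventually_U: "u \<in> U \<Longrightarrow> \<forall>\<^sub>F q in near S u. q \<in> U"
  by (rule eventually_near_open[OF U_open])

lemma eventually_regular: "u \<in> U \<Longrightarrow> f \<in> reg S u \<Longrightarrow> \<forall>\<^sub>F q in near S u. f \<in> reg S q"
  by (rule chart_in_U) (auto intro: presented_point.eventually_reg)

lemma dx_reg: "u \<in> U \<Longrightarrow> q \<in> U \<Longrightarrow> dx u i \<in> reg S q"
  unfolding dx_def[abs_def]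
  by (intro germ_algebra.germ_diff[OF germ_algebra_U] germ_algebra.germ_const[OF germ_algebra_U] x_reg)

text \<open>
  The value at \<open>u\<close> of the coordinate vector field \<open>\<partial> / \<partial> x\<^sub>i\<close>.
\<close>

definition field_at :: "idx \<Rightarrow> 'u \<Rightarrow> ('u \<Rightarrow> 'k) \<Rightarrow> 'k" where
  "field_at i u = (THE v. v \<in> tangent S u \<and> (\<forall>j. v (x j) = (if j = i then 1 else 0)))"

lemma field_at:
  assumes u: "u \<in> U"
  shows "field_at i u \<in> tangent S u" "field_at i u (x j) = (if j = i then 1 else 0)"
proof -
  obtain v where v: "v \<in> tangent S u" "v (x I1) = (if I1 = i then 1 else 0)" "v (x I2) = (if I2 = i then 1 else 0)"
    by (rule tangent_exists[OF u])
  have "\<exists>!v. v \<in> tangent S u \<and> (\<forall>j. v (x j) = (if j = i then 1 else 0))"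
  proof (rule ex1I[of _ v])
    have "v (x j) = (if j = i then 1 else 0)" for j using v(2,3) by (cases j) auto
    with v(1) show "v \<in> tangent S u \<and> (\<forall>j. v (x j) = (if j = i then 1 else 0))" by simp
    then show "w = v" if "w \<in> tangent S u \<and> (\<forall>j. w (x j) = (if j = i then 1 else 0))" for w
      using that by (intro tangent_unique[OF u]) auto
  qed
  from theI'[OF this] show "field_at i u \<in> tangent S u" "field_at i u (x j) = (if j = i then 1 else 0)"
    by (auto simp: field_at_def)
qed

text \<open>
  The partial derivative of \<open>f\<close> with respect to the coordinate \<open>x i\<close>.
\<close>

definition partial :: "idx \<Rightarrow> ('u \<Rightarrow> 'k) \<Rightarrow> 'u \<Rightarrow> 'k" where
  "partial i f q = field_at i q f"

lemma partial_add: "q \<in> U \<Longrightarrow> f \<in> reg S q \<Longrightarrow> g \<in> reg S q \<Longrightarrow> partial i (\<lambda>q. f q + g q) q = partial i f q + partial i g q"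
  unfolding partial_def by (rule chart_in_U) (auto intro: presented_point.tangent_add field_at)

lemma partial_mult: "q \<in> U \<Longrightarrow> f \<in> reg S q \<Longrightarrow> g \<in> reg S q \<Longrightarrow>
    partial i (\<lambda>q. f q * g q) q = f q * partial i g q + g q * partial i f q"
  unfolding partial_def by (rule chart_in_U) (auto intro: presented_point.tangent_mult field_at)

lemma partial_const: "q \<in> U \<Longrightarrow> partial i (\<lambda>_. c) q = 0"
  unfolding partial_def by (rule chart_in_U) (auto intro: presented_point.tangent_const field_at)

lemma partial_cong: "q \<in> U \<Longrightarrow> f \<in> reg S q \<Longrightarrow> \<forall>\<^sub>F r in near S q. g r = f r \<Longrightarrow> partial i g q = partial i f q"
  unfolding partial_def by (rule chart_in_U, assumption) (rule presented_point.tangent_cong[OF _ field_at(1)])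

lemma partial_x: "q \<in> U \<Longrightarrow> partial i (x j) q = (if j = i then 1 else 0)"
  unfolding partial_def by (rule field_at)

lemma partial_dx: "u \<in> U \<Longrightarrow> q \<in> U \<Longrightarrow> partial i (dx u j) q = (if j = i then 1 else 0)"
  unfolding dx_def[abs_def] diff_conv_add_uminus
  by (subst partial_add) (auto simp: partial_x partial_const intro: x_reg germ_algebra.germ_const[OF germ_algebra_U])

text \<open>
  The derivatives of the generators \<open>z\<^sub>l\<close> of the coordinate ring satisfy a linear system: writing
  \<open>z\<^sub>l - z\<^sub>l(u) = g dx\<^sub>1 + h dx\<^sub>2\<close> and differentiating, \<open>\<partial> z\<^sub>l\<close> is a regular function plus a combination of
  \<open>\<partial> g\<close> and \<open>\<partial> h\<close>, hence of the \<open>\<partial> z\<^sub>m\<close>, with coefficients that vanish at \<open>u\<close>.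
\<close>

theorem partial_reg:
  assumes u: "u \<in> U" and f: "f \<in> reg S u"
  shows "partial i f \<in> reg S u"
proof -
  obtain V zs where "presented_point S V (set zs) u" by (rule chart_in_U[OF u])
  then interpret presented_point S V "set zs" u .
  define N where "N = length zs"
  have chain: "\<exists>a. (\<forall>m. a m \<in> reg S u) \<and> (\<forall>\<^sub>F q in near S u. partial i g q = (\<Sum>m<N. a m q * partial i (zs ! m) q))"
    if "g \<in> reg S u" for g
  proof -
    from tangent_chain_rule[OF presented in_chart that] obtain a where a: "\<forall>m. a m \<in> reg S u"
      "\<forall>\<^sub>F q in near S u. \<forall>v\<in>tangent S q. v g = (\<Sum>m<N. a m q * v (zs ! m))"
      unfolding N_def[symmetric] by (elim exE conjE)
    have "\<forall>\<^sub>F q in near S u. partial i g q = (\<Sum>m<N. a m q * partial i (zs ! m) q)"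
      using a(2) eventually_U[OF u] unfolding partial_def by eventually_elim (simp add: field_at)
    with a(1) show ?thesis by blast
  qed
  have dxu: "dx u j \<in> reg S u" "dx u j u = 0" for j using dx_reg[OF u u] by (auto simp: dx_def)
  have "\<forall>l<N. partial i (zs ! l) \<in> reg S u"
  proof (rule nakayama)
    fix l assume l: "l < N"
    have zl: "zs ! l \<in> reg S u" using l by (intro gen_alg_reg gen_alg_gen) (simp add: N_def)
    obtain g h where gh: "g \<in> reg S u" "h \<in> reg S u"
      "\<forall>\<^sub>F q in near S u. (zs ! l) q - (zs ! l) u = g q * dx u I1 q + h q * dx u I2 q"
      using max_ideal_coords[OF u zl] by (rule germ_ideal_pair)
    obtain a where a: "\<forall>m. a m \<in> reg S u" "\<forall>\<^sub>F q in near S u. partial i g q = (\<Sum>m<N. a m q * partial i (zs ! m) q)"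
      using chain[OF gh(1)] by blast
    obtain b where b: "\<forall>m. b m \<in> reg S u" "\<forall>\<^sub>F q in near S u. partial i h q = (\<Sum>m<N. b m q * partial i (zs ! m) q)"
      using chain[OF gh(2)] by blast
    let ?c = "\<lambda>q. g q * (if I1 = i then 1 else 0) + h q * (if I2 = i then 1 else 0)"
    let ?M = "\<lambda>m q. dx u I1 q * a m q + dx u I2 q * b m q"
    have "\<forall>\<^sub>F q in near S u. partial i (zs ! l) q = ?c q + (\<Sum>m<N. ?M m q * partial i (zs ! m) q)"
      using eventually_near_near[OF in_points gh(3)] eventually_reg[OF gh(1)] eventually_reg[OF gh(2)]
        eventually_reg[OF zl] a(2) b(2) eventually_U[OF u]
    proof eventually_elim
      case (elim q)
      interpret q: germ_algebra "near S q" "reg S q" q by (rule germ_algebra_U[OF elim(7)])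
      have d: "dx u j \<in> reg S q" for j by (rule dx_reg[OF u elim(7)])
      have "partial i (zs ! l) q = partial i (\<lambda>q. (g q * dx u I1 q + h q * dx u I2 q) + (zs ! l) u) q"
      proof (rule partial_cong[OF elim(7)])
        show "(\<lambda>q. (g q * dx u I1 q + h q * dx u I2 q) + (zs ! l) u) \<in> reg S q"
          by (intro q.germ_add q.germ_mult q.germ_const d elim)
        show "\<forall>\<^sub>F r in near S q. (zs ! l) r = g r * dx u I1 r + h r * dx u I2 r + (zs ! l) u"
          using elim(1) by eventually_elim (simp add: algebra_simps)
      qed
      also have "\<dots> = partial i (\<lambda>q. g q * dx u I1 q + h q * dx u I2 q) q"
        using partial_add[OF elim(7) _ q.germ_const] partial_const[OF elim(7)]
        by (simp add: q.germ_add q.germ_mult d elim)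
      also have "\<dots> = partial i (\<lambda>q. g q * dx u I1 q) q + partial i (\<lambda>q. h q * dx u I2 q) q"
        by (rule partial_add[OF elim(7)]) (intro q.germ_mult d elim)+
      also have "\<dots> = ?c q + (dx u I1 q * partial i g q + dx u I2 q * partial i h q)"
        unfolding partial_mult[OF elim(7) elim(2) d] partial_mult[OF elim(7) elim(3) d] partial_dx[OF u elim(7)]
        by simp
      also have "\<dots> = ?c q + (\<Sum>m<N. ?M m q * partial i (zs ! m) q)"
        unfolding elim(5,6) by (simp add: sum_distrib_left sum.distrib algebra_simps)
      finally show ?case .
    qed
    moreover have "?c \<in> reg S u" using gh by (intro germ_add germ_mult germ_const)
    moreover have "\<forall>m<N. ?M m \<in> reg S u \<and> ?M m u = 0"
      using a(1) b(1) dxu by (auto intro!: germ_add germ_mult)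
    ultimately show "\<exists>c\<in>reg S u. \<exists>M. (\<forall>m<N. M m \<in> reg S u \<and> M m u = 0) \<and>
        (\<forall>\<^sub>F q in near S u. partial i (zs ! l) q = c q + (\<Sum>m<N. M m q * partial i (zs ! m) q))"
      by (intro bexI[of _ ?c] exI[of _ ?M] conjI)
  qed (auto intro: germ_add germ_mult germ_cong)
  then have z: "partial i (zs ! m) \<in> reg S u" if "m < N" for m using that by blast
  obtain a where a: "\<forall>m. a m \<in> reg S u" "\<forall>\<^sub>F q in near S u. partial i f q = (\<Sum>m<N. a m q * partial i (zs ! m) q)"
    using chain[OF f] by blast
  have "(\<lambda>q. \<Sum>m<N. a m q * partial i (zs ! m) q) \<in> reg S u"
    using a(1) z by (intro germ_sum germ_mult) auto
  then show ?thesis using a(2) by (rule germ_cong)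
qed

section \<open>Formal arcs and their specializations\<close>

text \<open>
  The coefficients of the power series obtained by pulling back \<open>f\<close> along the formal arc at \<open>u\<close> whose
  coordinates are the power series \<open>\<xi>\<close>.  They are determined recursively by the chain rule
  \<open>(arc f)' = \<xi>\<^sub>1' arc (\<partial>\<^sub>1 f) + \<xi>\<^sub>2' arc (\<partial>\<^sub>2 f)\<close>, which requires characteristic \<open>0\<close>.
\<close>

fun arc_coeff :: "'u \<Rightarrow> (idx \<Rightarrow> 'k fps) \<Rightarrow> nat \<Rightarrow> ('u \<Rightarrow> 'k) \<Rightarrow> 'k" where
  "arc_coeff u \<xi> 0 f = f u"
| "arc_coeff u \<xi> (Suc n) f =
     (\<Sum>j\<le>n. fps_nth (fps_deriv (\<xi> I1)) j * arc_coeff u \<xi> (n - j) (partial I1 f)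
            + fps_nth (fps_deriv (\<xi> I2)) j * arc_coeff u \<xi> (n - j) (partial I2 f)) / of_nat (Suc n)"

text \<open>
  The homomorphism from the local ring at \<open>u\<close> to \<open>k[[s]]\<close> given by the formal arc with
  coordinates \<open>\<xi>\<close>.
\<close>

definition arc :: "'u \<Rightarrow> (idx \<Rightarrow> 'k fps) \<Rightarrow> ('u \<Rightarrow> 'k) \<Rightarrow> 'k fps" where
  "arc u \<xi> f = Abs_fps (\<lambda>n. arc_coeff u \<xi> n f)"

lemma arc_nth: "fps_nth (arc u \<xi> f) n = arc_coeff u \<xi> n f"
  by (simp add: arc_def)

lemma arc_deriv:
  "fps_deriv (arc u \<xi> f) = fps_deriv (\<xi> I1) * arc u \<xi> (partial I1 f) + fps_deriv (\<xi> I2) * arc u \<xi> (partial I2 f)"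
proof (rule fps_ext)
  fix n
  have "fps_nth (fps_deriv (arc u \<xi> f)) n = of_nat (Suc n) * arc_coeff u \<xi> (Suc n) f"
    by (simp add: arc_nth del: arc_coeff.simps)
  also have "\<dots> = (\<Sum>j\<le>n. fps_nth (fps_deriv (\<xi> I1)) j * arc_coeff u \<xi> (n - j) (partial I1 f)
            + fps_nth (fps_deriv (\<xi> I2)) j * arc_coeff u \<xi> (n - j) (partial I2 f))"
    using of_nat_neq_0[of n, where 'a='k] by (simp del: of_nat_Suc)
  also have "\<dots> = fps_nth (fps_deriv (\<xi> I1) * arc u \<xi> (partial I1 f) + fps_deriv (\<xi> I2) * arc u \<xi> (partial I2 f)) n"
    by (simp only: fps_add_nth fps_mult_nth arc_nth sum.distrib atLeast0AtMost)
  finally show "fps_nth (fps_deriv (arc u \<xi> f)) n =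
    fps_nth (fps_deriv (\<xi> I1) * arc u \<xi> (partial I1 f) + fps_deriv (\<xi> I2) * arc u \<xi> (partial I2 f)) n" .
qed

context
  fixes u :: 'u and \<xi> :: "idx \<Rightarrow> 'k fps"
  assumes u: "u \<in> U"
begin

interpretation germ_algebra "near S u" "reg S u" u
  by (rule germ_algebra_U[OF u])

lemma partial_cong_near:
  assumes "f \<in> reg S u" "\<forall>\<^sub>F q in near S u. g q = f q"
  shows "\<forall>\<^sub>F q in near S u. partial i g q = partial i f q"
  using eventually_near_near[OF U_points[OF u] assms(2)] eventually_regular[OF u assms(1)] eventually_U[OF u]
  by eventually_elim (rule partial_cong)

lemma arc_coeff_cong:
  "f \<in> reg S u \<Longrightarrow> \<forall>\<^sub>F q in near S u. g q = f q \<Longrightarrow> arc_coeff u \<xi> n g = arc_coeff u \<xi> n f"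
proof (induction n arbitrary: f g rule: less_induct)
  case (less n)
  show ?case
  proof (cases n)
    case 0
    then show ?thesis using at_pt[OF less.prems(2)] by simp
  next
    case (Suc m)
    have "arc_coeff u \<xi> (m - j) (partial i g) = arc_coeff u \<xi> (m - j) (partial i f)" for i j
      by (rule less.IH[OF _ partial_reg[OF u less.prems(1)] partial_cong_near[OF less.prems]]) (simp add: Suc)
    then show ?thesis by (simp add: Suc)
  qed
qed

lemma arc_cong: "f \<in> reg S u \<Longrightarrow> \<forall>\<^sub>F q in near S u. g q = f q \<Longrightarrow> arc u \<xi> g = arc u \<xi> f"
  unfolding arc_def using arc_coeff_cong by presburger

lemma arc_coeff_add:
  "f \<in> reg S u \<Longrightarrow> g \<in> reg S u \<Longrightarrow> arc_coeff u \<xi> n (\<lambda>q. f q + g q) = arc_coeff u \<xi> n f + arc_coeff u \<xi> n g"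
proof (induction n arbitrary: f g rule: less_induct)
  case (less n)
  show ?case
  proof (cases n)
    case (Suc m)
    have "arc_coeff u \<xi> (m - j) (partial i (\<lambda>q. f q + g q)) =
        arc_coeff u \<xi> (m - j) (partial i f) + arc_coeff u \<xi> (m - j) (partial i g)" for i j
    proof -
      note p = partial_reg[OF u less.prems(1), of i] partial_reg[OF u less.prems(2), of i]
      have "\<forall>\<^sub>F q in near S u. partial i (\<lambda>q. f q + g q) q = partial i f q + partial i g q"
        using eventually_U[OF u] eventually_regular[OF u less.prems(1)] eventually_regular[OF u less.prems(2)]
        by eventually_elim (rule partial_add)
      from arc_coeff_cong[OF germ_add[OF p] this]
      show ?thesis using less.IH[of "m - j" "partial i f" "partial i g"] p by (simp add: Suc)
    qed
    then show ?thesis by (simp add: Suc sum.distrib algebra_simps add_divide_distrib)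
  qed simp
qed

lemma arc_add: "f \<in> reg S u \<Longrightarrow> g \<in> reg S u \<Longrightarrow> arc u \<xi> (\<lambda>q. f q + g q) = arc u \<xi> f + arc u \<xi> g"
  by (rule fps_ext) (simp add: arc_nth arc_coeff_add)

lemma arc_coeff_const: "arc_coeff u \<xi> n (\<lambda>_. c) = (if n = 0 then c else 0)"
proof (induction n arbitrary: c rule: less_induct)
  case (less n)
  show ?case
  proof (cases n)
    case (Suc m)
    have "arc_coeff u \<xi> (m - j) (partial i (\<lambda>_. c)) = 0" for i j
    proof -
      have "\<forall>\<^sub>F q in near S u. partial i (\<lambda>_. c) q = 0"
        using eventually_U[OF u] by eventually_elim (rule partial_const)
      from arc_coeff_cong[OF germ_const this] show ?thesis using less.IH[of "m - j" 0] by (simp add: Suc)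
    qed
    then show ?thesis by (simp add: Suc)
  qed simp
qed

lemma arc_const: "arc u \<xi> (\<lambda>_. c) = fps_const c"
  by (rule fps_ext) (simp add: arc_nth arc_coeff_const)

lemma arc_coeff_mult:
  "f \<in> reg S u \<Longrightarrow> g \<in> reg S u \<Longrightarrow> arc_coeff u \<xi> n (\<lambda>q. f q * g q) = fps_nth (arc u \<xi> f * arc u \<xi> g) n"
proof (induction n arbitrary: f g rule: less_induct)
  case (less n)
  show ?case
  proof (cases n)
    case 0
    then show ?thesis by (simp add: arc_nth)
  next
    case (Suc m)
    let ?D = "\<lambda>i. arc u \<xi> f * arc u \<xi> (partial i g) + arc u \<xi> g * arc u \<xi> (partial i f)"
    have "arc_coeff u \<xi> (m - j) (partial i (\<lambda>q. f q * g q)) = fps_nth (?D i) (m - j)" for i j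
    proof -
      note p = partial_reg[OF u less.prems(1), of i] partial_reg[OF u less.prems(2), of i]
      have "\<forall>\<^sub>F q in near S u. partial i (\<lambda>q. f q * g q) q = f q * partial i g q + g q * partial i f q"
        using eventually_U[OF u] eventually_regular[OF u less.prems(1)] eventually_regular[OF u less.prems(2)]
        by eventually_elim (rule partial_mult)
      note c = arc_coeff_cong[OF germ_add[OF germ_mult[OF less.prems(1) p(2)] germ_mult[OF less.prems(2) p(1)]] this]
      have c1: "arc_coeff u \<xi> (m - j) (\<lambda>q. f q * partial i g q) = fps_nth (arc u \<xi> f * arc u \<xi> (partial i g)) (m - j)"
        by (rule less.IH[OF _ less.prems(1) p(2)]) (simp add: Suc)
      have c2: "arc_coeff u \<xi> (m - j) (\<lambda>q. g q * partial i f q) = fps_nth (arc u \<xi> g * arc u \<xi> (partial i f)) (m - j)"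
        by (rule less.IH[OF _ less.prems(2) p(1)]) (simp add: Suc)
      show ?thesis
        by (simp only: c c1 c2 arc_coeff_add[OF germ_mult[OF less.prems(1) p(2)] germ_mult[OF less.prems(2) p(1)]] fps_add_nth)
    qed
    then have "of_nat (Suc m) * arc_coeff u \<xi> n (\<lambda>q. f q * g q) =
        (\<Sum>j\<le>m. fps_nth (fps_deriv (\<xi> I1)) j * fps_nth (?D I1) (m - j) + fps_nth (fps_deriv (\<xi> I2)) j * fps_nth (?D I2) (m - j))"
      using of_nat_neq_0[of m, where 'a='k] unfolding Suc by (simp del: of_nat_Suc fps_add_nth)
    also have "\<dots> = fps_nth (fps_deriv (\<xi> I1) * ?D I1 + fps_deriv (\<xi> I2) * ?D I2) m"
      by (simp only: fps_add_nth[of "_ * _" "_ * _"] fps_mult_nth[of "fps_deriv _"] sum.distrib atLeast0AtMost)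
    also have "fps_deriv (\<xi> I1) * ?D I1 + fps_deriv (\<xi> I2) * ?D I2 = fps_deriv (arc u \<xi> f * arc u \<xi> g)"
      by (simp add: arc_deriv algebra_simps)
    also have "fps_nth (fps_deriv (arc u \<xi> f * arc u \<xi> g)) m = of_nat (Suc m) * fps_nth (arc u \<xi> f * arc u \<xi> g) n"
      unfolding Suc by (simp del: fps_deriv_mult)
    finally show ?thesis using of_nat_neq_0[of m, where 'a='k] by (simp del: of_nat_Suc)
  qed
qed

lemma arc_mult: "f \<in> reg S u \<Longrightarrow> g \<in> reg S u \<Longrightarrow> arc u \<xi> (\<lambda>q. f q * g q) = arc u \<xi> f * arc u \<xi> g"
  by (rule fps_ext) (simp add: arc_nth arc_coeff_mult)

lemma arc_x:
  assumes "fps_nth (\<xi> i) 0 = x i u"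
  shows "arc u \<xi> (x i) = \<xi> i"
proof -
  have p: "arc u \<xi> (partial j (x i)) = fps_const (if i = j then 1 else 0)" for j
  proof -
    have "\<forall>\<^sub>F q in near S u. partial j (x i) q = (if i = j then 1 else 0)"
      using eventually_U[OF u] by eventually_elim (rule partial_x)
    from arc_cong[OF germ_const this] show ?thesis by (simp add: arc_const)
  qed
  have "fps_deriv (arc u \<xi> (x i)) = fps_deriv (\<xi> i)"
    unfolding arc_deriv p by (cases i) simp_all
  moreover have "fps_nth (arc u \<xi> (x i)) 0 = fps_nth (\<xi> i) 0" by (simp add: arc_nth assms)
  ultimately show ?thesis using fps_deriv_eq_iff[of "arc u \<xi> (x i)" "\<xi> i"] by simp
qed

lemma peval_reg: "(\<And>i. i < length fs \<Longrightarrow> fs ! i \<in> reg S u) \<Longrightarrow> (\<lambda>q. kev (gen_vals fs q) e) \<in> reg S u"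
proof (induction e)
  case (PVar i)
  then show ?case by (cases "i < length fs") (auto simp: gen_vals_def intro: germ_const)
qed (auto intro: germ_const germ_add germ_mult)

lemma arc_peval:
  assumes "\<And>i. i < length fs \<Longrightarrow> fs ! i \<in> reg S u"
  shows "arc u \<xi> (\<lambda>q. kev (gen_vals fs q) e) = peval fps_const (\<lambda>i. if i < length fs then arc u \<xi> (fs ! i) else 0) e"
proof (induction e)
  case (PVar i)
  then show ?case by (cases "i < length fs") (auto simp: gen_vals_def arc_const)
qed (use peval_reg[OF assms] in \<open>auto simp: arc_const arc_add arc_mult\<close>)

end

end

lemma scalar_embedding_fps: "scalar_embedding (fps_const :: 'k::field \<Rightarrow> 'k fps)"
  by unfold_locales simp_all

text \<open>Substitution of expressions for the variables.\<close>

fun psubst :: "(nat \<Rightarrow> 'k pexpr) \<Rightarrow> 'k pexpr \<Rightarrow> 'k pexpr" where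
  "psubst \<sigma> (PConst c) = PConst c"
| "psubst \<sigma> (PVar i) = \<sigma> i"
| "psubst \<sigma> (PAdd e f) = PAdd (psubst \<sigma> e) (psubst \<sigma> f)"
| "psubst \<sigma> (PMul e f) = PMul (psubst \<sigma> e) (psubst \<sigma> f)"

lemma peval_psubst: "peval h a (psubst \<sigma> e) = peval h (\<lambda>i. peval h a (\<sigma> i)) e"
  by (induction e) simp_all

lemma peval_prod: "h 1 = 1 \<Longrightarrow> peval h a (foldr PMul es (PConst 1)) = prod_list (map (peval h a) es)"
  by (induction es) simp_all

context patch
begin

text \<open>
  Specialization of formal arcs.  The series \<open>A\<close> consist of the pullbacks of the functions \<open>fs\<close> along the
  arc, followed by finitely many arbitrary series.  There are a point \<open>c\<close> near \<open>u\<close> and further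
  constants that satisfy all polynomial equations satisfied by the series \<open>A\<close> and one inequation.
\<close>

theorem arc_points:
  fixes \<xi> :: "idx \<Rightarrow> 'k fps" and A :: "nat \<Rightarrow> 'k fps"
  assumes u: "u \<in> U" and fs: "\<And>i. i < length fs \<Longrightarrow> fs ! i \<in> reg S u"
    and A: "\<And>i. i < length fs \<Longrightarrow> A i = arc u \<xi> (fs ! i)" "\<And>i. i \<ge> n \<Longrightarrow> A i = 0"
    and e0: "peval fps_const A e0 \<noteq> 0" and P: "\<forall>\<^sub>F q in near S u. P q"
  shows "\<exists>c b. P c \<and> kev b e0 \<noteq> 0 \<and> (\<forall>i<length fs. b i = (fs ! i) c) \<and>
           (\<forall>e. peval fps_const A e = 0 \<longrightarrow> kev b e = 0)"
proof -
  obtain V zs where pp: "presented_point S V (set zs) u" and pc: "point_complete V zs" by (rule chart_in_U[OF u])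
  interpret presented_point S V "set zs" u by (rule pp)
  define N r where "N = length zs" and "r = length fs"
  have zs: "zs ! l \<in> reg S u" if "l < length zs" for l
    using that by (intro gen_alg_reg gen_alg_gen) simp
  have "\<forall>i<r. \<exists>p q. kev (gen_vals zs u) q \<noteq> 0 \<and> (\<forall>c\<in>V. kev (gen_vals zs c) q \<noteq> 0 \<longrightarrow>
      (fs ! i) c = kev (gen_vals zs c) p / kev (gen_vals zs c) q)"
  proof (intro allI impI)
    fix i assume "i < r"
    then have "fs ! i \<in> reg S u" using fs by (simp add: r_def)
    then obtain Pi Qi where PQ: "Pi \<in> gen_alg (set zs)" "Qi \<in> gen_alg (set zs)" "Qi u \<noteq> 0"
      "\<And>q. q \<in> V \<Longrightarrow> Qi q \<noteq> 0 \<Longrightarrow> (fs ! i) q = Pi q / Qi q"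
      by (rule presents_regE[OF presented in_chart]) blast
    obtain p where p: "Pi = (\<lambda>q. kev (gen_vals zs q) p)" using PQ(1) by (rule gen_alg_peval)
    obtain q where q: "Qi = (\<lambda>c. kev (gen_vals zs c) q)" using PQ(2) by (rule gen_alg_peval)
    show "\<exists>p q. kev (gen_vals zs u) q \<noteq> 0 \<and> (\<forall>c\<in>V. kev (gen_vals zs c) q \<noteq> 0 \<longrightarrow>
      (fs ! i) c = kev (gen_vals zs c) p / kev (gen_vals zs c) q)"
      using PQ(3,4) unfolding p q by (intro exI[of _ p] exI[of _ q] conjI ballI impI)
  qed
  then obtain eP eQ where PQ: "\<And>i. i < r \<Longrightarrow> kev (gen_vals zs u) (eQ i) \<noteq> 0"
    "\<And>i c. i < r \<Longrightarrow> c \<in> V \<Longrightarrow> kev (gen_vals zs c) (eQ i) \<noteq> 0 \<Longrightarrow>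
      (fs ! i) c = kev (gen_vals zs c) (eP i) / kev (gen_vals zs c) (eQ i)" by metis
  obtain W where W: "W \<in> gen_alg (set zs)" "W u \<noteq> 0" "\<And>q. q \<in> V \<Longrightarrow> W q \<noteq> 0 \<Longrightarrow> P q"
    by (rule presents_nearE[OF presented in_chart P]) blast
  obtain eW where eW: "W = (\<lambda>q. kev (gen_vals zs q) eW)" using W(1) by (rule gen_alg_peval)
  \<comment> \<open>adjoining the pullbacks of the coordinates \<open>zs\<close> makes the specialized values the coordinates
    of a point of the chart; \<open>tr\<close> and \<open>sh\<close> place the two families of variables side by side\<close>
  define a where "a i = (if i < N then arc u \<xi> (zs ! i) else A (i - N))" for i
  define tr :: "'k pexpr \<Rightarrow> 'k pexpr" where "tr = psubst (\<lambda>i. if i < N then PVar i else PConst 0)"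
  define sh :: "'k pexpr \<Rightarrow> 'k pexpr" where "sh = psubst (\<lambda>i. PVar (i + N))"
  have tr: "peval fps_const a (tr e) = arc u \<xi> (\<lambda>q. kev (gen_vals zs q) e)" for e
  proof -
    have "peval fps_const a (tr e) = peval fps_const (\<lambda>i. if i < length zs then arc u \<xi> (zs ! i) else 0) e"
      unfolding tr_def peval_psubst by (rule arg_cong[where f="\<lambda>a. peval fps_const a e"]) (auto simp: a_def N_def)
    then show ?thesis using arc_peval[OF u zs, of \<xi> e] by simp
  qed
  have sh: "peval fps_const a (sh e) = peval fps_const A e" for e
    unfolding sh_def peval_psubst by (simp add: a_def)
  have nz: "peval fps_const a (tr e) \<noteq> 0" if "kev (gen_vals zs u) e \<noteq> 0" for e
  proof
    assume "peval fps_const a (tr e) = 0"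
    then have "fps_nth (peval fps_const a (tr e)) 0 = 0" by simp
    then show False using that unfolding tr by (simp add: arc_nth)
  qed
  \<comment> \<open>the inequations: \<open>e0\<close>, the neighbourhood on which \<open>P\<close> holds, and the denominators of the \<open>fs\<close>\<close>
  define E0 where "E0 = PMul (sh e0) (PMul (tr eW) (foldr PMul (map (\<lambda>i. tr (eQ i)) [0..<r]) (PConst 1)))"
  have "peval fps_const a E0 \<noteq> 0"
    using e0 nz[of eW] W(2) nz PQ(1) unfolding E0_def
    by (auto simp: peval_prod sh eW prod_list_zero_iff)
  moreover have "a i = 0" if "i \<ge> N + n" for i using that A(2) by (simp add: a_def)
  ultimately obtain c where c: "kev c E0 \<noteq> 0" "\<And>e. peval fps_const a e = 0 \<Longrightarrow> kev c e = 0"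
    using scalar_embedding.specialization[OF scalar_embedding_fps alg_closed_imp_poly_has_root infinite_UNIV_char_0, of "N + n" a E0]
    by blast
  define z where "z i = (if i < N then c i else 0)" for i
  define b where "b i = c (i + N)" for i
  have ctr: "kev c (tr e) = kev z e" for e
    unfolding tr_def peval_psubst by (rule arg_cong[where f="\<lambda>a. kev a e"]) (auto simp: z_def)
  have csh: "kev c (sh e) = kev b e" for e
    unfolding sh_def peval_psubst by (rule arg_cong[where f="\<lambda>a. kev a e"]) (auto simp: b_def)
  have "kev z e = 0" if "\<forall>q\<in>V. kev (gen_vals zs q) e = 0" for e
  proof -
    have "\<forall>\<^sub>F q in near S u. kev (gen_vals zs q) e = 0" using eventually_in_chart by eventually_elim (use that in blast)
    from arc_cong[OF u germ_const this] have "arc u \<xi> (\<lambda>q. kev (gen_vals zs q) e) = 0" by (simp add: arc_const[OF u])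
    then have "kev c (tr e) = 0" by (intro c(2)) (simp add: tr)
    then show ?thesis by (simp add: ctr)
  qed
  then obtain q where q: "q \<in> V" "gen_vals zs q = z" using pc unfolding point_complete_def by blast
  have E: "kev b e0 \<noteq> 0" "kev z eW \<noteq> 0" "\<And>i. i < r \<Longrightarrow> kev z (eQ i) \<noteq> 0"
    using c(1) unfolding E0_def by (auto simp: peval_prod csh ctr prod_list_zero_iff)
  have "P q" using W(3)[OF q(1)] E(2) by (simp add: eW q(2))
  moreover have "b i = (fs ! i) q" if i: "i < r" for i
  proof -
    have fi: "fs ! i \<in> reg S u" using fs i by (simp add: r_def)
    note Qr = gen_alg_reg[OF peval_gen_alg[of zs "eQ i"]]
    have "\<forall>\<^sub>F c in near S u. kev (gen_vals zs c) (eP i) = kev (gen_vals zs c) (eQ i) * (fs ! i) c"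
      using eventually_in_chart germ_nonzero[OF Qr PQ(1)[OF i]] by eventually_elim (simp add: PQ(2)[OF i])
    from arc_cong[OF u germ_mult[OF Qr fi] this]
    have "peval fps_const a (PAdd (PMul (tr (eQ i)) (PVar (i + N))) (PMul (PConst (-1)) (tr (eP i)))) = 0"
      using i A(1)[of i] by (simp add: tr arc_mult[OF u Qr fi] a_def r_def flip: fps_const_neg)
    from c(2)[OF this] have "kev z (eQ i) * b i = kev z (eP i)" by (simp add: ctr b_def)
    then have "b i = kev z (eP i) / kev z (eQ i)" using E(3)[OF i] by (simp add: nonzero_eq_divide_eq mult.commute)
    then show ?thesis using PQ(2)[OF i q(1)] E(3)[OF i] by (simp only: q(2) simp_thms)
  qed
  moreover have "kev b e = 0" if "peval fps_const A e = 0" for e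
    using c(2)[of "sh e"] that by (simp add: sh csh)
  ultimately show ?thesis using E(1) unfolding r_def by (intro exI[of _ q] exI[of _ b] conjI) auto
qed

end

section \<open>Functions on coordinate axes and hyperbolas\<close>

context patch
begin

text \<open>
  A function whose pullback to the formal arc \<open>x\<^sub>i = 0\<close>, \<open>x\<^sub>j = x\<^sub>j(u) + s\<close> is nonzero does not vanish
  identically on the axis \<open>x\<^sub>i = 0\<close> near \<open>u\<close>.
\<close>

lemma alg_line_point:
  assumes u: "u \<in> U" and xi: "x i u = 0" and f: "f \<in> reg S u"
    and nz: "arc u (\<lambda>j. if j = i then 0 else fps_const (x j u) + fps_X) f \<noteq> 0" and P: "\<forall>\<^sub>F q in near S u. P q"
  obtains c where "P c" "c \<in> U" "x i c = 0" "f c \<noteq> 0"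
proof -
  define \<xi> where "\<xi> = (\<lambda>j. if j = i then 0 else fps_const (x j u) + fps_X)"
  let ?fs = "[f, x i]"
  let ?A = "\<lambda>m::nat. if m = 0 then arc u \<xi> f else (0 :: 'k fps)"
  have ax: "arc u \<xi> (x i) = 0" using arc_x[OF u, of \<xi> i] xi by (simp add: \<xi>_def)
  have "\<exists>c b. (P c \<and> c \<in> U) \<and> kev b (PVar 0) \<noteq> 0 \<and> (\<forall>m<length ?fs. b m = (?fs ! m) c) \<and>
           (\<forall>e. peval fps_const ?A e = 0 \<longrightarrow> kev b e = 0)"
  proof (rule arc_points[OF u])
    show "?fs ! m \<in> reg S u" if "m < length ?fs" for m
      using that f x_reg[OF u] by (auto simp: less_Suc_eq)
    show "?A m = arc u \<xi> (?fs ! m)" if "m < length ?fs" for m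
      using that ax by (auto simp: less_Suc_eq)
    show "?A m = 0" if "m \<ge> 1" for m using that by simp
    show "peval fps_const ?A (PVar 0) \<noteq> 0" using nz by (simp add: \<xi>_def)
    show "\<forall>\<^sub>F q in near S u. P q \<and> q \<in> U" using P eventually_U[OF u] by eventually_elim simp
  qed
  then obtain c b where c: "P c" "c \<in> U" "kev b (PVar 0) \<noteq> 0" "\<forall>m<length ?fs. b m = (?fs ! m) c"
    "\<forall>e. peval fps_const ?A e = 0 \<longrightarrow> kev b e = 0" by blast
  have "b 0 = f c" "b 1 = x i c" using c(4) by (auto simp: numeral_2_eq_2)
  moreover have "b 1 = 0" using c(5)[rule_format, of "PVar 1"] by simp
  ultimately show thesis using that[of c] c(1,2,3) by simp
qed

lemma arc_on_axis_other:
  assumes u: "u \<in> U"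
  shows "arc u (\<lambda>j. if j = i then 0 else fps_const (x j u) + fps_X) (x (other i)) = fps_const (x (other i) u) + fps_X"
  by (subst arc_x[OF u]) (auto simp: idx_other)

lemma fps_shift_nonzero: "fps_const c + fps_X \<noteq> (0 :: 'k fps)"
proof
  assume "fps_const c + fps_X = (0 :: 'k fps)"
  then have "fps_nth (fps_const c + fps_X) 1 = (0 :: 'k)" by simp
  then show False by simp
qed

lemma axis_point:
  assumes u: "u \<in> U" and xi: "x i u = 0" and P: "\<forall>\<^sub>F q in near S u. P q"
  obtains c where "P c" "c \<in> U" "x i c = 0" "x (other i) c \<noteq> 0"
  by (rule alg_line_point[OF u xi x_reg[OF u, of "other i"] _ P])
    (use arc_on_axis_other[OF u, of i] fps_shift_nonzero that in auto)

text \<open>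
  The Zariski tangent space of the hyperbola contains \<open>x\<^sub>1 \<partial>\<^sub>1 - x\<^sub>2 \<partial>\<^sub>2\<close>: a function that vanishes on the
  hyperbola vanishes along its formal parametrisation \<open>x\<^sub>1 = x\<^sub>1(u) (1 + s)\<close>, whose velocity is this vector.
\<close>

lemma hyperbola_tangent:
  assumes u: "u \<in> U" and t: "x I1 u * x I2 u = t" "t \<noteq> 0"
    and f: "f \<in> reg S u" "\<forall>\<^sub>F q in near S u. x I1 q * x I2 q = t \<longrightarrow> f q = 0"
    and v: "v \<in> tangent S u" "v (x I1) = x I1 u" "v (x I2) = - x I2 u"
  shows "v f = 0"
proof -
  have x0: "x i u \<noteq> 0" for i using t by (cases i) auto
  define g where "g = fps_const (x I1 u) * (1 + fps_X)"
  define \<xi> where "\<xi> i = (if i = I1 then g else fps_const t * inverse g)" for i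
  have g0: "fps_nth g 0 = x I1 u" "fps_nth g 1 = x I1 u" by (simp_all add: g_def)
  have prod: "\<xi> I1 * \<xi> I2 = fps_const t"
    using inverse_mult_eq_1[of g] x0[of I1] g0 by (simp add: \<xi>_def algebra_simps)
  have \<xi>0: "fps_nth (\<xi> i) 0 = x i u" for i
    using g0 t x0[of I1] by (cases i) (auto simp: \<xi>_def field_simps)
  have ax: "arc u \<xi> (x i) = \<xi> i" for i using arc_x[OF u \<xi>0] .
  have \<xi>1: "fps_nth (\<xi> I2) 1 = - x I2 u"
  proof -
    have "fps_nth (\<xi> I1 * \<xi> I2) 1 = 0" by (simp add: prod)
    then have "x I1 u * fps_nth (\<xi> I2) 1 + x I1 u * x I2 u = 0"
      using \<xi>0[of I1] \<xi>0[of I2] g0 by (simp add: fps_mult_nth_1 \<xi>_def)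
    then have "x I1 u * (fps_nth (\<xi> I2) 1 + x I2 u) = 0" by (simp add: algebra_simps)
    then show ?thesis using x0[of I1] by (simp add: eq_neg_iff_add_eq_0)
  qed
  have "arc u \<xi> f = 0"
  proof (rule ccontr)
    assume nz: "arc u \<xi> f \<noteq> 0"
    let ?fs = "[f, x I1, x I2]"
    let ?A = "\<lambda>m::nat. if m = 0 then arc u \<xi> f else if m = 1 then \<xi> I1 else if m = 2 then \<xi> I2 else (0 :: 'k fps)"
    have "\<exists>c b. (x I1 c * x I2 c = t \<longrightarrow> f c = 0) \<and> kev b (PVar 0) \<noteq> 0 \<and> (\<forall>m<length ?fs. b m = (?fs ! m) c) \<and>
             (\<forall>e. peval fps_const ?A e = 0 \<longrightarrow> kev b e = 0)"
    proof (rule arc_points[OF u])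
      show "?fs ! m \<in> reg S u" if "m < length ?fs" for m
        using that f x_reg[OF u] by (auto simp: less_Suc_eq)
      show "?A m = arc u \<xi> (?fs ! m)" if "m < length ?fs" for m
        using that ax by (auto simp: less_Suc_eq numeral_2_eq_2)
      show "?A m = 0" if "m \<ge> 3" for m using that by simp
      show "peval fps_const ?A (PVar 0) \<noteq> 0" using nz by simp
    qed (rule f)
    then obtain c b where c: "x I1 c * x I2 c = t \<longrightarrow> f c = 0" "kev b (PVar 0) \<noteq> 0" "\<forall>m<length ?fs. b m = (?fs ! m) c"
      "\<forall>e. peval fps_const ?A e = 0 \<longrightarrow> kev b e = 0" by blast
    have b: "b 0 = f c" "b 1 = x I1 c" "b 2 = x I2 c"
      using c(3)[rule_format, of 0] c(3)[rule_format, of 1] c(3)[rule_format, of 2] by (auto simp: numeral_2_eq_2)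
    have "kev b (PAdd (PMul (PVar 1) (PVar 2)) (PConst (- t))) = 0"
      by (rule c(4)[rule_format]) (simp add: prod)
    then have "x I1 c * x I2 c = t" using b by simp
    then show False using c(1,2) b by simp
  qed
  then have "arc_coeff u \<xi> 1 f = 0" using arc_nth[of u \<xi> f 1] by simp
  then have e: "x I1 u * partial I1 f u - x I2 u * partial I2 f u = 0"
    using \<xi>1 g0 by (simp add: \<xi>_def)
  interpret germ_algebra "near S u" "reg S u" u by (rule germ_algebra_U[OF u])
  obtain V zs where pp: "presented_point S V (set zs) u" by (rule chart_in_U[OF u])
  have "v = (\<lambda>f. x I1 u * field_at I1 u f + (- x I2 u) * field_at I2 u f)"
  proof (rule tangent_unique[OF u v(1)])
    show "(\<lambda>f. x I1 u * field_at I1 u f + (- x I2 u) * field_at I2 u f) \<in> tangent S u"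
      by (rule presented_point.tangent_lincomb[OF pp field_at(1)[OF u] field_at(1)[OF u]])
    show "v (x i) = x I1 u * field_at I1 u (x i) + (- x I2 u) * field_at I2 u (x i)" for i
      using v by (cases i) (simp_all add: field_at[OF u])
  qed
  then show ?thesis using e by (simp add: partial_def)
qed

text \<open>
  A function that vanishes on the axis is divisible by the coordinate.  The ideal \<open>I\<close> of these functions
  is finitely generated, and \<open>I \<subseteq> (x\<^sub>i) + dx\<^sub>j I\<close>: if \<open>a x\<^sub>i + b dx\<^sub>j\<close> vanishes on the axis, so
  does \<open>b\<close>.  Nakayama's lemma gives \<open>I \<subseteq> (x\<^sub>i)\<close>.
\<close>

theorem axis_ideal:
  assumes u: "u \<in> U" and xi: "x i u = 0"
    and f: "f \<in> reg S u" "\<forall>\<^sub>F q in near S u. x i q = 0 \<longrightarrow> f q = 0"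
  shows "f \<in> lideal S u {x i}"
proof -
  obtain V zs where "presented_point S V (set zs) u" by (rule chart_in_U[OF u])
  then interpret presented_point S V "set zs" u .
  define van where "van g \<longleftrightarrow> (\<forall>\<^sub>F q in near S u. x i q = 0 \<longrightarrow> g q = 0)" for g :: "'u \<Rightarrow> 'k"
  define J where "J = {g \<in> gen_alg (set zs). van g}"
  have "ideal_in (gen_alg (set zs)) J"
    unfolding ideal_in_def
  proof (intro conjI ballI)
    show "J \<subseteq> gen_alg (set zs)" by (auto simp: J_def)
    show "0 \<in> J" using gen_alg_const[of 0] by (simp add: J_def van_def zero_fun_def)
    fix g assume g: "g \<in> J"
    then have vg: "van g" and gg: "g \<in> gen_alg (set zs)" by (auto simp: J_def)
    { fix h assume h: "h \<in> J"
      then have vh: "van h" by (auto simp: J_def)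
      have "van (\<lambda>q. g q + h q)"
        using vg vh unfolding van_def by eventually_elim auto
      then show "g + h \<in> J" using g h gen_alg_add[of g _ h] by (simp add: J_def plus_fun_def) }
    { fix a assume a: "a \<in> gen_alg (set zs)"
      have "van (\<lambda>q. a q * g q)"
        using vg unfolding van_def by eventually_elim auto
      then show "a * g \<in> J" using gen_alg_mult[OF a gg] by (simp add: J_def times_fun_def) }
  qed
  then obtain G where G: "finite G" "G \<subseteq> J" "J \<subseteq> ispan (gen_alg (set zs)) G"
    using noetherian_gen_alg[of "set zs"] unfolding noetherian_set_def by blast
  then obtain ws where ws: "set ws = G" using finite_list by blast
  define N and w where "N = length ws" and "w l = ws ! l" for l
  have Gw: "G = w ` {..<N}" unfolding ws[symmetric] w_def N_def by (auto simp: in_set_conv_nth)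
  have span: "g \<in> germ_ideal (w ` {..<N})" if "g \<in> J" for g
  proof -
    have "g \<in> ispan (gen_alg (set zs)) G" using that G by blast
    then show ?thesis
    proof (induction g rule: ispan.induct)
      case ispan_0
      then show ?case by (intro germ_ideal_0) simp
    next
      case (ispan_step g a b)
      show ?case
        by (rule germ_ideal_step[OF ispan_step(4) gen_alg_reg[OF ispan_step(2)]])
          (use ispan_step(3) in \<open>auto simp: Gw plus_fun_def times_fun_def\<close>)
    qed
  qed
  have van_span: "g \<in> germ_ideal (w ` {..<N})" if g: "g \<in> reg S u" "van g" for g
  proof -
    obtain P Q where PQ: "P \<in> gen_alg (set zs)" "Q \<in> gen_alg (set zs)" "Q u \<noteq> 0"
      "\<forall>\<^sub>F q in near S u. q \<in> V \<and> Q q \<noteq> 0 \<and> g q = P q / Q q" using g(1) by (rule fraction)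
    have "van P"
      using PQ(4) g(2) unfolding van_def by eventually_elim auto
    then have "P \<in> germ_ideal (w ` {..<N})" using PQ(1) by (intro span) (simp add: J_def)
    then have "(\<lambda>q. inverse (Q q) * P q) \<in> germ_ideal (w ` {..<N})"
      by (rule germ_ideal_mult) (rule germ_inverse[OF gen_alg_reg[OF PQ(2)] PQ(3)])
    then show ?thesis
      by (rule germ_ideal_cong) (use PQ(4) in eventually_elim, simp add: divide_inverse mult.commute)
  qed
  let ?j = "other i"
  have dxu: "dx u j \<in> reg S u" "dx u j u = 0" for j using dx_reg[OF u u] by (auto simp: dx_def)
  have dxi: "dx u i = x i" by (auto simp: dx_def xi)
  have "\<forall>l<N. w l \<in> germ_ideal {x i}"
  proof (rule nakayama)
    fix l assume l: "l < N"
    then have "w l \<in> J" using G Gw by blast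
    then have wl: "w l \<in> reg S u" "van (w l)" using gen_alg_reg by (auto simp: J_def)
    have "w l u = 0" using at_pt[OF wl(2)[unfolded van_def]] xi by simp
    moreover have "{dx u I1, dx u I2} = {x i, dx u ?j}" using dxi by (cases i) auto
    ultimately have "w l \<in> germ_ideal {x i, dx u ?j}" using max_ideal_coords[OF u wl(1)] by simp
    then obtain a b where ab: "a \<in> reg S u" "b \<in> reg S u" "\<forall>\<^sub>F q in near S u. w l q = a q * x i q + b q * dx u ?j q"
      by (rule germ_ideal_pair)
    have "van b"
      using eventually_near_near[OF in_points eventually_conj[OF wl(2)[unfolded van_def] ab(3)]]
        eventually_U[OF u] eventually_reg[OF ab(2)]
      unfolding van_def
    proof eventually_elim
      case (elim q)
      show ?case
      proof (intro impI, rule ccontr)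
        assume xq: "x i q = 0" and bq: "b q \<noteq> 0"
        let ?\<xi> = "\<lambda>j. if j = i then 0 else fps_const (x j q) + fps_X"
        let ?g = "\<lambda>r. b r * dx u ?j r"
        interpret q: germ_algebra "near S q" "reg S q" q by (rule germ_algebra_U[OF elim(2)])
        have dq: "dx u ?j \<in> reg S q" by (rule dx_reg[OF u elim(2)])
        have "arc q ?\<xi> b \<noteq> 0"
        proof
          assume "arc q ?\<xi> b = 0"
          then have "fps_nth (arc q ?\<xi> b) 0 = 0" by simp
          then show False using bq by (simp add: arc_nth)
        qed
        moreover have "arc q ?\<xi> (dx u ?j) = fps_const (x ?j q - x ?j u) + fps_X"
        proof -
          have "arc q ?\<xi> (dx u ?j) = arc q ?\<xi> (\<lambda>r. x ?j r + (- x ?j u))" by (simp add: dx_def[abs_def])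
          also have "\<dots> = arc q ?\<xi> (x ?j) + arc q ?\<xi> (\<lambda>_. - x ?j u)"
            by (rule arc_add[OF elim(2) x_reg[OF elim(2)] q.germ_const])
          also have "\<dots> = fps_const (x ?j q) + fps_X + fps_const (- x ?j u)"
            by (simp add: arc_const[OF elim(2)] arc_on_axis_other[OF elim(2), of i])
          also have "\<dots> = fps_const (x ?j q + (- x ?j u)) + fps_X" by (simp only: fps_const_add[symmetric] ac_simps)
          finally show ?thesis by simp
        qed
        ultimately have "arc q ?\<xi> ?g \<noteq> 0"
          using fps_shift_nonzero by (simp add: arc_mult[OF elim(2) elim(3) dq])
        then obtain c where c: "(x i c = 0 \<longrightarrow> w l c = 0) \<and> w l c = a c * x i c + b c * dx u ?j c" "c \<in> U" "x i c = 0" "?g c \<noteq> 0"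
          using alg_line_point[OF elim(2) xq q.germ_mult[OF elim(3) dq] _ elim(1)] by blast
        from c(1,3) have "w l c = 0" "w l c = b c * dx u ?j c" by auto
        then show False using c(4) by simp
      qed
    qed
    then have "b \<in> germ_ideal (w ` {..<N})" by (rule van_span[OF ab(2)])
    then obtain m where m: "\<forall>l. m l \<in> reg S u" "\<forall>\<^sub>F q in near S u. b q = (\<Sum>l<N. m l q * w l q)"
      using germ_ideal_finite by blast
    have "\<forall>\<^sub>F q in near S u. w l q = a q * x i q + (\<Sum>l<N. (dx u ?j q * m l q) * w l q)"
      using ab(3) m(2) by eventually_elim (simp add: sum_distrib_left algebra_simps)
    moreover have "(\<lambda>q. a q * x i q) \<in> germ_ideal {x i}" using ab(1) by (rule germ_ideal_gen) simp
    moreover have "\<forall>l<N. (\<lambda>q. dx u ?j q * m l q) \<in> reg S u \<and> dx u ?j u * m l u = 0"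
      using m(1) dxu by (auto intro: germ_mult)
    ultimately show "\<exists>c\<in>germ_ideal {x i}. \<exists>M. (\<forall>m<N. M m \<in> reg S u \<and> M m u = 0) \<and>
        (\<forall>\<^sub>F q in near S u. w l q = c q + (\<Sum>m<N. M m q * w m q))"
      by (intro bexI[of _ "\<lambda>q. a q * x i q"] exI[of _ "\<lambda>l q. dx u ?j q * m l q"] conjI)
  qed (auto intro: germ_ideal_add germ_ideal_mult germ_ideal_cong)
  then have "w ` {..<N} \<subseteq> germ_ideal {x i}" by auto
  moreover have "f \<in> germ_ideal (w ` {..<N})" by (rule van_span) (use f in \<open>simp_all add: van_def\<close>)
  ultimately show ?thesis using germ_ideal_trans by blast
qed

end

section \<open>Morphisms\<close>

text \<open>
  \<open>\<phi>\<close> is continuous at \<open>p\<close> and pulls back regular germs to regular germs.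
\<close>

definition morph_at :: "('p, 'k::field) space \<Rightarrow> ('q, 'k) space \<Rightarrow> ('p \<Rightarrow> 'q) \<Rightarrow> 'p \<Rightarrow> bool" where
  "morph_at X Y \<phi> p \<longleftrightarrow> filterlim \<phi> (near Y (\<phi> p)) (near X p) \<and> (\<forall>f\<in>reg Y (\<phi> p). (\<lambda>q. f (\<phi> q)) \<in> reg X p)"

lemma morph_eventually: "morph_at X Y \<phi> p \<Longrightarrow> eventually P (near Y (\<phi> p)) \<Longrightarrow> \<forall>\<^sub>F q in near X p. P (\<phi> q)"
  unfolding morph_at_def filterlim_iff by blast

lemma morph_reg: "morph_at X Y \<phi> p \<Longrightarrow> f \<in> reg Y (\<phi> p) \<Longrightarrow> (\<lambda>q. f (\<phi> q)) \<in> reg X p"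
  unfolding morph_at_def by blast

lemma morph_comp:
  assumes "morph_at X Y \<phi> p" "morph_at Y Z \<psi> (\<phi> p)" shows "morph_at X Z (\<lambda>q. \<psi> (\<phi> q)) p"
proof -
  have "filterlim (\<lambda>q. \<psi> (\<phi> q)) (near Z (\<psi> (\<phi> p))) (near X p)"
    using assms unfolding morph_at_def by (auto intro: filterlim_compose)
  moreover have "(\<lambda>q. f (\<psi> (\<phi> q))) \<in> reg X p" if "f \<in> reg Z (\<psi> (\<phi> p))" for f
    using morph_reg[OF assms(1) morph_reg[OF assms(2) that]] .
  ultimately show ?thesis unfolding morph_at_def by simp
qed

text \<open>
  It suffices to pull back generators of a coordinate ring; continuity follows, since
  neighbourhoods are given by inequations.
\<close>

lemma morph_at_criterion:
  assumes X: "germ_algebra (near X p) (reg X p) p" and Y: "presented_point Y W H (\<phi> p)"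
    and W: "\<forall>\<^sub>F q in near X p. \<phi> q \<in> W" and H: "\<And>h. h \<in> H \<Longrightarrow> (\<lambda>q. h (\<phi> q)) \<in> reg X p"
  shows "morph_at X Y \<phi> p"
proof -
  interpret X: germ_algebra "near X p" "reg X p" p by (rule X)
  interpret Y: presented_point Y W H "\<phi> p" by (rule Y)
  have alg: "(\<lambda>q. f (\<phi> q)) \<in> reg X p" if "f \<in> gen_alg H" for f
    using that
  proof (induction f rule: gen_alg.induct)
    case (gen_alg_gen g)
    then show ?case by (rule H)
  qed (auto intro: X.germ_const X.germ_add X.germ_mult)
  have ev: "\<forall>\<^sub>F q in near X p. P (\<phi> q)" if P: "eventually P (near Y (\<phi> p))" for P
  proof -
    obtain Q where Q: "Q \<in> gen_alg H" "Q (\<phi> p) \<noteq> 0" "\<And>q. q \<in> W \<Longrightarrow> Q q \<noteq> 0 \<Longrightarrow> P q"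
      by (rule presents_nearE[OF Y.presented Y.in_chart P]) blast
    show ?thesis
      using W X.germ_nonzero[OF alg[OF Q(1)] Q(2)] by eventually_elim (rule Q(3))
  qed
  have "(\<lambda>q. f (\<phi> q)) \<in> reg X p" if f: "f \<in> reg Y (\<phi> p)" for f
  proof -
    obtain P Q where PQ: "P \<in> gen_alg H" "Q \<in> gen_alg H" "Q (\<phi> p) \<noteq> 0"
      "\<forall>\<^sub>F q in near Y (\<phi> p). q \<in> W \<and> Q q \<noteq> 0 \<and> f q = P q / Q q" using f by (rule Y.fraction)
    show ?thesis
    proof (rule X.germ_cong)
      show "(\<lambda>q. P (\<phi> q) / Q (\<phi> q)) \<in> reg X p" by (intro X.germ_divide alg PQ)
      show "\<forall>\<^sub>F q in near X p. f (\<phi> q) = P (\<phi> q) / Q (\<phi> q)"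
        using ev[OF PQ(4)] by eventually_elim simp
    qed
  qed
  then show ?thesis unfolding morph_at_def filterlim_iff using ev by blast
qed

lemma eventually_points: "p \<in> points X \<Longrightarrow> \<forall>\<^sub>F q in near X p. q \<in> points X"
  by (rule eventually_near_open) simp_all

lemma morph_continuous:
  assumes "\<And>p. p \<in> points X \<Longrightarrow> \<phi> p \<in> points Y \<and> morph_at X Y \<phi> p"
  shows "continuous_map (zar X) (zar Y) \<phi>"
  unfolding continuous_map_def
proof (intro conjI allI impI)
  show "\<phi> \<in> points X \<rightarrow> points Y" using assms by auto
  fix \<Omega> assume \<Omega>: "openin (zar Y) \<Omega>"
  show "openin (zar X) {p \<in> points X. \<phi> p \<in> \<Omega>}"
    unfolding openin_subopen[of _ "{p \<in> points X. \<phi> p \<in> \<Omega>}"]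
  proof
    fix p assume p: "p \<in> {p \<in> points X. \<phi> p \<in> \<Omega>}"
    then have "morph_at X Y \<phi> p" "\<phi> p \<in> \<Omega>" using assms by auto
    from morph_eventually[OF this(1) eventually_near_open[OF \<Omega> this(2)]]
    have "\<forall>\<^sub>F q in near X p. \<phi> q \<in> \<Omega>" .
    then obtain T where "openin (zar X) T" "p \<in> T" "\<forall>q\<in>T. \<phi> q \<in> \<Omega>"
      using p eventually_near_iff[of p X "\<lambda>q. \<phi> q \<in> \<Omega>"] by auto
    then show "\<exists>T. openin (zar X) T \<and> p \<in> T \<and> T \<subseteq> {p \<in> points X. \<phi> p \<in> \<Omega>}"
      using openin_subset[of "zar X" T] by (intro exI[of _ T]) auto
  qed
qed

lemma lideal_pullback:
  assumes X: "germ_algebra (near X p) (reg X p) p" and Y: "germ_algebra (near Y (\<phi> p)) (reg Y (\<phi> p)) (\<phi> p)"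
    and m: "morph_at X Y \<phi> p" and f: "f \<in> lideal Y (\<phi> p) G"
  shows "(\<lambda>q. f (\<phi> q)) \<in> lideal X p ((\<lambda>g q. g (\<phi> q)) ` G)"
proof -
  interpret X: germ_algebra "near X p" "reg X p" p by (rule X)
  interpret Y: germ_algebra "near Y (\<phi> p)" "reg Y (\<phi> p)" "\<phi> p" by (rule Y)
  show ?thesis
    using f
  proof (induction f rule: Y.germ_ideal.induct)
    case (germ_ideal_0 f)
    show ?case by (rule X.germ_ideal_0) (rule morph_eventually[OF m germ_ideal_0])
  next
    case (germ_ideal_step f a g f')
    show ?case
      by (rule X.germ_ideal_step[OF germ_ideal_step(5) morph_reg[OF m germ_ideal_step(2)] imageI[OF germ_ideal_step(3)]])
        (rule morph_eventually[OF m germ_ideal_step(4)])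
  qed
qed

lemma points_prod_space_subset: "points (prod_space X Y) \<subseteq> points X \<times> points Y"
proof -
  have "points (prod_space X Y) \<subseteq> \<Union>{{z \<in> V \<times> W. F z \<noteq> 0} | V W F. tensor_on X Y V W F}"
    by (simp add: prod_space_def)
  also have "\<dots> \<subseteq> points X \<times> points Y"
  proof (intro Union_least)
    fix A assume "A \<in> {{z \<in> V \<times> W. F z \<noteq> 0} | V W F. tensor_on X Y V W F}"
    then obtain V W F where A: "tensor_on X Y V W F" "A = {z \<in> V \<times> W. F z \<noteq> 0}" by auto
    then have "V \<subseteq> points X" "W \<subseteq> points Y" unfolding tensor_on_def using openin_subset by blast+
    then show "A \<subseteq> points X \<times> points Y" unfolding A(2) by auto
  qed
  finally show ?thesis .
qed

section \<open>Charts of the tower\<close>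

lemma presents_product:
  assumes "presents X V G" "presents Y W H"
  shows "presents (prod_space X Y) (V \<times> W) ((\<lambda>g z. g (fst z)) ` G \<union> (\<lambda>h z. h (snd z)) ` H)"
  using presents_prod_gens[OF assms] unfolding prod_gens_def[OF assms] .

text \<open>
  The coordinate ring of the product of an affine chart of the surface with affine \<open>k\<close>-space.
\<close>

definition chart_gens :: "('u \<Rightarrow> 'k) list \<Rightarrow> nat \<Rightarrow> ('u \<times> 'k list \<Rightarrow> 'k) set" where
  "chart_gens zs k = (\<lambda>g z. g (fst z)) ` set zs \<union> (\<lambda>h z. h (snd z)) ` {(\<lambda>ys. ys ! j) | j. j < k}"

context patch
begin

text \<open>The chart \<open>\<C>(w)\<close> of the tower.\<close>

abbreviation CH :: "word \<Rightarrow> ('u \<times> 'k list, 'k) space" where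
  "CH w \<equiv> chart S U w"

lemma chart_presents:
  assumes "presents S V (set zs)"
  shows "presents (CH w) ((V \<inter> U) \<times> {ys. length ys = length w}) (chart_gens zs (length w))"
  unfolding chart_def chart_gens_def by (rule presents_product[OF presents_restr[OF assms] presents_affine_space])

lemma chart_points: "points (CH w) = U \<times> {ys. length ys = length w}"
proof
  show "points (CH w) \<subseteq> U \<times> {ys. length ys = length w}"
    using points_prod_space_subset[of "restr_space S U" "affine_space (length w)"] points_affine_space[of "length w", where 'k='k]
    by (auto simp: chart_def restr_space_def)
  show "U \<times> {ys. length ys = length w} \<subseteq> points (CH w)"
  proof
    fix q assume q: "q \<in> U \<times> {ys :: 'k list. length ys = length w}"
    then have "fst q \<in> U" by auto
    then obtain V zs where "presented_point S V (set zs) (fst q)" by (rule chart_in_U)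
    then have V: "presents S V (set zs)" "fst q \<in> V" by (simp_all add: presented_point_def)
    show "q \<in> points (CH w)"
      by (rule presents_points[OF chart_presents[OF V(1)]]) (use q V(2) in auto)
  qed
qed

lemma chart_presented:
  assumes q: "q \<in> points (CH w)" and V: "presented_point S V (set zs) (fst q)"
  shows "presented_point (CH w) ((V \<inter> U) \<times> {ys. length ys = length w}) (chart_gens zs (length w)) q"
  using chart_presents[of V zs w] V q unfolding presented_point_def chart_points by auto

lemma chart_presentedE:
  assumes "q \<in> points (CH w)"
  obtains V zs where "presented_point S V (set zs) (fst q)" "point_complete V zs"
    "presented_point (CH w) ((V \<inter> U) \<times> {ys. length ys = length w}) (chart_gens zs (length w)) q"
proof -
  have "fst q \<in> U" using assms by (auto simp: chart_points)
  then obtain V zs where V: "presented_point S V (set zs) (fst q)" "point_complete V zs" by (rule chart_in_U)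
  then show thesis using that chart_presented[OF assms V(1)] by blast
qed

lemma germ_chart: "q \<in> points (CH w) \<Longrightarrow> germ_algebra (near (CH w) q) (reg (CH w) q) q"
  by (erule chart_presentedE) (unfold presented_point_def, elim conjE, rule presents_germ_algebra)

lemma fst_morph:
  assumes q: "q \<in> points (CH w)" shows "morph_at (CH w) S fst q"
proof -
  obtain V zs where V: "presented_point S V (set zs) (fst q)" 
    "presented_point (CH w) ((V \<inter> U) \<times> {ys. length ys = length w}) (chart_gens zs (length w)) q"
    using q by (rule chart_presentedE)
  interpret q: presented_point "CH w" "(V \<inter> U) \<times> {ys. length ys = length w}" "chart_gens zs (length w)" q by (rule V(2))
  show ?thesis
  proof (rule morph_at_criterion[where \<phi> = fst, OF germ_chart[OF q] V(1)])
    show "\<forall>\<^sub>F z in near (CH w) q. fst z \<in> V" using q.eventually_in_chart by eventually_elim auto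
    fix h assume "h \<in> set zs"
    then show "(\<lambda>z. h (fst z)) \<in> reg (CH w) q"
      by (intro q.gen_alg_reg gen_alg_gen) (simp add: chart_gens_def)
  qed
qed

lemma coord_reg:
  assumes q: "q \<in> points (CH w)" and j: "j < length w" shows "(\<lambda>z. snd z ! j) \<in> reg (CH w) q"
proof -
  obtain V zs where V: "presented_point S V (set zs) (fst q)" 
    "presented_point (CH w) ((V \<inter> U) \<times> {ys. length ys = length w}) (chart_gens zs (length w)) q"
    using q by (rule chart_presentedE)
  interpret q: presented_point "CH w" "(V \<inter> U) \<times> {ys. length ys = length w}" "chart_gens zs (length w)" q by (rule V(2))
  show ?thesis
    by (intro q.gen_alg_reg gen_alg_gen) (use j in \<open>auto simp: chart_gens_def\<close>)
qed

lemma morph_into_chart: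
  assumes X: "germ_algebra (near X p) (reg X p) p" and pp: "\<phi> p \<in> points (CH w)"
    and m: "morph_at X S (\<lambda>q. fst (\<phi> q)) p"
    and r: "\<And>j. j < length w \<Longrightarrow> (\<lambda>q. snd (\<phi> q) ! j) \<in> reg X p"
    and e: "\<forall>\<^sub>F q in near X p. \<phi> q \<in> points (CH w)"
  shows "morph_at X (CH w) \<phi> p"
proof -
  obtain V zs where V: "presented_point S V (set zs) (fst (\<phi> p))" 
    "presented_point (CH w) ((V \<inter> U) \<times> {ys. length ys = length w}) (chart_gens zs (length w)) (\<phi> p)"
    using pp by (rule chart_presentedE)
  interpret u: presented_point S V "set zs" "fst (\<phi> p)" by (rule V(1))
  show ?thesis
  proof (rule morph_at_criterion[where \<phi> = \<phi>, OF X V(2)])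
    show "\<forall>\<^sub>F q in near X p. \<phi> q \<in> (V \<inter> U) \<times> {ys. length ys = length w}"
      using morph_eventually[OF m, of "\<lambda>q. q \<in> V", OF u.eventually_in_chart] e
      by eventually_elim (auto simp: chart_points mem_Times_iff)
    fix h assume "h \<in> chart_gens zs (length w)"
    then consider g where "g \<in> set zs" "h = (\<lambda>z. g (fst z))" | j where "j < length w" "h = (\<lambda>z. snd z ! j)"
      unfolding chart_gens_def by auto
    then show "(\<lambda>q. h (\<phi> q)) \<in> reg X p"
    proof cases
      case 1
      have "g \<in> reg S (fst (\<phi> p))" by (intro u.gen_alg_reg gen_alg_gen 1)
      from morph_reg[OF m this] show ?thesis by (simp add: 1)
    next
      case 2
      then show ?thesis using r by simp
    qed
  qed
qed

lemma proj_points: "q \<in> points (CH (p # w)) \<Longrightarrow> proj q \<in> points (CH w)"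
  by (auto simp: chart_points proj_def)

lemma proj_morph:
  assumes q: "q \<in> points (CH (p # w))" shows "morph_at (CH (p # w)) (CH w) proj q"
proof (rule morph_into_chart[where \<phi> = proj, OF germ_chart[OF q] proj_points[OF q]])
  interpret germ_algebra "near (CH (p # w)) q" "reg (CH (p # w)) q" q by (rule germ_chart[OF q])
  show "morph_at (CH (p # w)) S (\<lambda>q. fst (proj q)) q" using fst_morph[OF q] by (simp add: proj_def)
  show "\<forall>\<^sub>F q in near (CH (p # w)) q. proj q \<in> points (CH w)"
    using eventually_points[OF q] by eventually_elim (rule proj_points)
  fix j assume j: "j < length w"
  have "(\<lambda>z. snd z ! Suc j) \<in> reg (CH (p # w)) q" using j by (intro coord_reg q) simp
  then show "(\<lambda>z. snd (proj z) ! j) \<in> reg (CH (p # w)) q"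
  proof (rule germ_cong)
    show "\<forall>\<^sub>F z in near (CH (p # w)) q. snd (proj z) ! j = snd z ! Suc j"
      using eventually_points[OF q] by eventually_elim (use j in \<open>auto simp: proj_def chart_points nth_tl\<close>)
  qed
qed

text \<open>The section of \<open>proj\<close> on which the new coordinate vanishes.\<close>

definition zero_sect :: "'u \<times> 'k list \<Rightarrow> 'u \<times> 'k list" where
  "zero_sect q = (fst q, 0 # snd q)"

lemma proj_zero_sect [simp]: "proj (zero_sect q) = q"
  by (simp add: proj_def zero_sect_def)

lemma zero_sect_points: "q \<in> points (CH w) \<Longrightarrow> zero_sect q \<in> points (CH (p # w))"
  by (auto simp: chart_points zero_sect_def)

lemma zero_sect_morph:
  assumes q: "q \<in> points (CH w)" shows "morph_at (CH w) (CH (p # w)) zero_sect q"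
proof (rule morph_into_chart[where \<phi> = zero_sect, OF germ_chart[OF q] zero_sect_points[OF q]])
  interpret germ_algebra "near (CH w) q" "reg (CH w) q" q by (rule germ_chart[OF q])
  show "morph_at (CH w) S (\<lambda>q. fst (zero_sect q)) q" using fst_morph[OF q] by (simp add: zero_sect_def)
  show "\<forall>\<^sub>F q in near (CH w) q. zero_sect q \<in> points (CH (p # w))"
    using eventually_points[OF q] by eventually_elim (rule zero_sect_points)
  fix j assume "j < length (p # w)"
  then show "(\<lambda>z. snd (zero_sect z) ! j) \<in> reg (CH w) q"
    using coord_reg[OF q] germ_const by (cases j) (auto simp: zero_sect_def)
qed

lemma hd_reg:
  assumes q: "q \<in> points (CH (p # w))" shows "(\<lambda>z. hd (snd z)) \<in> reg (CH (p # w)) q"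
proof (rule germ_algebra.germ_cong[OF germ_chart[OF q]])
  show "(\<lambda>z. snd z ! 0) \<in> reg (CH (p # w)) q" by (rule coord_reg[OF q]) simp
  show "\<forall>\<^sub>F z in near (CH (p # w)) q. hd (snd z) = snd z ! 0"
    using eventually_points[OF q] by eventually_elim (auto simp: chart_points intro!: hd_conv_nth)
qed

lemma x_fst_reg: "q \<in> points (CH w) \<Longrightarrow> (\<lambda>z. x i (fst z)) \<in> reg (CH w) q"
  by (rule morph_reg[OF fst_morph x_reg]) (auto simp: chart_points)

lemma active_reg: "q \<in> points (CH w) \<Longrightarrow> active x w i \<in> reg (CH w) q"
proof (induction w arbitrary: q)
  case Nil
  have "active x [] i = (\<lambda>z. x i (fst z))" by (auto simp: fun_eq_iff)
  then show ?case using x_fst_reg[OF Nil] by simp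
next
  case (Cons p w)
  show ?case
  proof (cases "i = p")
    case True
    then have "active x (p # w) i = (\<lambda>z. active x w p (proj z))" by (auto simp: fun_eq_iff)
    then show ?thesis using morph_reg[OF proj_morph[OF Cons.prems] Cons.IH[OF proj_points[OF Cons.prems]]] True by simp
  next
    case False
    then have "active x (p # w) i = (\<lambda>z. hd (snd z))" by (auto simp: fun_eq_iff)
    then show ?thesis using hd_reg[OF Cons.prems] by simp
  qed
qed

end

section \<open>The model surface\<close>

text \<open>
  The exponents \<open>m\<^sub>i\<close> of the active coordinates in \<open>x\<^sub>1 x\<^sub>2 = C a\<^sub>1\<^sup>m\<^sup>1 a\<^sub>2\<^sup>m\<^sup>2\<close>, and the multiplicities of the twigs
  \<open>a\<^sub>i = 0\<close>.
\<close>

fun twig_mult :: "word \<Rightarrow> idx \<Rightarrow> nat" where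
  "twig_mult [] i = 1"
| "twig_mult (p # w) i = (if i = p then twig_mult w p + twig_mult w (other p) else twig_mult w (other p))"

lemma twig_mult_pos: "0 < twig_mult w i"
  by (induction w arbitrary: i) auto

lemma node_coeffs_mult: "node_coeffs (p # w) = (twig_mult w (other p), twig_mult w p)"
proof (induction w arbitrary: p)
  case (Cons r w)
  have "p \<noteq> r \<Longrightarrow> p = other r" by (simp add: idx_other)
  then show ?case
    using Cons[of r] by (cases "p = r") (auto simp: idx_other)
qed simp

text \<open>
  The node binomial, with its coefficients expressed by \<open>twig_mult\<close>.  For the empty word the value is
  \<open>0\<close>, because the model surface over \<open>U\<close> is \<open>U\<close> itself.
\<close>

fun binom :: "(idx \<Rightarrow> 'u \<Rightarrow> 'k::field) \<Rightarrow> word \<Rightarrow> 'u \<times> 'k list \<Rightarrow> 'k" where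
  "binom x [] q = 0"
| "binom x (p # w) q = of_nat (twig_mult w (other p)) * (hd (snd q) * active x w p (proj q))
      + of_nat (twig_mult w p) * active x w (other p) (proj q)"

text \<open>
  The model surface: the node binomials of \<open>w\<close> and of its suffixes, the strings of all lower
  levels, vanish.
\<close>

fun on_model :: "(idx \<Rightarrow> 'u \<Rightarrow> 'k::field) \<Rightarrow> word \<Rightarrow> 'u \<times> 'k list \<Rightarrow> bool" where
  "on_model x [] q \<longleftrightarrow> True"
| "on_model x (p # w) q \<longleftrightarrow> binom x (p # w) q = 0 \<and> on_model x w (proj q)"

text \<open>
  The active coordinates in the chart of \<open>w\<close> of a point of the model surface, in terms of its active
  coordinates \<open>a\<close> in the chart of \<open>p # w\<close>: the node binomial is solved for the deactivated coordinate.
  The values lie in any \<open>k\<close>-algebra with structure map \<open>h\<close>, so that arcs are included.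
\<close>

definition down :: "('k::field \<Rightarrow> 'a::comm_ring_1) \<Rightarrow> idx \<Rightarrow> word \<Rightarrow> (idx \<Rightarrow> 'a) \<Rightarrow> idx \<Rightarrow> 'a" where
  "down h p w a i = (if i = p then a p
     else h (- (of_nat (twig_mult w (other p)) / of_nat (twig_mult w p))) * (a (other p) * a p))"

text \<open>
  The coordinates \<open>x\<close> of a point of the model surface with active coordinates \<open>a\<close>; similarly, \<open>lift_y\<close>
  gives its new coordinates.
\<close>

fun lift_x :: "('k::field \<Rightarrow> 'a::comm_ring_1) \<Rightarrow> word \<Rightarrow> (idx \<Rightarrow> 'a) \<Rightarrow> idx \<Rightarrow> 'a" where
  "lift_x h [] a = a"
| "lift_x h (p # w) a = lift_x h w (down h p w a)"

fun lift_y :: "('k::field \<Rightarrow> 'a::comm_ring_1) \<Rightarrow> word \<Rightarrow> (idx \<Rightarrow> 'a) \<Rightarrow> 'a list" where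
  "lift_y h [] a = []"
| "lift_y h (p # w) a = a (other p) # lift_y h w (down h p w a)"

lemma length_lift_y [simp]: "length (lift_y h w a) = length w"
  by (induction w arbitrary: a) auto

lemma of_nat_mult_nonzero: "of_nat (twig_mult w i) \<noteq> (0 :: 'k::field_char_0)"
  using twig_mult_pos[of w i] by simp

lemma lift_active:
  fixes x :: "idx \<Rightarrow> 'u \<Rightarrow> 'k::field_char_0"
  assumes "on_model x w q" "length (snd q) = length w"
  shows "lift_x (\<lambda>k. k) w (\<lambda>i. active x w i q) = (\<lambda>i. x i (fst q)) \<and> lift_y (\<lambda>k. k) w (\<lambda>i. active x w i q) = snd q"
  using assms
proof (induction w arbitrary: q)
  case Nil
  then show ?case by (auto simp: fun_eq_iff)
next
  case (Cons p w)
  have "down (\<lambda>k. k) p w (\<lambda>i. active x (p # w) i q) = (\<lambda>i. active x w i (proj q))"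
  proof
    fix i
    have "of_nat (twig_mult w p) * active x w (other p) (proj q) = - (of_nat (twig_mult w (other p)) * (hd (snd q) * active x w p (proj q)))"
      using Cons.prems(1) by (simp add: eq_neg_iff_add_eq_0 add.commute)
    then have "active x w (other p) (proj q) = - (of_nat (twig_mult w (other p)) / of_nat (twig_mult w p)) * (hd (snd q) * active x w p (proj q))"
      using of_nat_mult_nonzero[of w p, where 'k='k] by (simp add: field_simps)
    then show "down (\<lambda>k. k) p w (\<lambda>i. active x (p # w) i q) i = active x w i (proj q)"
      using idx_other(1)[of i p] by (auto simp: down_def idx_other)
  qed
  moreover have "snd q = hd (snd q) # tl (snd q)" using Cons.prems(2) by (cases "snd q") auto
  ultimately show ?case
    using Cons.IH[of "proj q"] Cons.prems by (auto simp: proj_def idx_other)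
qed

lemma lift_hom:
  assumes \<theta>: "\<And>a b. \<theta> (a * b) = \<theta> a * \<theta> b" "\<And>c. \<theta> (h c) = h' c"
  shows "\<theta> (lift_x h w a i) = lift_x h' w (\<lambda>i. \<theta> (a i)) i \<and> map \<theta> (lift_y h w a) = lift_y h' w (\<lambda>i. \<theta> (a i))"
proof (induction w arbitrary: a)
  case (Cons p w)
  have "(\<lambda>i. \<theta> (down h p w a i)) = down h' p w (\<lambda>i. \<theta> (a i))"
    by (auto simp: down_def fun_eq_iff \<theta>)
  then show ?case using Cons[of "down h p w a"] by simp
qed simp

lemma lift_x_nonzero:
  fixes h :: "'k::field_char_0 \<Rightarrow> 'a::idom"
  assumes h: "\<And>c. c \<noteq> 0 \<Longrightarrow> h c \<noteq> 0"
  shows "(\<And>i. a i \<noteq> 0) \<Longrightarrow> lift_x h w a i \<noteq> 0"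
proof (induction w arbitrary: a)
  case (Cons p w)
  have "down h p w a i \<noteq> 0" for i
    using Cons.prems by (auto simp: down_def less_imp_neq[OF twig_mult_pos, symmetric] intro!: h)
  then show ?case using Cons.IH by simp
qed simp

lemma lift_x_monomial:
  "\<exists>C::'k::field_char_0. C \<noteq> 0 \<and> (\<forall>a. lift_x (\<lambda>k. k) w a i * lift_x (\<lambda>k. k) w a (other i)
      = C * (a j ^ twig_mult w j * a (other j) ^ twig_mult w (other j)))"
proof (induction w arbitrary: j)
  case Nil
  have "(\<lambda>a :: idx \<Rightarrow> 'k. a i * a (other i)) = (\<lambda>a. a j * a (other j))"
    using idx_other(1)[of i j] by (cases "i = j") (auto simp: idx_other mult.commute)
  then show ?case by (intro exI[of _ 1]) (auto dest: fun_cong)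
next
  case (Cons p w)
  from Cons[of p] obtain C :: 'k where C: "C \<noteq> 0" "\<And>a. lift_x (\<lambda>k. k) w a i * lift_x (\<lambda>k. k) w a (other i)
      = C * (a p ^ twig_mult w p * a (other p) ^ twig_mult w (other p))" by blast
  let ?c = "- (of_nat (twig_mult w (other p)) / of_nat (twig_mult w p)) :: 'k"
  have c: "?c \<noteq> 0" using of_nat_mult_nonzero[where 'k='k] by simp
  have "lift_x (\<lambda>k. k) (p # w) a i * lift_x (\<lambda>k. k) (p # w) a (other i) =
      (C * ?c ^ twig_mult w (other p)) * (a j ^ twig_mult (p # w) j * a (other j) ^ twig_mult (p # w) (other j))" for a
  proof -
    have "lift_x (\<lambda>k. k) (p # w) a i * lift_x (\<lambda>k. k) (p # w) a (other i) =
       C * (a p ^ twig_mult w p * (?c * (a (other p) * a p)) ^ twig_mult w (other p))"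
      unfolding lift_x.simps C(2) by (simp add: down_def idx_other)
    also have "\<dots> = (C * ?c ^ twig_mult w (other p)) * (a p ^ twig_mult (p # w) p * a (other p) ^ twig_mult (p # w) (other p))"
      by (simp only: power_mult_distrib power_add twig_mult.simps idx_other if_True if_False refl) (simp add: ac_simps)
    also have "a p ^ twig_mult (p # w) p * a (other p) ^ twig_mult (p # w) (other p) = a j ^ twig_mult (p # w) j * a (other j) ^ twig_mult (p # w) (other j)"
      using idx_other(1)[of j p] by (cases "j = p") (auto simp only: idx_other mult.commute)
    finally show ?thesis .
  qed
  then show ?case using C(1) c by (intro exI[of _ "C * ?c ^ twig_mult w (other p)"]) auto
qed

section \<open>Tangent lines of the smooth fibres\<close>

lemma pushforward_apply: "f \<in> reg Y (\<phi> p) \<Longrightarrow> pushforward Y \<phi> p v f = v (\<lambda>q. f (\<phi> q))"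
  by (simp add: pushforward_def o_def)

lemma pushforward_tangent:
  assumes X: "presented_point X V G p" and Y: "presented_point Y W H (\<phi> p)" and m: "morph_at X Y \<phi> p"
    and v: "v \<in> tangent X p"
  shows "pushforward Y \<phi> p v \<in> tangent Y (\<phi> p)"
proof -
  interpret X: presented_point X V G p by (rule X)
  interpret Y: presented_point Y W H "\<phi> p" by (rule Y)
  show ?thesis
  proof (rule Y.tangentI)
    fix f g assume fg: "f \<in> reg Y (\<phi> p)" "g \<in> reg Y (\<phi> p)"
    note r = morph_reg[OF m fg(1)] morph_reg[OF m fg(2)]
    show "pushforward Y \<phi> p v (\<lambda>q. f q + g q) = pushforward Y \<phi> p v f + pushforward Y \<phi> p v g"
      using X.tangent_add[OF v r] by (simp add: pushforward_apply fg Y.germ_add)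
    show "pushforward Y \<phi> p v (\<lambda>q. f q * g q) = f (\<phi> p) * pushforward Y \<phi> p v g + g (\<phi> p) * pushforward Y \<phi> p v f"
      using X.tangent_mult[OF v r] by (simp add: pushforward_apply fg Y.germ_mult)
    assume "\<forall>\<^sub>F q in near Y (\<phi> p). f q = g q"
    from X.tangent_cong[OF v r(2) morph_eventually[OF m this]]
    show "pushforward Y \<phi> p v f = pushforward Y \<phi> p v g" by (simp add: pushforward_apply fg)
  next
    fix f c assume f: "f \<in> reg Y (\<phi> p)"
    show "pushforward Y \<phi> p v (\<lambda>q. c * f q) = c * pushforward Y \<phi> p v f"
      using X.tangent_cmult[OF v morph_reg[OF m f], of c] by (simp add: pushforward_apply f Y.germ_cmult)
  qed (simp add: pushforward_def)
qed

lemma tangent_sub_iff: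
  assumes "p \<in> points X"
  shows "v \<in> tangent_sub X C p \<longleftrightarrow> v \<in> tangent X p \<and>
    (\<forall>f\<in>reg X p. (\<forall>\<^sub>F q in near X p. q \<in> C \<longrightarrow> f q = 0) \<longrightarrow> v f = 0)"
  unfolding tangent_sub_def eventually_near_iff[OF assms] by blast

context patch
begin

lemma chart_tangent_ext:
  assumes q: "q \<in> points (CH w)" and v: "v \<in> tangent (CH w) q" "v' \<in> tangent (CH w) q"
    and vx: "\<And>i. v (\<lambda>z. x i (fst z)) = v' (\<lambda>z. x i (fst z))"
    and vy: "\<And>j. j < length w \<Longrightarrow> v (\<lambda>z. snd z ! j) = v' (\<lambda>z. snd z ! j)"
  shows "v = v'"
proof -
  obtain V zs where V: "presented_point S V (set zs) (fst q)" 
    "presented_point (CH w) ((V \<inter> U) \<times> {ys. length ys = length w}) (chart_gens zs (length w)) q"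
    using q by (rule chart_presentedE)
  interpret u: presented_point S V "set zs" "fst q" by (rule V(1))
  have uU: "fst q \<in> U" using q by (auto simp: chart_points)
  note m = fst_morph[OF q]
  have eq: "pushforward S fst q v = pushforward S fst q v'"
    by (rule tangent_unique[OF uU pushforward_tangent[where \<phi> = fst, OF V(2,1) m v(1)] pushforward_tangent[where \<phi> = fst, OF V(2,1) m v(2)]])
      (simp add: pushforward_apply x_reg[OF uU] vx)
  show ?thesis
  proof (rule presented_point.tangent_ext[OF V(2) v])
    fix h assume "h \<in> chart_gens zs (length w)"
    then consider g where "g \<in> set zs" "h = (\<lambda>z. g (fst z))" | j where "j < length w" "h = (\<lambda>z. snd z ! j)"
      unfolding chart_gens_def by auto
    then show "v h = v' h"
    proof cases
      case 1
      have "g \<in> reg S (fst q)" by (intro u.gen_alg_reg gen_alg_gen 1)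
      with fun_cong[OF eq, of g] show ?thesis by (simp add: pushforward_apply 1)
    next
      case 2
      then show ?thesis using vy by simp
    qed
  qed
qed

lemma chart_tangent_cong:
  "q \<in> points (CH w) \<Longrightarrow> v \<in> tangent (CH w) q \<Longrightarrow> f \<in> reg (CH w) q \<Longrightarrow> \<forall>\<^sub>F z in near (CH w) q. g z = f z \<Longrightarrow> v g = v f"
  by (rule chart_presentedE, assumption) (rule presented_point.tangent_cong)

lemma chart_tangent_step:
  assumes q: "q \<in> points (CH (p # w))" and v: "v \<in> tangent (CH (p # w)) q" "v' \<in> tangent (CH (p # w)) q"
    and e: "pushforward (CH w) proj q v = pushforward (CH w) proj q v'"
    and h: "v (\<lambda>z. hd (snd z)) = v' (\<lambda>z. hd (snd z))"
  shows "v = v'"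
proof (rule chart_tangent_ext[OF q v])
  note P = proj_points[OF q]
  show "v (\<lambda>z. x i (fst z)) = v' (\<lambda>z. x i (fst z))" for i
    using fun_cong[OF e, of "\<lambda>z. x i (fst z)"] pushforward_apply[where \<phi> = proj, OF x_fst_reg[OF P], of v i] pushforward_apply[where \<phi> = proj, OF x_fst_reg[OF P], of v' i]
    by (simp add: proj_def)
  show "v (\<lambda>z. snd z ! j) = v' (\<lambda>z. snd z ! j)" if j: "j < length (p # w)" for j
  proof (cases j)
    case 0
    have "\<forall>\<^sub>F z in near (CH (p # w)) q. snd z ! j = hd (snd z)"
      using eventually_points[OF q] by eventually_elim (auto simp: chart_points 0 intro!: hd_conv_nth[symmetric])
    from chart_tangent_cong[OF q v(1) hd_reg[OF q] this] chart_tangent_cong[OF q v(2) hd_reg[OF q] this] h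
    show ?thesis by simp
  next
    case (Suc m)
    have m: "m < length w" using j Suc by simp
    have ev: "\<forall>\<^sub>F z in near (CH (p # w)) q. snd (proj z) ! m = snd z ! j"
      using eventually_points[OF q] by eventually_elim (use m Suc in \<open>auto simp: proj_def chart_points nth_tl\<close>)
    note c = coord_reg[OF q j]
    have "v (\<lambda>z. snd (proj z) ! m) = v' (\<lambda>z. snd (proj z) ! m)"
      using fun_cong[OF e, of "\<lambda>z. snd z ! m"] by (simp add: pushforward_apply[where \<phi> = proj, OF coord_reg[OF P m]])
    then show ?thesis
      using chart_tangent_cong[OF q v(1) c ev] chart_tangent_cong[OF q v(2) c ev] by simp
  qed
qed

text \<open>
  The part of the patch that contains the hyperbolas \<open>x\<^sub>1 x\<^sub>2 = t\<close> with \<open>t \<noteq> 0\<close>.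
\<close>

definition U0 :: "'u set" where
  "U0 = {c \<in> U. x I1 c \<noteq> 0 \<and> x I2 c \<noteq> 0}"

text \<open>
  The new coordinates of the point of the model surface over a point \<open>c\<close> of \<open>U0\<close>: each node binomial
  is solved for its new coordinate.
\<close>

fun sec :: "word \<Rightarrow> 'u \<Rightarrow> 'k list" where
  "sec [] c = []"
| "sec (p # w) c = (- (of_nat (twig_mult w p) / of_nat (twig_mult w (other p))) *
     (active x w (other p) (c, sec w c) / active x w p (c, sec w c))) # sec w c"

text \<open>The section of the model surface over \<open>U0\<close>.\<close>

definition sect :: "word \<Rightarrow> 'u \<Rightarrow> 'u \<times> 'k list" where
  "sect w c = (c, sec w c)"

text \<open>The active coordinates along this section, as functions on the patch.\<close>

definition act :: "word \<Rightarrow> idx \<Rightarrow> 'u \<Rightarrow> 'k" where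
  "act w i c = active x w i (sect w c)"

lemma length_sec [simp]: "length (sec w c) = length w"
  by (induction w) auto

lemma proj_sect [simp]: "proj (sect (p # w) c) = sect w c"
  by (simp add: proj_def sect_def)

lemma fst_sect [simp]: "fst (sect w c) = c"
  by (simp add: sect_def)

lemma act_Nil: "act [] i = x i"
  by (auto simp: act_def fun_eq_iff)

lemma act_same: "act (p # w) p = act w p"
  by (auto simp: act_def fun_eq_iff)

lemma act_other: "act (p # w) (other p) c = - (of_nat (twig_mult w p) / of_nat (twig_mult w (other p))) * (act w (other p) c / act w p c)"
  by (simp add: act_def sect_def idx_other)

lemma hd_sec: "hd (snd (sect (p # w) c)) = act (p # w) (other p) c"
  by (simp add: act_def sect_def idx_other)

lemma U0_U: "c \<in> U0 \<Longrightarrow> c \<in> U"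
  by (simp add: U0_def)

lemma sect_points: "c \<in> U \<Longrightarrow> sect w c \<in> points (CH w)"
  by (simp add: chart_points sect_def)

lemma act_nonzero: "c \<in> U0 \<Longrightarrow> act w i c \<noteq> 0"
proof (induction w arbitrary: i)
  case Nil
  then show ?case by (cases i) (auto simp: U0_def act_Nil)
next
  case (Cons p w)
  show ?case
  proof (cases "i = p")
    case False
    then have "i = other p" by (simp add: idx_other)
    then show ?thesis using Cons twig_mult_pos[THEN less_imp_neq, symmetric] by (simp add: act_other)
  qed (simp add: act_same Cons)
qed

lemma act_relation: "c \<in> U0 \<Longrightarrow> of_nat (twig_mult w (other p)) * (act (p # w) (other p) c * act w p c)
    + of_nat (twig_mult w p) * act w (other p) c = 0"
  using act_nonzero[of c w p] twig_mult_pos[of w "other p", THEN less_imp_neq, symmetric]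
  by (simp add: act_other field_simps)

lemma on_model_sect:
  assumes c: "c \<in> U0" and q: "fst q = c"
  shows "on_model x w q \<and> length (snd q) = length w \<longleftrightarrow> q = sect w c"
  using q
proof (induction w arbitrary: q)
  case Nil
  then show ?case by (cases q) (auto simp: sect_def)
next
  case (Cons p w)
  have a: "act w p c \<noteq> 0" by (rule act_nonzero[OF c])
  note rel = act_relation[OF c, of w p]
  have M: "of_nat (twig_mult w (other p)) \<noteq> (0::'k)" by (rule of_nat_mult_nonzero)
  show ?case
  proof
    assume h: "on_model x (p # w) q \<and> length (snd q) = length (p # w)"
    then have pq: "proj q = sect w c" using Cons.IH[of "proj q"] Cons.prems by (auto simp: proj_def)
    have "of_nat (twig_mult w (other p)) * (hd (snd q) * act w p c) + of_nat (twig_mult w p) * act w (other p) c = 0"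
      using h by (simp add: pq act_def)
    with rel have "of_nat (twig_mult w (other p)) * (hd (snd q) * act w p c) = of_nat (twig_mult w (other p)) * (act (p # w) (other p) c * act w p c)"
      by (metis add_right_cancel)
    then have "hd (snd q) = act (p # w) (other p) c" using a M by simp
    moreover have "snd q = hd (snd q) # tl (snd q)" using h by (cases "snd q") auto
    moreover have "tl (snd q) = sec w c" using pq by (simp add: proj_def sect_def)
    ultimately show "q = sect (p # w) c"
      using Cons.prems by (cases q) (simp add: sect_def act_def idx_other)
  next
    assume q: "q = sect (p # w) c"
    have "on_model x w (proj q)" using Cons.IH[of "proj q"] q by simp
    moreover have "binom x (p # w) q = 0" using rel by (simp add: q hd_sec) (simp add: act_def)
    ultimately show "on_model x (p # w) q \<and> length (snd q) = length (p # w)" by (simp add: q sect_def)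
  qed
qed

lemma sect_Nil_morph:
  assumes u: "u \<in> U" shows "morph_at S (CH []) (sect []) u"
proof (rule morph_into_chart[where \<phi> = "sect []", OF germ_algebra_U[OF u] sect_points[OF u]])
  show "morph_at S S (\<lambda>q. fst (sect [] q)) u" by (simp add: morph_at_def filterlim_ident)
  show "\<forall>\<^sub>F q in near S u. sect [] q \<in> points (CH [])"
    using eventually_U[OF u] by eventually_elim (rule sect_points)
qed simp

lemma sect_morph: "u \<in> U0 \<Longrightarrow> morph_at S (CH w) (sect w) u"
proof (induction w)
  case Nil
  then show ?case by (intro sect_Nil_morph U0_U)
next
  case (Cons p w)
  then have u: "u \<in> U" and m: "morph_at S (CH w) (sect w) u" by (auto simp: U0_U)
  interpret germ_algebra "near S u" "reg S u" u by (rule germ_algebra_U[OF u])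
  show ?case
  proof (rule morph_into_chart[where \<phi> = "sect (p # w)", OF germ_algebra_U[OF u] sect_points[OF u]])
    show "morph_at S S (\<lambda>q. fst (sect (p # w) q)) u" by (simp add: morph_at_def filterlim_ident)
    show "\<forall>\<^sub>F q in near S u. sect (p # w) q \<in> points (CH (p # w))"
      using eventually_U[OF u] by eventually_elim (rule sect_points)
    fix j assume j: "j < length (p # w)"
    show "(\<lambda>q. snd (sect (p # w) q) ! j) \<in> reg S u"
    proof (cases j)
      case 0
      have r: "(\<lambda>c. active x w i (sect w c)) \<in> reg S u" for i
        by (rule morph_reg[OF m active_reg[OF sect_points[OF u]]])
      have "active x w p (sect w u) \<noteq> 0" using act_nonzero[OF Cons.prems] by (simp add: act_def)
      then have "(\<lambda>c. - (of_nat (twig_mult w p) / of_nat (twig_mult w (other p))) *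
          (active x w (other p) (sect w c) / active x w p (sect w c))) \<in> reg S u"
        by (intro germ_cmult germ_divide r)
      then show ?thesis by (simp add: 0 sect_def)
    next
      case (Suc m')
      have "(\<lambda>c. snd (sect w c) ! m') \<in> reg S u"
        by (rule morph_reg[OF m coord_reg[OF sect_points[OF u]]]) (use j Suc in simp)
      then show ?thesis by (simp add: Suc sect_def)
    qed
  qed
qed

lemma act_reg: "u \<in> U0 \<Longrightarrow> act w i \<in> reg S u"
  unfolding act_def[abs_def] by (rule morph_reg[OF sect_morph active_reg[OF sect_points]]) (auto simp: U0_U)

lemma eventually_U0: "u \<in> U0 \<Longrightarrow> \<forall>\<^sub>F c in near S u. c \<in> U0"
proof -
  assume u0: "u \<in> U0"
  then have u: "u \<in> U" by (rule U0_U)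
  interpret germ_algebra "near S u" "reg S u" u by (rule germ_algebra_U[OF u])
  have "x i u \<noteq> 0" for i using u0 by (cases i) (auto simp: U0_def)
  then have "\<forall>\<^sub>F c in near S u. x I1 c \<noteq> 0" "\<forall>\<^sub>F c in near S u. x I2 c \<noteq> 0"
    using x_reg[OF u] by (auto intro: germ_nonzero)
  with eventually_U[OF u] show ?thesis by eventually_elim (simp add: U0_def)
qed

text \<open>The part of the section over the hyperbola \<open>x\<^sub>1 x\<^sub>2 = t\<close>.\<close>

definition graph :: "word \<Rightarrow> 'k \<Rightarrow> ('u \<times> 'k list) set" where
  "graph w t = {sect w c | c. c \<in> U \<and> x I1 c * x I2 c = t}"

lemma graph_iff:
  assumes "t \<noteq> 0"
  shows "q \<in> graph w t \<longleftrightarrow> q \<in> points (CH w) \<and> x I1 (fst q) * x I2 (fst q) = t \<and> on_model x w q"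
proof -
  have U0: "c \<in> U0" if "c \<in> U" "x I1 c * x I2 c = t" for c using that assms by (auto simp: U0_def)
  show ?thesis
  proof
    assume "q \<in> graph w t"
    then obtain c where c: "c \<in> U" "x I1 c * x I2 c = t" "q = sect w c" by (auto simp: graph_def)
    then show "q \<in> points (CH w) \<and> x I1 (fst q) * x I2 (fst q) = t \<and> on_model x w q"
      using sect_points[of c w] on_model_sect[OF U0[OF c(1,2)], of q w] by simp
  next
    assume h: "q \<in> points (CH w) \<and> x I1 (fst q) * x I2 (fst q) = t \<and> on_model x w q"
    then have c: "fst q \<in> U" "x I1 (fst q) * x I2 (fst q) = t" "length (snd q) = length w" by (auto simp: chart_points)
    then have "q = sect w (fst q)" using on_model_sect[OF U0[OF c(1,2)], of q w] h by simp
    then show "q \<in> graph w t" using c unfolding graph_def by blast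
  qed
qed

lemma binom_reg: "q \<in> points (CH (p # w)) \<Longrightarrow> binom x (p # w) \<in> reg (CH (p # w)) q"
proof -
  assume q: "q \<in> points (CH (p # w))"
  interpret germ_algebra "near (CH (p # w)) q" "reg (CH (p # w)) q" q by (rule germ_chart[OF q])
  have "(\<lambda>z. active x w i (proj z)) \<in> reg (CH (p # w)) q" for i
    by (rule morph_reg[OF proj_morph[OF q] active_reg[OF proj_points[OF q]]])
  then have "(\<lambda>z. of_nat (twig_mult w (other p)) * (hd (snd z) * active x w p (proj z))
      + of_nat (twig_mult w p) * active x w (other p) (proj z)) \<in> reg (CH (p # w)) q"
    by (intro germ_add germ_cmult germ_mult hd_reg q)
  moreover have "binom x (p # w) = (\<lambda>z. of_nat (twig_mult w (other p)) * (hd (snd z) * active x w p (proj z))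
      + of_nat (twig_mult w p) * active x w (other p) (proj z))" by (auto simp: fun_eq_iff)
  ultimately show ?thesis by simp
qed

lemma chart_zero_set_closed: "(\<And>q. q \<in> points (CH w) \<Longrightarrow> f \<in> reg (CH w) q) \<Longrightarrow> closedin (zar (CH w)) {q \<in> points (CH w). f q = 0}"
proof (rule zero_set_closed)
  fix q assume "q \<in> points (CH w)"
  then show "\<exists>V G. presents (CH w) V G \<and> q \<in> V"
    by (rule chart_presentedE) (auto simp: presented_point_def)
qed

lemma proj_continuous: "continuous_map (zar (CH (p # w))) (zar (CH w)) proj"
  by (rule morph_continuous) (simp add: proj_points proj_morph)

lemma model_closed: "closedin (zar (CH w)) {q \<in> points (CH w). on_model x w q}"
proof (induction w)
  case (Cons p w)
  have "closedin (zar (CH (p # w))) {q \<in> points (CH (p # w)). proj q \<in> {q \<in> points (CH w). on_model x w q}}"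
    by (rule closedin_continuous_map_preimage[OF proj_continuous Cons])
  from closedin_Int[OF this chart_zero_set_closed[OF binom_reg]]
  show ?case by (rule back_subst[where P="closedin (zar (CH (p # w)))"]) (auto intro: proj_points)
qed simp

lemma graph_closed:
  assumes "t \<noteq> 0" shows "closedin (zar (CH w)) (graph w t)"
proof -
  have "closedin (zar (CH w)) {q \<in> points (CH w). x I1 (fst q) * x I2 (fst q) - t = 0}"
  proof (rule chart_zero_set_closed)
    fix q assume q: "q \<in> points (CH w)"
    interpret germ_algebra "near (CH w) q" "reg (CH w) q" q by (rule germ_chart[OF q])
    show "(\<lambda>q. x I1 (fst q) * x I2 (fst q) - t) \<in> reg (CH w) q"
      by (intro germ_diff germ_mult germ_const x_fst_reg q)
  qed
  moreover have "graph w t = {q \<in> points (CH w). x I1 (fst q) * x I2 (fst q) - t = 0} \<inter> {q \<in> points (CH w). on_model x w q}"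
    unfolding set_eq_iff graph_iff[OF assms] by simp blast
  ultimately show ?thesis using closedin_Int[OF _ model_closed] by simp
qed

context
  fixes u :: 'u and \<nu> :: "('u \<Rightarrow> 'k) \<Rightarrow> 'k"
  assumes u: "u \<in> U0" and \<nu>: "\<nu> \<in> tangent S u" "\<nu> (x I1) = x I1 u" "\<nu> (x I2) = - x I2 u"
begin

lemma uU: "u \<in> U"
  by (rule U0_U[OF u])

text \<open>
  The velocity of the prolonged curve, the image of \<open>\<nu> = x\<^sub>1 \<partial>\<^sub>1 - x\<^sub>2 \<partial>\<^sub>2\<close> under the section.
\<close>

definition vel :: "word \<Rightarrow> ('u \<times> 'k list \<Rightarrow> 'k) \<Rightarrow> 'k" where
  "vel w = pushforward (CH w) (sect w) u \<nu>"

lemma vel_apply: "f \<in> reg (CH w) (sect w u) \<Longrightarrow> vel w f = \<nu> (\<lambda>c. f (sect w c))"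
  unfolding vel_def by (rule pushforward_apply)

lemma vel_active: "vel w (active x w i) = \<nu> (act w i)"
  unfolding vel_apply[OF active_reg[OF sect_points[OF uU]]] act_def[abs_def] ..

lemma vel_tangent: "vel w \<in> tangent (CH w) (sect w u)"
proof -
  obtain V zs where V: "presented_point S V (set zs) (fst (sect w u))" 
    "presented_point (CH w) ((V \<inter> U) \<times> {ys. length ys = length w}) (chart_gens zs (length w)) (sect w u)"
    using sect_points[OF uU] by (rule chart_presentedE)
  from V(1) have "presented_point S V (set zs) u" by simp
  then show ?thesis unfolding vel_def using V(2) sect_morph[OF u] \<nu>(1) by (rule pushforward_tangent)
qed

lemma vel_proj: "pushforward (CH w) proj (sect (p # w) u) (\<lambda>f. c * vel (p # w) f) = (\<lambda>f. c * vel w f)"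
proof
  fix f
  note q = sect_points[OF uU, of "p # w"]
  show "pushforward (CH w) proj (sect (p # w) u) (\<lambda>f. c * vel (p # w) f) f = c * vel w f"
  proof (cases "f \<in> reg (CH w) (sect w u)")
    case True
    then have r: "(\<lambda>z. f (proj z)) \<in> reg (CH (p # w)) (sect (p # w) u)"
      using morph_reg[OF proj_morph[OF q]] by simp
    have "pushforward (CH w) proj (sect (p # w) u) (\<lambda>f. c * vel (p # w) f) f = c * vel (p # w) (\<lambda>z. f (proj z))"
      using True by (intro pushforward_apply) simp
    then show ?thesis by (simp add: vel_apply[OF r] vel_apply[OF True])
  qed (simp add: pushforward_def vel_def)
qed

text \<open>
  The first part says that the logarithmic derivative of \<open>a\<^sub>1\<^sup>m\<^sup>1 a\<^sub>2\<^sup>m\<^sup>2\<close> along the curve is zero; it is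
  proved by differentiating the node binomials.  The second part is the resulting slope: it is the value
  of the new coordinate in the next chart.
\<close>

lemma vel_relation:
  "of_nat (twig_mult w i) * act w (other i) u * \<nu> (act w i) + of_nat (twig_mult w (other i)) * act w i u * \<nu> (act w (other i)) = 0
   \<and> \<nu> (act w i) \<noteq> 0"
  "\<nu> (act w (other p)) = act (p # w) (other p) u * \<nu> (act w p)"
proof -
  obtain V zs where "presented_point S V (set zs) u" by (rule chart_in_U[OF uU])
  then interpret presented_point S V "set zs" u .
  have M: "twig_mult w i \<noteq> 0" for w i using twig_mult_pos[of w i] by simp
  have a0: "act w i u \<noteq> 0" for w i by (rule act_nonzero[OF u])
  have ar: "act w i \<in> reg S u" for w i by (rule act_reg[OF u])
  have step: "\<nu> (act w (other p)) = act (p # w) (other p) u * \<nu> (act w p)"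
    if "of_nat (twig_mult w p) * act w (other p) u * \<nu> (act w p) + of_nat (twig_mult w (other p)) * act w p u * \<nu> (act w (other p)) = 0" for w p
  proof -
    have "of_nat (twig_mult w p) * act w (other p) u = - (of_nat (twig_mult w (other p)) * (act (p # w) (other p) u * act w p u))"
      using act_relation[OF u, of w p] by (simp add: eq_neg_iff_add_eq_0 add.commute)
    with that have "(of_nat (twig_mult w (other p)) * act w p u) * (\<nu> (act w (other p)) - act (p # w) (other p) u * \<nu> (act w p)) = 0"
      by (simp add: algebra_simps)
    then show ?thesis using M a0 by simp
  qed
  have der: "of_nat (twig_mult w (other p)) * (act (p # w) (other p) u * \<nu> (act w p) + act w p u * \<nu> (act (p # w) (other p)))
      + of_nat (twig_mult w p) * \<nu> (act w (other p)) = 0" for w p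
  proof -
    let ?f = "\<lambda>c. of_nat (twig_mult w (other p)) * (act (p # w) (other p) c * act w p c) + of_nat (twig_mult w p) * act w (other p) c"
    have "\<forall>\<^sub>F c in near S u. ?f c = 0"
      using eventually_U0[OF u] by eventually_elim (rule act_relation)
    from tangent_cong[OF \<nu>(1) germ_const this] have "\<nu> ?f = 0" by (simp add: tangent_const[OF \<nu>(1)])
    moreover have "\<nu> ?f = of_nat (twig_mult w (other p)) * (act (p # w) (other p) u * \<nu> (act w p) + act w p u * \<nu> (act (p # w) (other p)))
      + of_nat (twig_mult w p) * \<nu> (act w (other p))"
      by (simp only: tangent_add[OF \<nu>(1)] tangent_cmult[OF \<nu>(1)] tangent_mult[OF \<nu>(1)] germ_cmult germ_mult ar)
    ultimately show ?thesis by simp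
  qed
  have main: "of_nat (twig_mult w i) * act w (other i) u * \<nu> (act w i) + of_nat (twig_mult w (other i)) * act w i u * \<nu> (act w (other i)) = 0
     \<and> \<nu> (act w i) \<noteq> 0" for w i
  proof (induction w arbitrary: i)
    case Nil
    show ?case using \<nu> a0[of "[]" i] by (cases i) (auto simp: act_Nil)
  next
    case (Cons p w)
    let ?m = "of_nat (twig_mult w p) :: 'k" and ?M = "of_nat (twig_mult w (other p)) :: 'k"
    let ?n = "act (p # w) (other p) u"
    note s = step[OF conjunct1[OF Cons.IH[of p]]]
    have E: "(?m + ?M) * ?n * \<nu> (act w p) + ?M * act w p u * \<nu> (act (p # w) (other p)) = 0"
      using der[where w=w and p=p] unfolding s by (simp add: algebra_simps)
    show ?case
    proof (cases "i = p")
      case True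
      then show ?thesis using E conjunct2[OF Cons.IH[of p]] by (simp add: act_same idx_other)
    next
      case False
      then have i: "i = other p" by (simp add: idx_other)
      have "\<nu> (act (p # w) (other p)) \<noteq> 0"
      proof
        assume "\<nu> (act (p # w) (other p)) = 0"
        with E have "(?m + ?M) * ?n * \<nu> (act w p) = 0" by simp
        moreover have "?m + ?M \<noteq> 0" using of_nat_mult_nonzero[of "p # w" p, where 'k='k] by (metis twig_mult.simps(2) of_nat_add)
        ultimately show False using a0[of "p # w" "other p"] conjunct2[OF Cons.IH[of p]] by simp
      qed
      then show ?thesis using E by (simp add: i act_same idx_other algebra_simps)
    qed
  qed
  show "of_nat (twig_mult w i) * act w (other i) u * \<nu> (act w i) + of_nat (twig_mult w (other i)) * act w i u * \<nu> (act w (other i)) = 0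
   \<and> \<nu> (act w i) \<noteq> 0" by (rule main)
  show "\<nu> (act w (other p)) = act (p # w) (other p) u * \<nu> (act w p)"
    by (rule step[OF conjunct1[OF main]])
qed

lemma scaled_vel_tangent: "(\<lambda>f. c * vel w f) \<in> tangent (CH w) (sect w u)"
proof -
  obtain V zs where "presented_point (CH w) ((V \<inter> U) \<times> {ys. length ys = length w}) (chart_gens zs (length w)) (sect w u)"
    using sect_points[OF uU] by (rule chart_presentedE)
  from presented_point.tangent_lincomb[OF this vel_tangent vel_tangent, of c 0] show ?thesis by simp
qed

lemma active_Cons: "active x (p # w) p = (\<lambda>z. active x w p (proj z))" "active x (p # w) (other p) = (\<lambda>z. hd (snd z))"
  by (auto simp: fun_eq_iff idx_other)

lemma vel_focal: "(\<lambda>f. c * vel w f) \<in> focal S U x w (sect w u)"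
proof (induction w)
  case Nil
  show ?case using scaled_vel_tangent by simp
next
  case (Cons p w)
  show ?case
    using scaled_vel_tangent[of c "p # w"] Cons
    by (simp add: vel_proj line_in_def vel_active vel_relation(2) hd_sec)
qed

text \<open>
  Focal vectors are determined by their values on the active coordinates; this is the case of
  the multiples of the velocity.
\<close>

lemma focal_vel:
  assumes "v \<in> focal S U x w (sect w u)" "\<And>i. v (active x w i) = c * vel w (active x w i)"
  shows "v = (\<lambda>f. c * vel w f)"
  using assms
proof (induction w arbitrary: v)
  case Nil
  then have v: "v \<in> tangent (CH []) (sect [] u)" by simp
  have "active x [] i = (\<lambda>z. x i (fst z))" for i by (auto simp: fun_eq_iff)
  with Nil show ?case by (intro chart_tangent_ext[OF sect_points[OF uU] v scaled_vel_tangent]) (metis, simp)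
next
  case (Cons p w)
  note q = sect_points[OF uU, of "p # w"] and q' = sect_points[OF uU, of w]
  let ?v = "pushforward (CH w) proj (sect (p # w) u) v"
  have v: "v \<in> tangent (CH (p # w)) (sect (p # w) u)" and l: "?v \<in> line_in x p w (focal S U x w (sect w u)) (sect (p # w) u)"
    using Cons.prems(1) by simp_all
  have app: "?v f = v (\<lambda>z. f (proj z))" if "f \<in> reg (CH w) (sect w u)" for f
    using that by (intro pushforward_apply) simp
  have p: "?v (active x w p) = c * vel w (active x w p)"
  proof -
    have "?v (active x w p) = v (active x (p # w) p)"
      unfolding active_Cons(1) by (rule app[OF active_reg[OF q']])
    also have "\<dots> = c * vel (p # w) (active x (p # w) p)" by (rule Cons.prems(2))
    also have "\<dots> = c * vel w (active x w p)" by (simp only: vel_active act_same)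
    finally show ?thesis .
  qed
  have o: "?v (active x w (other p)) = c * vel w (active x w (other p))"
    using l p by (simp add: line_in_def vel_active vel_relation(2) hd_sec)
  have e: "?v = (\<lambda>f. c * vel w f)"
  proof (rule Cons.IH)
    show "?v \<in> focal S U x w (sect w u)" using l by (simp add: line_in_def)
    show "?v (active x w i) = c * vel w (active x w i)" for i
      using p o idx_other(1)[of i p] by (cases "i = p") auto
  qed
  show ?case
  proof (rule chart_tangent_step[OF q v scaled_vel_tangent])
    show "?v = pushforward (CH w) proj (sect (p # w) u) (\<lambda>f. c * vel (p # w) f)"
      unfolding vel_proj by (rule e)
    show "v (\<lambda>z. hd (snd z)) = c * vel (p # w) (\<lambda>z. hd (snd z))"
      using Cons.prems(2)[of "other p"] unfolding active_Cons .
  qed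
qed

lemma line_in_vel:
  assumes "hd (snd q) = act (p # w) (other p) u"
  shows "line_in x p w (focal S U x w (sect w u)) q = range (\<lambda>c f. c * vel w f)"
proof (intro equalityI subsetI)
  fix v assume "v \<in> line_in x p w (focal S U x w (sect w u)) q"
  then have v: "v \<in> focal S U x w (sect w u)" "v (active x w (other p)) = act (p # w) (other p) u * v (active x w p)"
    by (auto simp: line_in_def assms)
  define c where "c = v (active x w p) / \<nu> (act w p)"
  have p: "v (active x w p) = c * vel w (active x w p)"
    using conjunct2[OF vel_relation(1)[of w p]] by (simp add: c_def vel_active)
  have "v (active x w i) = c * vel w (active x w i)" for i
    using p v(2) idx_other(1)[of i p] by (cases "i = p") (auto simp: vel_active vel_relation(2))
  from focal_vel[OF v(1) this] show "v \<in> range (\<lambda>c f. c * vel w f)" by blast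
next
  fix v assume "v \<in> range (\<lambda>c f. c * vel w f)"
  then obtain c where "v = (\<lambda>f. c * vel w f)" by blast
  then show "v \<in> line_in x p w (focal S U x w (sect w u)) q"
    using vel_focal[of c w] by (simp add: line_in_def assms vel_active vel_relation(2))
qed

text \<open>
  The point \<open>q\<close> represents the tangent line of the curve exactly if its new coordinate has the
  value given by the section.
\<close>

lemma line_in_vel_iff:
  "line_in x p w (focal S U x w (sect w u)) q = range (\<lambda>c f. c * vel w f) \<longleftrightarrow> hd (snd q) = act (p # w) (other p) u"
proof
  assume e: "line_in x p w (focal S U x w (sect w u)) q = range (\<lambda>c f. c * vel w f)"
  have "(\<lambda>f. 1 * vel w f) \<in> range (\<lambda>c f. c * vel w f)" by (rule rangeI)
  then have "(\<lambda>f. 1 * vel w f) \<in> line_in x p w (focal S U x w (sect w u)) q" unfolding e .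
  then have "vel w (active x w (other p)) = hd (snd q) * vel w (active x w p)" by (simp add: line_in_def)
  then have "act (p # w) (other p) u * \<nu> (act w p) = hd (snd q) * \<nu> (act w p)"
    by (simp add: vel_active vel_relation(2)[of w p, symmetric])
  then show "hd (snd q) = act (p # w) (other p) u" using conjunct2[OF vel_relation(1)[of w p]] by simp
qed (rule line_in_vel)

text \<open>
  The tangent space of the curve is spanned by the velocity.  It cannot be larger: \<open>x\<^sub>1 x\<^sub>2 - t\<close> restricts
  it to a line over the patch, and each node binomial determines the component along one more coordinate.
\<close>

lemma tangent_sub_vel:
  assumes t: "x I1 u * x I2 u = t"
  shows "tangent_sub (CH w) (graph w t) (sect w u) = range (\<lambda>c f. c * vel w f)"
proof -
  have t0: "t \<noteq> 0" using u t by (auto simp: U0_def)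
  have sub: "(\<lambda>f. c * vel w f) \<in> tangent_sub (CH w) (graph w t) (sect w u)" for c w
    unfolding tangent_sub_iff[OF sect_points[OF uU]]
  proof (intro conjI ballI impI scaled_vel_tangent)
    fix f assume f: "f \<in> reg (CH w) (sect w u)" and z: "\<forall>\<^sub>F q in near (CH w) (sect w u). q \<in> graph w t \<longrightarrow> f q = 0"
    have "\<nu> (\<lambda>c. f (sect w c)) = 0"
    proof (rule hyperbola_tangent[OF uU t t0 morph_reg[OF sect_morph[OF u] f] _ \<nu>])
      show "\<forall>\<^sub>F c in near S u. x I1 c * x I2 c = t \<longrightarrow> f (sect w c) = 0"
        using morph_eventually[OF sect_morph[OF u] z] eventually_U[OF uU]
        by eventually_elim (auto simp: graph_def)
    qed
    then show "c * vel w f = 0" by (simp add: vel_apply[OF f])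
  qed
  have "\<exists>c. v = (\<lambda>f. c * vel w f)" if "v \<in> tangent_sub (CH w) (graph w t) (sect w u)" for v
    using that
  proof (induction w arbitrary: v)
    case Nil
    note q = sect_points[OF uU, of "[]"]
    obtain V G where "presented_point (CH []) V G (sect [] u)" using q by (rule chart_presentedE)
    then interpret presented_point "CH []" V G "sect [] u" .
    from Nil have v: "v \<in> tangent (CH []) (sect [] u)" and
      van: "\<And>f. f \<in> reg (CH []) (sect [] u) \<Longrightarrow> \<forall>\<^sub>F q in near (CH []) (sect [] u). q \<in> graph [] t \<longrightarrow> f q = 0 \<Longrightarrow> v f = 0"
      unfolding tangent_sub_iff[OF q] by blast+
    let ?X = "\<lambda>i z. x i (fst z)"
    have X: "?X i \<in> reg (CH []) (sect [] u)" for i by (rule x_fst_reg[OF q])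
    have "v (\<lambda>z. ?X I1 z * ?X I2 z - t) = 0"
      by (rule van) (auto intro!: germ_diff germ_mult germ_const X always_eventually simp: graph_def)
    then have e: "x I1 u * v (?X I2) + x I2 u * v (?X I1) = 0"
      using tangent_diff[OF v germ_mult[OF X X] germ_const, of I1 I2 t] tangent_mult[OF v X X, of I1 I2]
      by (simp add: tangent_const[OF v])
    have x0: "x I1 u \<noteq> 0" using u by (simp add: U0_def)
    define c where "c = v (?X I1) / x I1 u"
    have e2: "v (?X I2) = - c * x I2 u" using e x0 by (simp add: c_def field_simps eq_neg_iff_add_eq_0)
    have "v = (\<lambda>f. c * vel [] f)"
    proof (rule chart_tangent_ext[OF q v scaled_vel_tangent])
      show "v (?X i) = c * vel [] (?X i)" for i
        unfolding vel_apply[OF X] using e2 x0 \<nu>(2,3) by (cases i) (auto simp: c_def)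
    qed simp
    then show ?case by blast
  next
    case (Cons p w)
    note q = sect_points[OF uU, of "p # w"] and q' = sect_points[OF uU, of w]
    obtain V G where "presented_point (CH (p # w)) V G (sect (p # w) u)" using q by (rule chart_presentedE)
    then interpret presented_point "CH (p # w)" V G "sect (p # w) u" .
    obtain V' G' where P': "presented_point (CH w) V' G' (sect w u)" using q' by (rule chart_presentedE)
    then have P'': "presented_point (CH w) V' G' (proj (sect (p # w) u))" by simp
    note pm = proj_morph[OF q]
    from Cons.prems have v: "v \<in> tangent (CH (p # w)) (sect (p # w) u)" and
      van: "\<And>f. f \<in> reg (CH (p # w)) (sect (p # w) u) \<Longrightarrow>
        \<forall>\<^sub>F q in near (CH (p # w)) (sect (p # w) u). q \<in> graph (p # w) t \<longrightarrow> f q = 0 \<Longrightarrow> v f = 0"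
      unfolding tangent_sub_iff[OF q] by blast+
    let ?v = "pushforward (CH w) proj (sect (p # w) u) v"
    have app: "?v f = v (\<lambda>z. f (proj z))" if "f \<in> reg (CH w) (sect w u)" for f
      using that by (intro pushforward_apply) simp
    have "?v \<in> tangent_sub (CH w) (graph w t) (sect w u)"
      unfolding tangent_sub_iff[OF q']
    proof (intro conjI ballI impI)
      show "?v \<in> tangent (CH w) (sect w u)"
        using pushforward_tangent[where \<phi> = proj, OF presented_point_axioms P'' pm v] by simp
      fix f assume f: "f \<in> reg (CH w) (sect w u)" and z: "\<forall>\<^sub>F q in near (CH w) (sect w u). q \<in> graph w t \<longrightarrow> f q = 0"
      have f': "f \<in> reg (CH w) (proj (sect (p # w) u))" using f by simp
      have "v (\<lambda>z. f (proj z)) = 0"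
      proof (rule van[OF morph_reg[OF pm f']])
        have "\<forall>\<^sub>F z in near (CH (p # w)) (sect (p # w) u). proj z \<in> graph w t \<longrightarrow> f (proj z) = 0"
          using morph_eventually[OF pm, of "\<lambda>q. q \<in> graph w t \<longrightarrow> f q = 0"] z by simp
        then show "\<forall>\<^sub>F z in near (CH (p # w)) (sect (p # w) u). z \<in> graph (p # w) t \<longrightarrow> f (proj z) = 0"
          by eventually_elim (auto simp: graph_def)
      qed
      then show "?v f = 0" by (simp add: app[OF f])
    qed
    from Cons.IH[OF this] obtain c where c: "?v = (\<lambda>f. c * vel w f)" by blast
    have binom_eq: "binom x (p # w) = (\<lambda>z. of_nat (twig_mult w (other p)) * (hd (snd z) * active x w p (proj z))
      + of_nat (twig_mult w p) * active x w (other p) (proj z))" by (auto simp: fun_eq_iff)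
    have ar: "(\<lambda>z. active x w i (proj z)) \<in> reg (CH (p # w)) (sect (p # w) u)" for i
      using morph_reg[OF pm, of "active x w i"] active_reg[OF q'] by simp
    have kills: "v' (binom x (p # w)) = of_nat (twig_mult w (other p)) * (act (p # w) (other p) u * v' (\<lambda>z. active x w p (proj z))
        + act w p u * v' (\<lambda>z. hd (snd z))) + of_nat (twig_mult w p) * v' (\<lambda>z. active x w (other p) (proj z))"
      if v': "v' \<in> tangent (CH (p # w)) (sect (p # w) u)" for v'
      unfolding binom_eq
      by (simp only: tangent_add[OF v'] tangent_cmult[OF v'] tangent_mult[OF v'] germ_cmult germ_mult hd_reg[OF q] ar hd_sec proj_sect)
        (simp add: act_def)
    have bz: "\<forall>\<^sub>F z in near (CH (p # w)) (sect (p # w) u). z \<in> graph (p # w) t \<longrightarrow> binom x (p # w) z = 0"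
      by (rule always_eventually) (simp add: graph_iff[OF t0])
    have b1: "v (binom x (p # w)) = 0" by (rule van[OF binom_reg[OF q] bz])
    have b2: "c * vel (p # w) (binom x (p # w)) = 0"
      using sub[of c "p # w"] bz binom_reg[OF q] unfolding tangent_sub_iff[OF q] by blast
    have ve: "v (\<lambda>z. active x w i (proj z)) = c * vel (p # w) (\<lambda>z. active x w i (proj z))" for i
      using fun_cong[OF c, of "active x w i"] app[OF active_reg[OF q']]
      by (simp add: vel_apply[OF ar] vel_apply[OF active_reg[OF q']])
    have "of_nat (twig_mult w (other p)) * act w p u * (v (\<lambda>z. hd (snd z)) - c * vel (p # w) (\<lambda>z. hd (snd z)))
        = v (binom x (p # w)) - c * vel (p # w) (binom x (p # w))"
      unfolding kills[OF v] kills[OF scaled_vel_tangent, of c] ve by (simp add: algebra_simps)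
    then have "of_nat (twig_mult w (other p)) * act w p u * (v (\<lambda>z. hd (snd z)) - c * vel (p # w) (\<lambda>z. hd (snd z))) = 0"
      by (simp only: b1 b2 diff_zero)
    then have hd: "v (\<lambda>z. hd (snd z)) = c * vel (p # w) (\<lambda>z. hd (snd z))"
      using twig_mult_pos[of w "other p"] act_nonzero[OF u, of w p] by simp
    have "v = (\<lambda>f. c * vel (p # w) f)"
      by (rule chart_tangent_step[OF q v scaled_vel_tangent _ hd]) (simp only: vel_proj c)
    then show ?case by blast
  qed
  then show ?thesis using sub by blast
qed

lemma vel_line: "linear_dim (range (\<lambda>c f. c * vel w f)) 1"
  unfolding linear_dim_def
proof (intro exI[of _ "[vel w]"] conjI allI impI ballI)
  show "length [vel w] = 1" by simp
  fix cs :: "'k list" assume "length cs = 1"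
  then show "(\<lambda>f. \<Sum>i<1. cs ! i * ([vel w] ! i) f) \<in> range (\<lambda>c f. c * vel w f)" by simp
next
  fix v assume "v \<in> range (\<lambda>c f. c * vel w f)"
  then obtain c where c: "v = (\<lambda>f. c * vel w f)" by blast
  show "\<exists>!cs. length cs = 1 \<and> v = (\<lambda>f. \<Sum>i<1. cs ! i * ([vel w] ! i) f)"
  proof (rule ex1I[of _ "[c]"])
    show "length [c] = 1 \<and> v = (\<lambda>f. \<Sum>i<1. [c] ! i * ([vel w] ! i) f)" by (simp add: c)
    fix cs assume cs: "length cs = 1 \<and> v = (\<lambda>f. \<Sum>i<1. cs ! i * ([vel w] ! i) f)"
    then obtain d where d: "cs = [d]" by (cases cs) auto
    from cs have "c * vel w (active x w I1) = d * vel w (active x w I1)" unfolding c d by (auto dest!: fun_cong[of _ _ "active x w I1"])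
    then show "cs = [c]" using d vel_relation(1)[of w I1] by (simp add: vel_active)
  qed
qed

end

text \<open>
  The closure in the definition of a prolongation adds no points, since the graph is closed in
  the chart.
\<close>

theorem prolonged_fibre_graph:
  assumes t: "t \<noteq> 0" shows "prolonged_fibre S U x t w = graph w t"
proof (induction w)
  case Nil
  show ?case unfolding set_eq_iff graph_iff[OF t] by simp
next
  case (Cons p w)
  let ?A = "{q \<in> points (CH (p # w)). proj q \<in> graph w t \<and>
      linear_dim (tangent_sub (CH w) (graph w t) (proj q)) 1 \<and>
      tangent_sub (CH w) (graph w t) (proj q) = line_in x p w (focal S U x w (proj q)) q}"
  have "?A = graph (p # w) t"
  proof (intro equalityI subsetI)
    fix q assume q: "q \<in> ?A"
    then obtain c where c: "c \<in> U" "x I1 c * x I2 c = t" "proj q = sect w c" by (auto simp: graph_def)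
    then have c0: "c \<in> U0" using t by (auto simp: U0_def)
    obtain \<nu> where \<nu>: "\<nu> \<in> tangent S c" "\<nu> (x I1) = x I1 c" "\<nu> (x I2) = - x I2 c" by (rule tangent_exists[OF c(1)])
    from q have "line_in x p w (focal S U x w (sect w c)) q = range (\<lambda>d f. d * vel c \<nu> w f)"
      using tangent_sub_vel[OF c0 \<nu> c(2), of w] c(3) by simp
    then have h: "hd (snd q) = act (p # w) (other p) c" using line_in_vel_iff[OF c0 \<nu>] by simp
    have "fst q = c" "tl (snd q) = sec w c" using c(3) by (auto simp: proj_def sect_def)
    moreover have "snd q = hd (snd q) # tl (snd q)" using q by (cases "snd q") (auto simp: chart_points)
    ultimately have "q = sect (p # w) c" using h by (cases q) (simp add: sect_def act_def idx_other)
    then show "q \<in> graph (p # w) t" using c unfolding graph_def by blast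
  next
    fix q assume "q \<in> graph (p # w) t"
    then obtain c where c: "c \<in> U" "x I1 c * x I2 c = t" "q = sect (p # w) c" by (auto simp: graph_def)
    then have c0: "c \<in> U0" using t by (auto simp: U0_def)
    obtain \<nu> where \<nu>: "\<nu> \<in> tangent S c" "\<nu> (x I1) = x I1 c" "\<nu> (x I2) = - x I2 c" by (rule tangent_exists[OF c(1)])
    have T: "tangent_sub (CH w) (graph w t) (proj q) = range (\<lambda>d f. d * vel c \<nu> w f)"
      using tangent_sub_vel[OF c0 \<nu> c(2), of w] c(3) by simp
    have "line_in x p w (focal S U x w (proj q)) q = range (\<lambda>d f. d * vel c \<nu> w f)"
      using line_in_vel[OF c0 \<nu>, of q p w] c(3) by (simp add: hd_sec)
    then show "q \<in> ?A" using T vel_line[OF c0 \<nu>] c sect_points[OF c(1)] by (auto simp: graph_def)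
  qed
  then show ?case
    using closure_of_closedin[OF graph_closed[OF t, of "p # w"]] by (simp add: prolong_def Cons)
qed

end

section \<open>Points of the family near the special fibre\<close>

text \<open>
  The variables \<open>0\<close> and \<open>1\<close> stand for \<open>x\<^sub>1\<close> and \<open>x\<^sub>2\<close>, and \<open>n, n + 1, \<dots>\<close> for the new coordinates, the
  most recent one first.  With the new coordinates of \<open>w\<close> starting at \<open>n\<close>, \<open>avar w n i\<close> is the variable
  of the active coordinate \<open>active x w i\<close>.
\<close>

fun avar :: "word \<Rightarrow> nat \<Rightarrow> idx \<Rightarrow> nat" where
  "avar [] n i = (if i = I1 then 0 else 1)"
| "avar (p # w) n i = (if i = p then avar w (Suc n) p else n)"

text \<open>The node binomial of \<open>p # w\<close> as an expression in these variables.\<close>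

definition rel_expr :: "idx \<Rightarrow> word \<Rightarrow> nat \<Rightarrow> 'k::field pexpr" where
  "rel_expr p w n = PAdd (PMul (PConst (of_nat (twig_mult w (other p)))) (PMul (PVar n) (PVar (avar w (Suc n) p))))
     (PMul (PConst (of_nat (twig_mult w p))) (PVar (avar w (Suc n) (other p))))"

text \<open>The values \<open>b\<close> of the variables satisfy the equations of the model surface.\<close>

fun model_vals :: "('k::field \<Rightarrow> 'a::comm_ring_1) \<Rightarrow> (nat \<Rightarrow> 'a) \<Rightarrow> word \<Rightarrow> nat \<Rightarrow> bool" where
  "model_vals h b [] n \<longleftrightarrow> True"
| "model_vals h b (p # w) n \<longleftrightarrow> peval h b (rel_expr p w n) = 0 \<and> model_vals h b w (Suc n)"

lemma model_vals_transfer: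
  "(\<And>e. peval h A e = 0 \<Longrightarrow> kev b e = 0) \<Longrightarrow> model_vals h A w n \<Longrightarrow> model_vals (\<lambda>k. k) b w n"
  by (induction w arbitrary: n) auto

lemma model_vals_point:
  fixes x :: "idx \<Rightarrow> 'u \<Rightarrow> 'k::field"
  assumes "b 0 = x I1 (fst q)" "b 1 = x I2 (fst q)"
  shows "length (snd q) = length w \<Longrightarrow> (\<And>j. j < length w \<Longrightarrow> b (n + j) = snd q ! j) \<Longrightarrow>
    (\<forall>i. b (avar w n i) = active x w i q) \<and> (model_vals (\<lambda>k. k) b w n \<longleftrightarrow> on_model x w q)"
  using assms
proof (induction w arbitrary: n q)
  case Nil
  have "b (avar [] n i) = active x [] i q" for i
    using Nil by (cases i) simp_all
  then show ?case by simp
next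
  case (Cons p w)
  have hd: "b n = hd (snd q)"
    using Cons.prems(1) Cons.prems(2)[of 0] by (cases "snd q") auto
  have tl: "b (Suc n + j) = snd (proj q) ! j" if "j < length w" for j
    using Cons.prems(1) Cons.prems(2)[of "Suc j"] that by (cases "snd q") (auto simp: proj_def)
  have IH: "(\<forall>i. b (avar w (Suc n) i) = active x w i (proj q)) \<and> (model_vals (\<lambda>k. k) b w (Suc n) \<longleftrightarrow> on_model x w (proj q))"
    by (rule Cons.IH[OF _ tl]) (use Cons.prems in \<open>auto simp: proj_def\<close>)
  then show ?case by (simp add: hd rel_expr_def)
qed

lemma (in scalar_embedding) model_vals_lift:
  assumes "A 0 = X I1" "A 1 = X I2" and char0: "\<And>n. n > 0 \<Longrightarrow> of_nat n \<noteq> (0 :: 'k)"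
  shows "X = lift_x h w a \<Longrightarrow> (\<And>j. j < length w \<Longrightarrow> A (n + j) = lift_y h w a ! j) \<Longrightarrow>
    (\<forall>i. A (avar w n i) = a i) \<and> model_vals h A w n"
proof (induction w arbitrary: n a)
  case Nil
  have "A (avar [] n i) = a i" for i
    using assms(1,2) Nil by (cases i) simp_all
  then show ?case by simp
next
  case (Cons p w)
  have hd: "A n = a (other p)" using Cons.prems(2)[of 0] by simp
  have "A (Suc n + j) = lift_y h w (down h p w a) ! j" if "j < length w" for j
    using Cons.prems(2)[of "Suc j"] that by simp
  then have IH: "(\<forall>i. A (avar w (Suc n) i) = down h p w a i) \<and> model_vals h A w (Suc n)"
    using Cons.prems(1) by (intro Cons.IH) auto
  let ?m = "of_nat (twig_mult w p) :: 'k" and ?M = "of_nat (twig_mult w (other p)) :: 'k"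
  have "?m \<noteq> 0" by (rule char0[OF twig_mult_pos])
  then have "?M + ?m * (- (?M / ?m)) = 0" by simp
  then have "h ?M + h ?m * h (- (?M / ?m)) = 0" by (metis h_add h_mult h_0)
  then have "h ?M * (a (other p) * a p) + h ?m * (h (- (?M / ?m)) * (a (other p) * a p)) = 0"
    by (metis distrib_right mult.assoc mult_zero_left)
  then have "peval h A (rel_expr p w n) = 0"
    using IH by (simp add: rel_expr_def hd down_def idx_other)
  moreover have "A (avar (p # w) n i) = a i" for i
    using IH hd idx_other(1)[of i p] by (auto simp: down_def)
  ultimately show ?case using IH by simp
qed

lemma peval_const_term: "fps_nth (peval fps_const A e) 0 = kev (\<lambda>i. fps_nth (A i) 0) e"
  by (induction e) simp_all

text \<open>
  A coordinate patch together with a neighbourhood \<open>T\<close> of \<open>0\<close> in the parameter line.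
\<close>

locale patch_disc = patch S U x org
  for S :: "('u, 'k::{alg_closed_field, field_char_0}) space" and U x org +
  fixes T :: "'k set"
  assumes T_open: "openin (zar affine_line) T" and T_0: "0 \<in> T"
begin

text \<open>The product \<open>\<C>(w) \<times> T\<close>, which contains the family.\<close>

abbreviation FA :: "word \<Rightarrow> (('u \<times> 'k list) \<times> 'k, 'k) space" where
  "FA w \<equiv> prod_space (CH w) (restr_space affine_line T)"

text \<open>The coordinate ring of this product.\<close>

definition fam_gens :: "('u \<Rightarrow> 'k) list \<Rightarrow> nat \<Rightarrow> (('u \<times> 'k list) \<times> 'k \<Rightarrow> 'k) set" where
  "fam_gens zs k = (\<lambda>g z. g (fst z)) ` chart_gens zs k \<union> (\<lambda>h z. h (snd z)) ` {\<lambda>t. t}"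

lemma fam_presented:
  assumes q: "q \<in> points (CH w)" and V: "presented_point S V (set zs) (fst q)"
  shows "presented_point (FA w) (((V \<inter> U) \<times> {ys. length ys = length w}) \<times> (UNIV \<inter> T)) (fam_gens zs (length w)) (q, 0)"
proof -
  note P = chart_presented[OF q V]
  from P have "presents (CH w) ((V \<inter> U) \<times> {ys. length ys = length w}) (chart_gens zs (length w))"
    by (simp add: presented_point_def)
  from presents_product[OF this presents_restr[OF presents_affine_line]]
  show ?thesis using P T_0 by (simp add: presented_point_def fam_gens_def)
qed

lemma fam_presentedE:
  assumes "q \<in> points (CH w)"
  obtains V zs where "presented_point S V (set zs) (fst q)"
    "presented_point (CH w) ((V \<inter> U) \<times> {ys. length ys = length w}) (chart_gens zs (length w)) q"
    "presented_point (FA w) (((V \<inter> U) \<times> {ys. length ys = length w}) \<times> (UNIV \<inter> T)) (fam_gens zs (length w)) (q, 0)"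
proof -
  obtain V zs where V: "presented_point S V (set zs) (fst q)" 
    "presented_point (CH w) ((V \<inter> U) \<times> {ys. length ys = length w}) (chart_gens zs (length w)) q"
    using assms by (rule chart_presentedE)
  with fam_presented[OF assms V(1)] show thesis using that by blast
qed

lemma germ_fam: "q \<in> points (CH w) \<Longrightarrow> germ_algebra (near (FA w) (q, 0)) (reg (FA w) (q, 0)) (q, 0)"
  by (erule fam_presentedE) (unfold presented_point_def, elim conjE, rule presents_germ_algebra)

lemma fam_points: "q \<in> points (CH w) \<Longrightarrow> (q, 0) \<in> points (FA w)"
  by (erule fam_presentedE) (rule presented_point.in_points)

lemma snd_fam_reg: "q \<in> points (CH w) \<Longrightarrow> snd \<in> reg (FA w) (q, 0)"
proof -
  assume "q \<in> points (CH w)"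
  then obtain V zs where "presented_point (FA w) (((V \<inter> U) \<times> {ys. length ys = length w}) \<times> (UNIV \<inter> T)) (fam_gens zs (length w)) (q, 0)"
    by (rule fam_presentedE)
  then interpret presented_point "FA w" "((V \<inter> U) \<times> {ys. length ys = length w}) \<times> (UNIV \<inter> T)" "fam_gens zs (length w)" "(q, 0)" .
  show ?thesis by (intro gen_alg_reg gen_alg_gen) (auto simp: fam_gens_def)
qed

lemma fst_fam_morph:
  assumes q: "q \<in> points (CH w)" shows "morph_at (FA w) (CH w) fst (q, 0)"
proof -
  obtain V zs where V: "presented_point (CH w) ((V \<inter> U) \<times> {ys. length ys = length w}) (chart_gens zs (length w)) q"
    "presented_point (FA w) (((V \<inter> U) \<times> {ys. length ys = length w}) \<times> (UNIV \<inter> T)) (fam_gens zs (length w)) (q, 0)"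
    using q by (rule fam_presentedE)
  interpret F: presented_point "FA w" "((V \<inter> U) \<times> {ys. length ys = length w}) \<times> (UNIV \<inter> T)" "fam_gens zs (length w)" "(q, 0)"
    by (rule V(2))
  from V(1) have V1: "presented_point (CH w) ((V \<inter> U) \<times> {ys. length ys = length w}) (chart_gens zs (length w)) (fst (q, 0 :: 'k))"
    by simp
  show ?thesis
  proof (rule morph_at_criterion[where \<phi> = fst, OF germ_fam[OF q] V1])
    show "\<forall>\<^sub>F z in near (FA w) (q, 0). fst z \<in> (V \<inter> U) \<times> {ys. length ys = length w}"
      using F.eventually_in_chart by eventually_elim auto
    fix h assume "h \<in> chart_gens zs (length w)"
    then show "(\<lambda>z. h (fst z)) \<in> reg (FA w) (q, 0)"
      by (intro F.gen_alg_reg gen_alg_gen) (simp add: fam_gens_def)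
  qed
qed

lemma zero_fibre_morph:
  assumes q: "q \<in> points (CH w)" shows "morph_at (CH w) (FA w) (\<lambda>z. (z, 0)) q"
proof -
  obtain V zs where V: "presented_point (CH w) ((V \<inter> U) \<times> {ys. length ys = length w}) (chart_gens zs (length w)) q"
    "presented_point (FA w) (((V \<inter> U) \<times> {ys. length ys = length w}) \<times> (UNIV \<inter> T)) (fam_gens zs (length w)) (q, 0)"
    using q by (rule fam_presentedE)
  interpret C: presented_point "CH w" "(V \<inter> U) \<times> {ys. length ys = length w}" "chart_gens zs (length w)" q
    by (rule V(1))
  show ?thesis
  proof (rule morph_at_criterion[where \<phi> = "\<lambda>z. (z, 0)", OF germ_chart[OF q] V(2)])
    show "\<forall>\<^sub>F z in near (CH w) q. (z, 0) \<in> ((V \<inter> U) \<times> {ys. length ys = length w}) \<times> (UNIV \<inter> T)"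
      using C.eventually_in_chart by eventually_elim (simp add: T_0)
    fix h assume "h \<in> fam_gens zs (length w)"
    then consider g where "g \<in> chart_gens zs (length w)" "h = (\<lambda>z. g (fst z))" | "h = snd"
      by (auto simp: fam_gens_def)
    then show "(\<lambda>z. h (z, 0)) \<in> reg (CH w) q"
    proof cases
      case 1
      have "g \<in> reg (CH w) q" by (intro C.gen_alg_reg gen_alg_gen 1)
      then show ?thesis by (simp add: 1)
    qed (simp add: C.germ_const)
  qed
qed

text \<open>
  Each point of the model surface with \<open>x\<^sub>1 x\<^sub>2 = 0\<close> is in the closure of the family over \<open>T - {0}\<close>.  The
  formal arc through \<open>q\<close> in the model surface has parameter \<open>t = \<xi>\<^sub>1 \<xi>\<^sub>2 \<noteq> 0\<close>, and a specialization of
  its coordinates and of \<open>t\<close> is a point of the family near \<open>(q, 0)\<close>.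
\<close>

theorem family_dense:
  assumes q: "q \<in> points (CH w)" and mod: "on_model x w q" and t0: "x I1 (fst q) * x I2 (fst q) = 0"
    and P: "eventually P (near (FA w) (q, 0))"
  obtains q' t where "t \<noteq> 0" "P (q', t)" "q' \<in> graph w t"
proof -
  obtain V zs where V: "presented_point S V (set zs) (fst q)"
    "presented_point (FA w) (((V \<inter> U) \<times> {ys. length ys = length w}) \<times> (UNIV \<inter> T)) (fam_gens zs (length w)) (q, 0)"
    using q by (rule fam_presentedE)
  define u k where "u = fst q" and "k = length w"
  have uU: "u \<in> U" and len: "length (snd q) = k" using q by (auto simp: chart_points u_def k_def)
  interpret u: presented_point S V "set zs" u using V(1) by (simp add: u_def)
  interpret F: presented_point "FA w" "((V \<inter> U) \<times> {ys. length ys = k}) \<times> (UNIV \<inter> T)" "fam_gens zs k" "(q, 0)"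
    using V(2) by (simp add: k_def)
  define fs where "fs = [x I1, x I2] @ zs"
  define r where "r = length fs"
  have r2: "2 \<le> r" by (simp add: r_def fs_def)
  have f01: "fs ! 0 = x I1" "fs ! 1 = x I2" by (simp_all add: fs_def)
  \<comment> \<open>the coordinates of a point \<open>z\<close> of the product: the functions \<open>fs\<close> on the surface, the new coordinates, and \<open>t\<close>\<close>
  define val where "val z i = (if i < r then (fs ! i) (fst (fst z)) else if i < r + k then snd (fst z) ! (i - r)
      else if i = r + k then snd z else 0)" for z :: "('u \<times> 'k list) \<times> 'k" and i
  have expr: "\<exists>e. f = (\<lambda>z. kev (val z) e)" if "f \<in> gen_alg (fam_gens zs k)" for f
    using that
  proof (induction f rule: gen_alg.induct)
    case (gen_alg_const c)
    then show ?case by (intro exI[of _ "PConst c"]) simp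
  next
    case (gen_alg_gen g)
    then consider m where "m < length zs" "g = (\<lambda>z. (zs ! m) (fst (fst z)))" | j where "j < k" "g = (\<lambda>z. snd (fst z) ! j)"
      | "g = (\<lambda>z. snd z)"
      unfolding fam_gens_def chart_gens_def by (auto simp: in_set_conv_nth)
    then show ?case
    proof cases
      case 1
      then show ?thesis by (intro exI[of _ "PVar (m + 2)"]) (simp add: val_def r_def fs_def fun_eq_iff)
    next
      case 2
      then show ?thesis by (intro exI[of _ "PVar (r + j)"]) (simp add: val_def fun_eq_iff)
    next
      case 3
      then show ?thesis by (intro exI[of _ "PVar (r + k)"]) (simp add: val_def fun_eq_iff)
    qed
  next
    case (gen_alg_add f g)
    then obtain e e' where "f = (\<lambda>z. kev (val z) e)" "g = (\<lambda>z. kev (val z) e')" by blast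
    then show ?case by (intro exI[of _ "PAdd e e'"]) simp
  next
    case (gen_alg_mult f g)
    then obtain e e' where "f = (\<lambda>z. kev (val z) e)" "g = (\<lambda>z. kev (val z) e')" by blast
    then show ?case by (intro exI[of _ "PMul e e'"]) simp
  qed
  obtain Q where Q: "Q \<in> gen_alg (fam_gens zs k)" "Q (q, 0) \<noteq> 0"
    "\<And>z. z \<in> ((V \<inter> U) \<times> {ys. length ys = k}) \<times> (UNIV \<inter> T) \<Longrightarrow> Q z \<noteq> 0 \<Longrightarrow> P z"
    by (rule presents_nearE[OF F.presented F.in_chart P]) blast
  obtain e where e: "Q = (\<lambda>z. kev (val z) e)" using expr[OF Q(1)] by blast
  obtain R where R: "R \<in> gen_alg {\<lambda>t. t}" "R 0 \<noteq> (0 :: 'k)" "{t \<in> UNIV. R t \<noteq> 0} \<subseteq> T"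
    by (rule presents_nbhd[OF presents_affine_line _ T_open T_0]) auto
  from R(1) have "R \<in> gen_alg (set [\<lambda>t. t])" by simp
  then obtain e1 where e1: "R = (\<lambda>t. kev (gen_vals [\<lambda>t. t] t) e1)" by (rule gen_alg_peval)
  define e2 where "e2 = psubst (\<lambda>i. if i = 0 then PVar (r + k) else PConst 0) e1"
  have e2: "kev b e2 = R (b (r + k))" for b
    unfolding e2_def e1 peval_psubst by (rule arg_cong[where f="\<lambda>a. kev a e1"]) (auto simp: gen_vals_def)
  \<comment> \<open>the arc through \<open>q\<close> in the model surface along which both active coordinates move with unit speed\<close>
  define a where "a i = fps_const (active x w i q) + fps_X" for i
  define \<xi> where "\<xi> = lift_x fps_const w a"
  define \<eta> where "\<eta> = lift_y fps_const w a"
  have a0: "(\<lambda>i. fps_nth (a i) 0) = (\<lambda>i. active x w i q)" by (simp add: a_def)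
  have lm: "lift_x (\<lambda>k. k) w (\<lambda>i. active x w i q) = (\<lambda>i. x i (fst q))" "lift_y (\<lambda>k. k) w (\<lambda>i. active x w i q) = snd q"
    using lift_active[OF mod] len by (auto simp: k_def)
  have lh: "fps_nth (lift_x fps_const w a i) 0 = lift_x (\<lambda>k. k) w (\<lambda>i. fps_nth (a i) 0) i \<and>
      map (\<lambda>f. fps_nth f 0) (lift_y fps_const w a) = lift_y (\<lambda>k. k) w (\<lambda>i. fps_nth (a i) 0)" for i
    by (rule lift_hom[where \<theta> = "\<lambda>f. fps_nth f 0"]) simp_all
  have \<xi>0: "fps_nth (\<xi> i) 0 = x i u" for i using lh[of i] unfolding a0 lm \<xi>_def u_def by simp
  have \<eta>0: "map (\<lambda>f. fps_nth f 0) \<eta> = snd q" using lh unfolding a0 lm \<eta>_def by simp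
  have \<eta>len: "length \<eta> = k" by (simp add: \<eta>_def k_def)
  have \<xi>nz: "\<xi> i \<noteq> 0" for i
    unfolding \<xi>_def by (rule lift_x_nonzero) (auto simp: a_def fps_shift_nonzero)
  define A where "A i = (if i < r then arc u \<xi> (fs ! i) else if i < r + k then \<eta> ! (i - r)
      else if i = r + k then \<xi> I1 * \<xi> I2 else 0)" for i
  have zsr: "zs ! l \<in> reg S u" if "l < length zs" for l
    using that by (intro u.gen_alg_reg gen_alg_gen) simp
  have fsr: "fs ! i \<in> reg S u" if "i < length fs" for i
  proof -
    consider "i = 0" | "i = 1" | m where "i = Suc (Suc m)" by (metis One_nat_def nat.exhaust)
    then show ?thesis
      by cases (use that zsr x_reg[OF uU] in \<open>auto simp: fs_def\<close>)
  qed
  have A01: "A 0 = \<xi> I1" "A 1 = \<xi> I2"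
    using r2 arc_x[of u \<xi> I1, OF uU \<xi>0] arc_x[of u \<xi> I2, OF uU \<xi>0] f01 by (auto simp: A_def)
  have Aval: "(\<lambda>i. fps_nth (A i) 0) = val (q, 0)"
  proof
    fix i
    have "fps_nth (\<eta> ! (i - r)) 0 = snd q ! (i - r)" if "r \<le> i" "i < r + k"
      using arg_cong[OF \<eta>0, of "\<lambda>l. l ! (i - r)"] \<eta>len that by simp
    then show "fps_nth (A i) 0 = val (q, 0) i"
      using t0 by (auto simp: A_def val_def arc_nth u_def[symmetric] \<xi>0)
  qed
  define e0 where "e0 = PMul e (PMul (PVar (r + k)) e2)"
  have nz: "peval fps_const A e' \<noteq> 0" if "kev (val (q, 0)) e' \<noteq> 0" for e'
    using that peval_const_term[of A e'] unfolding Aval by auto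
  have "peval fps_const A e0 \<noteq> 0"
    using nz[of e] nz[of e2] Q(2) R(2) \<xi>nz by (simp add: e0_def e e2 A_def val_def)
  moreover have "A i = arc u \<xi> (fs ! i)" if "i < length fs" for i using that by (simp add: A_def r_def)
  moreover have "A i = 0" if "i \<ge> Suc (r + k)" for i using that by (simp add: A_def)
  moreover have "\<forall>\<^sub>F c in near S u. c \<in> V \<inter> U"
    using u.eventually_in_chart eventually_U[OF uU] by eventually_elim simp
  ultimately have "\<exists>c b. c \<in> V \<inter> U \<and> kev b e0 \<noteq> 0 \<and> (\<forall>i<length fs. b i = (fs ! i) c) \<and>
           (\<forall>e. peval fps_const A e = 0 \<longrightarrow> kev b e = 0)"
    by (intro arc_points[OF uU fsr])
  then obtain c b where c: "c \<in> V \<inter> U" "kev b e0 \<noteq> 0" "\<forall>i<length fs. b i = (fs ! i) c"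
    "\<And>e. peval fps_const A e = 0 \<Longrightarrow> kev b e = 0" by blast
  define ys where "ys = map (\<lambda>j. b (r + j)) [0..<k]"
  define t where "t = b (r + k)"
  have b: "b = val ((c, ys), t)"
  proof
    fix i
    have "b i = 0" if "i > r + k" using c(4)[of "PVar i"] that by (simp add: A_def)
    then show "b i = val ((c, ys), t) i"
      using c(3) by (auto simp: val_def ys_def t_def r_def)
  qed
  have nz: "kev b e \<noteq> 0" "t \<noteq> 0" "R t \<noteq> 0" using c(2) by (auto simp: e0_def e2 t_def)
  have "P ((c, ys), t)"
  proof (rule Q(3))
    show "((c, ys), t) \<in> ((V \<inter> U) \<times> {ys. length ys = k}) \<times> (UNIV \<inter> T)" using c(1) R(3) nz(3) by (auto simp: ys_def)
    show "Q ((c, ys), t) \<noteq> 0" using nz(1) by (simp add: e b)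
  qed
  moreover have "(c, ys) \<in> graph w t"
    unfolding graph_iff[OF nz(2)]
  proof (intro conjI)
    show "(c, ys) \<in> points (CH w)" using c(1) by (simp add: chart_points ys_def k_def)
    have "0 < length fs" "1 < length fs" by (simp_all add: fs_def)
    then have b01: "b 0 = x I1 c" "b 1 = x I2 c"
      using c(3)[rule_format, of 0] c(3)[rule_format, of 1] f01 by simp_all
    have "kev b (PAdd (PVar (r + k)) (PMul (PConst (-1)) (PMul (PVar 0) (PVar 1)))) = 0"
      using A01 r2 by (intro c(4)) (simp add: A_def flip: fps_const_neg)
    then show "x I1 (fst (c, ys)) * x I2 (fst (c, ys)) = t" using b01 by (simp add: t_def)
    have "(\<forall>i. A (avar w r i) = a i) \<and> model_vals fps_const A w r"
      by (rule scalar_embedding.model_vals_lift[OF scalar_embedding_fps, where X = \<xi>])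
        (use A01 \<eta>len in \<open>auto simp: \<xi>_def A_def \<eta>_def k_def\<close>)
    then have "model_vals (\<lambda>k. k) b w r" using model_vals_transfer[of fps_const A b w r] c(4) by blast
    moreover have "(\<forall>i. b (avar w r i) = active x w i (c, ys)) \<and> (model_vals (\<lambda>k. k) b w r \<longleftrightarrow> on_model x w (c, ys))"
      by (rule model_vals_point) (use b01 in \<open>auto simp: ys_def k_def\<close>)
    ultimately show "on_model x w (c, ys)" by blast
  qed
  ultimately show thesis using that nz(2) by blast
qed

section \<open>The ideal of the special fibre\<close>

text \<open>
  The definition of the special ideal, with the fibres over \<open>t \<noteq> 0\<close> replaced by their
  description as graphs.
\<close>

lemma special_ideal_iff:
  assumes q: "q \<in> points (CH w)"
  shows "f \<in> special_ideal S U x T w q \<longleftrightarrow> (\<exists>F\<in>reg (FA w) (q, 0).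
     (\<forall>\<^sub>F z in near (FA w) (q, 0). snd z \<noteq> 0 \<longrightarrow> fst z \<in> graph w (snd z) \<longrightarrow> F z = 0) \<and>
     (\<forall>\<^sub>F z in near (CH w) q. f z = F (z, 0)))"
  unfolding special_ideal_def Let_def eventually_near_iff[OF q] eventually_near_iff[OF fam_points[OF q]]
  by (simp add: prolonged_fibre_graph split_paired_all Ball_def cong: conj_cong imp_cong)

lemma special_idealI:
  assumes "q \<in> points (CH w)" "F \<in> reg (FA w) (q, 0)"
    "\<And>z. snd z \<noteq> 0 \<Longrightarrow> fst z \<in> graph w (snd z) \<Longrightarrow> F z = 0" "\<And>z. f z = F (z, 0)"
  shows "f \<in> special_ideal S U x T w q"
  unfolding special_ideal_iff[OF assms(1)]
  by (rule bexI[OF _ assms(2)], intro conjI always_eventually allI impI) (auto intro: assms(3,4))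

text \<open>
  By density, a function on the product that vanishes on the family vanishes at \<open>(q, 0)\<close>.
\<close>

lemma special_ideal_zero:
  assumes q: "q \<in> points (CH w)" and mod: "on_model x w q" and t0: "x I1 (fst q) * x I2 (fst q) = 0"
    and f: "f \<in> special_ideal S U x T w q"
  shows "f q = 0"
proof (rule ccontr)
  assume fq: "f q \<noteq> 0"
  from f obtain F where F: "F \<in> reg (FA w) (q, 0)"
    "\<forall>\<^sub>F z in near (FA w) (q, 0). snd z \<noteq> 0 \<longrightarrow> fst z \<in> graph w (snd z) \<longrightarrow> F z = 0"
    "\<forall>\<^sub>F z in near (CH w) q. f z = F (z, 0)" unfolding special_ideal_iff[OF q] by blast
  have "f q = F (q, 0)" by (rule germ_algebra.at_pt[OF germ_chart[OF q] F(3)])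
  then have "\<forall>\<^sub>F z in near (FA w) (q, 0). F z \<noteq> 0"
    using fq by (intro germ_algebra.germ_nonzero[OF germ_fam[OF q] F(1)]) simp
  with F(2) have "\<forall>\<^sub>F z in near (FA w) (q, 0). \<not> (snd z \<noteq> 0 \<and> fst z \<in> graph w (snd z))"
    by eventually_elim auto
  then show False by (rule family_dense[OF q mod t0]) auto
qed

lemma special_ideal_cong:
  assumes q: "q \<in> points (CH w)" and f: "f \<in> special_ideal S U x T w q" and e: "\<forall>\<^sub>F z in near (CH w) q. g z = f z"
  shows "g \<in> special_ideal S U x T w q"
proof -
  from f obtain F where F: "F \<in> reg (FA w) (q, 0)"
    "\<forall>\<^sub>F z in near (FA w) (q, 0). snd z \<noteq> 0 \<longrightarrow> fst z \<in> graph w (snd z) \<longrightarrow> F z = 0"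
    "\<forall>\<^sub>F z in near (CH w) q. f z = F (z, 0)" unfolding special_ideal_iff[OF q] by blast
  have "\<forall>\<^sub>F z in near (CH w) q. g z = F (z, 0)" using F(3) e by eventually_elim simp
  then show ?thesis unfolding special_ideal_iff[OF q] using F(1,2) by (intro bexI[of _ F] conjI)
qed

lemma special_ideal_add:
  assumes q: "q \<in> points (CH w)" and f: "f \<in> special_ideal S U x T w q" and g: "g \<in> special_ideal S U x T w q"
  shows "(\<lambda>z. f z + g z) \<in> special_ideal S U x T w q"
proof -
  from f obtain F where F: "F \<in> reg (FA w) (q, 0)"
    "\<forall>\<^sub>F z in near (FA w) (q, 0). snd z \<noteq> 0 \<longrightarrow> fst z \<in> graph w (snd z) \<longrightarrow> F z = 0"
    "\<forall>\<^sub>F z in near (CH w) q. f z = F (z, 0)" unfolding special_ideal_iff[OF q] by blast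
  from g obtain G where G: "G \<in> reg (FA w) (q, 0)"
    "\<forall>\<^sub>F z in near (FA w) (q, 0). snd z \<noteq> 0 \<longrightarrow> fst z \<in> graph w (snd z) \<longrightarrow> G z = 0"
    "\<forall>\<^sub>F z in near (CH w) q. g z = G (z, 0)" unfolding special_ideal_iff[OF q] by blast
  show ?thesis
    unfolding special_ideal_iff[OF q]
  proof (intro bexI[of _ "\<lambda>z. F z + G z"] conjI)
    show "\<forall>\<^sub>F z in near (FA w) (q, 0). snd z \<noteq> 0 \<longrightarrow> fst z \<in> graph w (snd z) \<longrightarrow> F z + G z = 0"
      using F(2) G(2) by eventually_elim simp
    show "\<forall>\<^sub>F z in near (CH w) q. f z + g z = F (z, 0) + G (z, 0)"
      using F(3) G(3) by eventually_elim simp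
    show "(\<lambda>z. F z + G z) \<in> reg (FA w) (q, 0)" by (rule germ_algebra.germ_add[OF germ_fam[OF q] F(1) G(1)])
  qed
qed

lemma special_ideal_mult:
  assumes q: "q \<in> points (CH w)" and f: "f \<in> special_ideal S U x T w q" and g: "g \<in> reg (CH w) q"
  shows "(\<lambda>z. g z * f z) \<in> special_ideal S U x T w q"
proof -
  from f obtain F where F: "F \<in> reg (FA w) (q, 0)"
    "\<forall>\<^sub>F z in near (FA w) (q, 0). snd z \<noteq> 0 \<longrightarrow> fst z \<in> graph w (snd z) \<longrightarrow> F z = 0"
    "\<forall>\<^sub>F z in near (CH w) q. f z = F (z, 0)" unfolding special_ideal_iff[OF q] by blast
  show ?thesis
    unfolding special_ideal_iff[OF q]
  proof (intro bexI[of _ "\<lambda>z. g (fst z) * F z"] conjI)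
    show "\<forall>\<^sub>F z in near (FA w) (q, 0). snd z \<noteq> 0 \<longrightarrow> fst z \<in> graph w (snd z) \<longrightarrow> g (fst z) * F z = 0"
      using F(2) by eventually_elim simp
    show "\<forall>\<^sub>F z in near (CH w) q. g z * f z = g (fst (z, 0)) * F (z, 0)"
      using F(3) by eventually_elim simp
    have "(\<lambda>z. g (fst z)) \<in> reg (FA w) (q, 0)" by (rule morph_reg[OF fst_fam_morph[OF q]]) (simp add: g)
    then show "(\<lambda>z. g (fst z) * F z) \<in> reg (FA w) (q, 0)" using F(1) by (rule germ_algebra.germ_mult[OF germ_fam[OF q]])
  qed
qed

text \<open>
  The node binomials that define the model surface, as functions on the chart of \<open>w\<close>.
\<close>

fun model_eqs :: "word \<Rightarrow> ('u \<times> 'k list \<Rightarrow> 'k) set" where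
  "model_eqs [] = {}"
| "model_eqs (p # w) = insert (binom x (p # w)) ((\<lambda>b z. b (proj z)) ` model_eqs w)"

lemma on_model_iff: "on_model x w q \<longleftrightarrow> (\<forall>b\<in>model_eqs w. b q = 0)"
  by (induction w arbitrary: q) auto

lemma model_eqs_reg: "b \<in> model_eqs w \<Longrightarrow> q \<in> points (CH w) \<Longrightarrow> b \<in> reg (CH w) q"
proof (induction w arbitrary: b q)
  case (Cons p w)
  from Cons.prems(1) consider "b = binom x (p # w)" | b' where "b' \<in> model_eqs w" "b = (\<lambda>z. b' (proj z))" by auto
  then show ?case
  proof cases
    case 1
    show ?thesis unfolding 1 by (intro binom_reg Cons.prems(2))
  next
    case 2
    then show ?thesis
      using morph_reg[OF proj_morph[OF Cons.prems(2)] Cons.IH[OF 2(1) proj_points[OF Cons.prems(2)]]] by simp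
  qed
qed simp

text \<open>
  The function \<open>x\<^sub>1 x\<^sub>2\<close>, which is the parameter \<open>t\<close> on the family.
\<close>

definition tfun :: "'u \<times> 'k list \<Rightarrow> 'k" where
  "tfun z = x I1 (fst z) * x I2 (fst z)"

lemma tfun_reg: "q \<in> points (CH w) \<Longrightarrow> tfun \<in> reg (CH w) q"
  unfolding tfun_def[abs_def] by (intro germ_algebra.germ_mult[OF germ_chart] x_fst_reg)

lemma special_gens:
  assumes q: "q \<in> points (CH w)" and b: "b \<in> insert tfun (model_eqs w)"
  shows "b \<in> special_ideal S U x T w q"
proof (cases "b \<in> model_eqs w")
  case True
  show ?thesis
  proof (rule special_idealI[OF q, of "\<lambda>z. b (fst z)"])
    show "(\<lambda>z. b (fst z)) \<in> reg (FA w) (q, 0)"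
      by (rule morph_reg[OF fst_fam_morph[OF q]]) (simp add: model_eqs_reg[OF True q])
    fix z :: "('u \<times> 'k list) \<times> 'k" assume "snd z \<noteq> 0" "fst z \<in> graph w (snd z)"
    then show "b (fst z) = 0" using True by (simp add: graph_iff on_model_iff)
  qed simp
next
  case False
  then have b: "b = tfun" using assms by simp
  show ?thesis
  proof (rule special_idealI[OF q, of "\<lambda>z. tfun (fst z) - snd z"])
    have "(\<lambda>z. tfun (fst z)) \<in> reg (FA w) (q, 0)"
      by (rule morph_reg[OF fst_fam_morph[OF q]]) (simp add: tfun_reg[OF q])
    then show "(\<lambda>z. tfun (fst z) - snd z) \<in> reg (FA w) (q, 0)"
      using snd_fam_reg[OF q] by (rule germ_algebra.germ_diff[OF germ_fam[OF q]])
    fix z :: "('u \<times> 'k list) \<times> 'k" assume "snd z \<noteq> 0" "fst z \<in> graph w (snd z)"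
    then show "tfun (fst z) - snd z = 0" by (simp add: graph_iff tfun_def)
  qed (simp add: b)
qed

lemma zero_special: "q \<in> points (CH w) \<Longrightarrow> (\<lambda>_. 0) \<in> special_ideal S U x T w q"
  by (rule special_idealI[of _ _ "\<lambda>_. 0"]) (auto intro: germ_algebra.germ_const[OF germ_fam])

lemma chart_eventually_reg: "q \<in> points (CH w) \<Longrightarrow> f \<in> reg (CH w) q \<Longrightarrow> \<forall>\<^sub>F z in near (CH w) q. f \<in> reg (CH w) z"
  by (erule chart_presentedE) (erule presented_point.eventually_reg)

lemma lideal_special_near:
  assumes q: "q \<in> points (CH w)" and f: "f \<in> lideal (CH w) q (insert tfun (model_eqs w))"
  shows "\<forall>\<^sub>F z in near (CH w) q. f \<in> special_ideal S U x T w z"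
proof -
  interpret germ_algebra "near (CH w) q" "reg (CH w) q" q by (rule germ_chart[OF q])
  show ?thesis
    using f
  proof (induction f rule: germ_ideal.induct)
    case (germ_ideal_0 f)
    show ?case
      using eventually_near_near[OF q germ_ideal_0] eventually_points[OF q]
      by eventually_elim (rule special_ideal_cong[OF _ zero_special])
  next
    case (germ_ideal_step f a b f')
    show ?case
      using eventually_near_near[OF q germ_ideal_step(4)] eventually_points[OF q] germ_ideal_step(5)
        chart_eventually_reg[OF q germ_ideal_step(2)]
    proof eventually_elim
      case (elim z)
      show ?case
        by (rule special_ideal_cong[OF elim(2) special_ideal_add[OF elim(2) elim(3) special_ideal_mult[OF elim(2) special_gens[OF elim(2) germ_ideal_step(3)] elim(4)]] elim(1)])
    qed
  qed
qed

text \<open>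
  The axis of the model surface on which the active coordinate \<open>active x w i\<close> vanishes.
\<close>

definition axis :: "word \<Rightarrow> idx \<Rightarrow> ('u \<times> 'k list) set" where
  "axis w i = {q \<in> points (CH w). on_model x w q \<and> active x w i q = 0}"

lemma tfun_monomial:
  obtains C where "C \<noteq> 0" "\<And>q. q \<in> points (CH w) \<Longrightarrow> on_model x w q \<Longrightarrow>
    tfun q = C * (active x w i q ^ twig_mult w i * active x w (other i) q ^ twig_mult w (other i))"
proof -
  obtain C :: 'k where C: "C \<noteq> 0" "\<And>a. lift_x (\<lambda>k. k) w a I1 * lift_x (\<lambda>k. k) w a (other I1)
      = C * (a i ^ twig_mult w i * a (other i) ^ twig_mult w (other i))"
    using lift_x_monomial[of w I1 i] by blast
  show thesis
  proof (rule that[OF C(1)])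
    fix q assume "q \<in> points (CH w)" "on_model x w q"
    then have "lift_x (\<lambda>k. k) w (\<lambda>i. active x w i q) = (\<lambda>i. x i (fst q))"
      using lift_active[of x w q] by (auto simp: chart_points)
    then show "tfun q = C * (active x w i q ^ twig_mult w i * active x w (other i) q ^ twig_mult w (other i))"
      using C(2)[of "\<lambda>i. active x w i q"] by (simp add: tfun_def)
  qed
qed

lemma axis_tfun: "q \<in> axis w i \<Longrightarrow> tfun q = 0"
proof -
  assume q: "q \<in> axis w i"
  obtain C where "\<And>q. q \<in> points (CH w) \<Longrightarrow> on_model x w q \<Longrightarrow>
    tfun q = C * (active x w i q ^ twig_mult w i * active x w (other i) q ^ twig_mult w (other i))"
    using tfun_monomial[of w i] by blast
  then show ?thesis using q twig_mult_pos[of w i] by (simp add: axis_def)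
qed

theorem special_support_axes: "special_support S U x T w = axis w I1 \<union> axis w I2"
proof (intro equalityI subsetI)
  fix q assume "q \<in> special_support S U x T w"
  then have q: "q \<in> points (CH w)" "\<And>f. f \<in> special_ideal S U x T w q \<Longrightarrow> f q = 0" by (auto simp: special_support_def)
  have "on_model x w q" unfolding on_model_iff using q(2)[OF special_gens[OF q(1)]] by blast
  moreover have "tfun q = 0" by (rule q(2)[OF special_gens[OF q(1)]]) simp
  moreover obtain C where "C \<noteq> 0" "\<And>q. q \<in> points (CH w) \<Longrightarrow> on_model x w q \<Longrightarrow>
    tfun q = C * (active x w I1 q ^ twig_mult w I1 * active x w (other I1) q ^ twig_mult w (other I1))"
    using tfun_monomial[of w I1] by blast
  ultimately show "q \<in> axis w I1 \<union> axis w I2" using q(1) by (auto simp: axis_def)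
next
  fix q assume "q \<in> axis w I1 \<union> axis w I2"
  then obtain i where "q \<in> axis w i" by blast
  then have "q \<in> points (CH w)" "on_model x w q" "tfun q = 0" using axis_tfun[of q w i] by (simp_all add: axis_def)
  then show "q \<in> special_support S U x T w"
    unfolding special_support_def using special_ideal_zero by (auto simp: tfun_def)
qed

text \<open>
  Suppose that \<open>a\<^sub>i\<^sup>n\<close> is the restriction to \<open>t = 0\<close> of a function \<open>F\<close> vanishing on the family, so that
  \<open>F = a\<^sub>i\<^sup>n + t G\<close>.  On the family, \<open>t\<close> is divisible by \<open>a\<^sub>i\<^sup>n\<^sup>+\<^sup>1\<close>, and dividing \<open>F = 0\<close> by \<open>a\<^sub>i\<^sup>n \<noteq> 0\<close> one obtains
  \<open>H = 0\<close> for a function \<open>H\<close> that is \<open>1\<close> at \<open>(q, 0)\<close>.  This contradicts density.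
\<close>

theorem active_power_not_special:
  assumes q: "q \<in> axis w i" and n: "n < twig_mult w i"
  shows "(\<lambda>z. active x w i z ^ n) \<notin> special_ideal S U x T w q"
proof
  from q have qp: "q \<in> points (CH w)" and mod: "on_model x w q" and aq: "active x w i q = 0" by (auto simp: axis_def)
  have t0: "x I1 (fst q) * x I2 (fst q) = 0" using axis_tfun[OF q] by (simp add: tfun_def)
  assume "(\<lambda>z. active x w i z ^ n) \<in> special_ideal S U x T w q"
  then obtain F where F: "F \<in> reg (FA w) (q, 0)"
    "\<forall>\<^sub>F z in near (FA w) (q, 0). snd z \<noteq> 0 \<longrightarrow> fst z \<in> graph w (snd z) \<longrightarrow> F z = 0"
    "\<forall>\<^sub>F z in near (CH w) q. active x w i z ^ n = F (z, 0)" unfolding special_ideal_iff[OF qp] by blast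
  obtain V zs where V: "presented_point (FA w) (((V \<inter> U) \<times> {ys. length ys = length w}) \<times> (UNIV \<inter> T)) (fam_gens zs (length w)) (q, 0)"
    using qp by (rule fam_presentedE)
  interpret presented_point "FA w" "((V \<inter> U) \<times> {ys. length ys = length w}) \<times> (UNIV \<inter> T)" "fam_gens zs (length w)" "(q, 0)"
    by (rule V)
  note fm = fst_fam_morph[OF qp]
  have zm: "morph_at (CH w) (FA w) (\<lambda>z. (z, 0)) (fst (q, 0 :: 'k))" using zero_fibre_morph[OF qp] by simp
  note sl = morph_comp[OF fm zm]
  have "(\<lambda>z. F z - F (fst z, 0)) \<in> germ_ideal {snd}"
  proof (rule first_order[where \<phi> = "\<lambda>z. (fst z, 0)", OF _ _ _ _ F(1)])
    show "(fst (q, 0), 0) = (q, 0)" by simp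
    show "(\<lambda>z. f (fst z, 0)) \<in> reg (FA w) (q, 0)" if "f \<in> reg (FA w) (q, 0)" for f
      using morph_reg[OF sl, of f] that by simp
    show "\<forall>\<^sub>F z in near (FA w) (q, 0). (fst z, 0) \<in> ((V \<inter> U) \<times> {ys. length ys = length w}) \<times> (UNIV \<inter> T)"
      using eventually_in_chart by eventually_elim (use T_0 in auto)
    fix g assume "g \<in> fam_gens zs (length w)"
    then consider h where "g = (\<lambda>z. h (fst z))" | "g = snd" by (auto simp: fam_gens_def)
    then show "(\<lambda>z. g z - g (fst z, 0)) \<in> germ_ideal {snd}"
    proof cases
      case 1
      then show ?thesis by (intro germ_ideal_0) simp
    next
      case 2
      then show ?thesis using germ_ideal_base[of snd "{snd}"] by simp
    qed
  qed
  then obtain G where G: "G \<in> reg (FA w) (q, 0)" "\<forall>\<^sub>F z in near (FA w) (q, 0). F z - F (fst z, 0) = G z * snd z"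
    by (rule germ_ideal_single)
  have Fe: "\<forall>\<^sub>F z in near (FA w) (q, 0). active x w i (fst z) ^ n = F (fst z, 0)"
    using morph_eventually[OF fm, of "\<lambda>z. active x w i z ^ n = F (z, 0)"] F(3) by simp
  obtain C where C: "\<And>q. q \<in> points (CH w) \<Longrightarrow> on_model x w q \<Longrightarrow>
    tfun q = C * (active x w i q ^ twig_mult w i * active x w (other i) q ^ twig_mult w (other i))"
    using tfun_monomial[of w i] by blast
  define d where "d = twig_mult w i - n"
  have d: "d > 0" "twig_mult w i = n + d" using n by (auto simp: d_def)
  have ar: "(\<lambda>z. active x w j (fst z)) \<in> reg (FA w) (q, 0)" for j
    by (rule morph_reg[OF fm]) (simp add: active_reg[OF qp])
  \<comment> \<open>\<open>F = a\<^sub>i\<^sup>n H\<close> on the family\<close>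
  define H where "H z = 1 + C * (active x w i (fst z) ^ d * active x w (other i) (fst z) ^ twig_mult w (other i)) * G z" for z
  have "H \<in> reg (FA w) (q, 0)"
    unfolding H_def[abs_def] by (intro germ_add germ_mult germ_cmult germ_const germ_power ar G)
  moreover have "H (q, 0) = 1" using aq d by (simp add: H_def)
  ultimately have "\<forall>\<^sub>F z in near (FA w) (q, 0). H z \<noteq> 0" by (intro germ_nonzero) simp_all
  then have "\<forall>\<^sub>F z in near (FA w) (q, 0). \<not> (snd z \<noteq> 0 \<and> fst z \<in> graph w (snd z))"
    using F(2) G(2) Fe
  proof eventually_elim
    case (elim z)
    show ?case
    proof
      assume z: "snd z \<noteq> 0 \<and> fst z \<in> graph w (snd z)"
      then have gz: "fst z \<in> points (CH w)" "tfun (fst z) = snd z" "on_model x w (fst z)"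
        by (auto simp: graph_iff tfun_def)
      have tz: "snd z = C * (active x w i (fst z) ^ (n + d) * active x w (other i) (fst z) ^ twig_mult w (other i))"
        using C[OF gz(1,3)] gz(2) d(2) by simp
      then have "active x w i (fst z) \<noteq> 0" using z d by auto
      moreover have "active x w i (fst z) ^ n * H z = active x w i (fst z) ^ n + snd z * G z"
        unfolding tz H_def by (simp add: algebra_simps power_add)
      moreover have "active x w i (fst z) ^ n + snd z * G z = F z"
        using elim(3,4) by (simp add: algebra_simps)
      ultimately show False using elim(1,2) z by simp
    qed
  qed
  then show False by (rule family_dense[OF qp mod t0]) auto
qed

end

section \<open>The twigs\<close>

lemma irreducible_image:
  assumes f: "continuous_map \<sigma> \<tau> f" and Z: "irreducible_set \<sigma> Z"
  shows "irreducible_set \<tau> (f ` Z)"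
  unfolding irreducible_set_def
proof (intro conjI allI impI)
  have Zt: "Z \<subseteq> topspace \<sigma>" "Z \<noteq> {}" using Z by (auto simp: irreducible_set_def)
  show "f ` Z \<noteq> {}" using Zt by simp
  show "f ` Z \<subseteq> topspace \<tau>" using continuous_map_image_subset_topspace[OF f] Zt by blast
  fix A B assume A: "closedin \<tau> A" and B: "closedin \<tau> B" and AB: "f ` Z \<subseteq> A \<union> B"
  let ?A = "{z \<in> topspace \<sigma>. f z \<in> A}" and ?B = "{z \<in> topspace \<sigma>. f z \<in> B}"
  have c: "closedin \<sigma> ?A" "closedin \<sigma> ?B"
    using closedin_continuous_map_preimage[OF f A] closedin_continuous_map_preimage[OF f B] by auto
  have "Z \<subseteq> ?A \<union> ?B" using Zt AB by auto
  then have "Z \<subseteq> ?A \<or> Z \<subseteq> ?B" using Z c unfolding irreducible_set_def by blast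
  then show "f ` Z \<subseteq> A \<or> f ` Z \<subseteq> B" by blast
qed

lemma irreducible_open_meet:
  assumes Z: "irreducible_set \<tau> Z" and W: "openin \<tau> W" "W \<inter> Z \<noteq> {}" and W': "openin \<tau> W'" "W' \<inter> Z \<noteq> {}"
  shows "W \<inter> W' \<inter> Z \<noteq> {}"
proof
  assume e: "W \<inter> W' \<inter> Z = {}"
  have Zt: "Z \<subseteq> topspace \<tau>" using Z by (auto simp: irreducible_set_def)
  have "closedin \<tau> (topspace \<tau> - W)" "closedin \<tau> (topspace \<tau> - W')" using W W' by auto
  moreover have "Z \<subseteq> (topspace \<tau> - W) \<union> (topspace \<tau> - W')" using Zt e by blast
  ultimately have "Z \<subseteq> topspace \<tau> - W \<or> Z \<subseteq> topspace \<tau> - W'" using Z unfolding irreducible_set_def by blast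
  then show False using W W' by blast
qed

lemma irreducible_components_two:
  assumes "irreducible_set \<tau> Z1" "closedin \<tau> Z1" "irreducible_set \<tau> Z2" "closedin \<tau> Z2"
    and n: "\<not> Z1 \<subseteq> Z2" "\<not> Z2 \<subseteq> Z1"
  shows "irreducible_components \<tau> (Z1 \<union> Z2) = {Z1, Z2}"
proof -
  have sub: "Z' \<subseteq> Z1 \<or> Z' \<subseteq> Z2" if "irreducible_set \<tau> Z'" "Z' \<subseteq> Z1 \<union> Z2" for Z'
    using that assms(2,4) unfolding irreducible_set_def by blast
  show ?thesis
  proof (intro equalityI subsetI)
    fix Z assume "Z \<in> irreducible_components \<tau> (Z1 \<union> Z2)"
    then have Z: "irreducible_set \<tau> Z" "Z \<subseteq> Z1 \<union> Z2"
      "\<And>Z'. irreducible_set \<tau> Z' \<Longrightarrow> closedin \<tau> Z' \<Longrightarrow> Z' \<subseteq> Z1 \<union> Z2 \<Longrightarrow> Z \<subseteq> Z' \<Longrightarrow> Z' = Z"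
      unfolding irreducible_components_def by blast+
    from sub[OF Z(1,2)] show "Z \<in> {Z1, Z2}" using Z(3)[OF assms(1,2)] Z(3)[OF assms(3,4)] by blast
  next
    fix Z assume "Z \<in> {Z1, Z2}"
    then show "Z \<in> irreducible_components \<tau> (Z1 \<union> Z2)"
      unfolding irreducible_components_def using assms(1-4) sub n by blast
  qed
qed

lemma affine_line_poly: "f \<in> gen_alg {\<lambda>t. t} \<Longrightarrow> \<exists>p. f = poly p"
proof (induction f rule: gen_alg.induct)
  case (gen_alg_const c)
  show ?case by (intro exI[of _ "[:c:]"]) auto
next
  case (gen_alg_gen g)
  then show ?case by (intro exI[of _ "[:0, 1:]"]) auto
next
  case (gen_alg_add f g)
  then obtain p q where "f = poly p" "g = poly q" by blast
  then show ?case by (intro exI[of _ "p + q"]) auto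
next
  case (gen_alg_mult f g)
  then obtain p q where "f = poly p" "g = poly q" by blast
  then show ?case by (intro exI[of _ "p * q"]) auto
qed

lemma affine_line_irreducible: "irreducible_set (zar (affine_line :: ('k::field_char_0, 'k) space)) UNIV"
  unfolding irreducible_set_def
proof (intro conjI allI impI)
  show "(UNIV :: 'k set) \<subseteq> points affine_line" by (simp add: points_affine_line)
  fix A B :: "'k set" assume A: "closedin (zar affine_line) A" and B: "closedin (zar affine_line) B" and AB: "UNIV \<subseteq> A \<union> B"
  have key: "\<exists>p. p \<noteq> 0 \<and> (\<forall>t. poly p t \<noteq> 0 \<longrightarrow> t \<notin> C)" if C: "closedin (zar affine_line) C" "\<not> UNIV \<subseteq> C" for C :: "'k set"
  proof -
    obtain a where a: "a \<notin> C" using C by blast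
    have "openin (zar affine_line) (points affine_line - C)" using C(1) by (simp add: closedin_def)
    moreover have "a \<in> points affine_line - C" using a by (simp add: points_affine_line)
    ultimately obtain Q where Q: "Q \<in> gen_alg {\<lambda>t. t}" "Q a \<noteq> 0" "{t \<in> UNIV. Q t \<noteq> 0} \<subseteq> points affine_line - C"
      by (rule presents_nbhd[OF presents_affine_line UNIV_I]) blast
    obtain p where "Q = poly p" using affine_line_poly[OF Q(1)] by blast
    then show ?thesis using Q(2,3) by (intro exI[of _ p]) auto
  qed
  show "UNIV \<subseteq> A \<or> UNIV \<subseteq> B"
  proof (rule ccontr)
    assume "\<not> (UNIV \<subseteq> A \<or> UNIV \<subseteq> B)"
    then obtain p q where p: "p \<noteq> 0" "\<forall>t. poly p t \<noteq> 0 \<longrightarrow> t \<notin> A" and q: "q \<noteq> 0" "\<forall>t. poly q t \<noteq> 0 \<longrightarrow> t \<notin> B"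
      using key[OF A] key[OF B] by blast
    have "p * q \<noteq> 0" using p q by simp
    then have "finite {t. poly (p * q) t = 0}" by (rule poly_roots_finite)
    then have "\<exists>t. t \<notin> {t. poly (p * q) t = 0}" by (rule ex_new_if_finite[OF infinite_UNIV_char_0])
    then obtain t where "poly p t \<noteq> 0" "poly q t \<noteq> 0" by auto
    then show False using p(2) q(2) AB by blast
  qed
qed simp

context patch_disc
begin

lemma node_points: "node org w \<in> points (CH w)"
  using org_U by (simp add: node_def chart_points)

lemma proj_node: "proj (node org (p # w)) = node org w"
  by (simp add: node_def proj_def)

lemma active_node: "active x w i (node org w) = 0"
proof (induction w arbitrary: i)
  case Nil
  then show ?case by (simp add: node_def org_zero)
next
  case (Cons p w)
  have "hd (snd (node org (p # w))) = (0 :: 'k)" by (simp add: node_def)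
  then show ?case using Cons by (simp add: proj_node)
qed

lemma on_model_node: "on_model x w (node org w)"
proof (induction w)
  case (Cons p w)
  have "hd (snd (node org (p # w))) = (0 :: 'k)" by (simp add: node_def)
  then show ?case using Cons by (simp add: proj_node active_node)
qed simp

lemma node_axis: "node org w \<in> axis w i"
  by (simp add: axis_def node_points on_model_node active_node)

text \<open>The axes meet only in the node.\<close>

lemma node_unique:
  "q \<in> points (CH w) \<Longrightarrow> on_model x w q \<Longrightarrow> active x w i q = 0 \<Longrightarrow> active x w (other i) q = 0 \<Longrightarrow> q = node org w"
proof (induction w arbitrary: q i)
  case Nil
  then have "fst q = org" by (intro org_unique[of _ i]) (auto simp: chart_points)
  then show ?case using Nil by (cases q) (auto simp: node_def chart_points)
next
  case (Cons p w)
  have a: "active x (p # w) p q = 0" "active x (p # w) (other p) q = 0"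
    using Cons.prems(3,4) idx_other(1)[of i p] by (cases "i = p"; simp add: idx_other)+
  then have a': "active x w p (proj q) = 0" "hd (snd q) = 0" by (simp_all add: idx_other)
  with Cons.prems(2) have "active x w (other p) (proj q) = 0"
    using twig_mult_pos[of w p] by simp
  then have "proj q = node org w"
    using Cons.IH[OF proj_points[OF Cons.prems(1)] _ a'(1)] Cons.prems(2) by simp
  moreover have "snd q = hd (snd q) # tl (snd q)" using Cons.prems(1) by (cases "snd q") (auto simp: chart_points)
  ultimately show ?case using a'(2) by (cases q) (auto simp: node_def proj_def)
qed

text \<open>
  Where the new coordinate vanishes, the node binomial is a multiple of the deactivated coordinate, so the
  axis is a copy of an axis one level below.
\<close>

lemma axis_retained: "axis (p # w) (other p) = zero_sect ` axis w (other p)"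
proof (intro equalityI subsetI)
  fix q assume "q \<in> axis (p # w) (other p)"
  then have q: "q \<in> points (CH (p # w))" "on_model x (p # w) q" "hd (snd q) = 0" by (auto simp: axis_def idx_other)
  then have "active x w (other p) (proj q) = 0" using twig_mult_pos[of w p] by simp
  then have "proj q \<in> axis w (other p)" using q proj_points by (simp add: axis_def)
  moreover have "snd q = hd (snd q) # tl (snd q)" using q(1) by (cases "snd q") (auto simp: chart_points)
  then have "q = zero_sect (proj q)" using q(3) by (cases q) (auto simp: zero_sect_def proj_def)
  ultimately show "q \<in> zero_sect ` axis w (other p)" by blast
next
  fix q assume "q \<in> zero_sect ` axis w (other p)"
  then obtain q' where q': "q' \<in> axis w (other p)" "q = zero_sect q'" by blast
  have "hd (snd q) = 0" "proj q = q'" using q' by (auto simp: zero_sect_def proj_def)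
  then show "q \<in> axis (p # w) (other p)" using q' zero_sect_points by (auto simp: axis_def idx_other)
qed

text \<open>
  Where the retained coordinate vanishes, the node binomial makes the deactivated coordinate
  vanish too, and the new one is free.
\<close>

lemma axis_emergent: "axis (p # w) p = {q \<in> points (CH (p # w)). proj q = node org w}"
proof (intro equalityI subsetI)
  fix q assume "q \<in> axis (p # w) p"
  then have q: "q \<in> points (CH (p # w))" "on_model x (p # w) q" "active x w p (proj q) = 0" by (auto simp: axis_def)
  then have "active x w (other p) (proj q) = 0" using twig_mult_pos[of w p] by simp
  then show "q \<in> {q \<in> points (CH (p # w)). proj q = node org w}"
    using node_unique[OF proj_points[OF q(1)] _ q(3)] q by simp
next
  fix q assume "q \<in> {q \<in> points (CH (p # w)). proj q = node org w}"
  then show "q \<in> axis (p # w) p" by (simp add: axis_def active_node on_model_node)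
qed

text \<open>The parametrisation of the emergent axis by the new coordinate.\<close>

definition line :: "word \<Rightarrow> 'k \<Rightarrow> 'u \<times> 'k list" where
  "line w t = (org, t # replicate (length w) 0)"

lemma line_points: "line w t \<in> points (CH (p # w))"
  using org_U by (simp add: line_def chart_points)

lemma axis_emergent_line: "axis (p # w) p = range (line w)"
proof -
  have "q = line w (hd (snd q))" if "q \<in> points (CH (p # w))" "proj q = node org w" for q
    using that by (cases q; cases "snd q") (auto simp: chart_points proj_def node_def line_def)
  then show ?thesis unfolding axis_emergent using line_points by (auto simp: proj_def node_def line_def)
qed

lemma germ_line: "germ_algebra (near affine_line t) (reg affine_line t) t"
  by (rule presents_germ_algebra[OF presents_affine_line UNIV_I])

lemma const_morph:
  assumes X: "germ_algebra (near X p) (reg X p) p" and u: "u \<in> U" shows "morph_at X S (\<lambda>_. u) p"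
proof -
  obtain V zs where V: "presented_point S V (set zs) u" by (rule chart_in_U[OF u])
  show ?thesis
    by (rule morph_at_criterion[where \<phi> = "\<lambda>_. u", OF X V])
      (use V germ_algebra.germ_const[OF X] in \<open>auto simp: presented_point_def\<close>)
qed

lemma line_morph: "morph_at affine_line (CH (p # w)) (line w) t"
proof (rule morph_into_chart[where \<phi> = "line w", OF germ_line line_points])
  show "morph_at affine_line S (\<lambda>q. fst (line w q)) t" using const_morph[OF germ_line org_U] by (simp add: line_def)
  show "\<forall>\<^sub>F q in near affine_line t. line w q \<in> points (CH (p # w))" by (simp add: line_points)
  fix j assume "j < length (p # w)"
  then show "(\<lambda>q. snd (line w q) ! j) \<in> reg affine_line t"
    using presents_gen_alg[OF presents_affine_line UNIV_I gen_alg_gen, of "\<lambda>t. t" t] germ_algebra.germ_const[OF germ_line]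
    by (cases j) (simp_all add: line_def)
qed

lemma restr_reg_iff:
  "p \<in> points X \<Longrightarrow> f \<in> reg (restr_space X Z) p \<longleftrightarrow> (\<exists>g\<in>reg X p. \<forall>\<^sub>F q in near X p. q \<in> Z \<longrightarrow> f q = g q)"
  unfolding eventually_near_iff by (auto simp: restr_space_def)

lemma axis_Nil: "axis [] i = sect [] ` {u \<in> U. x i u = 0}"
  by (auto simp: axis_def chart_points sect_def image_iff)

lemma axis_irreducible_Nil: "irreducible_set (zar (CH [])) (axis [] i)"
proof -
  have "continuous_map (subtopology (zar S) U) (zar (CH [])) (sect [])"
    unfolding continuous_map_def
  proof (intro conjI allI impI)
    show "sect [] \<in> topspace (subtopology (zar S) U) \<rightarrow> points (CH [])" using sect_points by auto
    fix \<Omega> assume \<Omega>: "openin (zar (CH [])) \<Omega>"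
    have "openin (zar S) {u \<in> U. sect [] u \<in> \<Omega>}"
      unfolding openin_subopen[of _ "{u \<in> U. sect [] u \<in> \<Omega>}"]
    proof
      fix u assume u: "u \<in> {u \<in> U. sect [] u \<in> \<Omega>}"
      then have uU: "u \<in> U" and s: "sect [] u \<in> \<Omega>" by auto
      from morph_eventually[OF sect_Nil_morph[OF uU] eventually_near_open[OF \<Omega> s]]
      have "\<forall>\<^sub>F c in near S u. sect [] c \<in> \<Omega>" .
      with eventually_U[OF uU] have "\<forall>\<^sub>F c in near S u. c \<in> U \<and> sect [] c \<in> \<Omega>" by eventually_elim simp
      then show "\<exists>T. openin (zar S) T \<and> u \<in> T \<and> T \<subseteq> {u \<in> U. sect [] u \<in> \<Omega>}"
        unfolding eventually_near_iff[OF U_points[OF uU]] by blast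
    qed
    moreover have "{u \<in> topspace (subtopology (zar S) U). sect [] u \<in> \<Omega>} = {u \<in> U. sect [] u \<in> \<Omega>} \<inter> U"
      using U_points by auto
    ultimately show "openin (subtopology (zar S) U) {u \<in> topspace (subtopology (zar S) U). sect [] u \<in> \<Omega>}"
      unfolding openin_subtopology by blast
  qed
  moreover have "irreducible_set (subtopology (zar S) U) {u \<in> U. x i u = 0}"
    unfolding irreducible_set_def
  proof (intro conjI allI impI)
    show "{u \<in> U. x i u = 0} \<noteq> {}" using org_U org_zero by blast
    show "{u \<in> U. x i u = 0} \<subseteq> topspace (subtopology (zar S) U)" using U_points by auto
    fix A B assume A: "closedin (subtopology (zar S) U) A" and B: "closedin (subtopology (zar S) U) B"
      and AB: "{u \<in> U. x i u = 0} \<subseteq> A \<union> B"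
    from A B obtain A' B' where A': "closedin (zar S) A'" "A = A' \<inter> U" and B': "closedin (zar S) B'" "B = B' \<inter> U"
      unfolding closedin_subtopology by blast
    have "{u \<in> U. x i u = 0} \<subseteq> A' \<union> B'" using AB A' B' by blast
    then have "{u \<in> U. x i u = 0} \<subseteq> A' \<or> {u \<in> U. x i u = 0} \<subseteq> B'"
      using coord_axis_irreducible[of i] A' B' unfolding irreducible_set_def by blast
    then show "{u \<in> U. x i u = 0} \<subseteq> A \<or> {u \<in> U. x i u = 0} \<subseteq> B" using A' B' by blast
  qed
  ultimately show ?thesis unfolding axis_Nil by (rule irreducible_image)
qed

lemma zero_sect_continuous: "continuous_map (zar (CH w)) (zar (CH (p # w))) zero_sect"
  by (rule morph_continuous) (simp add: zero_sect_points zero_sect_morph)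

lemma irreducible_axis: "irreducible_set (zar (CH w)) (axis w i)"
proof (induction w arbitrary: i)
  case Nil
  show ?case by (rule axis_irreducible_Nil)
next
  case (Cons p w)
  show ?case
  proof (cases "i = p")
    case True
    have "continuous_map (zar affine_line) (zar (CH (p # w))) (line w)"
      by (rule morph_continuous) (simp add: line_points line_morph)
    from irreducible_image[OF this affine_line_irreducible] show ?thesis
      by (simp add: True axis_emergent_line)
  next
    case False
    then have "i = other p" by (simp add: idx_other)
    then show ?thesis
      using irreducible_image[OF zero_sect_continuous Cons.IH[of "other p"], of p] by (simp add: axis_retained)
  qed
qed

lemma axis_closed: "closedin (zar (CH w)) (axis w i)"
proof -
  have "axis w i = {q \<in> points (CH w). on_model x w q} \<inter> {q \<in> points (CH w). active x w i q = 0}"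
    by (auto simp: axis_def)
  then show ?thesis using closedin_Int[OF model_closed chart_zero_set_closed[OF active_reg]] by simp
qed

lemma axis_nontrivial: "\<exists>q\<in>axis w i. active x w (other i) q \<noteq> 0"
proof (induction w arbitrary: i)
  case Nil
  obtain c where "c \<in> U" "x i c = 0" "x (other i) c \<noteq> 0"
    using axis_point[OF org_U org_zero, of "\<lambda>_. True" i] by auto
  then show ?case by (intro bexI[of _ "sect [] c"]) (auto simp: axis_Nil sect_def)
next
  case (Cons p w)
  show ?case
  proof (cases "i = p")
    case True
    show ?thesis
      unfolding True axis_emergent_line by (intro bexI[of _ "line w 1"]) (auto simp: line_def idx_other)
  next
    case False
    then have i: "i = other p" by (simp add: idx_other)
    from Cons[of "other p"] obtain q where q: "q \<in> axis w (other p)" "active x w p q \<noteq> 0" by (auto simp: idx_other)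
    then show ?thesis unfolding i axis_retained by (intro bexI[of _ "zero_sect q"]) (auto simp: idx_other)
  qed
qed

lemma axis_not_subset: "i \<noteq> j \<Longrightarrow> \<not> axis w i \<subseteq> axis w j"
  using axis_nontrivial[of w i] by (auto simp: axis_def idx_other)

lemma twigs_axes: "twigs S U x T w = {axis w I1, axis w I2}"
  unfolding twigs_def special_support_axes
  by (rule irreducible_components_two) (auto intro: irreducible_axis axis_closed simp: axis_not_subset)

lemma twigs_axis: "twigs S U x T w = {axis w i, axis w (other i)}"
  unfolding twigs_axes by (cases i) auto

lemma proj_axis_retained: "proj ` axis (p # w) (other p) = axis w (other p)"
  unfolding axis_retained by (simp add: image_image)

lemma proj_axis_emergent: "proj ` axis (p # w) p = {node org w}"
  using node_axis[of "p # w" p] unfolding axis_emergent by auto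

text \<open>
  An axis is not collapsed to a point, which distinguishes the retained twig from the emergent
  one.
\<close>

lemma axis_not_node: "axis w i \<noteq> {node org w}"
  using axis_nontrivial[of w i] active_node by auto

lemma emergent_iff: "emergent_twig S U x org T (p # w) Z \<longleftrightarrow> Z = axis (p # w) p"
proof
  assume "emergent_twig S U x org T (p # w) Z"
  then have "Z \<in> {axis (p # w) p, axis (p # w) (other p)}" "proj ` Z = {node org w}"
    unfolding emergent_twig_def twigs_axis[of "p # w" p] by simp_all
  then show "Z = axis (p # w) p" using proj_axis_retained[of p w] axis_not_node[of w "other p"] by auto
next
  assume "Z = axis (p # w) p"
  then show "emergent_twig S U x org T (p # w) Z"
    unfolding emergent_twig_def twigs_axis[of "p # w" p] by (simp add: node_axis proj_axis_emergent)
qed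

text \<open>The inverse isomorphism is \<open>zero_sect\<close>.\<close>

lemma retained_space_iso:
  "space_iso (restr_space (CH (p # w)) (axis (p # w) (other p))) (restr_space (CH w) (axis w (other p))) proj"
proof -
  let ?Z = "axis (p # w) (other p)" and ?Z' = "axis w (other p)"
  have ZZ: "?Z \<subseteq> points (CH (p # w))" "?Z' \<subseteq> points (CH w)" by (auto simp: axis_def)
  have zs: "zero_sect (proj q) = q" if "q \<in> ?Z" for q using that unfolding axis_retained by auto
  have "homeomorphic_maps (subtopology (zar (CH (p # w))) ?Z) (subtopology (zar (CH w)) ?Z') proj zero_sect"
    unfolding homeomorphic_maps_def
  proof (intro conjI ballI)
    show "continuous_map (subtopology (zar (CH (p # w))) ?Z) (subtopology (zar (CH w)) ?Z') proj"
    proof (intro continuous_map_into_subtopology continuous_map_from_subtopology proj_continuous)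
      show "proj \<in> topspace (subtopology (zar (CH (p # w))) ?Z) \<rightarrow> ?Z'"
        using proj_axis_retained[of p w] by (intro funcsetI) (simp, blast)
    qed
    show "continuous_map (subtopology (zar (CH w)) ?Z') (subtopology (zar (CH (p # w))) ?Z) zero_sect"
      by (intro continuous_map_into_subtopology continuous_map_from_subtopology zero_sect_continuous) (auto simp: axis_retained)
  qed (use zs in auto)
  then have "homeomorphic_map (zar (restr_space (CH (p # w)) ?Z)) (zar (restr_space (CH w) ?Z')) proj"
    unfolding homeomorphic_map_maps by (auto simp: restr_space_def)
  moreover have "f \<in> reg (restr_space (CH w) ?Z') (proj q) \<longleftrightarrow> f \<circ> proj \<in> reg (restr_space (CH (p # w)) ?Z) q"
    if "q \<in> points (restr_space (CH (p # w)) ?Z)" for q f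
  proof -
    from that have q: "q \<in> points (CH (p # w))" "q \<in> ?Z" by (auto simp: restr_space_def)
    note q' = proj_points[OF q(1)]
    have zq: "zero_sect (proj q) = q" by (rule zs[OF q(2)])
    have zm: "morph_at (CH w) (CH (p # w)) zero_sect (proj q)" by (rule zero_sect_morph[OF q'])
    show ?thesis
      unfolding restr_reg_iff[OF q'] restr_reg_iff[OF q(1)]
    proof
      assume "\<exists>g\<in>reg (CH w) (proj q). \<forall>\<^sub>F z in near (CH w) (proj q). z \<in> ?Z' \<longrightarrow> f z = g z"
      then obtain g where g: "g \<in> reg (CH w) (proj q)" "\<forall>\<^sub>F z in near (CH w) (proj q). z \<in> ?Z' \<longrightarrow> f z = g z" by blast
      have "\<forall>\<^sub>F z in near (CH (p # w)) q. z \<in> ?Z \<longrightarrow> (f \<circ> proj) z = g (proj z)"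
        using morph_eventually[OF proj_morph[OF q(1)] g(2)] by eventually_elim (use proj_axis_retained[of p w] in auto)
      then show "\<exists>g\<in>reg (CH (p # w)) q. \<forall>\<^sub>F z in near (CH (p # w)) q. z \<in> ?Z \<longrightarrow> (f \<circ> proj) z = g z"
        by (intro bexI[of _ "\<lambda>z. g (proj z)"] morph_reg[OF proj_morph[OF q(1)] g(1)])
    next
      assume "\<exists>g\<in>reg (CH (p # w)) q. \<forall>\<^sub>F z in near (CH (p # w)) q. z \<in> ?Z \<longrightarrow> (f \<circ> proj) z = g z"
      then obtain g where g: "g \<in> reg (CH (p # w)) q" "\<forall>\<^sub>F z in near (CH (p # w)) q. z \<in> ?Z \<longrightarrow> (f \<circ> proj) z = g z" by blast
      have "\<forall>\<^sub>F z in near (CH w) (proj q). zero_sect z \<in> ?Z \<longrightarrow> (f \<circ> proj) (zero_sect z) = g (zero_sect z)"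
        by (rule morph_eventually[OF zm]) (use g(2) zq in simp)
      then have "\<forall>\<^sub>F z in near (CH w) (proj q). z \<in> ?Z' \<longrightarrow> f z = g (zero_sect z)"
        by eventually_elim (auto simp: axis_retained)
      then show "\<exists>g\<in>reg (CH w) (proj q). \<forall>\<^sub>F z in near (CH w) (proj q). z \<in> ?Z' \<longrightarrow> f z = g z"
        using morph_reg[OF zm, of g] g(1) unfolding zq by (intro bexI[of _ "\<lambda>z. g (zero_sect z)"])
    qed
  qed
  ultimately show ?thesis unfolding space_iso_def by blast
qed

lemma retained_iff: "retained_twig S U x org T (p # w) Z \<longleftrightarrow> Z = axis (p # w) (other p)"
proof
  assume "retained_twig S U x org T (p # w) Z"
  then obtain Z' where Z: "Z \<in> {axis (p # w) p, axis (p # w) (other p)}"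
    and iso: "space_iso (restr_space (CH (p # w)) Z) (restr_space (CH w) Z') proj"
    unfolding retained_twig_def twigs_axis[of "p # w" p] by auto
  have "Z \<noteq> axis (p # w) p"
  proof
    assume Z: "Z = axis (p # w) p"
    have "inj_on proj (points (restr_space (CH (p # w)) Z))"
      using iso homeomorphic_imp_injective_map unfolding space_iso_def by blast
    moreover have "points (restr_space (CH (p # w)) Z) = Z" by (auto simp: restr_space_def Z axis_def)
    ultimately have "inj_on proj (range (line w))" by (simp add: Z axis_emergent_line)
    moreover have "proj (line w 0) = proj (line w 1)" by (simp add: proj_def line_def)
    ultimately have "line w 0 = line w 1" by (meson inj_onD rangeI)
    then show False by (simp add: line_def)
  qed
  then show "Z = axis (p # w) (other p)" using Z by blast
next
  assume "Z = axis (p # w) (other p)"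
  then show "retained_twig S U x org T (p # w) Z"
    unfolding retained_twig_def twigs_axis[of "p # w" p] twigs_axis[of "tl (p # w)" p]
    using node_axis retained_space_iso by simp
qed

end

section \<open>Functions vanishing on a twig\<close>

context patch_disc
begin

text \<open>
  The node binomial expresses the deactivated coordinate by the product of the two active
  ones, hence by either of them.
\<close>

lemma lower_active:
  assumes q: "q \<in> points (CH (p # w))"
    and G: "g \<in> {active x (p # w) p, active x (p # w) (other p)}" "g \<in> G" "binom x (p # w) \<in> G"
  shows "(\<lambda>z. active x w (other p) (proj z)) \<in> lideal (CH (p # w)) q G"
proof -
  interpret germ_algebra "near (CH (p # w)) q" "reg (CH (p # w)) q" q by (rule germ_chart[OF q])
  let ?m = "of_nat (twig_mult w p) :: 'k" and ?M = "of_nat (twig_mult w (other p)) :: 'k"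
  have m: "?m \<noteq> 0" using twig_mult_pos[of w p] by simp
  have r: "active x (p # w) i \<in> reg (CH (p # w)) q" for i by (rule active_reg[OF q])
  have "\<exists>h\<in>reg (CH (p # w)) q. \<forall>z. active x (p # w) p z * active x (p # w) (other p) z = h z * g z"
  proof (cases "g = active x (p # w) p")
    case True
    show ?thesis unfolding True by (intro bexI[of _ "active x (p # w) (other p)"] allI mult.commute r)
  next
    case False
    then have g: "g = active x (p # w) (other p)" using G(1) by blast
    show ?thesis unfolding g by (intro bexI[of _ "active x (p # w) p"] allI refl r)
  qed
  then obtain h where h: "h \<in> reg (CH (p # w)) q" "\<And>z. active x (p # w) p z * active x (p # w) (other p) z = h z * g z" by blast
  have e: "active x w (other p) (proj z) = 1 / ?m * binom x (p # w) z - ?M / ?m * (h z * g z)" for z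
  proof -
    have "binom x (p # w) z = ?M * (h z * g z) + ?m * active x w (other p) (proj z)"
      using h(2)[of z, symmetric] by (simp add: idx_other mult.commute)
    then show ?thesis using m by (simp add: field_simps del: binom.simps active.simps)
  qed
  show ?thesis
    unfolding e by (intro germ_ideal_diff germ_ideal_cmult germ_ideal_gen h germ_ideal_base G)
qed

text \<open>
  The generators \<open>active x w i\<close> and \<open>model_eqs w\<close>, pulled back by \<open>proj\<close>, lie in the ideal
  generated by the retained coordinate and the equations one level higher.
\<close>

lemma lower_gens:
  assumes q: "q \<in> points (CH (p # w))"
  shows "(\<lambda>g z. g (proj z)) ` (range (active x w) \<union> model_eqs w)
    \<subseteq> lideal (CH (p # w)) q (insert (active x (p # w) p) (model_eqs (p # w)))" (is "_ \<subseteq> lideal _ _ ?G")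
proof
  interpret germ_algebra "near (CH (p # w)) q" "reg (CH (p # w)) q" q by (rule germ_chart[OF q])
  fix h assume "h \<in> (\<lambda>g z. g (proj z)) ` (range (active x w) \<union> model_eqs w)"
  then consider i where "h = (\<lambda>z. active x w i (proj z))" | b where "b \<in> model_eqs w" "h = (\<lambda>z. b (proj z))" by blast
  then show "h \<in> germ_ideal ?G"
  proof cases
    case 1
    show ?thesis
    proof (cases "i = p")
      case True
      then have "h = active x (p # w) p" unfolding 1 by (simp add: fun_eq_iff)
      then show ?thesis by (intro germ_ideal_base) blast
    next
      case False
      then have i: "i = other p" by (simp add: idx_other)
      show ?thesis unfolding 1 i by (rule lower_active[OF q, of "active x (p # w) p"]) simp_all
    qed
  next
    case 2
    then show ?thesis by (intro germ_ideal_base) auto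
  qed
qed

text \<open>Modulo the equations of the model, the active coordinates generate all coordinates.\<close>

lemma coords_active:
  assumes "q \<in> points (CH w)" "f \<in> range (\<lambda>i z. x i (fst z)) \<union> (\<lambda>j z. snd z ! j) ` {..<length w}"
  shows "f \<in> lideal (CH w) q (range (active x w) \<union> model_eqs w)"
  using assms
proof (induction w arbitrary: q f)
  case Nil
  interpret germ_algebra "near (CH []) q" "reg (CH []) q" q by (rule germ_chart[OF Nil(1)])
  from Nil(2) obtain i where "f = (\<lambda>z. x i (fst z))" by auto
  then have "f = active x [] i" by (simp add: fun_eq_iff)
  then show ?case by (auto intro: germ_ideal_base)
next
  case (Cons p w)
  note q = Cons.prems(1)
  note q' = proj_points[OF q]
  interpret germ_algebra "near (CH (p # w)) q" "reg (CH (p # w)) q" q by (rule germ_chart[OF q])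
  let ?G = "range (active x (p # w)) \<union> model_eqs (p # w)"
  have low: "(\<lambda>z. f' (proj z)) \<in> germ_ideal ?G"
    if f': "f' \<in> range (\<lambda>i z. x i (fst z)) \<union> (\<lambda>j z. snd z ! j) ` {..<length w}" for f'
  proof (rule germ_ideal_trans)
    show "(\<lambda>z. f' (proj z)) \<in> germ_ideal ((\<lambda>g z. g (proj z)) ` (range (active x w) \<union> model_eqs w))"
      by (rule lideal_pullback[OF germ_chart[OF q] germ_chart[OF q'] proj_morph[OF q] Cons.IH[OF q' f']])
    show "(\<lambda>g z. g (proj z)) ` (range (active x w) \<union> model_eqs w) \<subseteq> germ_ideal ?G"
      using lower_gens[OF q] germ_ideal_mono[of _ "insert (active x (p # w) p) (model_eqs (p # w))" ?G] by blast
  qed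
  from Cons.prems(2) consider i where "f = (\<lambda>z. x i (fst z))" | j where "j < Suc (length w)" "f = (\<lambda>z. snd z ! j)" by auto
  then show ?case
  proof cases
    case 1
    have "(\<lambda>z. x i (fst (proj z))) \<in> germ_ideal ?G" by (rule low) blast
    then show ?thesis unfolding 1 proj_def fst_conv .
  next
    case 2
    show ?thesis
    proof (cases j)
      case 0
      have "active x (p # w) (other p) \<in> germ_ideal ?G" by (intro germ_ideal_base) blast
      then show ?thesis
      proof (rule germ_ideal_cong)
        show "\<forall>\<^sub>F z in near (CH (p # w)) q. f z = active x (p # w) (other p) z"
          using eventually_points[OF q]
          by eventually_elim (auto simp: 2(2) 0 chart_points idx_other intro!: hd_conv_nth[symmetric])
      qed
    next
      case (Suc l)
      have "(\<lambda>z. snd (proj z) ! l) \<in> germ_ideal ?G"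
        by (rule low) (use 2(1) Suc in auto)
      then show ?thesis
      proof (rule germ_ideal_cong)
        show "\<forall>\<^sub>F z in near (CH (p # w)) q. f z = snd (proj z) ! l"
          using eventually_points[OF q]
          by eventually_elim (use 2(1) Suc in \<open>auto simp: 2(2) proj_def chart_points nth_tl\<close>)
      qed
    qed
  qed
qed

text \<open>
  Modulo the new coordinate, \<open>f\<close> equals its restriction to the section \<open>zero_sect\<close>, to which the
  assertion for the lower level applies.
\<close>

lemma vanishing_retained:
  assumes q: "q \<in> axis (p # w) (other p)" and f: "f \<in> reg (CH (p # w)) q"
    and van: "\<forall>\<^sub>F z in near (CH (p # w)) q. z \<in> axis (p # w) (other p) \<longrightarrow> f z = 0"
    and IH: "\<And>q f. q \<in> axis w (other p) \<Longrightarrow> f \<in> reg (CH w) q \<Longrightarrow>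
      \<forall>\<^sub>F z in near (CH w) q. z \<in> axis w (other p) \<longrightarrow> f z = 0 \<Longrightarrow>
      f \<in> lideal (CH w) q (insert (active x w (other p)) (model_eqs w))"
  shows "f \<in> lideal (CH (p # w)) q (insert (active x (p # w) (other p)) (model_eqs (p # w)))"
proof -
  have qp: "q \<in> points (CH (p # w))" using q by (simp add: axis_def)
  note qp' = proj_points[OF qp]
  have q': "proj q \<in> axis w (other p)" "zero_sect (proj q) = q" using q unfolding axis_retained by auto
  obtain V zs where V: "presented_point (CH (p # w)) ((V \<inter> U) \<times> {ys. length ys = length (p # w)}) (chart_gens zs (length (p # w))) q"
    using qp by (rule chart_presentedE)
  interpret presented_point "CH (p # w)" "(V \<inter> U) \<times> {ys. length ys = length (p # w)}" "chart_gens zs (length (p # w))" q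
    by (rule V)
  have zm: "morph_at (CH w) (CH (p # w)) zero_sect (proj q)" by (rule zero_sect_morph[OF qp'])
  have zf: "(\<lambda>z. g (zero_sect z)) \<in> reg (CH w) (proj q)" if "g \<in> reg (CH (p # w)) q" for g
    by (rule morph_reg[OF zm]) (simp add: q' that)
  let ?G = "insert (active x (p # w) (other p)) (model_eqs (p # w))"
  have "\<forall>\<^sub>F z in near (CH w) (proj q). zero_sect z \<in> axis (p # w) (other p) \<longrightarrow> f (zero_sect z) = 0"
    by (rule morph_eventually[OF zm]) (simp add: q' van)
  then have "\<forall>\<^sub>F z in near (CH w) (proj q). z \<in> axis w (other p) \<longrightarrow> f (zero_sect z) = 0"
    by eventually_elim (auto simp: axis_retained)
  from IH[OF q'(1) zf[OF f] this]
  have fw: "(\<lambda>z. f (zero_sect z)) \<in> lideal (CH w) (proj q) (insert (active x w (other p)) (model_eqs w))" .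
  have "(\<lambda>z. f (zero_sect (proj z))) \<in> germ_ideal ((\<lambda>g z. g (proj z)) ` insert (active x w (other p)) (model_eqs w))"
    by (rule lideal_pullback[OF germ_chart[OF qp] germ_chart[OF qp'] proj_morph[OF qp] fw])
  then have base: "(\<lambda>z. f (zero_sect (proj z))) \<in> germ_ideal ?G"
  proof (rule germ_ideal_trans)
    have "(\<lambda>z. active x w (other p) (proj z)) \<in> germ_ideal ?G"
      by (rule lower_active[OF qp, of "active x (p # w) (other p)"]) simp_all
    moreover have "(\<lambda>z. b (proj z)) \<in> germ_ideal ?G" if "b \<in> model_eqs w" for b
      by (rule germ_ideal_base) (use that in auto)
    ultimately show "(\<lambda>g z. g (proj z)) ` insert (active x w (other p)) (model_eqs w) \<subseteq> germ_ideal ?G" by blast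
  qed
  have "(\<lambda>z. f z - f (zero_sect (proj z))) \<in> germ_ideal {active x (p # w) (other p)}"
  proof (rule first_order[where \<phi> = "\<lambda>z. zero_sect (proj z)", OF q'(2) _ _ _ f])
    show "(\<lambda>z. g (zero_sect (proj z))) \<in> reg (CH (p # w)) q" if "g \<in> reg (CH (p # w)) q" for g
      using morph_reg[OF proj_morph[OF qp] zf[OF that]] .
    show "\<forall>\<^sub>F z in near (CH (p # w)) q. zero_sect (proj z) \<in> (V \<inter> U) \<times> {ys. length ys = length (p # w)}"
      using eventually_in_chart by eventually_elim (auto simp: zero_sect_def proj_def)
    fix g assume "g \<in> chart_gens zs (length (p # w))"
    then consider h where "g = (\<lambda>z. h (fst z))" | j where "j < length (p # w)" "g = (\<lambda>z. snd z ! j)"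
      unfolding chart_gens_def by auto
    then show "(\<lambda>z. g z - g (zero_sect (proj z))) \<in> germ_ideal {active x (p # w) (other p)}"
    proof cases
      case 1
      then show ?thesis by (intro germ_ideal_0) (simp add: zero_sect_def proj_def)
    next
      case 2
      show ?thesis
      proof (cases j)
        case 0
        have "active x (p # w) (other p) \<in> germ_ideal {active x (p # w) (other p)}" by (intro germ_ideal_base) simp
        then show ?thesis
        proof (rule germ_ideal_cong)
          show "\<forall>\<^sub>F z in near (CH (p # w)) q. g z - g (zero_sect (proj z)) = active x (p # w) (other p) z"
            using eventually_points[OF qp]
            by eventually_elim (auto simp: 2(2) 0 chart_points idx_other zero_sect_def intro!: hd_conv_nth[symmetric])
        qed
      next
        case (Suc l)
        have "\<forall>\<^sub>F z in near (CH (p # w)) q. g z - g (zero_sect (proj z)) = 0"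
          using eventually_points[OF qp]
          by eventually_elim (use 2(1) Suc in \<open>auto simp: 2(2) proj_def zero_sect_def chart_points nth_tl\<close>)
        then show ?thesis by (rule germ_ideal_0)
      qed
    qed
  qed
  then have "(\<lambda>z. f z - f (zero_sect (proj z))) \<in> germ_ideal ?G" by (rule germ_ideal_mono) simp
  from germ_ideal_add[OF base this] show ?thesis by simp
qed

text \<open>
  The map that keeps the new coordinate and sets all other coordinates to zero retracts the chart to the
  emergent axis.  By \<open>first_order\<close>, \<open>f\<close> equals its pullback under the retraction, which is \<open>0\<close>, modulo all
  coordinates but the new one; these are handled by \<open>lower_gens\<close> and \<open>coords_active\<close>.
\<close>

lemma vanishing_emergent:
  assumes q: "q \<in> axis (p # w) p" and f: "f \<in> reg (CH (p # w)) q"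
    and van: "\<forall>\<^sub>F z in near (CH (p # w)) q. z \<in> axis (p # w) p \<longrightarrow> f z = 0"
  shows "f \<in> lideal (CH (p # w)) q (insert (active x (p # w) p) (model_eqs (p # w)))"
proof -
  have qp: "q \<in> points (CH (p # w))" using q by (simp add: axis_def)
  note qp' = proj_points[OF qp]
  obtain t where t: "q = line w t" using q by (auto simp: axis_emergent_line)
  then have qt: "hd (snd q) = t" "fst q = org" "snd q = t # replicate (length w) 0" by (simp_all add: line_def)
  obtain V zs where V: "presented_point S V (set zs) (fst q)"
    "presented_point (CH (p # w)) ((V \<inter> U) \<times> {ys. length ys = length (p # w)}) (chart_gens zs (length (p # w))) q"
    using qp by (rule chart_presentedE)
  interpret u: presented_point S V "set zs" "fst q" by (rule V(1))
  interpret presented_point "CH (p # w)" "(V \<inter> U) \<times> {ys. length ys = length (p # w)}" "chart_gens zs (length (p # w))" q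
    by (rule V(2))
  let ?G = "insert (active x (p # w) p) (model_eqs (p # w))"
  let ?\<phi> = "\<lambda>z. line w (hd (snd z)) :: 'u \<times> 'k list"
  have fix_q: "?\<phi> q = q" using t qt by simp
  have line_pts: "?\<phi> z \<in> points (CH (p # w))" for z :: "'u \<times> 'k list" by (rule line_points)
  have \<phi>m: "morph_at (CH (p # w)) (CH (p # w)) ?\<phi> q"
  proof (rule morph_into_chart[where \<phi> = ?\<phi>, OF germ_chart[OF qp] line_pts])
    show "morph_at (CH (p # w)) S (\<lambda>z. fst (?\<phi> z)) q" using const_morph[OF germ_chart[OF qp] org_U] by (simp add: line_def)
    show "\<forall>\<^sub>F z in near (CH (p # w)) q. ?\<phi> z \<in> points (CH (p # w))" by (simp add: line_points)
    fix j assume "j < length (p # w)"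
    then show "(\<lambda>z. snd (?\<phi> z) ! j) \<in> reg (CH (p # w)) q"
      using hd_reg[OF qp] germ_const by (cases j) (simp_all add: line_def)
  qed
  have low: "(\<lambda>z. g (proj z)) \<in> germ_ideal ?G"
    if g: "g \<in> range (\<lambda>i z. x i (fst z)) \<union> (\<lambda>j z. snd z ! j) ` {..<length w}" for g
  proof (rule germ_ideal_trans)
    show "(\<lambda>z. g (proj z)) \<in> germ_ideal ((\<lambda>g z. g (proj z)) ` (range (active x w) \<union> model_eqs w))"
      by (rule lideal_pullback[OF germ_chart[OF qp] germ_chart[OF qp'] proj_morph[OF qp] coords_active[OF qp' g]])
    show "(\<lambda>g z. g (proj z)) ` (range (active x w) \<union> model_eqs w) \<subseteq> germ_ideal ?G"
      by (rule lower_gens[OF qp])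
  qed
  have "\<forall>\<^sub>F z in near (CH (p # w)) q. ?\<phi> z \<in> axis (p # w) p \<longrightarrow> f (?\<phi> z) = 0"
    by (rule morph_eventually[OF \<phi>m]) (unfold fix_q, rule van)
  then have ev0: "\<forall>\<^sub>F z in near (CH (p # w)) q. f z - f (?\<phi> z) = f z"
    by eventually_elim (auto simp: axis_emergent_line)
  have "(\<lambda>z. f z - f (?\<phi> z)) \<in> germ_ideal ?G"
  proof (rule first_order[where \<phi> = ?\<phi>, OF fix_q _ _ _ f])
    show "(\<lambda>z. g (?\<phi> z)) \<in> reg (CH (p # w)) q" if "g \<in> reg (CH (p # w)) q" for g
      by (rule morph_reg[OF \<phi>m]) (unfold fix_q, rule that)
    show "\<forall>\<^sub>F z in near (CH (p # w)) q. ?\<phi> z \<in> (V \<inter> U) \<times> {ys. length ys = length (p # w)}"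
      using u.in_chart qt org_U by (simp add: line_def)
    fix g assume "g \<in> chart_gens zs (length (p # w))"
    then consider h where "h \<in> set zs" "g = (\<lambda>z. h (fst z))" | j where "j < length (p # w)" "g = (\<lambda>z. snd z ! j)"
      unfolding chart_gens_def by auto
    then show "(\<lambda>z. g z - g (?\<phi> z)) \<in> germ_ideal ?G"
    proof cases
      case 1
      have "(\<lambda>c. h c - h (fst q)) \<in> lideal S (fst q) {dx (fst q) I1, dx (fst q) I2}"
        by (rule max_ideal_coords) (use 1 qt org_U in \<open>auto intro: u.gen_alg_reg gen_alg_gen\<close>)
      then have "(\<lambda>z. h (fst z) - h (fst q)) \<in> germ_ideal ((\<lambda>g z. g (fst z)) ` {dx (fst q) I1, dx (fst q) I2})"
        by (rule lideal_pullback[OF germ_chart[OF qp] u.germ_algebra_axioms fst_morph[OF qp]])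
      then have "(\<lambda>z. h (fst z) - h (fst q)) \<in> germ_ideal ?G"
      proof (rule germ_ideal_trans)
        have "(\<lambda>z. dx (fst q) i (fst z)) \<in> germ_ideal ?G" for i
          using low[of "\<lambda>z. x i (fst z)"] by (simp add: dx_def qt org_zero proj_def)
        then show "(\<lambda>g z. g (fst z)) ` {dx (fst q) I1, dx (fst q) I2} \<subseteq> germ_ideal ?G" by blast
      qed
      then show ?thesis by (simp add: 1 line_def qt)
    next
      case 2
      show ?thesis
      proof (cases j)
        case 0
        have "\<forall>\<^sub>F z in near (CH (p # w)) q. g z - g (?\<phi> z) = 0"
          using eventually_points[OF qp]
          by eventually_elim (auto simp: 2(2) 0 line_def chart_points intro!: hd_conv_nth[symmetric])
        then show ?thesis by (rule germ_ideal_0)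
      next
        case (Suc l)
        have "(\<lambda>z. snd (proj z) ! l) \<in> germ_ideal ?G" by (rule low) (use 2(1) Suc in auto)
        then show ?thesis
        proof (rule germ_ideal_cong)
          show "\<forall>\<^sub>F z in near (CH (p # w)) q. g z - g (?\<phi> z) = snd (proj z) ! l"
            using eventually_points[OF qp]
            by eventually_elim (use 2(1) Suc in \<open>auto simp: 2(2) proj_def line_def chart_points nth_tl\<close>)
        qed
      qed
    qed
  qed
  then show ?thesis by (rule germ_ideal_cong) (use ev0 in eventually_elim, simp)
qed

text \<open>
  The axis is a reduced divisor of the model surface, with local equation \<open>active x w i\<close>.
\<close>

theorem vanishing_on_axis:
  assumes "q \<in> axis w i" "f \<in> reg (CH w) q" "\<forall>\<^sub>F z in near (CH w) q. z \<in> axis w i \<longrightarrow> f z = 0"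
  shows "f \<in> lideal (CH w) q (insert (active x w i) (model_eqs w))"
  using assms
proof (induction w arbitrary: i q f)
  case Nil
  note q = Nil(1)
  have qp: "q \<in> points (CH [])" using q by (simp add: axis_def)
  have u: "fst q \<in> U" "x i (fst q) = 0" "sect [] (fst q) = q" using q by (auto simp: axis_Nil)
  interpret germ_algebra "near (CH []) q" "reg (CH []) q" q by (rule germ_chart[OF qp])
  have sm: "morph_at S (CH []) (sect []) (fst q)" by (rule sect_Nil_morph[OF u(1)])
  have r: "(\<lambda>c. f (sect [] c)) \<in> reg S (fst q)" by (rule morph_reg[OF sm]) (simp only: u Nil(2))
  have "\<forall>\<^sub>F c in near S (fst q). sect [] c \<in> axis [] i \<longrightarrow> f (sect [] c) = 0"
    by (rule morph_eventually[OF sm]) (simp only: u Nil(3))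
  then have "\<forall>\<^sub>F c in near S (fst q). x i c = 0 \<longrightarrow> f (sect [] c) = 0"
    using eventually_U[OF u(1)] by eventually_elim (auto simp: axis_Nil)
  from axis_ideal[OF u(1,2) r this]
  have "(\<lambda>c. f (sect [] c)) \<in> lideal S (fst q) {x i}" .
  from lideal_pullback[OF germ_chart[OF qp] germ_algebra_U[OF u(1)] fst_morph[OF qp] this]
  have "(\<lambda>z. f (sect [] (fst z))) \<in> germ_ideal ((\<lambda>g z. g (fst z)) ` {x i})" .
  moreover have "(\<lambda>z. x i (fst z)) = active x [] i" by (simp add: fun_eq_iff)
  ultimately have "(\<lambda>z. f (sect [] (fst z))) \<in> germ_ideal (insert (active x [] i) (model_eqs []))" by simp
  then show ?case
  proof (rule germ_ideal_cong)
    show "\<forall>\<^sub>F z in near (CH []) q. f z = f (sect [] (fst z))"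
      using eventually_points[OF qp] by eventually_elim (auto simp: chart_points sect_def)
  qed
next
  case (Cons p w)
  show ?case
  proof (cases "i = p")
    case True
    show ?thesis unfolding True by (rule vanishing_emergent) (use Cons.prems True in simp_all)
  next
    case False
    then have i: "i = other p" by (simp add: idx_other)
    show ?thesis unfolding i by (rule vanishing_retained[OF _ _ _ Cons.IH]) (use Cons.prems i in simp_all)
  qed
qed

end

section \<open>Length of a uniserial ring\<close>

context cring
begin

lemma unit_times_power:
  assumes p: "\<pi> \<in> carrier R" and dec: "\<And>a. a \<in> carrier R \<Longrightarrow> a \<in> Units R \<or> (\<exists>b\<in>carrier R. a = \<pi> \<otimes> b)"
    and a: "a \<in> carrier R"
  shows "(\<exists>j<n. \<exists>u\<in>Units R. a = \<pi> [^] j \<otimes> u) \<or> (\<exists>b\<in>carrier R. a = \<pi> [^] (n :: nat) \<otimes> b)"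
proof (induction n)
  case 0
  show ?case using a by (intro disjI2 bexI[of _ a]) simp_all
next
  case (Suc n)
  then show ?case
  proof
    assume "\<exists>j<n. \<exists>u\<in>Units R. a = \<pi> [^] j \<otimes> u"
    then show ?thesis using less_SucI by blast
  next
    assume "\<exists>b\<in>carrier R. a = \<pi> [^] n \<otimes> b"
    then obtain b where b: "b \<in> carrier R" "a = \<pi> [^] n \<otimes> b" by blast
    from dec[OF b(1)] show ?thesis
    proof
      assume "b \<in> Units R"
      then show ?thesis using b(2) by blast
    next
      assume "\<exists>c\<in>carrier R. b = \<pi> \<otimes> c"
      then obtain c where c: "c \<in> carrier R" "b = \<pi> \<otimes> c" by blast
      have "a = \<pi> [^] Suc n \<otimes> c" using p c b(2) by (simp add: m_assoc)
      then show ?thesis using c(1) by blast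
    qed
  qed
qed

lemma power_ideal_step:
  assumes p: "\<pi> \<in> carrier R" shows "PIdl (\<pi> [^] Suc j) \<subseteq> PIdl (\<pi> [^] (j :: nat))"
proof (rule cgenideal_minimal[OF cgenideal_ideal])
  have "\<pi> [^] Suc j = \<pi> \<otimes> \<pi> [^] j" using p by (simp add: m_comm)
  then show "\<pi> [^] Suc j \<in> PIdl (\<pi> [^] j)" using p unfolding cgenideal_def by blast
qed (use p in simp)

lemma power_notin_ideal:
  assumes p: "\<pi> \<in> carrier R" and z: "\<pi> [^] (m :: nat) = \<zero>" and nz: "\<And>n. n < m \<Longrightarrow> \<pi> [^] n \<noteq> \<zero>" and j: "j < m"
  shows "\<pi> [^] j \<notin> PIdl (\<pi> [^] Suc j)"
proof
  assume "\<pi> [^] j \<in> PIdl (\<pi> [^] Suc j)"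
  then obtain r where r: "r \<in> carrier R" "\<pi> [^] j = r \<otimes> \<pi> [^] Suc j" unfolding cgenideal_def by blast
  have "m - 1 = j + (m - Suc j)" "m = Suc j + (m - Suc j)" using j by auto
  then have e: "\<pi> [^] (m - 1) = \<pi> [^] j \<otimes> \<pi> [^] (m - Suc j)" "\<pi> [^] Suc j \<otimes> \<pi> [^] (m - Suc j) = \<pi> [^] m"
    using nat_pow_mult[OF p, of j "m - Suc j"] nat_pow_mult[OF p, of "Suc j" "m - Suc j"] by (simp_all only:)
  note e(1)
  also have "\<pi> [^] j \<otimes> \<pi> [^] (m - Suc j) = (r \<otimes> \<pi> [^] Suc j) \<otimes> \<pi> [^] (m - Suc j)" by (rule arg_cong[OF r(2)])
  also have "\<dots> = r \<otimes> (\<pi> [^] Suc j \<otimes> \<pi> [^] (m - Suc j))" using r(1) p by (intro m_assoc nat_pow_closed)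
  also have "\<dots> = \<zero>" unfolding e(2) z using r(1) by simp
  finally have "\<pi> [^] (m - 1) = \<zero>" .
  then show False using nz[of "m - 1"] j by simp
qed

text \<open>
  An ideal \<open>I\<close> is determined by the least \<open>j\<close> with \<open>\<pi>\<^sup>j \<in> I\<close>, which decreases strictly along a chain
  of ideals.  The ideals generated by the powers of \<open>\<pi>\<close> are a chain of length \<open>m\<close>.
\<close>

theorem uniserial_length:
  assumes p: "\<pi> \<in> carrier R" and z: "\<pi> [^] (m :: nat) = \<zero>" and nz: "\<And>n. n < m \<Longrightarrow> \<pi> [^] n \<noteq> \<zero>"
    and dec: "\<And>a. a \<in> carrier R \<Longrightarrow> a \<in> Units R \<or> (\<exists>b\<in>carrier R. a = \<pi> \<otimes> b)"
  shows "ring_length R = enat m"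
  unfolding ring_length_def chain_length_def
proof (intro antisym Sup_least Sup_upper)
  define v where "v I = (LEAST j. \<pi> [^] (j :: nat) \<in> I)" for I
  have pow0: "\<pi> [^] m \<in> I" if "ideal I R" for I
    using additive_subgroup.zero_closed[OF ideal.axioms(1)[OF that]] z by simp
  have v_in: "\<pi> [^] v I \<in> I" if "ideal I R" for I unfolding v_def by (rule LeastI[of "\<lambda>j. \<pi> [^] j \<in> I"], rule pow0[OF that])
  have v_le: "v I \<le> j" if "\<pi> [^] j \<in> I" for I j unfolding v_def by (rule Least_le) (rule that)
  have strict: "v I' < v I" if I: "ideal I R" and I': "ideal I' R" and sub: "I \<subset> I'" for I I'
  proof (rule ccontr)
    assume "\<not> v I' < v I"
    have "a \<in> I" if a: "a \<in> I'" for a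
    proof -
      interpret I: ideal I R by (rule I)
      interpret I': ideal I' R by (rule I')
      have aR: "a \<in> carrier R" by (rule I'.Icarr[OF a])
      from unit_times_power[OF p dec aR, of m]
      have "(\<exists>j. \<exists>u\<in>Units R. a = \<pi> [^] (j :: nat) \<otimes> u) \<or> a = \<zero>" using z by auto
      then show ?thesis
      proof
        assume "\<exists>j. \<exists>u\<in>Units R. a = \<pi> [^] (j :: nat) \<otimes> u"
        then obtain j :: nat and u where u: "u \<in> Units R" "a = \<pi> [^] j \<otimes> u" by blast
        have "a \<otimes> inv u \<in> I'" by (rule I'.I_r_closed[OF a]) (use u in simp)
        also have "a \<otimes> inv u = \<pi> [^] j" unfolding u(2) using p u(1) Units_closed[OF u(1)] Units_inv_closed[OF u(1)] by (simp add: m_assoc[of "\<pi> [^] j"])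
        finally have "v I' \<le> j" by (rule v_le)
        then have "v I \<le> j" using \<open>\<not> v I' < v I\<close> by simp
        then have "\<pi> [^] j = \<pi> [^] v I \<otimes> \<pi> [^] (j - v I)" using nat_pow_mult[OF p, of "v I" "j - v I"] by simp
        then have "\<pi> [^] j \<in> I" using I.I_r_closed[OF v_in[OF I]] p by simp
        then show ?thesis unfolding u(2) by (rule I.I_r_closed) (rule Units_closed[OF u(1)])
      next
        assume "a = \<zero>"
        then show ?thesis by simp
      qed
    qed
    then show False using sub by blast
  qed
  fix e assume "e \<in> {enat n |n. \<exists>c. (\<forall>i\<le>n. c i \<in> {I. ideal I R}) \<and> (\<forall>i<n. c i \<subset> c (Suc i))}"
  then obtain n c where e: "e = enat n" and c: "\<forall>i\<le>n. c i \<in> {I. ideal I R}" "\<forall>i<n. c i \<subset> c (Suc i)"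
    by (elim CollectE exE conjE)
  have n: "\<And>i. i \<le> n \<Longrightarrow> ideal (c i) R" "\<And>i. i < n \<Longrightarrow> c i \<subset> c (Suc i)" using c by simp_all
  have "v (c i) + i \<le> m" if "i \<le> n" for i
    using that
  proof (induction i)
    case 0
    then show ?case using v_le[OF pow0[OF n(1)[of 0]]] by simp
  next
    case (Suc i)
    then show ?case using strict[OF n(1)[of i] n(1)[of "Suc i"] n(2)[of i]] by simp
  qed
  from this[of n] show "e \<le> enat m" by (simp add: e)
next
  have "\<exists>c. (\<forall>i\<le>m. c i \<in> {I. ideal I R}) \<and> (\<forall>i<m. c i \<subset> c (Suc i))"
  proof (intro exI[of _ "\<lambda>i. PIdl (\<pi> [^] (m - i))"] conjI allI impI CollectI)
    show "ideal (PIdl (\<pi> [^] (m - i))) R" for i using p by (intro cgenideal_ideal) simp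
    fix i assume i: "i < m"
    have e: "m - i = Suc (m - Suc i)" using i by simp
    have "\<pi> [^] (m - Suc i) \<in> PIdl (\<pi> [^] (m - Suc i))" using p by (intro cgenideal_self nat_pow_closed)
    moreover have "\<pi> [^] (m - Suc i) \<notin> PIdl (\<pi> [^] Suc (m - Suc i))"
      by (rule power_notin_ideal[OF p z nz]) (use i in auto)
    ultimately have "PIdl (\<pi> [^] Suc (m - Suc i)) \<noteq> PIdl (\<pi> [^] (m - Suc i))" by (metis (full_types))
    then show "PIdl (\<pi> [^] (m - i)) \<subset> PIdl (\<pi> [^] (m - Suc i))"
      unfolding e by (rule psubsetI[OF power_ideal_step[OF p]])
  qed
  then show "enat m \<in> {enat n |n. \<exists>c. (\<forall>i\<le>n. c i \<in> {I. ideal I R}) \<and> (\<forall>i<n. c i \<subset> c (Suc i))}"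
    by (intro CollectI exI[of _ m] conjI refl)
qed

lemma uniserial_quotient_length:
  assumes J: "ideal J R" and p: "\<pi> \<in> carrier R" and z: "\<pi> [^] (m :: nat) \<in> J" and nz: "\<And>n. n < m \<Longrightarrow> \<pi> [^] n \<notin> J"
    and dec: "\<And>a. a \<in> carrier R \<Longrightarrow> (\<exists>b\<in>carrier R. a \<otimes> b \<ominus> \<one> \<in> J) \<or> (\<exists>b\<in>carrier R. a \<ominus> \<pi> \<otimes> b \<in> J)"
  shows "ring_length (R Quot J) = enat m"
proof -
  interpret J: ideal J R by (rule J)
  have Q0: "\<zero>\<^bsub>R Quot J\<^esub> = J" by (simp add: FactRing_def)
  have carr: "carrier (R Quot J) = (\<lambda>a. J +> a) ` carrier R" by (auto simp: FactRing_def A_RCOSETS_def')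
  have zero_iff: "J +> a = \<zero>\<^bsub>R Quot J\<^esub> \<longleftrightarrow> a \<in> J" if "a \<in> carrier R" for a
    unfolding Q0 using a_coset_join1[OF _ that J.a_subgroup] a_coset_join2[OF that J.a_subgroup] by blast
  have hom: "ring_hom_cring R (R Quot J) ((+>) J)" by (rule J.rcos_ring_hom_cring) (rule is_cring)
  interpret h: ring_hom_cring R "R Quot J" "(+>) J" by (rule hom)
  have eqI: "J +> a = J +> b" if "a \<ominus> b \<in> J" "a \<in> carrier R" "b \<in> carrier R" for a b
  proof -
    have d: "a \<ominus> b \<in> carrier R" using that by simp
    have "a = (a \<ominus> b) \<oplus> b" using that by (simp add: a_minus_def a_assoc l_neg)
    then have "J +> a = (J +> (a \<ominus> b)) \<oplus>\<^bsub>R Quot J\<^esub> (J +> b)"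
      using h.hom_add[OF d that(3)] by (simp only:)
    also have "\<dots> = \<zero>\<^bsub>R Quot J\<^esub> \<oplus>\<^bsub>R Quot J\<^esub> (J +> b)"
      by (rule arg_cong[OF iffD2[OF zero_iff[OF d] that(1)]])
    also have "\<dots> = J +> b" by (rule h.S.l_zero[OF h.hom_closed[OF that(3)]])
    finally show ?thesis .
  qed
  have pow: "(J +> \<pi>) [^]\<^bsub>R Quot J\<^esub> n = J +> \<pi> [^] n" for n :: nat
  proof (induction n)
    case (Suc n)
    then show ?case using h.hom_mult[OF nat_pow_closed[OF p, of n] p] by simp
  qed simp
  show ?thesis
  proof (rule h.S.uniserial_length)
    show "J +> \<pi> \<in> carrier (R Quot J)" using p by simp
    show "(J +> \<pi>) [^]\<^bsub>R Quot J\<^esub> m = \<zero>\<^bsub>R Quot J\<^esub>"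
      unfolding pow zero_iff[OF nat_pow_closed[OF p]] by (rule z)
    show "(J +> \<pi>) [^]\<^bsub>R Quot J\<^esub> n \<noteq> \<zero>\<^bsub>R Quot J\<^esub>" if "n < m" for n
      unfolding pow zero_iff[OF nat_pow_closed[OF p]] by (rule nz[OF that])
    fix A assume "A \<in> carrier (R Quot J)"
    then obtain a where a: "a \<in> carrier R" "A = J +> a" unfolding carr by (rule imageE)
    from dec[OF a(1)] show "A \<in> Units (R Quot J) \<or> (\<exists>B\<in>carrier (R Quot J). A = (J +> \<pi>) \<otimes>\<^bsub>R Quot J\<^esub> B)"
    proof
      assume "\<exists>b\<in>carrier R. a \<otimes> b \<ominus> \<one> \<in> J"
      then obtain b where b: "b \<in> carrier R" "a \<otimes> b \<ominus> \<one> \<in> J" by blast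
      have "A \<otimes>\<^bsub>R Quot J\<^esub> (J +> b) = \<one>\<^bsub>R Quot J\<^esub>"
        using eqI[OF b(2)] a b(1) by simp
      then have "A \<in> Units (R Quot J)"
        using a b(1) h.S.m_comm[of A "J +> b"] unfolding Units_def by auto
      then show ?thesis ..
    next
      assume "\<exists>b\<in>carrier R. a \<ominus> \<pi> \<otimes> b \<in> J"
      then obtain b where b: "b \<in> carrier R" "a \<ominus> \<pi> \<otimes> b \<in> J" by blast
      have "A = (J +> \<pi>) \<otimes>\<^bsub>R Quot J\<^esub> (J +> b)" using eqI[OF b(2)] a b(1) p by simp
      then show ?thesis using b(1) by (intro disjI2 bexI[of _ "J +> b"]) simp_all
    qed
  qed
qed

end

section \<open>Multiplicities of the twigs\<close>

text \<open>
  \<open>P\<close> holds at the generic point of \<open>Z\<close>, that is, on an open set that meets \<open>Z\<close>.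
\<close>

definition generically :: "'p topology \<Rightarrow> 'p set \<Rightarrow> ('p \<Rightarrow> bool) \<Rightarrow> bool" where
  "generically \<tau> Z P \<longleftrightarrow> (\<exists>W. openin \<tau> W \<and> W \<inter> Z \<noteq> {} \<and> (\<forall>q\<in>W. P q))"

lemma generically_mono: "generically \<tau> Z P \<Longrightarrow> (\<And>q. q \<in> topspace \<tau> \<Longrightarrow> P q \<Longrightarrow> Q q) \<Longrightarrow> generically \<tau> Z Q"
  unfolding generically_def by (meson openin_subset subsetD)

lemma generically_conj:
  assumes "irreducible_set \<tau> Z" "generically \<tau> Z P" "generically \<tau> Z Q"
  shows "generically \<tau> Z (\<lambda>q. P q \<and> Q q)"
proof -
  obtain W where W: "openin \<tau> W" "W \<inter> Z \<noteq> {}" "\<forall>q\<in>W. P q" using assms(2) unfolding generically_def by blast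
  obtain W' where W': "openin \<tau> W'" "W' \<inter> Z \<noteq> {}" "\<forall>q\<in>W'. Q q" using assms(3) unfolding generically_def by blast
  show ?thesis
    unfolding generically_def
    using openin_Int[OF W(1) W'(1)] irreducible_open_meet[OF assms(1) W(1,2) W'(1,2)] W(3) W'(3) by blast
qed

lemma generically_const: "irreducible_set \<tau> Z \<Longrightarrow> (\<And>q. q \<in> topspace \<tau> \<Longrightarrow> P q) \<Longrightarrow> generically \<tau> Z P"
  unfolding generically_def irreducible_set_def by (intro exI[of _ "topspace \<tau>"]) auto

lemma generically_near:
  assumes "q \<in> Z" "q \<in> points X" "eventually P (near X q)" shows "generically (zar X) Z P"
  using assms unfolding eventually_near_iff[OF assms(2)] generically_def by blast

lemma generically_point:
  assumes "generically (zar X) Z P"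
  obtains q where "q \<in> Z" "q \<in> points X" "eventually P (near X q)"
proof -
  obtain W where W: "openin (zar X) W" "W \<inter> Z \<noteq> {}" "\<forall>q\<in>W. P q" using assms unfolding generically_def by blast
  then obtain q where q: "q \<in> W" "q \<in> Z" by blast
  have "q \<in> points X" using openin_subset[OF W(1)] q(1) by blast
  moreover have "eventually P (near X q)"
    using eventually_near_open[OF W(1) q(1)] by eventually_elim (use W(3) in blast)
  ultimately show ?thesis using that q(2) by blast
qed

lemma function_ring_cring:
  assumes c: "\<And>c. (\<lambda>_. c) \<in> A" and a: "\<And>f g. f \<in> A \<Longrightarrow> g \<in> A \<Longrightarrow> (\<lambda>p. f p + g p) \<in> A"
    and m: "\<And>f g. f \<in> A \<Longrightarrow> g \<in> A \<Longrightarrow> (\<lambda>p. f p * g p) \<in> A"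
  shows "cring (function_ring A)"
proof (rule cringI)
  show "abelian_group (function_ring A)"
  proof (rule abelian_groupI)
    fix f assume f: "f \<in> carrier (function_ring A)"
    have "(\<lambda>p. -1 * f p) \<in> A" by (rule m[OF c]) (use f in \<open>simp add: function_ring_def\<close>)
    then show "\<exists>g\<in>carrier (function_ring A). g \<oplus>\<^bsub>function_ring A\<^esub> f = \<zero>\<^bsub>function_ring A\<^esub>"
      by (intro bexI[of _ "\<lambda>p. -1 * f p"]) (simp_all add: function_ring_def)
  qed (use c a in \<open>auto simp: function_ring_def ac_simps\<close>)
  show "comm_monoid (function_ring A)"
    by (rule comm_monoidI) (use c m in \<open>auto simp: function_ring_def ac_simps\<close>)
qed (auto simp: function_ring_def algebra_simps)

lemma function_ring_minus:
  assumes "cring (function_ring A)" "f \<in> A" "g \<in> A" "\<And>c. (\<lambda>_. c) \<in> A" "\<And>f g. f \<in> A \<Longrightarrow> g \<in> A \<Longrightarrow> (\<lambda>p. f p * g p) \<in> A"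
  shows "f \<ominus>\<^bsub>function_ring A\<^esub> g = (\<lambda>p. f p - g p)"
proof -
  interpret cring "function_ring A" by (rule assms(1))
  have n: "(\<lambda>p. -1 * g p) \<in> A" by (rule assms(5)[OF assms(4,3)])
  have "\<ominus>\<^bsub>function_ring A\<^esub> g = (\<lambda>p. -1 * g p)"
    by (rule minus_equality) (use n assms(3) in \<open>simp_all add: function_ring_def\<close>)
  then show ?thesis by (simp add: a_minus_def) (simp add: function_ring_def)
qed

lemma function_ring_power: "f [^]\<^bsub>function_ring A\<^esub> (n :: nat) = (\<lambda>p. f p ^ n)"
  by (induction n) (simp_all add: function_ring_def nat_pow_def mult.commute)

context patch_disc
begin

text \<open>
  Where the other active coordinate \<open>a\<close> is nonzero, \<open>active x w i ^ m - t / (C a ^ m')\<close>, with the exponents of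
  \<open>tfun_monomial\<close>, is regular, vanishes on the family, and restricts to \<open>active x w i ^ m\<close> at \<open>t = 0\<close>.
\<close>

lemma active_power_special:
  assumes q: "q \<in> points (CH w)" and a: "active x w (other i) q \<noteq> 0"
  shows "(\<lambda>z. active x w i z ^ twig_mult w i) \<in> special_ideal S U x T w q"
proof -
  interpret Y: germ_algebra "near (FA w) (q, 0)" "reg (FA w) (q, 0)" "(q, 0)" by (rule germ_fam[OF q])
  obtain C where C: "C \<noteq> 0" "\<And>q. q \<in> points (CH w) \<Longrightarrow> on_model x w q \<Longrightarrow>
    tfun q = C * (active x w i q ^ twig_mult w i * active x w (other i) q ^ twig_mult w (other i))"
    using tfun_monomial[of w i] by blast
  let ?D = "\<lambda>z. C * active x w (other i) (fst z) ^ twig_mult w (other i)"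
  have ar: "(\<lambda>z. active x w j (fst z)) \<in> reg (FA w) (q, 0)" for j
    by (rule morph_reg[OF fst_fam_morph[OF q]]) (simp add: active_reg[OF q])
  show ?thesis
  proof (rule special_idealI[OF q, of "\<lambda>z. active x w i (fst z) ^ twig_mult w i - snd z / ?D z"])
    show "(\<lambda>z. active x w i (fst z) ^ twig_mult w i - snd z / ?D z) \<in> reg (FA w) (q, 0)"
      using C(1) a by (intro Y.germ_diff Y.germ_divide Y.germ_power Y.germ_cmult ar snd_fam_reg q) simp
    fix z :: "('u \<times> 'k list) \<times> 'k" assume z: "snd z \<noteq> 0" "fst z \<in> graph w (snd z)"
    then have "fst z \<in> points (CH w)" "on_model x w (fst z)" "tfun (fst z) = snd z" by (auto simp: graph_iff tfun_def)
    then have e: "snd z = active x w i (fst z) ^ twig_mult w i * ?D z" using C(2)[of "fst z"] by (simp only: mult.left_commute)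
    then have "?D z \<noteq> 0" using z(1) by auto
    then show "active x w i (fst z) ^ twig_mult w i - snd z / ?D z = 0" by (subst e) simp
  qed simp
qed

text \<open>The functions that are regular at the generic point of an axis.\<close>

abbreviation GF :: "word \<Rightarrow> idx \<Rightarrow> ('u \<times> 'k list \<Rightarrow> 'k) set" where
  "GF w i \<equiv> generic_functions (CH w) (axis w i)"

text \<open>The ideal of the special fibre at the generic point of an axis.\<close>

definition generic_ideal :: "word \<Rightarrow> idx \<Rightarrow> ('u \<times> 'k list \<Rightarrow> 'k) set" where
  "generic_ideal w i = {f \<in> GF w i. \<exists>W. openin (zar (CH w)) W \<and> W \<inter> axis w i \<noteq> {} \<and> (\<forall>q\<in>W. f \<in> special_ideal S U x T w q)}"

lemma GF_iff: "f \<in> GF w i \<longleftrightarrow> generically (zar (CH w)) (axis w i) (\<lambda>q. f \<in> reg (CH w) q)"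
  by (simp add: generic_functions_def generically_def regular_on_def)

lemma generic_ideal_iff:
  "f \<in> generic_ideal w i \<longleftrightarrow> f \<in> GF w i \<and> generically (zar (CH w)) (axis w i) (\<lambda>q. f \<in> special_ideal S U x T w q)"
  by (simp add: generic_ideal_def generically_def)

lemma GF_const: "(\<lambda>_. c) \<in> GF w i"
  unfolding GF_iff by (rule generically_const[OF irreducible_axis germ_algebra.germ_const[OF germ_chart]])

lemma GF_add: "f \<in> GF w i \<Longrightarrow> g \<in> GF w i \<Longrightarrow> (\<lambda>q. f q + g q) \<in> GF w i"
  unfolding GF_iff by (drule (1) generically_conj[OF irreducible_axis]) (erule generically_mono, blast intro: germ_algebra.germ_add[OF germ_chart])

lemma GF_mult: "f \<in> GF w i \<Longrightarrow> g \<in> GF w i \<Longrightarrow> (\<lambda>q. f q * g q) \<in> GF w i"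
  unfolding GF_iff by (drule (1) generically_conj[OF irreducible_axis]) (erule generically_mono, blast intro: germ_algebra.germ_mult[OF germ_chart])

lemma GF_near: "q \<in> axis w i \<Longrightarrow> f \<in> reg (CH w) q \<Longrightarrow> f \<in> GF w i"
  unfolding GF_iff by (rule generically_near[OF _ _ chart_eventually_reg]) (auto simp: axis_def)

lemma active_GF: "active x w j \<in> GF w i"
  unfolding GF_iff by (rule generically_const[OF irreducible_axis active_reg])

lemma GF_cring: "cring (function_ring (GF w i))"
  by (rule function_ring_cring[OF GF_const GF_add GF_mult])

lemma generic_ideal_add: "f \<in> generic_ideal w i \<Longrightarrow> g \<in> generic_ideal w i \<Longrightarrow> (\<lambda>q. f q + g q) \<in> generic_ideal w i"
  unfolding generic_ideal_iff
  by (elim conjE, rule conjI[OF GF_add], assumption, assumption, drule (1) generically_conj[OF irreducible_axis])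
    (erule generically_mono, blast intro: special_ideal_add)

lemma generic_ideal_mult: "f \<in> generic_ideal w i \<Longrightarrow> g \<in> GF w i \<Longrightarrow> (\<lambda>q. g q * f q) \<in> generic_ideal w i"
proof -
  assume f: "f \<in> generic_ideal w i" and g: "g \<in> GF w i"
  have "generically (zar (CH w)) (axis w i) (\<lambda>q. f \<in> special_ideal S U x T w q \<and> g \<in> reg (CH w) q)"
    using f g unfolding generic_ideal_iff GF_iff[of g] by (intro generically_conj[OF irreducible_axis]) simp_all
  then have "generically (zar (CH w)) (axis w i) (\<lambda>q. (\<lambda>z. g z * f z) \<in> special_ideal S U x T w q)"
    by (rule generically_mono) (blast intro: special_ideal_mult)
  then show ?thesis using f g GF_mult[of g w i f] unfolding generic_ideal_iff by blast
qed

lemma generic_ideal_ideal: "ideal (generic_ideal w i) (function_ring (GF w i))"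
proof -
  interpret cring "function_ring (GF w i)" by (rule GF_cring)
  have z: "(\<lambda>_. 0) \<in> generic_ideal w i"
    unfolding generic_ideal_iff by (intro conjI GF_const generically_const[OF irreducible_axis zero_special])
  have sub: "generic_ideal w i \<subseteq> GF w i" by (auto simp: generic_ideal_iff)
  have neg: "\<ominus>\<^bsub>function_ring (GF w i)\<^esub> f = (\<lambda>p. -1 * f p)" if "f \<in> generic_ideal w i" for f
    by (rule minus_equality) (use sub that GF_mult[OF GF_const, of f w i "-1"] in \<open>auto simp: function_ring_def\<close>)
  show ?thesis
  proof (rule idealI[OF ring_axioms])
    show "subgroup (generic_ideal w i) (add_monoid (function_ring (GF w i)))"
    proof (rule add.subgroupI)
      show "generic_ideal w i \<subseteq> carrier (function_ring (GF w i))" using sub by (simp add: function_ring_def)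
      show "generic_ideal w i \<noteq> {}" using z by blast
      fix f assume f: "f \<in> generic_ideal w i"
      show "\<ominus>\<^bsub>function_ring (GF w i)\<^esub> f \<in> generic_ideal w i"
        unfolding neg[OF f] by (rule generic_ideal_mult[OF f GF_const])
      fix g assume "g \<in> generic_ideal w i"
      with f show "f \<oplus>\<^bsub>function_ring (GF w i)\<^esub> g \<in> generic_ideal w i"
        using generic_ideal_add by (simp add: function_ring_def)
    qed
    fix f g assume "f \<in> generic_ideal w i" "g \<in> carrier (function_ring (GF w i))"
    then have "(\<lambda>q. g q * f q) \<in> generic_ideal w i" by (intro generic_ideal_mult) (simp_all add: function_ring_def)
    then show "g \<otimes>\<^bsub>function_ring (GF w i)\<^esub> f \<in> generic_ideal w i" "f \<otimes>\<^bsub>function_ring (GF w i)\<^esub> g \<in> generic_ideal w i"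
      by (simp_all add: function_ring_def mult.commute)
  qed
qed

lemma lideal_generic:
  assumes q: "q \<in> axis w i" and f: "f \<in> lideal (CH w) q (insert tfun (model_eqs w))"
  shows "f \<in> generic_ideal w i"
proof -
  have qp: "q \<in> points (CH w)" using q by (simp add: axis_def)
  have "f \<in> reg (CH w) q"
    by (rule germ_algebra.germ_ideal_subset[OF germ_chart[OF qp] f]) (use tfun_reg[OF qp] model_eqs_reg qp in blast)
  then show ?thesis
    unfolding generic_ideal_iff using GF_near[OF q] generically_near[OF q qp lideal_special_near[OF qp f]] by blast
qed

lemma generic_unit_or_multiple:
  assumes f: "f \<in> GF w i"
  shows "(\<exists>g\<in>GF w i. (\<lambda>q. f q * g q - 1) \<in> generic_ideal w i) \<or> (\<exists>g\<in>GF w i. (\<lambda>q. f q - active x w i q * g q) \<in> generic_ideal w i)"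
proof -
  obtain q where q: "q \<in> axis w i" "q \<in> points (CH w)" "\<forall>\<^sub>F z in near (CH w) q. f \<in> reg (CH w) z"
    using f unfolding GF_iff by (rule generically_point)
  show ?thesis
  proof (cases "\<forall>\<^sub>F z in near (CH w) q. z \<in> axis w i \<longrightarrow> f z = 0")
    case True
    interpret germ_algebra "near (CH w) q" "reg (CH w) q" q by (rule germ_chart[OF q(2)])
    have "f \<in> germ_ideal (insert (active x w i) (model_eqs w))"
      by (rule vanishing_on_axis[OF q(1) at_pt[OF q(3)] True])
    then have "\<exists>g\<in>reg (CH w) q. (\<lambda>z. f z - active x w i z * g z) \<in> germ_ideal (model_eqs w)"
      by (rule germ_ideal_split)
    then obtain g where g: "g \<in> reg (CH w) q" "(\<lambda>z. f z - active x w i z * g z) \<in> germ_ideal (model_eqs w)" by blast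
    have "(\<lambda>z. f z - active x w i z * g z) \<in> generic_ideal w i"
      by (rule lideal_generic[OF q(1) germ_ideal_mono[OF g(2)]]) blast
    then show ?thesis by (intro disjI2 bexI[of _ g] GF_near[OF q(1) g(1)])
  next
    case False
    have "\<exists>z\<in>axis w i. f \<in> reg (CH w) z \<and> f z \<noteq> 0"
    proof (rule ccontr)
      assume n: "\<not> (\<exists>z\<in>axis w i. f \<in> reg (CH w) z \<and> f z \<noteq> 0)"
      have "\<forall>\<^sub>F z in near (CH w) q. z \<in> axis w i \<longrightarrow> f z = 0" using q(3) by eventually_elim (use n in blast)
      then show False using False by blast
    qed
    then obtain z where z: "z \<in> axis w i" "f \<in> reg (CH w) z" "f z \<noteq> 0" by blast
    then have zp: "z \<in> points (CH w)" by (simp add: axis_def)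
    interpret germ_algebra "near (CH w) z" "reg (CH w) z" z by (rule germ_chart[OF zp])
    have "\<forall>\<^sub>F y in near (CH w) z. f y * inverse (f y) - 1 = 0"
      using germ_nonzero[OF z(2,3)] by eventually_elim simp
    then have "(\<lambda>y. f y * inverse (f y) - 1) \<in> germ_ideal (insert tfun (model_eqs w))" by (rule germ_ideal_0)
    then show ?thesis
      by (intro disjI1 bexI[of _ "\<lambda>y. inverse (f y)"] lideal_generic[OF z(1)] GF_near[OF z(1) germ_inverse[OF z(2,3)]])
  qed
qed

theorem axis_multiplicity: "twig_multiplicity S U x T w (axis w i) = enat (twig_mult w i)"
proof -
  let ?R = "function_ring (GF w i)"
  interpret cring ?R by (rule GF_cring)
  have sub: "f [^]\<^bsub>?R\<^esub> (n :: nat) = (\<lambda>p. f p ^ n)" for f n by (rule function_ring_power)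
  have minus: "f \<ominus>\<^bsub>?R\<^esub> g = (\<lambda>p. f p - g p)" if "f \<in> GF w i" "g \<in> GF w i" for f g
    by (rule function_ring_minus[OF GF_cring that GF_const GF_mult])
  have car: "carrier ?R = GF w i" by (simp add: function_ring_def)
  have mult: "f \<otimes>\<^bsub>?R\<^esub> g = (\<lambda>p. f p * g p)" for f g by (simp add: function_ring_def)
  have one: "\<one>\<^bsub>?R\<^esub> = (\<lambda>_. 1)" by (simp add: function_ring_def)
  have pow_GF: "(\<lambda>z. active x w i z ^ n) \<in> GF w i" for n
    using nat_pow_closed[of "active x w i" n] active_GF unfolding car sub by blast
  have "ring_length (?R Quot generic_ideal w i) = enat (twig_mult w i)"
  proof (rule uniserial_quotient_length[OF generic_ideal_ideal])
    show "active x w i \<in> carrier ?R" unfolding car by (rule active_GF)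
    obtain q where q: "q \<in> axis w i" "active x w (other i) q \<noteq> 0" using axis_nontrivial by blast
    then have qp: "q \<in> points (CH w)" by (simp add: axis_def)
    have "\<forall>\<^sub>F z in near (CH w) q. (\<lambda>z. active x w i z ^ twig_mult w i) \<in> special_ideal S U x T w z"
      using eventually_points[OF qp] germ_algebra.germ_nonzero[OF germ_chart[OF qp] active_reg[OF qp] q(2)]
      by eventually_elim (rule active_power_special)
    from generically_near[OF q(1) qp this]
    show "active x w i [^]\<^bsub>?R\<^esub> twig_mult w i \<in> generic_ideal w i"
      unfolding sub generic_ideal_iff using pow_GF by blast
    show "active x w i [^]\<^bsub>?R\<^esub> n \<notin> generic_ideal w i" if n: "n < twig_mult w i" for n
    proof
      assume "active x w i [^]\<^bsub>?R\<^esub> n \<in> generic_ideal w i"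
      then have "generically (zar (CH w)) (axis w i) (\<lambda>q. (\<lambda>z. active x w i z ^ n) \<in> special_ideal S U x T w q)"
        unfolding sub generic_ideal_iff by blast
      then obtain W q where "q \<in> axis w i" "(\<lambda>z. active x w i z ^ n) \<in> special_ideal S U x T w q"
        unfolding generically_def by blast
      then show False using active_power_not_special n by blast
    qed
    fix f assume "f \<in> carrier ?R"
    then have f: "f \<in> GF w i" unfolding car .
    have unit: "f \<otimes>\<^bsub>?R\<^esub> g \<ominus>\<^bsub>?R\<^esub> \<one>\<^bsub>?R\<^esub> = (\<lambda>p. f p * g p - 1)" if "g \<in> GF w i" for g
      unfolding mult one by (rule minus[OF GF_mult[OF f that] GF_const])
    have multiple: "f \<ominus>\<^bsub>?R\<^esub> active x w i \<otimes>\<^bsub>?R\<^esub> g = (\<lambda>p. f p - active x w i p * g p)" if "g \<in> GF w i" for g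
      unfolding mult by (rule minus[OF f GF_mult[OF active_GF that]])
    show "(\<exists>g\<in>carrier ?R. f \<otimes>\<^bsub>?R\<^esub> g \<ominus>\<^bsub>?R\<^esub> \<one>\<^bsub>?R\<^esub> \<in> generic_ideal w i)
      \<or> (\<exists>g\<in>carrier ?R. f \<ominus>\<^bsub>?R\<^esub> active x w i \<otimes>\<^bsub>?R\<^esub> g \<in> generic_ideal w i)"
      unfolding car using generic_unit_or_multiple[OF f] by (simp add: unit multiple cong: bex_cong)
  qed
  then show ?thesis unfolding twig_multiplicity_def generic_local_ring_def generic_ideal_def .
qed

end

theorem theorem5p1:
  fixes S :: "('u, 'k::{alg_closed_field, field_char_0}) space"
    and U :: "'u set" and x :: "idx \<Rightarrow> 'u \<Rightarrow> 'k" and org :: 'u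
    and T :: "'k set" and w :: word and \<alpha> \<beta> :: nat
  assumes "nonsingular_surface S"
    and "coordinate_patch S U x org"
    and "openin (zar affine_line) T" and "0 \<in> T"
    and "w \<noteq> []"
    and "node_coeffs w = (\<alpha>, \<beta>)"
  shows "(\<forall>q. node_binomial x w q =
             of_nat \<alpha> * (new_coord x w q * retained_coord x w q)
             + of_nat \<beta> * deactivated_coord x w q) \<and>
         (\<exists>!Z. retained_twig S U x org T w Z) \<and>
         (\<exists>!Z. emergent_twig S U x org T w Z) \<and>
         (\<forall>Z. retained_twig S U x org T w Z \<longrightarrow> twig_multiplicity S U x T w Z = enat \<alpha>) \<and>
         (\<forall>Z. emergent_twig S U x org T w Z \<longrightarrow> twig_multiplicity S U x T w Z = enat (\<alpha> + \<beta>))"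
proof -
  interpret patch_disc S U x org T
    using assms by unfold_locales (simp_all add: nonsingular_surface_def)
  obtain p v where w: "w = p # v" using assms(5) by (cases w) auto
  have ab: "\<alpha> = twig_mult w (other p)" "\<alpha> + \<beta> = twig_mult w p"
    using assms(6) node_coeffs_mult[of p v] unfolding w by (auto simp: idx_other)
  have "\<forall>q. node_binomial x w q = of_nat \<alpha> * (new_coord x w q * retained_coord x w q)
      + of_nat \<beta> * deactivated_coord x w q"
    using assms(5,6) by (simp add: node_binomial_def)
  moreover have "retained_twig S U x org T w Z \<longleftrightarrow> Z = axis w (other p)" for Z unfolding w by (rule retained_iff)
  moreover have "emergent_twig S U x org T w Z \<longleftrightarrow> Z = axis w p" for Z unfolding w by (rule emergent_iff)
  ultimately show ?thesis by (simp add: axis_multiplicity flip: ab)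
qed

end
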